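(* Let $u \in \mathbb{Z}_{>0}$, $b \in \mathbb{Q}$, and let $f_1,\dots,f_n : \mathbb{R} \to \mathbb{R}_{\ge 0}$ be nondecreasing rational functions (on rational input they return rational output). Let \[ Z(f,b,u) = \Big\{x \in \{0,1,\dots,u-1\}^n : \sum_{j=1}^n f_j(x_j) \le b\Big\}. \] Let $L$ be the maximum input encoding length. There is a deterministic algorithm which, given $\delta > 0$, computes $Z' \in \mathbb{R}$ such that \[ |Z(f,b,u)| \le Z' \le (1+\delta)\,|Z(f,b,u)|, \] using $O\!\left(n^5 (\log u)^3 (L + \log n)/\delta^2\right)$ arithmetic operations on $O(L \log u + \log n)$-bit numbers.
   Context: The encoding length of a rational number $p/q$ (with $p\in\mathbb{Z}$, $q\in\mathbb{Z}_{>0}$) is $\lceil \log(|p|+1)\rceil + \lceil \log(q+1)\rceil$. The functions $f_j$ are given explicitly and can be evaluated on rational inputs; it is assumed that if $x_j \in \mathbb{Q}$ has encoding length $L_x$, then $f_j(x_j)$ has encoding length at most $L\cdot L_x$.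
   Formalization: In the bounds log u is read as max(1, log u) and δ² as min(1, δ)², since for u=1 or δ→∞ the stated bound falls below one operation; δ is a rational input counted in L, and Z' (up to n log u bits) is output as mantissa and binary exponent. *)

theory Defs
  imports Complex_Main "HOL-Library.FuncSet"
begin

definition enc_len :: "rat \<Rightarrow> nat" where
  "enc_len r = (case quotient_of r of (p, q) \<Rightarrow>
     nat \<lceil>log 2 (of_int (\<bar>p\<bar> + 1))\<rceil> + nat \<lceil>log 2 (of_int (q + 1))\<rceil>)"

definition solutions :: "nat \<Rightarrow> (nat \<Rightarrow> real \<Rightarrow> real) \<Rightarrow> rat \<Rightarrow> nat \<Rightarrow> (nat \<Rightarrow> nat) set" where
  "solutions n f b u =
     {x \<in> {1..n} \<rightarrow>\<^sub>E {0..<u}. (\<Sum>j=1..n. f j (real (x j))) \<le> of_rat b}"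

text \<open>
  The value of a real function at a rational point, as a rational number; meaningful only for
  functions that map rationals to rationals.
\<close>

definition rat_value :: "(real \<Rightarrow> real) \<Rightarrow> rat \<Rightarrow> rat" where
  "rat_value g x = (THE q. of_rat q = g (of_rat x))"

text \<open>
  The evaluation oracle through which an algorithm accesses the functions. It is cut off outside
  the index range, so that it carries no information besides f 1, ..., f n.
\<close>

definition evaluator :: "nat \<Rightarrow> (nat \<Rightarrow> real \<Rightarrow> real) \<Rightarrow> int \<Rightarrow> rat \<Rightarrow> rat" where
  "evaluator n f j x = (if 1 \<le> j \<and> j \<le> int n then rat_value (f (nat j)) x else 0)"

text \<open>
  L bounds the encoding lengths of all numbers of the input (the accuracy d included), and the
  values of the functions in the assumed sense. The least such L is the maximum input encoding
  length.
\<close>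

definition input_length_le ::
    "nat \<Rightarrow> (nat \<Rightarrow> real \<Rightarrow> real) \<Rightarrow> rat \<Rightarrow> nat \<Rightarrow> rat \<Rightarrow> nat \<Rightarrow> bool" where
  "input_length_le n f b u d L \<longleftrightarrow>
     enc_len (of_nat u) \<le> L \<and> enc_len b \<le> L \<and> enc_len d \<le> L \<and>
     (\<forall>j\<in>{1..n}. \<forall>x. enc_len (rat_value (f j) x) \<le> L * enc_len x)"

text \<open>
  Algorithms are programs of a unit-cost random access machine over the rationals, written as
  while programs. The memory consists of named arrays; since a program mentions only finitely many
  names, this is equivalent to a single array. Scalar variables are entries at position 0.
  Conditions are expressions, with nonzero values counting as true. The
  expression \<open>Query i e\<close> evaluates the \<open>i\<close>-th input function at \<open>e\<close>.
\<close>

datatype binop = Add | Sub | Mul | Divide | Leq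

datatype expr =
    Num rat
  | Cell string expr
  | Op binop expr expr
  | Floor expr
  | Query expr expr

datatype prog =
    Skip
  | Assign string expr expr
  | Seq prog prog
  | If expr prog prog
  | While expr prog

type_synonym state = "string \<Rightarrow> int \<Rightarrow> rat"

fun apply_op :: "binop \<Rightarrow> rat \<Rightarrow> rat \<Rightarrow> rat" where
  "apply_op Add x y = x + y"
| "apply_op Sub x y = x - y"
| "apply_op Mul x y = x * y"
| "apply_op Divide x y = x / y"
| "apply_op Leq x y = (if x \<le> y then 1 else 0)"

fun val :: "(int \<Rightarrow> rat \<Rightarrow> rat) \<Rightarrow> state \<Rightarrow> expr \<Rightarrow> rat" where
  "val F s (Num c) = c"
| "val F s (Cell a i) = s a \<lfloor>val F s i\<rfloor>"
| "val F s (Op h e1 e2) = apply_op h (val F s e1) (val F s e2)"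
| "val F s (Floor e) = of_int \<lfloor>val F s e\<rfloor>"
| "val F s (Query i e) = F \<lfloor>val F s i\<rfloor> (val F s e)"

fun ops :: "expr \<Rightarrow> nat" where
  "ops (Num c) = 1"
| "ops (Cell a i) = ops i + 1"
| "ops (Op h e1 e2) = ops e1 + ops e2 + 1"
| "ops (Floor e) = ops e + 1"
| "ops (Query i e) = ops i + ops e + 1"

text \<open>The largest encoding length of a number occurring in the evaluation of an expression.\<close>

fun bits :: "(int \<Rightarrow> rat \<Rightarrow> rat) \<Rightarrow> state \<Rightarrow> expr \<Rightarrow> nat" where
  "bits F s (Num c) = enc_len c"
| "bits F s (Cell a i) = max (bits F s i) (enc_len (val F s (Cell a i)))"
| "bits F s (Op h e1 e2) =
     max (max (bits F s e1) (bits F s e2)) (enc_len (val F s (Op h e1 e2)))"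
| "bits F s (Floor e) = max (bits F s e) (enc_len (val F s (Floor e)))"
| "bits F s (Query i e) =
     max (max (bits F s i) (bits F s e)) (enc_len (val F s (Query i e)))"

text \<open>
  \<open>exec F p s t m s'\<close>: with oracle \<open>F\<close>, the program \<open>p\<close> started in \<open>s\<close> halts
  in \<open>s'\<close> after \<open>t\<close> operations on numbers of encoding length at most \<open>m\<close>. All elementary
  steps are counted, not only the arithmetic ones.
\<close>

inductive exec ::
    "(int \<Rightarrow> rat \<Rightarrow> rat) \<Rightarrow> prog \<Rightarrow> state \<Rightarrow> nat \<Rightarrow> nat \<Rightarrow> state \<Rightarrow> bool"
  for F where
  Skip: "exec F Skip s 1 0 s"
| Assign: "exec F (Assign a i e) s (ops i + ops e + 1) (max (bits F s i) (bits F s e))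
     (s(a := (s a)(\<lfloor>val F s i\<rfloor> := val F s e)))"
| Seq: "exec F p s t m s' \<Longrightarrow> exec F q s' t' m' s'' \<Longrightarrow>
     exec F (Seq p q) s (t + t') (max m m') s''"
| IfTrue: "val F s e \<noteq> 0 \<Longrightarrow> exec F p s t m s' \<Longrightarrow>
     exec F (If e p q) s (ops e + 1 + t) (max (bits F s e) m) s'"
| IfFalse: "val F s e = 0 \<Longrightarrow> exec F q s t m s' \<Longrightarrow>
     exec F (If e p q) s (ops e + 1 + t) (max (bits F s e) m) s'"
| WhileFalse: "val F s e = 0 \<Longrightarrow> exec F (While e p) s (ops e + 1) (bits F s e) s"
| WhileTrue: "val F s e \<noteq> 0 \<Longrightarrow> exec F p s t m s' \<Longrightarrow> exec F (While e p) s' t' m' s'' \<Longrightarrow>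
     exec F (While e p) s (ops e + 1 + t + t') (max (bits F s e) (max m m')) s''"

inductive_cases exec_SkipE: "exec F Skip s t m s'"
inductive_cases exec_AssignE: "exec F (Assign a i e) s t m s'"
inductive_cases exec_SeqE: "exec F (Seq p q) s t m s'"
inductive_cases exec_IfE: "exec F (If e p q) s t m s'"
inductive_cases exec_WhileE: "exec F (While e p) s t m s'"

lemma exec_deterministic:
  assumes "exec F p s t m s'" and "exec F p s t1 m1 s1"
  shows "t1 = t \<and> m1 = m \<and> s1 = s'"
  using assms
proof (induction arbitrary: t1 m1 s1 rule: exec.induct)
  case (Skip s)
  then show ?case by (elim exec_SkipE) auto
next
  case (Assign a i e s)
  then show ?case by (elim exec_AssignE) auto
next
  case (Seq p s t m s' q t' m' s'')
  from Seq.prems obtain t2 m2 s2 t3 m3 where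
    "exec F p s t2 m2 s2" "exec F q s2 t3 m3 s1" "t1 = t2 + t3" "m1 = max m2 m3"
    by (elim exec_SeqE) blast
  with Seq.IH(1)[of t2 m2 s2] Seq.IH(2)[of t3 m3 s1] show ?case by simp
next
  case (IfTrue s e p t m s' q)
  from IfTrue.prems IfTrue.hyps(1) obtain t2 m2 where
    "exec F p s t2 m2 s1" "t1 = ops e + 1 + t2" "m1 = max (bits F s e) m2"
    by (elim exec_IfE) auto
  with IfTrue.IH[of t2 m2 s1] show ?case by simp
next
  case (IfFalse s e q t m s' p)
  from IfFalse.prems IfFalse.hyps(1) obtain t2 m2 where
    "exec F q s t2 m2 s1" "t1 = ops e + 1 + t2" "m1 = max (bits F s e) m2"
    by (elim exec_IfE) auto
  with IfFalse.IH[of t2 m2 s1] show ?case by simp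
next
  case (WhileFalse s e p)
  show ?case
    by (rule exec_WhileE[OF WhileFalse.prems]) (use WhileFalse.hyps in auto)
next
  case (WhileTrue s e p t m s' t' m' s'')
  obtain t2 m2 s2 t3 m3 where
    "exec F p s t2 m2 s2" "exec F (While e p) s2 t3 m3 s1"
    "t1 = ops e + 1 + t2 + t3" "m1 = max (bits F s e) (max m2 m3)"
    by (rule exec_WhileE[OF WhileTrue.prems]) (use WhileTrue.hyps(1) in auto)
  with WhileTrue.IH(1)[of t2 m2 s2] WhileTrue.IH(2)[of t3 m3 s1] show ?case by simp
qed

definition initial_state :: "nat \<Rightarrow> nat \<Rightarrow> rat \<Rightarrow> rat \<Rightarrow> state" where
  "initial_state n u b d =
     (\<lambda>_ _. 0)(''n'' := (\<lambda>_. 0)(0 := of_nat n), ''u'' := (\<lambda>_. 0)(0 := of_nat u),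
               ''b'' := (\<lambda>_. 0)(0 := b), ''delta'' := (\<lambda>_. 0)(0 := d))"

text \<open>
  The output may be as large as u to the power n, and hence need not fit into a single machine
  number. It is therefore returned in floating-point form, as a mantissa and a binary exponent.
\<close>

definition result :: "state \<Rightarrow> real" where
  "result s = of_rat (s ''mantissa'' 0) * 2 powi \<lfloor>s ''exponent'' 0\<rfloor>"

text \<open>
  The logarithm as it occurs multiplicatively in the resource bounds: it is the binary logarithm
  for arguments at least 2. At 1 the bounds would otherwise degenerate to 0.
\<close>

definition lg :: "nat \<Rightarrow> real" where
  "lg k = max 1 (log 2 (real k))"

end

theory Submission
  imports Defs
begin

text \<open>
  Every coordinate range is thinned to a geometric grid whose points satisfy \<open>g' <= (1 + e) * (g + 1)\<close>,
  where \<open>e = min 1 d / (6 * n)\<close>. Since the functions are monotone, counting grid points with the weights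
  \<open>g' - g\<close> is correct up to the factor \<open>(1 + e) ^ n\<close>.

  If \<open>q\<close> bounds the denominators of the budget and of the values at grid points, then comparing sums of
  values with the budget is equivalent to comparing the sums of the floors after scaling by
  \<open>(q * (n + 1)) ^ (n + 1)\<close>. The resulting integers are too long for single numbers, so they are
  represented by \<open>n + 2\<close> digits in base \<open>q * (n + 1)\<close>.

  A dynamic program processes the coordinates one by one. It stores the number of partial solutions as
  a function of the budget spent, in the form of a sorted list of budgets with weights. The candidates of
  the next stage are extracted from a tournament tree in increasing order and are merged into a block as
  long as their total weight has grown by a factor of at most \<open>1 + e\<close> since the block was opened. Hence
  there are only \<open>O(n * log u / e)\<close> blocks, and a stage costs a factor of at most \<open>(1 + e) ^ 2\<close>. As the
  weights are too long as well, they are rounded up to floating point numbers whose mantissas have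
  \<open>O(log (n * log u / e))\<close> bits. Altogether the error is at most \<open>(1 + e) ^ (3 * n) <= 1 + d\<close>.
\<close>

section \<open>Execution with bounded numbers\<close>

text \<open>The budget constraint is sharp, so sums of values must be compared exactly, although
  numbers may have only \<open>O(L log u + log n)\<close> bits. This forces digit vectors for the
  budgets, whereas the counts tolerate a relative error. The constant 6 in \<open>e\<close> stems
  from three factors \<open>1 + e\<close> per coordinate, one for thinning and two for a stage:
  \<open>(1 + e) ^ (3 * n) <= exp (d / 2) <= 1 + d\<close>, if \<open>d\<close> is cut off at 1.
  There are \<open>O(n * log u / d)\<close> grid points and \<open>O(n^2 * log u / d)\<close>
  blocks, hence \<open>O(n^3 * (log u)^2 / d^2)\<close> candidates in each of the \<open>n\<close>
  stages. A candidate costs a path of \<open>O(L + log n)\<close> comparisons of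
  \<open>n + 2\<close> digits and an alignment of exponents of size \<open>O(n * log u)\<close>,
  both within \<open>O(n * log u * (L + log n))\<close>; the product is the time bound. All
  addresses, digits and mantissas are bounded by a polynomial of fixed degree in
  \<open>n * 2 ^ (L * l)\<close>, where \<open>l = O(log u)\<close> is the encoding length of
  \<open>u\<close>. The degree affects only the constant of the bit bound.\<close>

definition small :: "nat \<Rightarrow> rat \<Rightarrow> bool" where
  "small X x \<longleftrightarrow> (\<exists>p q. x = of_int p / of_int q \<and> \<bar>p\<bar> \<le> int X \<and> 0 < q \<and> q \<le> int X)"

lemma smallI: "\<bar>p\<bar> \<le> int X \<Longrightarrow> 0 < q \<Longrightarrow> q \<le> int X \<Longrightarrow> small X (of_int p / of_int q)"
  unfolding small_def by blast

lemma smallE: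
  assumes "small X x"
  obtains p q where "x = of_int p / of_int q" "\<bar>p\<bar> \<le> int X" "0 < q" "q \<le> int X"
  using assms unfolding small_def by blast

lemma small_mono: "small X x \<Longrightarrow> X \<le> Y \<Longrightarrow> small Y x"
  unfolding small_def by fastforce

lemma small_of_int: "\<bar>p\<bar> \<le> int X \<Longrightarrow> 1 \<le> X \<Longrightarrow> small X (of_int p)"
  using smallI[of p X 1] by simp

lemma small_of_nat: "p \<le> X \<Longrightarrow> 1 \<le> X \<Longrightarrow> small X (of_nat p)"
  using small_of_int[of "int p" X] by simp

text \<open>Cancelling a fraction only shrinks both of its parts. This is why \<open>small\<close>
  may ask for any representation instead of the reduced one: sums and products can then be bounded
  on the obvious common denominator.\<close>

lemma quotient_of_bound:
  assumes "x = of_int p / of_int q" "0 < q" "quotient_of x = (p', q')"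
  shows "\<bar>p'\<bar> \<le> \<bar>p\<bar>" "q' \<le> q" "0 < q'"
proof -
  show q': "0 < q'" using assms(3) by (simp add: quotient_of_denom_pos)
  have cop: "coprime p' q'" using assms(3) by (rule quotient_of_coprime)
  have "x = of_int p' / of_int q'" using assms(3) by (rule quotient_of_div)
  with assms have "of_int (p * q') = (of_int (p' * q) :: rat)"
    using q' by (simp add: field_simps)
  hence e: "p * q' = p' * q" by (rule of_int_eq_iff[THEN iffD1])
  have "q' dvd p' * q" using e by (metis dvd_triv_right)
  hence "q' dvd q" using cop by (metis coprime_commute coprime_dvd_mult_right_iff)
  then obtain r where r: "q = q' * r" by blast
  with assms(2) q' have r1: "1 \<le> r" by (metis int_one_le_iff_zero_less zero_less_mult_pos)
  show "q' \<le> q" using r r1 q' by (simp add: mult_le_cancel_left1)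
  have "p = p' * r" using e r q' by simp
  thus "\<bar>p'\<bar> \<le> \<bar>p\<bar>" using r1 by (simp add: abs_mult mult_le_cancel_left1)
qed

lemma enc_len_le_of_small:
  assumes "small X x"
  shows "enc_len x \<le> 2 * nat \<lceil>log 2 (real X + 1)\<rceil>"
proof -
  obtain p q where pq: "x = of_int p / of_int q" "\<bar>p\<bar> \<le> int X" "0 < q" "q \<le> int X"
    using assms by (rule smallE)
  obtain p' q' where q: "quotient_of x = (p', q')" by (metis surj_pair)
  note b = quotient_of_bound[OF pq(1) pq(3) q]
  have "log 2 (of_int (\<bar>p'\<bar> + 1)) \<le> log 2 (real X + 1)"
    using b pq by (intro log_mono) auto
  moreover have "log 2 (of_int (q' + 1)) \<le> log 2 (real X + 1)"
    using b pq by (intro log_mono) auto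
  ultimately have "nat \<lceil>log 2 (of_int (\<bar>p'\<bar> + 1))\<rceil> \<le> nat \<lceil>log 2 (real X + 1)\<rceil>"
    "nat \<lceil>log 2 (of_int (q' + 1))\<rceil> \<le> nat \<lceil>log 2 (real X + 1)\<rceil>"
    by (blast intro: nat_mono ceiling_mono)+
  thus ?thesis unfolding enc_len_def q prod.case by linarith
qed

lemma small_of_enc_len:
  assumes "enc_len x \<le> L"
  shows "small (2 ^ L) x"
proof -
  obtain p q where q: "quotient_of x = (p, q)" by (metis surj_pair)
  have q0: "0 < q" using q by (rule quotient_of_denom_pos)
  have *: "v \<le> 2 ^ L - 1" if "0 \<le> v" "nat \<lceil>log 2 (real_of_int (v + 1))\<rceil> \<le> L" for v :: int
  proof -
    have "log 2 (real_of_int (v + 1)) \<le> real L" using that(2) by linarith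
    hence "real_of_int (v + 1) \<le> 2 powr (real L)" using that(1)
      by (subst (asm) log_le_iff) auto
    hence "real_of_int (v + 1) \<le> real_of_int (2 ^ L)" by (simp add: powr_realpow)
    hence "v + 1 \<le> 2 ^ L" by (subst (asm) of_int_le_iff)
    thus ?thesis by simp
  qed
  have "\<bar>p\<bar> \<le> 2 ^ L - 1" "q \<le> 2 ^ L - 1"
    using assms q0 unfolding enc_len_def q prod.case
    by (intro *; linarith)+
  hence "\<bar>p\<bar> \<le> int (2 ^ L)" "q \<le> int (2 ^ L)" by auto
  thus ?thesis using smallI[of p "2^L" q] q0 quotient_of_div[OF q] by simp
qed

lemma small_add:
  assumes "small X x" "small Y y"
  shows "small (2 * X * Y) (x + y)" "small (2 * X * Y) (x - y)"
proof -
  obtain p q where x: "x = of_int p / of_int q" "\<bar>p\<bar> \<le> int X" "0 < q" "q \<le> int X"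
    using assms(1) by (rule smallE)
  obtain r t where y: "y = of_int r / of_int t" "\<bar>r\<bar> \<le> int Y" "0 < t" "t \<le> int Y"
    using assms(2) by (rule smallE)
  have a: "\<bar>p * t\<bar> \<le> int X * int Y" "\<bar>r * q\<bar> \<le> int X * int Y"
    using x y by (auto simp: abs_mult mult.commute[of r] intro!: mult_mono)
  have b: "0 < q * t" "q * t \<le> int X * int Y" using x y by (auto intro!: mult_mono)
  have "x + y = of_int (p * t + r * q) / of_int (q * t)" "x - y = of_int (p * t - r * q) / of_int (q * t)"
    using x(3) y(3) unfolding x(1) y(1) by (simp_all add: add_divide_distrib diff_divide_distrib)
  moreover have "\<bar>p * t + r * q\<bar> \<le> int (2 * X * Y)" "\<bar>p * t - r * q\<bar> \<le> int (2 * X * Y)" "q * t \<le> int (2 * X * Y)"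
    using a b by auto
  ultimately show "small (2 * X * Y) (x + y)" "small (2 * X * Y) (x - y)"
    using smallI b by metis+
qed

lemma small_mult:
  assumes "small X x" "small Y y"
  shows "small (X * Y) (x * y)"
proof -
  obtain p q where x: "x = of_int p / of_int q" "\<bar>p\<bar> \<le> int X" "0 < q" "q \<le> int X"
    using assms(1) by (rule smallE)
  obtain r t where y: "y = of_int r / of_int t" "\<bar>r\<bar> \<le> int Y" "0 < t" "t \<le> int Y"
    using assms(2) by (rule smallE)
  have "x * y = of_int (p * r) / of_int (q * t)" using x y by simp
  moreover have "\<bar>p * r\<bar> \<le> int (X * Y)" "0 < q * t" "q * t \<le> int (X * Y)"
    using x y by (auto simp: abs_mult intro!: mult_mono)
  ultimately show ?thesis using smallI by metis
qed

lemma small_inverse: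
  assumes "small X x"
  shows "small X (inverse x)"
proof -
  obtain p q where x: "x = of_int p / of_int q" "\<bar>p\<bar> \<le> int X" "0 < q" "q \<le> int X"
    using assms(1) by (rule smallE)
  consider "p = 0" | "p > 0" | "p < 0" by linarith
  thus ?thesis
  proof cases
    case 1
    thus ?thesis using x smallI[of 0 X q] by simp
  next
    case 2
    thus ?thesis using x smallI[of q X p] by simp
  next
    case 3
    have "inverse x = of_int (- q) / of_int (- p)" using x 3 by simp
    thus ?thesis using x 3 smallI[of "- q" X "- p"] by simp
  qed
qed

lemma small_floor:
  assumes "small X x"
  shows "small X (of_int \<lfloor>x\<rfloor>)"
proof -
  obtain p q where x: "x = of_int p / of_int q" "\<bar>p\<bar> \<le> int X" "0 < q" "q \<le> int X"
    using assms(1) by (rule smallE)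
  have f: "\<lfloor>x\<rfloor> = p div q" unfolding x(1) by (rule floor_divide_of_int_eq)
  have "p div q \<le> \<bar>p\<bar>" using x by (smt (verit) div_by_1 zdiv_mono2 div_neg_pos_less0)
  moreover have "- \<bar>p\<bar> \<le> p div q"
  proof (cases "p \<ge> 0")
    case True
    thus ?thesis using x pos_imp_zdiv_nonneg_iff[of q p] by linarith
  next
    case False
    hence "p * q \<le> p" using x by (simp add: mult_le_cancel_left2)
    hence "p * q div q \<le> p div q" using x by (intro zdiv_mono1)
    thus ?thesis using x False by simp
  qed
  ultimately have "\<bar>p div q\<bar> \<le> int X" using x by linarith
  thus ?thesis unfolding f using x by (intro small_of_int) auto
qed

section \<open>Growth of values under the evaluation of expressions\<close>

definition small_state :: "nat \<Rightarrow> state \<Rightarrow> bool" where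
  "small_state X s \<longleftrightarrow> (\<forall>a i. small X (s a i))"

text \<open>This is the exponent by which an expression can amplify a bound: a binary operation
  multiplies the bounds of its arguments and costs one more factor of at most \<open>2 * X\<close>,
  so values stay within \<open>(2 * X) ^ expr_size e\<close>. \<open>Floor\<close> is free because
  it enlarges neither part of a fraction.\<close>

fun expr_size :: "expr \<Rightarrow> nat" where
  "expr_size (Num c) = 1"
| "expr_size (Cell a i) = expr_size i + 1"
| "expr_size (Op h e1 e2) = expr_size e1 + expr_size e2 + 1"
| "expr_size (Floor e) = expr_size e"
| "expr_size (Query i e) = expr_size i + expr_size e + 1"

text \<open>Queries are excluded since the size of an oracle answer does not follow from the sizes
  of the arguments; \<open>wp_query\<close> treats them with an explicit bound.\<close>

fun consts_small :: "nat \<Rightarrow> expr \<Rightarrow> bool" where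
  "consts_small X (Num c) = small X c"
| "consts_small X (Cell a i) = consts_small X i"
| "consts_small X (Op h e1 e2) = (consts_small X e1 \<and> consts_small X e2)"
| "consts_small X (Floor e) = consts_small X e"
| "consts_small X (Query i e) = False"

lemma small_power_mono: "small ((2 * X) ^ k) x \<Longrightarrow> k \<le> l \<Longrightarrow> 1 \<le> X \<Longrightarrow> small ((2 * X) ^ l) x"
  by (erule small_mono) (rule power_increasing, auto)

lemma small_power: "small X x \<Longrightarrow> 1 \<le> k \<Longrightarrow> 1 \<le> X \<Longrightarrow> small ((2 * X) ^ k) x"
  by (rule small_power_mono[of _ 1]) (auto elim: small_mono)

text \<open>Division is a product with the reciprocal, which merely swaps the two parts of a
  fraction. Division by 0 yields 0 and is covered as well.\<close>

lemma val_small: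
  assumes "small_state X s" "1 \<le> X" "consts_small X e"
  shows "small ((2 * X) ^ expr_size e) (val F s e)"
  using assms(3)
proof (induction e)
  case (Num c)
  then show ?case using assms by (auto intro: small_mono)
next
  case (Cell a i)
  have "small X (val F s (Cell a i))" using assms(1) by (simp add: small_state_def)
  thus ?case using assms by (intro small_power) auto
next
  case (Op h e1 e2)
  let ?Y = "(2 * X) ^ expr_size e1" let ?Z = "(2 * X) ^ expr_size e2"
  have s: "small ?Y (val F s e1)" "small ?Z (val F s e2)" using Op by auto
  have le: "2 * ?Y * ?Z \<le> (2 * X) ^ expr_size (Op h e1 e2)"
    using assms(2) by (simp add: power_add mult.commute mult.left_commute)
  have le2: "?Y * ?Z \<le> (2 * X) ^ expr_size (Op h e1 e2)" using le by linarith
  have "1 \<le> (2 * X) ^ expr_size (Op h e1 e2)" using assms(2) by simp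
  hence "small ((2 * X) ^ expr_size (Op h e1 e2)) 0" "small ((2 * X) ^ expr_size (Op h e1 e2)) 1"
    using small_of_int[of 0] small_of_int[of 1] by auto
  thus ?case using s le le2 small_add[OF s] small_mult[OF s] small_mult[OF s(1) small_inverse[OF s(2)]]
    by (cases h) (auto simp: field_simps simp del: expr_size.simps intro: small_mono)
next
  case (Floor e)
  then show ?case by (simp add: small_floor)
qed auto

text \<open>
  No expression of the programs below has size more than 60.
\<close>

definition bit_bound :: "nat \<Rightarrow> nat" where
  "bit_bound X = 2 * nat \<lceil>log 2 (real ((2 * X) ^ 60) + 1)\<rceil>"

lemma enc_le_bit_bound: "small ((2 * X) ^ k) x \<Longrightarrow> k \<le> 60 \<Longrightarrow> 1 \<le> X \<Longrightarrow> enc_len x \<le> bit_bound X"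
  unfolding bit_bound_def using enc_len_le_of_small small_power_mono by blast

lemma bits_le:
  assumes "small_state X s" "1 \<le> X" "consts_small X e" "expr_size e \<le> 60"
  shows "bits F s e \<le> bit_bound X"
  using assms(3-4)
proof (induction e)
  case (Op h e1 e2)
  have "enc_len (val F s (Op h e1 e2)) \<le> bit_bound X"
    using Op.prems assms(1,2) by (intro enc_le_bit_bound[OF val_small]) auto
  thus ?case using Op by (auto simp del: val.simps)
next
  case (Cell a i)
  have "enc_len (val F s (Cell a i)) \<le> bit_bound X"
    using Cell.prems assms(1,2) by (intro enc_le_bit_bound[OF val_small]) auto
  thus ?case using Cell by (auto simp del: val.simps)
next
  case (Floor e)
  have "enc_len (val F s (Floor e)) \<le> bit_bound X"
    using Floor.prems assms(1,2) by (intro enc_le_bit_bound[OF val_small]) auto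
  thus ?case using Floor by (auto simp del: val.simps)
next
  case (Num c)
  thus ?case using assms(2) enc_le_bit_bound[of X 1 c] small_mono[of X c "2 * X"] by simp
qed auto

section \<open>Total correctness with bounds on time and number size\<close>

text \<open>Smallness of the whole memory is both assumed and guaranteed, so it travels through all
  rules without appearing in the postconditions. The bit bound then depends on \<open>X\<close>
  alone, and only assigned values have to be checked.\<close>

definition wp :: "(int \<Rightarrow> rat \<Rightarrow> rat) \<Rightarrow> nat \<Rightarrow> prog \<Rightarrow> state \<Rightarrow> nat \<Rightarrow> (state \<Rightarrow> bool) \<Rightarrow> bool" where
  "wp F X p s T Q \<longleftrightarrow> (small_state X s \<longrightarrow>
     (\<exists>t m s'. exec F p s t m s' \<and> t \<le> T \<and> m \<le> bit_bound X \<and> small_state X s' \<and> Q s'))"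

lemma wp_mono: "wp F X p s T Q \<Longrightarrow> T \<le> T' \<Longrightarrow> (\<And>s'. Q s' \<Longrightarrow> Q' s') \<Longrightarrow> wp F X p s T' Q'"
  unfolding wp_def by (meson le_trans)

lemma wp_time: "wp F X p s T Q \<Longrightarrow> T \<le> T' \<Longrightarrow> wp F X p s T' Q"
  by (erule wp_mono)

lemma wp_skip: "Q s \<Longrightarrow> wp F X Skip s 1 Q"
  unfolding wp_def by (meson Skip le_refl zero_le)

lemma wp_seq:
  assumes "wp F X p s T1 (\<lambda>s'. wp F X q s' T2 Q)"
  shows "wp F X (Seq p q) s (T1 + T2) Q"
  unfolding wp_def
proof
  assume "small_state X s"
  then obtain t m s1 where 1: "exec F p s t m s1" "t \<le> T1" "m \<le> bit_bound X" "small_state X s1" "wp F X q s1 T2 Q"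
    using assms unfolding wp_def[of F X p] by blast
  then obtain t' m' s2 where 2: "exec F q s1 t' m' s2" "t' \<le> T2" "m' \<le> bit_bound X" "small_state X s2" "Q s2"
    unfolding wp_def by blast
  show "\<exists>t m s'. exec F (Seq p q) s t m s' \<and> t \<le> T1 + T2 \<and> m \<le> bit_bound X \<and> small_state X s' \<and> Q s'"
    using exec.Seq[OF 1(1) 2(1)] 1 2 by (intro exI[of _ "t + t'"] exI[of _ "max m m'"] exI[of _ s2]) auto
qed

lemma small_state_upd: "small_state X s \<Longrightarrow> small X v \<Longrightarrow> small_state X (s(a := (s a)(i := v)))"
  unfolding small_state_def by auto

lemma wp_asg:
  assumes "1 \<le> X" "consts_small X i" "consts_small X e" "expr_size i \<le> 60" "expr_size e \<le> 60"
    "val F s i = of_int z" "val F s e = v" "small X v" "Q (s(a := (s a)(z := v)))"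
  shows "wp F X (Assign a i e) s (ops i + ops e + 1) Q"
  unfolding wp_def
proof
  assume g: "small_state X s"
  have b: "max (bits F s i) (bits F s e) \<le> bit_bound X"
    using bits_le[OF g assms(1)] assms(2-5) by simp
  have "small_state X (s(a := (s a)(z := v)))" using g assms(8) by (rule small_state_upd)
  thus "\<exists>t m s'. exec F (Assign a i e) s t m s' \<and> t \<le> ops i + ops e + 1 \<and> m \<le> bit_bound X \<and> small_state X s' \<and> Q s'"
    using exec.Assign[of F a i e s] b assms(6,7,9)
    by (intro exI[of _ "ops i + ops e + 1"] exI[of _ "max (bits F s i) (bits F s e)"]
        exI[of _ "s(a := (s a)(z := v))"]) simp
qed

text \<open>The budgets of the two branches are added rather than maximised, which keeps all times
  plain sums at the price of a constant factor.\<close>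

lemma wp_if:
  assumes "1 \<le> X" "consts_small X e" "expr_size e \<le> 60"
    "val F s e \<noteq> 0 \<Longrightarrow> wp F X p s T1 Q" "val F s e = 0 \<Longrightarrow> wp F X q s T2 Q"
  shows "wp F X (If e p q) s (ops e + 1 + (T1 + T2)) Q"
  unfolding wp_def
proof
  assume g: "small_state X s"
  have b: "bits F s e \<le> bit_bound X" using bits_le[OF g assms(1-3)] .
  show "\<exists>t m s'. exec F (If e p q) s t m s' \<and> t \<le> ops e + 1 + (T1 + T2) \<and> m \<le> bit_bound X \<and> small_state X s' \<and> Q s'"
  proof (cases "val F s e = 0")
    case True
    then obtain t m s' where "exec F q s t m s'" "t \<le> T2" "m \<le> bit_bound X" "small_state X s'" "Q s'"
      using assms(5) g unfolding wp_def by blast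
    thus ?thesis using exec.IfFalse[OF True, of q t m s' p] b
      by (intro exI[of _ "ops e + 1 + t"] exI[of _ "max (bits F s e) m"] exI[of _ s']) auto
  next
    case False
    then obtain t m s' where "exec F p s t m s'" "t \<le> T1" "m \<le> bit_bound X" "small_state X s'" "Q s'"
      using assms(4) g unfolding wp_def by blast
    thus ?thesis using exec.IfTrue[OF False, of p t m s' q] b
      by (intro exI[of _ "ops e + 1 + t"] exI[of _ "max (bits F s e) m"] exI[of _ s']) auto
  qed
qed

text \<open>The index of the invariant is fuel, an upper bound on the number of remaining rounds.
  The loop may stop earlier, so a crude bound such as the height of a tree can serve as the initial
  fuel.\<close>

lemma wp_while:
  assumes X: "1 \<le> X" "consts_small X e" "expr_size e \<le> 60"
    and inv: "I k s"
    and step: "\<And>k s. I (Suc k) s \<Longrightarrow> val F s e \<noteq> 0 \<Longrightarrow> wp F X p s Tb (I k)"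
    and zero: "\<And>s. I 0 s \<Longrightarrow> val F s e = 0"
    and fin: "\<And>k s. I k s \<Longrightarrow> val F s e = 0 \<Longrightarrow> Q s"
  shows "wp F X (While e p) s ((k + 1) * (ops e + 1) + k * Tb) Q"
  unfolding wp_def
proof
  assume "small_state X s"
  thus "\<exists>t m s'. exec F (While e p) s t m s' \<and> t \<le> (k + 1) * (ops e + 1) + k * Tb \<and> m \<le> bit_bound X \<and> small_state X s' \<and> Q s'"
    using inv
  proof (induction k arbitrary: s)
    case 0
    have v: "val F s e = 0" using zero 0 by simp
    show ?case using exec.WhileFalse[OF v, of p] bits_le[OF 0(1) X] fin[OF 0(2) v] 0
      by (intro exI[of _ "ops e + 1"] exI[of _ "bits F s e"] exI[of _ s]) auto
  next
    case (Suc k)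
    have b: "bits F s e \<le> bit_bound X" using bits_le[OF Suc.prems(1) X] .
    show ?case
    proof (cases "val F s e = 0")
      case True
      show ?thesis using exec.WhileFalse[OF True, of p] b fin[OF Suc.prems(2) True] Suc.prems
        by (intro exI[of _ "ops e + 1"] exI[of _ "bits F s e"] exI[of _ s]) auto
    next
      case False
      obtain t m s1 where 1: "exec F p s t m s1" "t \<le> Tb" "m \<le> bit_bound X" "small_state X s1" "I k s1"
        using step[OF Suc.prems(2) False] Suc.prems(1) unfolding wp_def by blast
      obtain t' m' s2 where 2: "exec F (While e p) s1 t' m' s2" "t' \<le> (k + 1) * (ops e + 1) + k * Tb"
        "m' \<le> bit_bound X" "small_state X s2" "Q s2"
        using Suc.IH[OF 1(4,5)] by blast
      show ?thesis using exec.WhileTrue[OF False 1(1) 2(1)] b 1 2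
        by (intro exI[of _ "ops e + 1 + t + t'"] exI[of _ "max (bits F s e) (max m m')"] exI[of _ s2]) auto
    qed
  qed
qed

section \<open>Notation, frame conditions and counting loops\<close>

abbreviation V :: "string \<Rightarrow> expr" where "V a \<equiv> Cell a (Num 0)"
abbreviation put :: "string \<Rightarrow> expr \<Rightarrow> prog" where "put a e \<equiv> Assign a (Num 0) e"
abbreviation plus_e (infixl "[+]" 65) where "e [+] e' \<equiv> Op Add e e'"
abbreviation minus_e (infixl "[-]" 65) where "e [-] e' \<equiv> Op Sub e e'"
abbreviation times_e (infixl "[*]" 70) where "e [*] e' \<equiv> Op Mul e e'"
abbreviation div_e (infixl "['/]" 70) where "e [/] e' \<equiv> Op Divide e e'"
abbreviation leq_e (infix "[\<le>]" 50) where "e [\<le>] e' \<equiv> Op Leq e e'"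
abbreviation seq (infixr ";;" 40) where "p ;; q \<equiv> Seq p q"

abbreviation upd :: "state \<Rightarrow> string \<Rightarrow> rat \<Rightarrow> state" where
  "upd s a v \<equiv> s(a := (s a)(0 := v))"

lemma wp_put:
  assumes "1 \<le> X" "consts_small X e" "expr_size e \<le> 60" "small X (val F s e)" "Q (upd s a (val F s e))"
  shows "wp F X (put a e) s (ops e + 2) Q"
  using wp_asg[of X "Num 0" e F s 0 "val F s e" Q a] assms small_of_int[of 0 X]
  by (simp add: numeral_2_eq_2)

lemma wp_putv:
  assumes "val F s e = v" "1 \<le> X" "consts_small X e" "expr_size e \<le> 60" "small X v" "Q (upd s a v)"
  shows "wp F X (put a e) s (ops e + 2) Q"
  using wp_put[of X e F s Q a] assms by simp

definition frame :: "string set \<Rightarrow> state \<Rightarrow> state \<Rightarrow> bool" where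
  "frame A s s' \<longleftrightarrow> (\<forall>a. a \<notin> A \<longrightarrow> s' a = s a)"

lemma frame_refl: "frame A s s" unfolding frame_def by blast
lemma frame_trans: "frame A s s' \<Longrightarrow> frame A s' s'' \<Longrightarrow> frame A s s''" unfolding frame_def by metis
lemma frame_mono: "frame A s s' \<Longrightarrow> A \<subseteq> A' \<Longrightarrow> frame A' s s'" unfolding frame_def by blast
definition loop :: "string \<Rightarrow> expr \<Rightarrow> prog \<Rightarrow> prog" where
  "loop i e p = (put i (Num 0) ;; While (V i [+] Num 1 [\<le>] e) (p ;; put i (V i [+] Num 1)))"

lemma small_0: "1 \<le> X \<Longrightarrow> small X 0" using small_of_int[of 0 X] by simp
lemma small_1: "1 \<le> X \<Longrightarrow> small X 1" using small_of_int[of 1 X] by simp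
lemma small_numeral: "numeral k \<le> X \<Longrightarrow> small X (numeral k)"
  using small_of_int[of "numeral k" X] order.trans[OF one_le_numeral, of k X] by simp

text \<open>\<open>J k\<close> describes the start of round \<open>k\<close>, after the counter has
  been advanced. The bound \<open>e\<close> is evaluated anew in every round, hence the invariant
  has to determine its value \<open>N\<close>. The guard \<open>i + 1 <= e\<close> expresses
  \<open>i < N\<close> by the only comparison available.\<close>

lemma wp_loop:
  assumes X: "N < X" "consts_small X e" "expr_size e \<le> 40"
    and init: "J 0 (upd s i 0)"
    and ev: "\<And>k s. k \<le> N \<Longrightarrow> J k s \<Longrightarrow> s i 0 = of_nat k \<Longrightarrow> val F s e = of_nat N"
    and step: "\<And>k s. k < N \<Longrightarrow> J k s \<Longrightarrow> s i 0 = of_nat k \<Longrightarrow>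
       wp F X p s Tb (\<lambda>s'. s' i 0 = of_nat k \<and> J (Suc k) (upd s' i (of_nat (Suc k))))"
    and fin: "\<And>s. J N s \<Longrightarrow> s i 0 = of_nat N \<Longrightarrow> Q s"
  shows "wp F X (loop i e p) s (10 + ops e + N * (Tb + ops e + 15)) Q"
proof -
  have X1: "1 \<le> X" using X by simp
  define I where "I = (\<lambda>k s. k \<le> N \<and> J (N - k) s \<and> s i 0 = of_nat (N - k))"
  have "wp F X (While (V i [+] Num 1 [\<le>] e) (p ;; put i (V i [+] Num 1))) (upd s i 0)
     ((N + 1) * (ops (V i [+] Num 1 [\<le>] e) + 1) + N * (Tb + (ops (V i [+] Num 1) + 2))) Q"
  proof (rule wp_while[where I = I])
    show "1 \<le> X" by fact
    show "consts_small X (V i [+] Num 1 [\<le>] e)" using X X1 by (simp add: small_0 small_1)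
    show "expr_size (V i [+] Num 1 [\<le>] e) \<le> 60" using X by simp
    show "I N (upd s i 0)" using init by (simp add: I_def)
  next
    fix k s assume a: "I (Suc k) s" "val F s (V i [+] Num 1 [\<le>] e) \<noteq> 0"
    have N: "N - k = Suc (N - Suc k)" using a(1) by (auto simp: I_def)
    show "wp F X (p ;; put i (V i [+] Num 1)) s (Tb + (ops (V i [+] Num 1) + 2)) (I k)"
    proof (rule wp_seq, rule wp_mono[OF step[of "N - Suc k"]])
      show "N - Suc k < N" "J (N - Suc k) s" "s i 0 = of_nat (N - Suc k)" using a by (auto simp: I_def)
      fix s' assume s': "s' i 0 = of_nat (N - Suc k) \<and> J (Suc (N - Suc k)) (upd s' i (of_nat (Suc (N - Suc k))))"
      show "wp F X (put i (V i [+] Num 1)) s' (ops (V i [+] Num 1) + 2) (I k)"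
      proof (rule wp_put)
        show "small X (val F s' (V i [+] Num 1))"
          using s' X small_of_nat[of "N - k" X] N by (simp add: add.commute)
        show "I k (upd s' i (val F s' (V i [+] Num 1)))"
          using s' a N by (auto simp: I_def add.commute)
      qed (use X X1 in \<open>auto simp: small_0 small_1\<close>)
    qed auto
  next
    fix s assume "I 0 s"
    thus "val F s (V i [+] Num 1 [\<le>] e) = 0" using ev[of N s] by (simp add: I_def)
  next
    fix k s assume a: "I k s" "val F s (V i [+] Num 1 [\<le>] e) = 0"
    have "val F s e = of_nat N" using ev[of "N - k" s] a by (auto simp: I_def)
    hence "\<not> of_nat (N - k + 1) \<le> (of_nat N :: rat)"
      using a by (auto simp: I_def add.commute split: if_splits)
    hence "\<not> N - k + 1 \<le> N" by (simp only: of_nat_le_iff not_False_eq_True)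
    hence "k = 0" using a by (auto simp: I_def)
    thus "Q s" using fin a by (simp add: I_def)
  qed
  hence "wp F X (loop i e p) s ((ops (Num 0) + 2) + ((N + 1) * (ops (V i [+] Num 1 [\<le>] e) + 1) + N * (Tb + (ops (V i [+] Num 1) + 2)))) Q"
    unfolding loop_def using X1 by (intro wp_seq wp_put) (auto simp: small_0)
  thus ?thesis by (rule wp_mono) (auto simp: algebra_simps)
qed

section \<open>Digit vectors\<close>

text \<open>With the array \<open>zero\<close>, which is never written, as a summand, the same
  program copies a vector.\<close>

definition add_vec :: "string \<Rightarrow> string \<Rightarrow> string \<Rightarrow> string \<Rightarrow> string \<Rightarrow> string \<Rightarrow> prog" where
  "add_vec A o1 B o2 C o3 = loop ''k'' (V ''K'')
     (Assign A (V o1 [+] V ''k'') (Cell B (V o2 [+] V ''k'') [+] Cell C (V o3 [+] V ''k'')))"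

lemma wp_add_vec:
  assumes X: "K < X"
    and o: "s ''K'' 0 = of_nat K" "s o1 0 = of_nat p1" "s o2 0 = of_nat p2" "s o3 0 = of_nat p3"
    and d: "A \<notin> {B, C, o1, o2, o3, ''K'', ''k''}" "''k'' \<notin> {o1, o2, o3, B, C}"
    and sm: "\<And>k. k < K \<Longrightarrow> small X (s B (int (p2 + k)) + s C (int (p3 + k)))"
    and Q: "\<And>s'. frame {A, ''k''} s s' \<Longrightarrow>
       (\<And>k. k < K \<Longrightarrow> s' A (int (p1 + k)) = s B (int (p2 + k)) + s C (int (p3 + k))) \<Longrightarrow>
       (\<And>i. i < int p1 \<or> int (p1 + K) \<le> i \<Longrightarrow> s' A i = s A i) \<Longrightarrow> Q s'"
  shows "wp F X (add_vec A o1 B o2 C o3) s (12 + K * 40) Q"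
  unfolding add_vec_def
proof (rule wp_time, rule wp_loop[where N = K and Tb = 20 and
    J = "\<lambda>k s'. frame {A, ''k''} s s' \<and> (\<forall>i<k. s' A (int (p1 + i)) = s B (int (p2 + i)) + s C (int (p3 + i)))
      \<and> (\<forall>i. i < int p1 \<or> int (p1 + k) \<le> i \<longrightarrow> s' A i = s A i)"])
  show "K < X" by fact
  show "frame {A, ''k''} s (upd s ''k'' 0) \<and>
    (\<forall>i<0. (upd s ''k'' 0) A (int (p1 + i)) = s B (int (p2 + i)) + s C (int (p3 + i))) \<and>
    (\<forall>i. i < int p1 \<or> int (p1 + 0) \<le> i \<longrightarrow> (upd s ''k'' 0) A i = s A i)"
    using d by (auto simp: frame_def)
next
  fix k s'
  assume "frame {A, ''k''} s s' \<and> (\<forall>i<k. s' A (int (p1 + i)) = s B (int (p2 + i)) + s C (int (p3 + i)))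
      \<and> (\<forall>i. i < int p1 \<or> int (p1 + k) \<le> i \<longrightarrow> s' A i = s A i)" "s' ''k'' 0 = of_nat k"
  thus "val F s' (V ''K'') = of_nat K" using o d by (auto simp: frame_def)
next
  fix k s'
  assume k: "k < K" and J: "frame {A, ''k''} s s' \<and> (\<forall>i<k. s' A (int (p1 + i)) = s B (int (p2 + i)) + s C (int (p3 + i)))
      \<and> (\<forall>i. i < int p1 \<or> int (p1 + k) \<le> i \<longrightarrow> s' A i = s A i)" and sk: "s' ''k'' 0 = of_nat k"
  have ss: "s' B = s B" "s' C = s C" "s' o1 = s o1" "s' o2 = s o2" "s' o3 = s o3"
    using J d by (auto simp: frame_def)
  have fl: "\<lfloor>of_nat a + of_nat b :: rat\<rfloor> = int (a + b)" for a b
    using floor_of_nat[of "a + b", where 'a = rat] by simp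
  show "wp F X (Assign A (V o1 [+] V ''k'') (Cell B (V o2 [+] V ''k'') [+] Cell C (V o3 [+] V ''k''))) s' 20
     (\<lambda>s'a. s'a ''k'' 0 = rat_of_nat k \<and> frame {A, ''k''} s (upd s'a ''k'' (rat_of_nat (Suc k))) \<and>
      (\<forall>i<Suc k. upd s'a ''k'' (rat_of_nat (Suc k)) A (int (p1 + i)) = s B (int (p2 + i)) + s C (int (p3 + i))) \<and>
      (\<forall>i. i < int p1 \<or> int (p1 + Suc k) \<le> i \<longrightarrow> upd s'a ''k'' (rat_of_nat (Suc k)) A i = s A i))"
  proof (rule wp_time[OF wp_asg[where z = "int (p1 + k)" and v = "s B (int (p2 + k)) + s C (int (p3 + k))"]])
    show "val F s' (V o1 [+] V ''k'') = of_int (int (p1 + k))" using sk ss o by simp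
    show "val F s' (Cell B (V o2 [+] V ''k'') [+] Cell C (V o3 [+] V ''k'')) = s B (int (p2 + k)) + s C (int (p3 + k))"
      using sk ss o by (simp add: fl)
    let ?s = "s'(A := (s' A)(int (p1 + k) := s B (int (p2 + k)) + s C (int (p3 + k))))"
    have "A \<noteq> ''k''" using d by simp
    hence A: "(upd ?s ''k'' (rat_of_nat (Suc k))) A = (s' A)(int (p1 + k) := s B (int (p2 + k)) + s C (int (p3 + k)))" by simp
    have "frame {A, ''k''} s (upd ?s ''k'' (rat_of_nat (Suc k)))" using J by (auto simp: frame_def)
    thus "?s ''k'' 0 = rat_of_nat k \<and> frame {A, ''k''} s (upd ?s ''k'' (rat_of_nat (Suc k))) \<and>
      (\<forall>i<Suc k. upd ?s ''k'' (rat_of_nat (Suc k)) A (int (p1 + i)) = s B (int (p2 + i)) + s C (int (p3 + i))) \<and>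
      (\<forall>i. i < int p1 \<or> int (p1 + Suc k) \<le> i \<longrightarrow> upd ?s ''k'' (rat_of_nat (Suc k)) A i = s A i)"
      unfolding A using J sk \<open>A \<noteq> ''k''\<close> by (auto simp: less_Suc_eq)
  qed (use X sm[OF k] in \<open>simp_all add: small_0\<close>)
next
  fix s' assume *: "frame {A, ''k''} s s' \<and> (\<forall>i<K. s' A (int (p1 + i)) = s B (int (p2 + i)) + s C (int (p3 + i)))
      \<and> (\<forall>i. i < int p1 \<or> int (p1 + K) \<le> i \<longrightarrow> s' A i = s A i)"
  show "Q s'" by (rule Q) (use * in blast)+
next
  show "consts_small X (V ''K'')" using X by (simp add: small_0)
  show "expr_size (V ''K'') \<le> 40" by simp
  show "10 + ops (V ''K'') + K * (20 + ops (V ''K'') + 15) \<le> 12 + K * 40" by simp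
qed

text \<open>
  The digits are arbitrary integers, the most significant one first. Vectors of digits can thus be
  added entrywise, without carries.
\<close>

fun horner :: "int \<Rightarrow> nat \<Rightarrow> (nat \<Rightarrow> int) \<Rightarrow> int" where
  "horner B 0 d = 0"
| "horner B (Suc k) d = B * horner B k d + d k"

lemma horner_cong: "(\<And>i. i < k \<Longrightarrow> d i = d' i) \<Longrightarrow> horner B k d = horner B k d'"
  by (induction k) auto

lemma horner_add: "horner B k (\<lambda>i. d i + d' i) = horner B k d + horner B k d'"
  by (induction k) (auto simp: algebra_simps)

lemma horner_diff: "horner B k (\<lambda>i. d i - d' i) = horner B k d - horner B k d'"
  by (induction k) (simp_all add: right_diff_distrib)

text \<open>
  The carry of the difference of the digits is propagated from the least significant digit upwards,
  rounding down; only its final sign matters, so it stays as small as the digits.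
\<close>

definition compare_keys :: prog where
  "compare_keys = (put ''d'' (Num 0) ;;
     loop ''k'' (V ''K'') (put ''d'' (Floor (V ''d'' [/] V ''B'')
        [+] (Cell ''ky'' (V ''y'' [*] V ''K'' [+] (V ''K'' [-] Num 1 [-] V ''k''))
        [-] Cell ''ky'' (V ''x'' [*] V ''K'' [+] (V ''K'' [-] Num 1 [-] V ''k''))))) ;;
     put ''le'' (Num 0 [\<le>] V ''d''))"

text \<open>This keeps the carry of a comparison bounded. A base of at least 2 halves it, so a carry
  of size \<open>4 * D + 4\<close> shrinks to \<open>2 * D + 2\<close> before a difference of digits
  of size at most \<open>2 * D\<close> is added.\<close>

lemma div_pos_abs_le:
  assumes B: "2 \<le> (B::int)" and c: "\<bar>c\<bar> \<le> 2 * D + 2"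
  shows "\<bar>c div B\<bar> \<le> D + 1"
proof -
  define q m where "q = c div B" and "m = c mod B"
  hence q: "q = c div B" "c = B * q + m" "0 \<le> m" "m < B" using B by simp_all
  have "q \<le> D + 1"
  proof (rule ccontr)
    assume "\<not> ?thesis"
    hence "2 * (D + 2) \<le> B * q" using B c by (intro mult_mono) auto
    moreover have "c \<le> 2 * D + 2" using c by simp
    ultimately show False using q(2,3) by simp
  qed
  moreover have "- (D + 1) \<le> q"
  proof (rule ccontr)
    assume "\<not> ?thesis"
    hence "q + 1 \<le> - (D + 1)" by linarith
    hence "B * (q + 1) \<le> B * - (D + 1)" using B by (intro mult_left_mono) auto
    moreover have "B * - (D + 1) \<le> 2 * - (D + 1)" using B c by (intro mult_right_mono_neg) auto
    moreover have "B * (q + 1) = B * q + B" by (simp add: distrib_left)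
    moreover have "- c \<le> 2 * D + 2" using c by simp
    ultimately show False using q(2-4) by simp
  qed
  ultimately show ?thesis using q(1) by linarith
qed

lemma wp_compare_keys:
  assumes X: "K < X" "4 * D + 4 \<le> int X" and D: "0 \<le> D"
    and o: "s ''K'' 0 = of_nat K" "s ''B'' 0 = of_int B" "s ''x'' 0 = of_nat x" "s ''y'' 0 = of_nat y"
    and B: "2 \<le> B"
    and dx: "\<And>k. k < K \<Longrightarrow> s ''ky'' (int (x * K + k)) = of_int (dx k)" "\<And>k. k < K \<Longrightarrow> \<bar>dx k\<bar> \<le> D"
    and dy: "\<And>k. k < K \<Longrightarrow> s ''ky'' (int (y * K + k)) = of_int (dy k)" "\<And>k. k < K \<Longrightarrow> \<bar>dy k\<bar> \<le> D"
    and Q: "\<And>s'. frame {''d'', ''k'', ''le''} s s' \<Longrightarrow>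
       s' ''le'' 0 = (if horner B K dx \<le> horner B K dy then 1 else 0) \<Longrightarrow> Q s'"
  shows "wp F X compare_keys s (30 + K * 60) Q"
proof -
  define d where "d = (\<lambda>i. dy i - dx i)"
  \<comment> \<open>\<open>L k\<close> is the value of the \<open>k\<close> least significant digits
    of the difference, obtained as the whole minus the high part.\<close>
  define L where "L = (\<lambda>k. horner B K d - B ^ k * horner B (K - k) d)"
  have LS: "L (Suc k) = L k + B ^ k * d (K - 1 - k)" if "k < K" for k
  proof -
    have "K - k = Suc (K - 1 - k)" using that by simp
    hence "horner B (K - k) d = B * horner B (K - Suc k) d + d (K - 1 - k)" by simp
    thus ?thesis unfolding L_def by (simp add: algebra_simps)
  qed
  \<comment> \<open>For \<open>k > 0\<close> the carry is \<open>L k div B ^ (k - 1)\<close>;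
    recording it after one more division also covers the start. Dividing by a positive number and
    rounding down does not change whether a number is nonnegative.\<close>
  define J where "J = (\<lambda>k s'. frame {''d'', ''k'', ''le''} s s' \<and>
     (\<exists>c. s' ''d'' 0 = of_int c \<and> c div B = L k div B ^ k \<and> (0 \<le> c \<longleftrightarrow> 0 \<le> L k) \<and> \<bar>c\<bar> \<le> 4 * D + 4))"
  have X0: "1 \<le> X" using X by auto
  have X1: "1 \<le> int X" using X by simp
  have loopwp: "wp F X (loop ''k'' (V ''K'') (put ''d'' (Floor (V ''d'' [/] V ''B'')
        [+] (Cell ''ky'' (V ''y'' [*] V ''K'' [+] (V ''K'' [-] Num 1 [-] V ''k''))
        [-] Cell ''ky'' (V ''x'' [*] V ''K'' [+] (V ''K'' [-] Num 1 [-] V ''k'')))))) s1 (10 + 2 + K * (40 + 2 + 15))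
      (\<lambda>s'. wp F X (put ''le'' (Num 0 [\<le>] V ''d'')) s' 6 Q)" if J0: "J 0 (upd s1 ''k'' 0)" for s1
  proof (rule wp_time[OF wp_loop[where N = K and J = J and Tb = 40]])
    show "J 0 (upd s1 ''k'' 0)" by fact
    fix k s' assume J: "J k s'" and sk: "s' ''k'' 0 = of_nat k"
    have "s' ''K'' = s ''K''" using J by (auto simp: J_def frame_def)
    thus "val F s' (V ''K'') = of_nat K" using o by simp
  next
    fix k s' assume k: "k < K" and J: "J k s'" and sk: "s' ''k'' 0 = of_nat k"
    have ss: "s' ''K'' = s ''K''" "s' ''B'' = s ''B''" "s' ''x'' = s ''x''" "s' ''y'' = s ''y''" "s' ''ky'' = s ''ky''"
      using J by (auto simp: J_def frame_def)
    obtain c where c: "s' ''d'' 0 = of_int c" "c div B = L k div B ^ k" "0 \<le> c \<longleftrightarrow> 0 \<le> L k" "\<bar>c\<bar> \<le> 4 * D + 4"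
      using J by (auto simp: J_def)
    define l where "l = K - 1 - k"
    have l: "l < K" "of_nat l = (of_nat K - 1 - of_nat k :: rat)" using k by (auto simp: l_def of_nat_diff)
    have fl: "\<lfloor>of_nat a * of_nat K + (of_nat K - 1 - of_nat k) :: rat\<rfloor> = int (a * K + l)" for a
      using floor_of_nat[of "a * K + l", where 'a = rat] l by simp
    have fd: "\<lfloor>of_int c / of_int B :: rat\<rfloor> = c div B" by (rule floor_divide_of_int_eq)
    let ?e = "Floor (V ''d'' [/] V ''B'')
        [+] (Cell ''ky'' (V ''y'' [*] V ''K'' [+] (V ''K'' [-] Num 1 [-] V ''k''))
        [-] Cell ''ky'' (V ''x'' [*] V ''K'' [+] (V ''K'' [-] Num 1 [-] V ''k'')))"
    have v: "val F s' ?e = of_int (c div B + d l)"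
      using ss c(1) o sk dx(1)[OF l(1)] dy(1)[OF l(1)] by (simp add: fl fd d_def)
    have dl: "\<bar>d l\<bar> \<le> 2 * D" using dx(2)[OF l(1)] dy(2)[OF l(1)] by (auto simp: d_def)
    have cb: "\<bar>c div B\<bar> \<le> 2 * D + 2"
      using div_pos_abs_le[OF B, of c "2 * D + 1"] c(4) by simp
    have b: "\<bar>c div B + d l\<bar> \<le> 4 * D + 4" using dl cb by linarith
    have Bk: "0 < B ^ k" "0 < B" using B by auto
    have n1: "c div B + d l = L (Suc k) div B ^ k"
      using LS[OF k] Bk c(2) by (simp add: l_def)
    have n2: "(c div B + d l) div B = L (Suc k) div B ^ Suc k"
      unfolding n1 using Bk zdiv_zmult2_eq[of B "L (Suc k)" "B ^ k"] by (simp add: mult.commute)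
    have n3: "0 \<le> c div B + d l \<longleftrightarrow> 0 \<le> L (Suc k)"
      unfolding n1 using Bk by (simp add: pos_imp_zdiv_nonneg_iff)
    obtain c' where c': "c' = c div B + d l" by blast
    have Jc: "J (Suc k) (upd (upd s' ''d'' (of_int c')) ''k'' (rat_of_nat (Suc k)))"
      unfolding J_def
    proof (intro conjI exI[of _ c'])
      show "frame {''d'', ''k'', ''le''} s (upd (upd s' ''d'' (of_int c')) ''k'' (rat_of_nat (Suc k)))"
        using J by (auto simp: J_def frame_def)
      show "\<bar>c'\<bar> \<le> 4 * D + 4" using b c' by simp
      show "c' div B = L (Suc k) div B ^ Suc k" using n2 c' by blast
      show "(0 \<le> c') = (0 \<le> L (Suc k))" using n3 c' by blast
    qed simp
    have smc: "small X (of_int c')" using b X X0 unfolding c' by (intro small_of_int) linarith+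
    show "wp F X (put ''d'' ?e) s' 40 (\<lambda>s'. s' ''k'' 0 = rat_of_nat k \<and> J (Suc k) (upd s' ''k'' (rat_of_nat (Suc k))))"
    proof (rule wp_time[OF wp_put])
      show "small X (val F s' ?e)" unfolding v using smc c' by simp
      show "consts_small X ?e" using X0 by (simp add: small_0 small_1)
      show "(upd s' ''d'' (val F s' ?e)) ''k'' 0 = rat_of_nat k \<and>
         J (Suc k) (upd (upd s' ''d'' (val F s' ?e)) ''k'' (rat_of_nat (Suc k)))"
        unfolding v using Jc sk by (simp add: c')
    qed (use X0 in auto)
  next
    fix s' assume J: "J K s'" and sk: "s' ''k'' 0 = of_nat K"
    obtain c where c: "s' ''d'' 0 = of_int c" "0 \<le> c \<longleftrightarrow> 0 \<le> L K"
      using J by (auto simp: J_def)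
    \<comment> \<open>After \<open>K\<close> rounds the high part is empty, so \<open>L K\<close> is
      the whole difference.\<close>
    have LK: "0 \<le> L K \<longleftrightarrow> horner B K dx \<le> horner B K dy"
      unfolding L_def d_def by (simp add: horner_diff)
    show "wp F X (put ''le'' (Num 0 [\<le>] V ''d'')) s' 6 Q"
    proof (rule wp_time[OF wp_put])
      show "Q (upd s' ''le'' (val F s' (Num 0 [\<le>] V ''d'')))"
        using c LK J by (intro Q) (auto simp: J_def frame_def)
    qed (use X0 c in \<open>auto simp: small_0 small_1\<close>)
  qed (use X X0 in \<open>auto simp: small_0\<close>)
  show ?thesis unfolding compare_keys_def
  proof (rule wp_time)
    show "wp F X (put ''d'' (Num 0) ;;
     loop ''k'' (V ''K'') (put ''d'' (Floor (V ''d'' [/] V ''B'')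
        [+] (Cell ''ky'' (V ''y'' [*] V ''K'' [+] (V ''K'' [-] Num 1 [-] V ''k''))
        [-] Cell ''ky'' (V ''x'' [*] V ''K'' [+] (V ''K'' [-] Num 1 [-] V ''k''))))) ;;
     put ''le'' (Num 0 [\<le>] V ''d'')) s ((ops (Num 0) + 2) + ((10 + 2 + K * (40 + 2 + 15)) + 6)) Q"
      by (intro wp_seq wp_put loopwp)
        (use X0 D in \<open>auto simp: small_0 J_def frame_def L_def intro!: exI[of _ 0]\<close>)
  qed auto
qed

section \<open>Tournament trees\<close>

text \<open>
  Replays the matches on the path from node \<open>v\<close> to the root; the children of node \<open>v\<close> are
  \<open>2 * v\<close> and \<open>2 * v + 1\<close>.
\<close>

definition repair :: prog where
  "repair = While (Num 1 [\<le>] V ''v'')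
     (put ''x'' (Cell ''tr'' (Num 2 [*] V ''v'')) ;;
      put ''y'' (Cell ''tr'' (Num 2 [*] V ''v'' [+] Num 1)) ;;
      compare_keys ;;
      If (V ''le'') (Assign ''tr'' (V ''v'') (V ''x'')) (Assign ''tr'' (V ''v'') (V ''y'')) ;;
      put ''v'' (Floor (V ''v'' [/] Num 2)))"

definition key_rep :: "state \<Rightarrow> nat \<Rightarrow> int \<Rightarrow> nat \<Rightarrow> (nat \<Rightarrow> nat \<Rightarrow> int) \<Rightarrow> bool" where
  "key_rep s K D I d \<longleftrightarrow> (\<forall>i\<le>I. \<forall>k<K. s ''ky'' (int (i * K + k)) = of_int (d i k) \<and> \<bar>d i k\<bar> \<le> D)"

definition nat_rep :: "(int \<Rightarrow> rat) \<Rightarrow> (nat \<Rightarrow> nat) \<Rightarrow> bool" where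
  "nat_rep A f \<longleftrightarrow> (\<forall>v. A (int v) = of_nat (f v))"

definition winner_ok :: "(nat \<Rightarrow> int) \<Rightarrow> (nat \<Rightarrow> nat) \<Rightarrow> nat \<Rightarrow> bool" where
  "winner_ok \<kappa> \<tau> x \<longleftrightarrow> \<tau> x = (if \<kappa> (\<tau> (2 * x)) \<le> \<kappa> (\<tau> (2 * x + 1)) then \<tau> (2 * x) else \<tau> (2 * x + 1))"

lemma nat_rep_upd: "nat_rep A f \<Longrightarrow> nat_rep (A(int v := of_nat w)) (f(v := w))"
  unfolding nat_rep_def by auto

text \<open>Replaying the match at \<open>v\<close> can only spoil the match at its parent. The
  nodes that may be wrong therefore shrink from \<open>v\<close> and its ancestors to
  \<open>v div 2\<close> and its ancestors.\<close>

lemma winner_ok_upd: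
  assumes ok: "\<forall>x. 1 \<le> x \<longrightarrow> x < N \<longrightarrow> winner_ok \<kappa> \<tau> x \<or> (\<exists>k. x = v div 2 ^ k)"
    and v: "1 \<le> v"
    and \<tau>': "\<tau>' = \<tau>(v := (if \<kappa> (\<tau> (2 * v)) \<le> \<kappa> (\<tau> (2 * v + 1)) then \<tau> (2 * v) else \<tau> (2 * v + 1)))"
  shows "\<forall>x. 1 \<le> x \<longrightarrow> x < N \<longrightarrow> winner_ok \<kappa> \<tau>' x \<or> (\<exists>k. x = (v div 2) div 2 ^ k)"
proof (intro allI impI)
  fix x assume x: "1 \<le> x" "x < N"
  show "winner_ok \<kappa> \<tau>' x \<or> (\<exists>k. x = (v div 2) div 2 ^ k)"
  proof (cases "x = v")
    case True
    thus ?thesis using v by (auto simp: winner_ok_def \<tau>')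
  next
    case False
    show ?thesis
    proof (cases "\<exists>k. x = v div 2 ^ k")
      case True
      then obtain k where k: "x = v div 2 ^ k" by blast
      with False obtain j where "k = Suc j" by (cases k) auto
      hence "x = (v div 2) div 2 ^ j" using k by (simp add: div_mult2_eq)
      thus ?thesis by blast
    next
      case nanc: False
      hence ok: "winner_ok \<kappa> \<tau> x" using ok x by blast
      show ?thesis
      proof (cases "x = v div 2")
        case True
        thus ?thesis by (intro disjI2 exI[of _ 0]) simp
      next
        case 2: False
        hence "2 * x \<noteq> v" "2 * x + 1 \<noteq> v" by auto
        thus ?thesis using ok False by (auto simp: winner_ok_def \<tau>')
      qed
    qed
  qed
qed

lemma wp_repair:
  assumes X: "K < X" "4 * D + 4 \<le> int X" and D: "0 \<le> D" and I: "I < X" and N: "2 * N < X"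
    and o: "s ''K'' 0 = of_nat K" "s ''B'' 0 = of_int B" "s ''v'' 0 = of_nat v0"
    and B: "2 \<le> B"
    and key: "key_rep s K D I d" and \<kappa>: "\<kappa> = (\<lambda>i. horner B K (d i))"
    and tr: "nat_rep (s ''tr'') \<tau>0" and \<tau>0: "\<And>v. \<tau>0 v \<le> I"
    and v0: "v0 < 2 ^ h" "v0 < N"
    and ok: "\<forall>x. 1 \<le> x \<longrightarrow> x < N \<longrightarrow> winner_ok \<kappa> \<tau>0 x \<or> (\<exists>k. x = v0 div 2 ^ k)"
    and Q: "\<And>s' \<tau>. frame {''v'', ''x'', ''y'', ''d'', ''k'', ''le'', ''tr''} s s' \<Longrightarrow> nat_rep (s' ''tr'') \<tau> \<Longrightarrow>
       (\<forall>v. \<tau> v \<le> I) \<Longrightarrow> (\<forall>x. x = 0 \<or> N \<le> x \<longrightarrow> \<tau> x = \<tau>0 x) \<Longrightarrow>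
       (\<forall>x. 1 \<le> x \<longrightarrow> x < N \<longrightarrow> winner_ok \<kappa> \<tau> x) \<Longrightarrow> Q s'"
  shows "wp F X repair s ((h + 1) * (100 + K * 60)) Q"
proof -
  let ?A = "{''v'', ''x'', ''y'', ''d'', ''k'', ''le'', ''tr''}"
  define J where "J = (\<lambda>h s'. \<exists>\<tau> v. frame ?A s s' \<and> nat_rep (s' ''tr'') \<tau> \<and> (\<forall>v. \<tau> v \<le> I) \<and>
     (\<forall>x. x = 0 \<or> N \<le> x \<longrightarrow> \<tau> x = \<tau>0 x) \<and> s' ''v'' 0 = of_nat v \<and> v < 2 ^ h \<and> v < N \<and>
     (\<forall>x. 1 \<le> x \<longrightarrow> x < N \<longrightarrow> winner_ok \<kappa> \<tau> x \<or> (\<exists>k. x = v div 2 ^ k)))"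
  have X4: "4 \<le> X" using X D by linarith
  have sm: "small X 0" "small X 1" "small X 2" "1 \<le> X" using X4 by (auto simp: small_0 small_1 small_numeral)
  have snat: "small X (of_nat a)" if "a < X" for a using that by (intro small_of_nat) auto
  show ?thesis unfolding repair_def
  proof (rule wp_time, rule wp_while[where I = J and k = h])
    show "J h s" unfolding J_def using frame_refl tr \<tau>0 o v0 ok by blast
  next
    fix h s1 assume J: "J (Suc h) s1" and nz: "val F s1 (Num 1 [\<le>] V ''v'') \<noteq> 0"
    obtain \<tau> v where t: "frame ?A s s1" "nat_rep (s1 ''tr'') \<tau>" "\<forall>v. \<tau> v \<le> I"
      "\<forall>x. x = 0 \<or> N \<le> x \<longrightarrow> \<tau> x = \<tau>0 x" "s1 ''v'' 0 = of_nat v" "v < 2 ^ Suc h" "v < N"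
      "\<forall>x. 1 \<le> x \<longrightarrow> x < N \<longrightarrow> winner_ok \<kappa> \<tau> x \<or> (\<exists>k. x = v div 2 ^ k)"
      using J unfolding J_def by blast
    have "1 \<le> (of_nat v :: rat)" using nz t(5) by (auto split: if_splits)
    hence v1: "1 \<le> v" using of_nat_le_iff[of 1 v, where 'a = rat] by simp
    have fl2: "\<lfloor>2 * of_nat v :: rat\<rfloor> = int (2 * v)" using floor_of_nat[of "2 * v", where 'a = rat] by simp
    have fl21: "\<lfloor>2 * of_nat v + 1 :: rat\<rfloor> = int (2 * v + 1)"
      using floor_of_nat[of "2 * v + 1", where 'a = rat] by simp
    have fld: "\<lfloor>of_nat v / 2 :: rat\<rfloor> = int (v div 2)"
      using floor_divide_of_nat_eq[of v 2, where 'a = rat] by simp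
    let ?x = "\<tau> (2 * v)" let ?y = "\<tau> (2 * v + 1)"
    let ?s2 = "upd (upd s1 ''x'' (of_nat ?x)) ''y'' (of_nat ?y)"
    have e1: "s1 ''K'' 0 = of_nat K" "s1 ''B'' 0 = of_int B" "s1 ''ky'' = s ''ky''"
      using t(1) o by (auto simp: frame_def)
    have xI: "?x \<le> I" "?y \<le> I" using t by auto
    have step: "wp F X (If (V ''le'') (Assign ''tr'' (V ''v'') (V ''x'')) (Assign ''tr'' (V ''v'') (V ''y'')) ;;
      put ''v'' (Floor (V ''v'' [/] Num 2))) s3 20 (J h)"
      if s3: "frame {''d'', ''k'', ''le''} ?s2 s3" "s3 ''le'' 0 = (if \<kappa> ?x \<le> \<kappa> ?y then 1 else 0)" for s3
    proof -
      define w where "w = (if \<kappa> ?x \<le> \<kappa> ?y then ?x else ?y)"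
      have wI: "w \<le> I" using xI by (auto simp: w_def)
      have s3v: "s3 ''v'' 0 = of_nat v" "s3 ''x'' 0 = of_nat ?x" "s3 ''y'' 0 = of_nat ?y" "s3 ''tr'' = s1 ''tr''"
        using s3(1) t(5) by (auto simp: frame_def)
      let ?s4 = "s3(''tr'' := (s3 ''tr'')(int v := of_nat w))"
      have fin: "J h (upd ?s4 ''v'' (of_nat (v div 2)))"
        unfolding J_def
      proof (intro exI conjI)
        show "frame ?A s (upd ?s4 ''v'' (of_nat (v div 2)))"
          using t(1) s3(1) by (auto simp: frame_def)
        show "nat_rep ((upd ?s4 ''v'' (of_nat (v div 2))) ''tr'') (\<tau>(v := w))"
          using nat_rep_upd[OF t(2), of v w] s3v(4) by simp
        show "\<forall>u. (\<tau>(v := w)) u \<le> I" using t(3) wI by simp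
        show "\<forall>x. x = 0 \<or> N \<le> x \<longrightarrow> (\<tau>(v := w)) x = \<tau>0 x" using t(4,7) v1 by auto
        show "upd ?s4 ''v'' (of_nat (v div 2)) ''v'' 0 = of_nat (v div 2)" by simp
        show "v div 2 < 2 ^ h" using t(6) by auto
        show "v div 2 < N" using t(7) by auto
        show "\<forall>x. 1 \<le> x \<longrightarrow> x < N \<longrightarrow> winner_ok \<kappa> (\<tau>(v := w)) x \<or> (\<exists>k. x = (v div 2) div 2 ^ k)"
          by (rule winner_ok_upd[OF t(8) v1]) (simp add: w_def)
      qed
      have st: "wp F X (put ''v'' (Floor (V ''v'' [/] Num 2))) ?s4 7 (J h)"
      proof (rule wp_time, rule wp_putv[where v = "of_nat (v div 2)"])
        show "val F ?s4 (Floor (V ''v'' [/] Num 2)) = of_nat (v div 2)"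
          using s3v(1) by (simp add: fld)
        show "small X (of_nat (v div 2))" using t(7) N by (intro snat) auto
      qed (use fin sm in auto)
      have asg: "wp F X (Assign ''tr'' (V ''v'') (V z)) s3 5 (\<lambda>s'. wp F X (put ''v'' (Floor (V ''v'' [/] Num 2))) s' 7 (J h))"
        if "s3 z 0 = of_nat w" for z
      proof (rule wp_time, rule wp_asg[where z = "int v" and v = "of_nat w"])
        show "val F s3 (V ''v'') = of_int (int v)" using s3v by simp
        show "val F s3 (V z) = of_nat w" using that by simp
        show "small X (of_nat w)" using wI I by (intro snat) auto
      qed (use st sm in auto)
      show ?thesis
      proof (rule wp_time, rule wp_seq, rule wp_if)
        assume "val F s3 (V ''le'') \<noteq> 0"
        thus "wp F X (Assign ''tr'' (V ''v'') (V ''x'')) s3 5 (\<lambda>s'. wp F X (put ''v'' (Floor (V ''v'' [/] Num 2))) s' 7 (J h))"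
          using s3v s3(2) by (intro asg) (auto simp: w_def)
      next
        assume "val F s3 (V ''le'') = 0"
        thus "wp F X (Assign ''tr'' (V ''v'') (V ''y'')) s3 5 (\<lambda>s'. wp F X (put ''v'' (Floor (V ''v'' [/] Num 2))) s' 7 (J h))"
          using s3v s3(2) by (intro asg) (auto simp: w_def split: if_splits)
      qed (use sm in auto)
    qed
    show "wp F X (put ''x'' (Cell ''tr'' (Num 2 [*] V ''v'')) ;;
      put ''y'' (Cell ''tr'' (Num 2 [*] V ''v'' [+] Num 1)) ;; compare_keys ;;
      If (V ''le'') (Assign ''tr'' (V ''v'') (V ''x'')) (Assign ''tr'' (V ''v'') (V ''y'')) ;;
      put ''v'' (Floor (V ''v'' [/] Num 2))) s1 (7 + (9 + ((30 + K * 60) + 20))) (J h)"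
    proof (rule wp_seq, rule wp_time, rule wp_putv[where v = "of_nat ?x"])
      show "val F s1 (Cell ''tr'' (Num 2 [*] V ''v'')) = of_nat ?x"
        using t(2,5) by (simp only: val.simps apply_op.simps floor_zero fl2 nat_rep_def)
      show "small X (of_nat ?x)" using xI I by (intro snat) auto
      show "wp F X (put ''y'' (Cell ''tr'' (Num 2 [*] V ''v'' [+] Num 1)) ;; compare_keys ;;
        If (V ''le'') (Assign ''tr'' (V ''v'') (V ''x'')) (Assign ''tr'' (V ''v'') (V ''y'')) ;;
        put ''v'' (Floor (V ''v'' [/] Num 2))) (upd s1 ''x'' (of_nat ?x)) (9 + ((30 + K * 60) + 20)) (J h)"
      proof (rule wp_seq, rule wp_time, rule wp_putv[where v = "of_nat ?y"])
        have "val F (upd s1 ''x'' (of_nat ?x)) (Cell ''tr'' (Num 2 [*] V ''v'' [+] Num 1)) =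
          val F s1 (Cell ''tr'' (Num 2 [*] V ''v'' [+] Num 1))" by simp
        thus "val F (upd s1 ''x'' (of_nat ?x)) (Cell ''tr'' (Num 2 [*] V ''v'' [+] Num 1)) = of_nat ?y"
          using t(2,5) by (simp only: val.simps apply_op.simps floor_zero fl21 nat_rep_def)
        show "small X (of_nat ?y)" using xI I by (intro snat) auto
        show "wp F X (compare_keys ;; If (V ''le'') (Assign ''tr'' (V ''v'') (V ''x'')) (Assign ''tr'' (V ''v'') (V ''y'')) ;;
          put ''v'' (Floor (V ''v'' [/] Num 2))) ?s2 ((30 + K * 60) + 20) (J h)"
        proof (rule wp_seq, rule wp_compare_keys[OF X D, where x = ?x and y = ?y and dx = "d ?x" and dy = "d ?y"])
          show "\<And>s'. frame {''d'', ''k'', ''le''} ?s2 s' \<Longrightarrow> s' ''le'' 0 = (if horner B K (d ?x) \<le> horner B K (d ?y) then 1 else 0) \<Longrightarrow>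
            wp F X (If (V ''le'') (Assign ''tr'' (V ''v'') (V ''x'')) (Assign ''tr'' (V ''v'') (V ''y'')) ;;
              put ''v'' (Floor (V ''v'' [/] Num 2))) s' 20 (J h)"
            by (rule step) (simp_all add: \<kappa>)
        qed (use e1 B key xI in \<open>auto simp: key_rep_def\<close>)
      qed (use sm in auto)
    qed (use sm in auto)
  next
    fix s1 assume "J 0 s1"
    thus "val F s1 (Num 1 [\<le>] V ''v'') = 0" by (auto simp: J_def)
  next
    fix h s1 assume J: "J h s1" and z: "val F s1 (Num 1 [\<le>] V ''v'') = 0"
    obtain \<tau> v where t: "frame ?A s s1" "nat_rep (s1 ''tr'') \<tau>" "\<forall>v. \<tau> v \<le> I"
      "\<forall>x. x = 0 \<or> N \<le> x \<longrightarrow> \<tau> x = \<tau>0 x" "s1 ''v'' 0 = of_nat v"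
      "\<forall>x. 1 \<le> x \<longrightarrow> x < N \<longrightarrow> winner_ok \<kappa> \<tau> x \<or> (\<exists>k. x = v div 2 ^ k)"
      using J unfolding J_def by blast
    have "\<not> 1 \<le> (of_nat v :: rat)" using z t(5) by (auto split: if_splits)
    hence "v = 0" by (cases v) auto
    \<comment> \<open>All quotients of 0 are 0, which is not a node of the tree, so no exception is
      left.\<close>
    hence "\<forall>x. 1 \<le> x \<longrightarrow> x < N \<longrightarrow> winner_ok \<kappa> \<tau> x" using t(6) by fastforce
    thus "Q s1" using t by (intro Q)
  qed (use sm in \<open>auto simp: algebra_simps\<close>)
qed

text \<open>Inner nodes are numbered from 1 to \<open>N - 1\<close> and leaves from \<open>N\<close>
  to \<open>2 * N - 1\<close>, so the children of inner nodes are always nodes and any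
  \<open>N\<close> is admissible. Keys of winners do not decrease on the way down from the
  root.\<close>

lemma tournament_min:
  assumes ok: "\<forall>x. 1 \<le> x \<longrightarrow> x < N \<longrightarrow> winner_ok \<kappa> \<tau> x" and v: "1 \<le> v" "v < 2 * N"
  shows "\<kappa> (\<tau> 1) \<le> \<kappa> (\<tau> v)"
  using v
proof (induction v rule: less_induct)
  case (less v)
  show ?case
  proof (cases "v = 1")
    case False
    hence d: "1 \<le> v div 2" "v div 2 < v" "v div 2 < N" using less.prems by auto
    have "\<kappa> (\<tau> (v div 2)) \<le> \<kappa> (\<tau> v)"
      using ok d unfolding winner_ok_def by (cases "even v") (auto elim!: evenE oddE split: if_splits dest!: spec[of _ "v div 2"])
    moreover have "\<kappa> (\<tau> 1) \<le> \<kappa> (\<tau> (v div 2))" using less.IH[of "v div 2"] d by simp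
    ultimately show ?thesis by linarith
  qed simp
qed

text \<open>Following a winner downwards ends at a leaf; the numbers of the visited nodes grow, so
  \<open>2 * N - v\<close> decreases.\<close>

lemma tournament_leaf:
  assumes ok: "\<forall>x. 1 \<le> x \<longrightarrow> x < N \<longrightarrow> winner_ok \<kappa> \<tau> x" and v: "1 \<le> v" "v < 2 * N"
  shows "\<exists>i<N. \<tau> v = \<tau> (N + i)"
  using v
proof (induction "2 * N - v" arbitrary: v rule: less_induct)
  case less
  show ?case
  proof (cases "v < N")
    case True
    hence "winner_ok \<kappa> \<tau> v" using ok less.prems by blast
    hence "\<tau> v = \<tau> (2 * v) \<or> \<tau> v = \<tau> (2 * v + 1)" by (auto simp: winner_ok_def)
    thus ?thesis using less.hyps[of "2 * v"] less.hyps[of "2 * v + 1"] less.prems True by force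
  next
    case False
    thus ?thesis using less.prems by (intro exI[of _ "v - N"]) auto
  qed
qed

section \<open>Accumulating rounded weights\<close>

text \<open>
  The total weight \<open>a\<close> and the weight \<open>w\<close> of the current block are rounded up, but the threshold \<open>th\<close>
  for opening the next block is rounded down; all three have the exponent \<open>e\<close>.
\<close>

definition bump :: prog where
  "bump = (put ''a'' (Floor ((V ''a'' [+] Num 1) [/] Num 2)) ;;
     put ''w'' (Floor ((V ''w'' [+] Num 1) [/] Num 2)) ;;
     put ''th'' (Floor (V ''th'' [/] Num 2)) ;;
     put ''e'' (V ''e'' [+] Num 1))"

definition acc_rep :: "state \<Rightarrow> int \<Rightarrow> int \<Rightarrow> int \<Rightarrow> nat \<Rightarrow> bool" where
  "acc_rep s a w th e \<longleftrightarrow> s ''a'' 0 = of_int a \<and> s ''w'' 0 = of_int w \<and> s ''th'' 0 = of_int th \<and> s ''e'' 0 = of_nat e"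

text \<open>One halving raises a quantity that is rounded up by at most the old unit
  \<open>2 ^ e\<close>, and \<open>2 ^ e + 2 ^ (e + 1) + ...\<close> telescopes to
  \<open>2 ^ e' - 2 ^ e\<close>. This form of the error makes the relation transitive. The threshold
  is rounded down, so its lower bound is expressed through \<open>th + 1\<close>.\<close>

definition bumped :: "int \<Rightarrow> int \<Rightarrow> int \<Rightarrow> nat \<Rightarrow> int \<Rightarrow> int \<Rightarrow> int \<Rightarrow> nat \<Rightarrow> bool" where
  "bumped a w th e a' w' th' e' \<longleftrightarrow> e \<le> e' \<and>
     a * 2 ^ e \<le> a' * 2 ^ e' \<and> a' * 2 ^ e' \<le> a * 2 ^ e + (2 ^ e' - 2 ^ e) \<and>
     w * 2 ^ e \<le> w' * 2 ^ e' \<and> w' * 2 ^ e' \<le> w * 2 ^ e + (2 ^ e' - 2 ^ e) \<and>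
     th' * 2 ^ e' \<le> th * 2 ^ e \<and> (th + 1) * 2 ^ e \<le> (th' + 1) * 2 ^ e' \<and>
     0 \<le> a' \<and> a' \<le> a \<and> 0 \<le> w' \<and> w' \<le> a' \<and> (1 \<le> w \<longrightarrow> 1 \<le> w') \<and> 0 \<le> th' \<and> th' \<le> th"

lemma bumped_refl: "0 \<le> w \<Longrightarrow> w \<le> a \<Longrightarrow> 0 \<le> th \<Longrightarrow> bumped a w th e a w th e"
  unfolding bumped_def by auto

lemma bumped_trans:
  "bumped a w th e a' w' th' e' \<Longrightarrow> bumped a' w' th' e' a'' w'' th'' e'' \<Longrightarrow> bumped a w th e a'' w'' th'' e''"
  unfolding bumped_def by (intro conjI; (elim conjE)?; (linarith | blast))

lemma bumped_step:
  assumes "0 \<le> w" "w \<le> a" "0 \<le> th"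
  shows "bumped a w th e ((a + 1) div 2) ((w + 1) div 2) (th div 2) (Suc e)"
proof -
  define P where "P = (2::int) ^ e"
  have P: "0 < P" by (simp add: P_def)
  obtain x y z where x: "x = (a + 1) div 2" and y: "y = (w + 1) div 2" and z: "z = th div 2" by blast
  have i: "a \<le> 2 * x" "2 * x \<le> a + 1" "w \<le> 2 * y" "2 * y \<le> w + 1" "2 * z \<le> th" "th + 1 \<le> 2 * (z + 1)"
    "y \<le> x" "0 \<le> y" "0 \<le> z" "x \<le> a" "1 \<le> w \<longrightarrow> 1 \<le> y" "z \<le> th"
    using assms unfolding x y z by presburger+
  have m: "a * P \<le> (2 * x) * P" "(2 * x) * P \<le> (a + 1) * P" "w * P \<le> (2 * y) * P" "(2 * y) * P \<le> (w + 1) * P"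
    "(2 * z) * P \<le> th * P" "(th + 1) * P \<le> (2 * (z + 1)) * P"
    using i P by (auto intro!: mult_right_mono simp del: mult_le_cancel_right)
  show ?thesis unfolding bumped_def x[symmetric] y[symmetric] z[symmetric] power_Suc P_def[symmetric]
    using i m assms by (auto simp: algebra_simps)
qed

lemma wp_bump:
  assumes X: "3 \<le> X" "a + 1 \<le> int X" "th \<le> int X" "e + 1 \<le> X"
    and s: "acc_rep s a w th e" "0 \<le> w" "w \<le> a" "0 \<le> th"
    and Q: "\<And>s'. frame {''a'', ''w'', ''th'', ''e''} s s' \<Longrightarrow>
      acc_rep s' ((a + 1) div 2) ((w + 1) div 2) (th div 2) (Suc e) \<Longrightarrow> Q s'"
  shows "wp F X bump s 35 Q"
proof -
  have sm: "small X 0" "small X 1" "small X 2" "1 \<le> X" using X by (auto simp: small_0 small_1 small_numeral)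
  have fl: "\<lfloor>(of_int v + 1) / 2 :: rat\<rfloor> = (v + 1) div 2" for v
    using floor_divide_of_int_eq[of "v + 1" 2, where 'a = rat] by simp
  have fl': "\<lfloor>of_int v / 2 :: rat\<rfloor> = v div 2" for v
    using floor_divide_of_int_eq[of v 2, where 'a = rat] by simp
  have si: "small X (of_int v)" if "0 \<le> v" "v \<le> int X" for v using that sm by (intro small_of_int) auto
  have r: "s ''a'' 0 = of_int a" "s ''w'' 0 = of_int w" "s ''th'' 0 = of_int th" "s ''e'' 0 = of_nat e"
    using s(1) by (auto simp: acc_rep_def)
  let ?a = "(a + 1) div 2" and ?w = "(w + 1) div 2" and ?th = "th div 2"
  have ints: "0 \<le> ?a" "?a \<le> int X" "0 \<le> ?w" "?w \<le> int X" "0 \<le> ?th" "?th \<le> int X"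
    using s X by linarith+
  let ?s1 = "upd s ''a'' (of_int ?a)"
  let ?s2 = "upd ?s1 ''w'' (of_int ?w)"
  let ?s3 = "upd ?s2 ''th'' (of_int ?th)"
  let ?s4 = "upd ?s3 ''e'' (of_nat (Suc e))"
  have Q4: "Q ?s4" by (rule Q) (auto simp: frame_def acc_rep_def)
  have "wp F X bump s ((ops (Floor ((V ''a'' [+] Num 1) [/] Num 2)) + 2) + ((ops (Floor ((V ''w'' [+] Num 1) [/] Num 2)) + 2) +
    ((ops (Floor (V ''th'' [/] Num 2)) + 2) + (ops (V ''e'' [+] Num 1) + 2)))) Q"
    unfolding bump_def
  proof (rule wp_seq, rule wp_putv[where v = "of_int ?a"], goal_cases)
    case 6
    show ?case
    proof (rule wp_seq, rule wp_putv[where v = "of_int ?w"], goal_cases)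
      case 6
      show ?case
      proof (rule wp_seq, rule wp_putv[where v = "of_int ?th"], goal_cases)
        case 6
        show ?case
          by (rule wp_putv[where v = "of_nat (Suc e)"])
            (use r Q4 sm X small_of_nat[of "Suc e" X] in simp_all)
      qed (use r sm si ints in \<open>simp_all add: fl'\<close>)
    qed (use r sm si ints in \<open>simp_all add: fl\<close>)
  qed (use r sm si ints in \<open>simp_all add: fl\<close>)
  thus ?thesis by (rule wp_time) simp
qed

text \<open>If the incoming exponent \<open>f\<close> is the smaller one, its mantissa is rounded.
  Otherwise a mantissa below \<open>R\<close> is doubled, which is exact. The accumulator is
  coarsened only if the incoming mantissa is at least \<open>R\<close>: then the sum has a mantissa
  of at least \<open>R\<close> as well, and an error of one unit in the last place is relatively
  small.\<close>

definition align :: prog where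
  "align = While (V ''e'' [-] V ''f'')
     (If (V ''f'' [\<le>] V ''e'')
       (put ''c'' (Floor ((V ''c'' [+] Num 1) [/] Num 2)) ;; put ''f'' (V ''f'' [+] Num 1))
       (If (V ''R'' [\<le>] V ''c'') bump
         (put ''c'' (V ''c'' [+] V ''c'') ;; put ''f'' (V ''f'' [-] Num 1))))"

lemma wp_align:
  assumes X: "3 \<le> X" "a0 + 1 \<le> int X" "th0 \<le> int X" "max e0 f0 + 1 \<le> X" "Cm + 1 \<le> int X"
    and s: "acc_rep s a0 w0 th0 e0" "0 \<le> w0" "w0 \<le> a0" "0 \<le> th0"
      "s ''c'' 0 = of_int c0" "s ''f'' 0 = of_nat f0" "s ''R'' 0 = of_int R"
    and c: "1 \<le> c0" "c0 \<le> Cm" "2 * R \<le> Cm"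
    and R: "0 < e0 \<Longrightarrow> R \<le> a0" and E: "e0 \<le> E" "f0 \<le> E"
    and Q: "\<And>s' a w th e c. frame {''a'', ''w'', ''th'', ''e'', ''c'', ''f''} s s' \<Longrightarrow> acc_rep s' a w th e \<Longrightarrow>
      s' ''c'' 0 = of_int c \<Longrightarrow> bumped a0 w0 th0 e0 a w th e \<Longrightarrow> e \<le> max e0 f0 \<Longrightarrow>
      c0 * 2 ^ f0 \<le> c * 2 ^ e \<Longrightarrow> c * 2 ^ e \<le> c0 * 2 ^ f0 + (2 ^ e - 1) \<Longrightarrow> 1 \<le> c \<Longrightarrow> c \<le> Cm \<Longrightarrow>
      (0 < e \<longrightarrow> R \<le> a + c) \<Longrightarrow> Q s'"
  shows "wp F X align s (10 + E * 100) Q"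
proof -
  let ?A = "{''a'', ''w'', ''th'', ''e'', ''c'', ''f''}"
  have sm: "small X 0" "small X 1" "small X 2" "1 \<le> X" using X by (auto simp: small_0 small_1 small_numeral)
  have fl: "\<lfloor>(of_int v + 1) / 2 :: rat\<rfloor> = (v + 1) div 2" for v
    using floor_divide_of_int_eq[of "v + 1" 2, where 'a = rat] by simp
  \<comment> \<open>While \<open>e < f\<close>, no rounding of the incoming weight has taken place.
    The last conjunct records what guarantees the precision: the accumulator itself, or an incoming
    mantissa that caused the coarsening.\<close>
  define P where "P = (\<lambda>s' a w th e c f. frame ?A s s' \<and> acc_rep s' a w th e \<and> s' ''c'' 0 = of_int c \<and> s' ''f'' 0 = of_nat f \<and>
     bumped a0 w0 th0 e0 a w th e \<and> max e f \<le> max e0 f0 \<and>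
     c0 * 2 ^ f0 \<le> c * 2 ^ f \<and> c * 2 ^ f \<le> c0 * 2 ^ f0 + (2 ^ f - 1) \<and> (e < f \<longrightarrow> c * 2 ^ f = c0 * 2 ^ f0) \<and>
     1 \<le> c \<and> c \<le> Cm \<and> (0 < e \<longrightarrow> R \<le> a \<or> R \<le> c \<and> e \<le> f))"
  define J where "J = (\<lambda>k s'. \<exists>a w th e c f. P s' a w th e c f \<and> k = (e - f) + (f - e))"
  have "wp F X align s (((e0 - f0) + (f0 - e0) + 1) * (ops (V ''e'' [-] V ''f'') + 1) + ((e0 - f0) + (f0 - e0)) * 80) Q"
    unfolding align_def
  proof (rule wp_while[where I = J])
    have "P s a0 w0 th0 e0 c0 f0"
      unfolding P_def using s c R bumped_refl[OF s(2-4)] frame_refl by auto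
    thus "J ((e0 - f0) + (f0 - e0)) s" unfolding J_def by blast
  next
    fix k s1 assume "J (Suc k) s1" "val F s1 (V ''e'' [-] V ''f'') \<noteq> 0"
    then obtain a w th e c f where P: "P s1 a w th e c f" and k: "Suc k = (e - f) + (f - e)"
      unfolding J_def by blast
    have p: "frame ?A s s1" "acc_rep s1 a w th e" "s1 ''c'' 0 = of_int c" "s1 ''f'' 0 = of_nat f" "s1 ''e'' 0 = of_nat e"
      "bumped a0 w0 th0 e0 a w th e" "max e f \<le> max e0 f0"
      "c0 * 2 ^ f0 \<le> c * 2 ^ f" "c * 2 ^ f \<le> c0 * 2 ^ f0 + (2 ^ f - 1)" "e < f \<longrightarrow> c * 2 ^ f = c0 * 2 ^ f0"
      "1 \<le> c" "c \<le> Cm" "0 < e \<longrightarrow> R \<le> a \<or> R \<le> c \<and> e \<le> f"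
      using P unfolding P_def acc_rep_def by blast+
    have b: "0 \<le> a" "a \<le> a0" "0 \<le> w" "w \<le> a" "0 \<le> th" "th \<le> th0" using p(6) by (auto simp: bumped_def)
    have sR: "s1 ''R'' 0 = of_int R" using p(1) s(7) by (simp add: frame_def)
    show "wp F X (If (V ''f'' [\<le>] V ''e'')
       (put ''c'' (Floor ((V ''c'' [+] Num 1) [/] Num 2)) ;; put ''f'' (V ''f'' [+] Num 1))
       (If (V ''R'' [\<le>] V ''c'') bump
         (put ''c'' (V ''c'' [+] V ''c'') ;; put ''f'' (V ''f'' [-] Num 1)))) s1 80 (J k)"
    proof (rule wp_time, rule wp_if)
      assume "val F s1 (V ''f'' [\<le>] V ''e'') \<noteq> 0"
      hence fe: "f < e" using p k by (auto split: if_splits)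
      define c' where "c' = (c + 1) div 2"
      have c': "c \<le> 2 * c'" "2 * c' \<le> c + 1" "1 \<le> c'" "c' \<le> c" using p(11) unfolding c'_def by linarith+
      let ?s2 = "upd (upd s1 ''c'' (of_int c')) ''f'' (of_nat (Suc f))"
      have pw: "c * 2 ^ f \<le> c' * 2 ^ Suc f" "c' * 2 ^ Suc f \<le> c * 2 ^ f + 2 ^ f"
        using mult_right_mono[OF c'(1), of "2 ^ f"] mult_right_mono[OF c'(2), of "2 ^ f"]
        by (simp_all add: algebra_simps)
      have "P ?s2 a w th e c' (Suc f)"
        unfolding P_def
      proof (intro conjI)
        show "frame ?A s ?s2" using p(1) by (auto simp: frame_def)
        show "acc_rep ?s2 a w th e" using p(2) by (auto simp: acc_rep_def)
        show "max e (Suc f) \<le> max e0 f0" using p(7) fe by auto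
        show "c0 * 2 ^ f0 \<le> c' * 2 ^ Suc f" using p(8) pw(1) by linarith
        show "c' * 2 ^ Suc f \<le> c0 * 2 ^ f0 + (2 ^ Suc f - 1)" using p(9) pw(2) power_Suc[of "2::int" f] by linarith
      qed (use p c' fe in auto)
      moreover have "k = (e - Suc f) + (Suc f - e)" using k fe by auto
      ultimately have J: "J k ?s2" unfolding J_def by blast
      show "wp F X (put ''c'' (Floor ((V ''c'' [+] Num 1) [/] Num 2)) ;; put ''f'' (V ''f'' [+] Num 1)) s1
        ((ops (Floor ((V ''c'' [+] Num 1) [/] Num 2)) + 2) + (ops (V ''f'' [+] Num 1) + 2)) (J k)"
      proof (rule wp_seq, rule wp_putv[where v = "of_int c'"], goal_cases)
        case 6
        show ?case
          by (rule wp_putv[where v = "of_nat (Suc f)"])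
            (use p J sm X fe small_of_nat[of "Suc f" X] in simp_all)
      next
        case 5 show ?case using c' p(12) X by (intro small_of_int) auto
      qed (use p sm in \<open>simp_all add: fl c'_def\<close>)
    next
      assume "val F s1 (V ''f'' [\<le>] V ''e'') = 0"
      hence ef: "e < f" using p by (auto split: if_splits)
      show "wp F X (If (V ''R'' [\<le>] V ''c'') bump
         (put ''c'' (V ''c'' [+] V ''c'') ;; put ''f'' (V ''f'' [-] Num 1))) s1
         (ops (V ''R'' [\<le>] V ''c'') + 1 + (35 + ((ops (V ''c'' [+] V ''c'') + 2) + (ops (V ''f'' [-] Num 1) + 2)))) (J k)"
      proof (rule wp_if)
        assume "val F s1 (V ''R'' [\<le>] V ''c'') \<noteq> 0"
        hence Rc: "R \<le> c" using p sR by (auto split: if_splits)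
        show "wp F X bump s1 35 (J k)"
        proof (rule wp_bump[OF _ _ _ _ p(2)])
          fix s' assume s': "frame {''a'', ''w'', ''th'', ''e''} s1 s'" "acc_rep s' ((a + 1) div 2) ((w + 1) div 2) (th div 2) (Suc e)"
          have "P s' ((a + 1) div 2) ((w + 1) div 2) (th div 2) (Suc e) c f"
            unfolding P_def
          proof (intro conjI)
            show "frame ?A s s'" using p(1) s'(1) by (auto simp: frame_def)
            show "bumped a0 w0 th0 e0 ((a + 1) div 2) ((w + 1) div 2) (th div 2) (Suc e)"
              using bumped_trans[OF p(6) bumped_step] b by blast
          qed (use p s' ef Rc in \<open>auto simp: frame_def\<close>)
          moreover have "k = (Suc e - f) + (f - Suc e)" using k ef by auto
          ultimately show "J k s'" unfolding J_def by blast
        qed (use b X p(7) in auto)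
      next
        assume "val F s1 (V ''R'' [\<le>] V ''c'') = 0"
        hence Rc: "c < R" using p sR by (auto split: if_splits)
        obtain f' where f': "f = Suc f'" using ef by (cases f) auto
        let ?s2 = "upd (upd s1 ''c'' (of_int (2 * c))) ''f'' (of_nat f')"
        have "P ?s2 a w th e (2 * c) f'"
          unfolding P_def
        proof (intro conjI)
          show "frame ?A s ?s2" using p(1) by (auto simp: frame_def)
          show "acc_rep ?s2 a w th e" using p(2) by (auto simp: acc_rep_def)
          show "c0 * 2 ^ f0 \<le> 2 * c * 2 ^ f'" "e < f' \<longrightarrow> 2 * c * 2 ^ f' = c0 * 2 ^ f0"
             using p(10) ef f' by (auto simp: algebra_simps)
          have "2 * c * 2 ^ f' = c0 * 2 ^ f0" using p(10) ef f' by (auto simp: algebra_simps)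
          moreover have "(1::int) \<le> 2 ^ f'" by simp
          ultimately show "2 * c * 2 ^ f' \<le> c0 * 2 ^ f0 + (2 ^ f' - 1)" by linarith
        qed (use p c ef f' Rc in auto)
        moreover have "k = (e - f') + (f' - e)" using k ef f' by auto
        ultimately have J: "J k ?s2" unfolding J_def by blast
        show "wp F X (put ''c'' (V ''c'' [+] V ''c'') ;; put ''f'' (V ''f'' [-] Num 1)) s1
          ((ops (V ''c'' [+] V ''c'') + 2) + (ops (V ''f'' [-] Num 1) + 2)) (J k)"
        proof (rule wp_seq, rule wp_putv[where v = "of_int (2 * c)"], goal_cases)
          case 6
          show ?case
            by (rule wp_putv[where v = "of_nat f'"])
              (use p J sm X f' small_of_nat[of f' X] in simp_all)
        next
          case 5 show ?case using Rc c p(11) X by (intro small_of_int) auto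
        qed (use p sm in simp_all)
      qed (use sm in auto)
    qed (use sm in auto)
  next
    fix s1 assume "J 0 s1" thus "val F s1 (V ''e'' [-] V ''f'') = 0" by (auto simp: J_def P_def acc_rep_def)
  next
    fix k s1 assume "J k s1" and z: "val F s1 (V ''e'' [-] V ''f'') = 0"
    then obtain a w th e c f where P: "P s1 a w th e c f" unfolding J_def by blast
    hence ef: "f = e" using z by (auto simp: P_def acc_rep_def)
    show "Q s1"
    proof (rule Q)
      show "frame ?A s s1" "acc_rep s1 a w th e" "s1 ''c'' 0 = of_int c" "bumped a0 w0 th0 e0 a w th e" "e \<le> max e0 f0"
        "c0 * 2 ^ f0 \<le> c * 2 ^ e" "c * 2 ^ e \<le> c0 * 2 ^ f0 + (2 ^ e - 1)" "1 \<le> c" "c \<le> Cm"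
        using P unfolding P_def ef by auto
      show "0 < e \<longrightarrow> R \<le> a + c" using P unfolding P_def ef bumped_def by auto
    qed
  qed (use sm in auto)
  moreover have "(e0 - f0) + (f0 - e0) \<le> E" using E by auto
  hence "((e0 - f0) + (f0 - e0) + 1) * (ops (V ''e'' [-] V ''f'') + 1) + ((e0 - f0) + (f0 - e0)) * 80 \<le> 10 + E * 100"
    by simp
  ultimately show ?thesis by (rule wp_time)
qed

text \<open>Halving stops as soon as the mantissa is below \<open>2 * R\<close>. Thus mantissas stay
  short, but never fall below \<open>R\<close> by this loop.\<close>

definition normalise :: prog where
  "normalise = While (Num 2 [*] V ''R'' [\<le>] V ''a'') bump"

lemma wp_normalise:
  assumes X: "3 \<le> X" "a0 + 1 \<le> int X" "th0 \<le> int X" "e0 + h + 1 \<le> X"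
    and s: "acc_rep s a0 w0 th0 e0" "0 \<le> w0" "w0 \<le> a0" "0 \<le> th0" "s ''R'' 0 = of_int R" "1 \<le> R"
    and R: "0 < e0 \<Longrightarrow> R \<le> a0" and h: "a0 \<le> 2 ^ h"
    and Q: "\<And>s' a w th e. frame {''a'', ''w'', ''th'', ''e''} s s' \<Longrightarrow> acc_rep s' a w th e \<Longrightarrow>
      bumped a0 w0 th0 e0 a w th e \<Longrightarrow> a < 2 * R \<Longrightarrow> (0 < e \<longrightarrow> R \<le> a) \<Longrightarrow> e \<le> e0 + h \<Longrightarrow> Q s'"
  shows "wp F X normalise s (10 + h * 50) Q"
proof -
  let ?A = "{''a'', ''w'', ''th'', ''e''}"
  have sm: "small X 0" "small X 1" "small X 2" "1 \<le> X" using X by (auto simp: small_0 small_1 small_numeral)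
  define P where "P = (\<lambda>k s' a w th e. frame ?A s s' \<and> acc_rep s' a w th e \<and>
     bumped a0 w0 th0 e0 a w th e \<and> (0 < e \<longrightarrow> R \<le> a) \<and> a \<le> 2 ^ k \<and> e + k = e0 + h)"
  define J where "J = (\<lambda>k s'. \<exists>a w th e. P k s' a w th e)"
  show ?thesis unfolding normalise_def
  proof (rule wp_time, rule wp_while[where I = J and k = h])
    have "P h s a0 w0 th0 e0" unfolding P_def using s R h bumped_refl[OF s(2-4)] frame_refl by auto
    thus "J h s" unfolding J_def by blast
  next
    fix k s1 assume "J (Suc k) s1" and nz: "val F s1 (Num 2 [*] V ''R'' [\<le>] V ''a'') \<noteq> 0"
    then obtain a w th e where P: "P (Suc k) s1 a w th e" unfolding J_def by blast
    have p: "frame ?A s s1" "acc_rep s1 a w th e" "bumped a0 w0 th0 e0 a w th e" "a \<le> 2 ^ Suc k" "Suc e + k = e0 + h"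
      "s1 ''R'' 0 = of_int R" "s1 ''a'' 0 = of_int a"
      using P s(5) unfolding P_def by (auto simp: frame_def acc_rep_def)
    have b: "0 \<le> a" "a \<le> a0" "0 \<le> w" "w \<le> a" "0 \<le> th" "th \<le> th0" using p(3) by (auto simp: bumped_def)
    have "2 * of_int R \<le> (of_int a :: rat)" using nz p by (auto split: if_splits)
    hence "(of_int (2 * R) :: rat) \<le> of_int a" by simp
    hence Ra: "2 * R \<le> a" by (simp only: of_int_le_iff)
    show "wp F X bump s1 35 (J k)"
    proof (rule wp_bump[OF _ _ _ _ p(2)])
      fix s' assume s': "frame ?A s1 s'" "acc_rep s' ((a + 1) div 2) ((w + 1) div 2) (th div 2) (Suc e)"
      have "P k s' ((a + 1) div 2) ((w + 1) div 2) (th div 2) (Suc e)"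
        unfolding P_def
      proof (intro conjI)
        show "frame ?A s s'" using p(1) s'(1) by (rule frame_trans)
        show "bumped a0 w0 th0 e0 ((a + 1) div 2) ((w + 1) div 2) (th div 2) (Suc e)"
          using bumped_trans[OF p(3) bumped_step] b by blast
        show "0 < Suc e \<longrightarrow> R \<le> (a + 1) div 2" using Ra by linarith
        show "(a + 1) div 2 \<le> 2 ^ k" using p(4) by simp
      qed (use p s' in auto)
      thus "J k s'" unfolding J_def by blast
    qed (use b X p in auto)
  next
    fix s1 assume "J 0 s1"
    then obtain a w th e where P: "P 0 s1 a w th e" unfolding J_def by blast
    hence p: "a \<le> 1" "s1 ''R'' 0 = of_int R" "s1 ''a'' 0 = of_int a" using s(5) by (auto simp: P_def frame_def acc_rep_def)
    hence "\<not> (of_int (2 * R) :: rat) \<le> of_int a" using s(6) by (subst of_int_le_iff) auto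
    thus "val F s1 (Num 2 [*] V ''R'' [\<le>] V ''a'') = 0" using p by simp
  next
    fix k s1 assume "J k s1" and z: "val F s1 (Num 2 [*] V ''R'' [\<le>] V ''a'') = 0"
    then obtain a w th e where P: "P k s1 a w th e" unfolding J_def by blast
    hence p: "s1 ''R'' 0 = of_int R" "s1 ''a'' 0 = of_int a" using s(5) by (auto simp: P_def frame_def acc_rep_def)
    have "\<not> (of_int (2 * R) :: rat) \<le> of_int a" using z p by (auto split: if_splits)
    hence "a < 2 * R" by (simp only: of_int_le_iff not_le)
    thus "Q s1" using P unfolding P_def by (intro Q[of s1 a w th e]) auto
  qed (use sm in auto)
qed

text \<open>The new row is the value of \<open>S\<close> before the increment, and \<open>a\<close>
  already contains the opening element. The threshold is therefore \<open>1 + ep\<close> times the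
  total right after the opening of the block, rounded down.\<close>

definition new_block :: prog where
  "new_block = (put ''o1'' (V ''S'' [*] V ''K'') ;;
     put ''o2'' (V ''i'' [*] V ''K'') ;;
     put ''o3'' (Num 0) ;;
     put ''S'' (V ''S'' [+] Num 1) ;;
     put ''w'' (V ''c'') ;;
     put ''th'' (Floor ((Num 1 [+] V ''ep'') [*] V ''a'')) ;;
     add_vec ''key'' ''o1'' ''ky'' ''o2'' ''zero'' ''o3'')"

text \<open>Closed blocks keep the mantissa and the exponent they had last. Only the row of the open
  block is rewritten, because \<open>w\<close> and \<open>e\<close> change with every
  element.\<close>

definition absorb :: prog where
  "absorb = (align ;;
     put ''a'' (V ''a'' [+] V ''c'') ;;
     If (V ''a'' [\<le>] V ''th'') (put ''w'' (V ''w'' [+] V ''c'')) new_block ;;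
     normalise ;;
     Assign ''ma'' (V ''S'' [-] Num 1) (V ''w'') ;;
     Assign ''ex'' (V ''S'' [-] Num 1) (V ''e''))"

text \<open>The intermediate values belong to the moment after \<open>align\<close>; the second
  occurrence of \<open>bumped\<close> describes \<open>normalise\<close>. The error analysis rests
  on this relation alone and does not refer to the program.\<close>

definition absorbed :: "rat \<Rightarrow> int \<Rightarrow> int \<Rightarrow> int \<Rightarrow> int \<Rightarrow> nat \<Rightarrow> int \<Rightarrow> nat \<Rightarrow> bool \<Rightarrow> int \<Rightarrow> int \<Rightarrow> int \<Rightarrow> nat \<Rightarrow> bool" where
  "absorbed \<epsilon> R a0 w0 th0 e0 c0 f0 new a w th e \<longleftrightarrow>
     (\<exists>a1 w1 th1 e1 c1. bumped a0 w0 th0 e0 a1 w1 th1 e1 \<and> c0 * 2 ^ f0 \<le> c1 * 2 ^ e1 \<and>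
        c1 * 2 ^ e1 \<le> c0 * 2 ^ f0 + (2 ^ e1 - 1) \<and> 1 \<le> c1 \<and> (0 < e1 \<longrightarrow> R \<le> a1 + c1) \<and>
        (new \<longleftrightarrow> \<not> a1 + c1 \<le> th1) \<and>
        bumped (a1 + c1) (if new then c1 else w1 + c1) (if new then \<lfloor>(1 + \<epsilon>) * of_int (a1 + c1)\<rfloor> else th1) e1 a w th e \<and>
        (0 < e \<longrightarrow> R \<le> a) \<and> a < 2 * R)"

lemma floor_one_plus:
  assumes "0 \<le> \<epsilon>" "\<epsilon> \<le> 1" "0 \<le> a"
  shows "0 \<le> \<lfloor>(1 + \<epsilon>) * of_int a :: rat\<rfloor>" "\<lfloor>(1 + \<epsilon>) * of_int a :: rat\<rfloor> \<le> 2 * a"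
proof -
  have "(1 + \<epsilon>) * of_int a \<le> 2 * of_int a" using assms by (intro mult_right_mono) auto
  hence "\<lfloor>(1 + \<epsilon>) * of_int a\<rfloor> \<le> \<lfloor>of_int (2 * a) :: rat\<rfloor>" by (intro floor_mono) simp
  thus "\<lfloor>(1 + \<epsilon>) * of_int a\<rfloor> \<le> 2 * a" unfolding floor_of_int .
  show "0 \<le> \<lfloor>(1 + \<epsilon>) * of_int a\<rfloor>" using assms by simp
qed

lemma wp_new_block:
  assumes X: "3 \<le> X" "S0 + 1 < X" "S0 * K + K < X" "i0 * K < X" "K < X" "4 * Cm \<le> int X"
    and s: "s ''S'' 0 = of_nat S0" "s ''K'' 0 = of_nat K" "s ''i'' 0 = of_nat i0" "s ''ep'' 0 = \<epsilon>"
      "s ''a'' 0 = of_int a" "s ''c'' 0 = of_int c" "s ''e'' 0 = of_nat e" "s ''zero'' = (\<lambda>_. 0)"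
    and b: "0 \<le> \<epsilon>" "\<epsilon> \<le> 1" "0 \<le> a" "a \<le> 2 * Cm" "1 \<le> c" "c \<le> Cm"
    and ky: "\<And>k. k < K \<Longrightarrow> small X (s ''ky'' (int (i0 * K + k)))"
    and Q: "\<And>s'. frame {''w'', ''th'', ''o1'', ''o2'', ''o3'', ''S'', ''key'', ''k''} s s' \<Longrightarrow>
       acc_rep s' a c \<lfloor>(1 + \<epsilon>) * of_int a\<rfloor> e \<Longrightarrow> s' ''S'' 0 = of_nat (Suc S0) \<Longrightarrow>
       (\<And>k. k < K \<Longrightarrow> s' ''key'' (int (S0 * K + k)) = s ''ky'' (int (i0 * K + k))) \<Longrightarrow>
       (\<And>j. j < int (S0 * K) \<Longrightarrow> s' ''key'' j = s ''key'' j) \<Longrightarrow> Q s'"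
  shows "wp F X new_block s (60 + K * 40) Q"
proof -
  have sm: "small X 0" "small X 1" "small X 2" "1 \<le> X" using X by (auto simp: small_0 small_1 small_numeral)
  have sn: "small X (of_nat v)" if "v \<le> X" for v using that sm by (intro small_of_nat) auto
  let ?th = "\<lfloor>(1 + \<epsilon>) * of_int a\<rfloor>"
  have th: "0 \<le> ?th" "?th \<le> 2 * a" using floor_one_plus b by auto
  have sth: "small X (of_int ?th)" using th b X by (intro small_of_int) auto
  have sc: "small X (of_int c)" using b X by (intro small_of_int) auto
  let ?s1 = "upd s ''o1'' (of_nat (S0 * K))"
  let ?s2 = "upd ?s1 ''o2'' (of_nat (i0 * K))"
  let ?s3 = "upd ?s2 ''o3'' 0"
  let ?s4 = "upd ?s3 ''S'' (of_nat (Suc S0))"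
  let ?s5 = "upd ?s4 ''w'' (of_int c)"
  let ?s6 = "upd ?s5 ''th'' (of_int ?th)"
  have last: "wp F X (add_vec ''key'' ''o1'' ''ky'' ''o2'' ''zero'' ''o3'') ?s6 (12 + K * 40) Q"
  proof (rule wp_add_vec[where K = K and ?p1.0 = "S0 * K" and ?p2.0 = "i0 * K" and ?p3.0 = 0])
    fix s' assume s': "frame {''key'', ''k''} ?s6 s'"
      "\<And>k. k < K \<Longrightarrow> s' ''key'' (int (S0 * K + k)) = ?s6 ''ky'' (int (i0 * K + k)) + ?s6 ''zero'' (int (0 + k))"
      "\<And>j. j < int (S0 * K) \<or> int (S0 * K + K) \<le> j \<Longrightarrow> s' ''key'' j = ?s6 ''key'' j"
    show "Q s'"
    proof (rule Q)
      show "frame {''w'', ''th'', ''o1'', ''o2'', ''o3'', ''S'', ''key'', ''k''} s s'"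
        using s'(1) by (auto simp: frame_def)
      show "acc_rep s' a c ?th e" "s' ''S'' 0 = of_nat (Suc S0)" using s'(1) s by (auto simp: frame_def acc_rep_def)
    next
      fix k assume "k < K"
      thus "s' ''key'' (int (S0 * K + k)) = s ''ky'' (int (i0 * K + k))" using s'(2)[of k] s by simp
    next
      fix j assume "j < int (S0 * K)"
      thus "s' ''key'' j = s ''key'' j" using s'(3)[of j] by simp
    qed
  qed (use X s ky in auto)
  have "wp F X new_block s ((ops (V ''S'' [*] V ''K'') + 2) + ((ops (V ''i'' [*] V ''K'') + 2) +
    ((ops (Num 0) + 2) + ((ops (V ''S'' [+] Num 1) + 2) + ((ops (V ''c'') + 2) +
    ((ops (Floor ((Num 1 [+] V ''ep'') [*] V ''a'')) + 2) + (12 + K * 40))))))) Q"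
    unfolding new_block_def
  proof (rule wp_seq, rule wp_putv[where v = "of_nat (S0 * K)"], goal_cases)
    case 6 show ?case
    proof (rule wp_seq, rule wp_putv[where v = "of_nat (i0 * K)"], goal_cases)
      case 6 show ?case
      proof (rule wp_seq, rule wp_putv[where v = 0], goal_cases)
        case 6 show ?case
        proof (rule wp_seq, rule wp_putv[where v = "of_nat (Suc S0)"], goal_cases)
          case 6 show ?case
          proof (rule wp_seq, rule wp_putv[where v = "of_int c"], goal_cases)
            case 6 show ?case
            proof (rule wp_seq, rule wp_putv[where v = "of_int ?th"], goal_cases)
              case 6 show ?case by (rule last)
            qed (use s sm sth in simp_all)
          qed (use s sm sc in simp_all)
        next
          case 5 show ?case using X by (intro sn) simp
        qed (use s sm in simp_all)
      qed (use s sm in simp_all)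
    next
      case 5 show ?case using X by (intro sn) simp
    qed (use s sm in simp_all)
  next
    case 5 show ?case using X by (intro sn) simp
  qed (use s sm in simp_all)
  thus ?thesis by (rule wp_time) simp
qed

text \<open>\<open>S1\<close> is the row of the block that is open afterwards: a fresh one if
  \<open>new\<close> holds, otherwise the last existing one. Naming it avoids truncated
  subtraction.\<close>

lemma wp_absorb:
  assumes X: "3 \<le> X" "S0 + 1 < X" "S0 * K + K < X" "i0 * K < X" "K < X" "4 * Cm + 2 \<le> int X" "E + h + 1 \<le> X"
    and s: "s ''S'' 0 = of_nat S0" "s ''K'' 0 = of_nat K" "s ''i'' 0 = of_nat i0" "s ''ep'' 0 = \<epsilon>"
      "acc_rep s a0 w0 th0 e0" "s ''R'' 0 = of_int R" "s ''c'' 0 = of_int c0" "s ''f'' 0 = of_nat f0" "s ''zero'' = (\<lambda>_. 0)"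
    and b: "0 \<le> \<epsilon>" "\<epsilon> \<le> 1" "0 \<le> w0" "w0 \<le> a0" "0 \<le> th0" "th0 \<le> 4 * Cm" "a0 < 2 * R" "1 \<le> R" "2 * R \<le> Cm" "1 \<le> c0" "c0 \<le> Cm"
      "0 < e0 \<Longrightarrow> R \<le> a0" "e0 \<le> E" "f0 \<le> E" "2 * Cm \<le> 2 ^ h" "S0 = 0 \<Longrightarrow> th0 = 0"
    and ky: "\<And>k. k < K \<Longrightarrow> small X (s ''ky'' (int (i0 * K + k)))"
    and Q: "\<And>s' new a w th e S1. frame {''a'', ''w'', ''th'', ''e'', ''c'', ''f'', ''o1'', ''o2'', ''o3'', ''S'', ''key'', ''k'', ''ma'', ''ex''} s s' \<Longrightarrow>
       acc_rep s' a w th e \<Longrightarrow> absorbed \<epsilon> R a0 w0 th0 e0 c0 f0 new a w th e \<Longrightarrow> th \<le> 4 * Cm \<Longrightarrow>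
       (new \<longrightarrow> S1 = S0) \<Longrightarrow> (\<not> new \<longrightarrow> S0 = Suc S1) \<Longrightarrow> s' ''S'' 0 = of_nat (Suc S1) \<Longrightarrow>
       s' ''ma'' = (s ''ma'')(int S1 := of_int w) \<Longrightarrow> s' ''ex'' = (s ''ex'')(int S1 := of_nat e) \<Longrightarrow>
       (new \<longrightarrow> (\<forall>k<K. s' ''key'' (int (S0 * K + k)) = s ''ky'' (int (i0 * K + k)))) \<Longrightarrow>
       (\<forall>j<int (S0 * K). s' ''key'' j = s ''key'' j) \<Longrightarrow> Q s'"
  shows "wp F X absorb s (150 + E * 100 + h * 50 + K * 40) Q"
proof -
  have sm: "small X 0" "small X 1" "small X 2" "1 \<le> X" using X by (auto simp: small_0 small_1 small_numeral)
  have sn: "small X (of_nat v)" if "v \<le> X" for v using that sm by (intro small_of_nat) auto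
  have si: "small X (of_int v)" if "\<bar>v\<bar> \<le> int X" for v using that sm by (intro small_of_int) auto
  let ?A = "{''a'', ''w'', ''th'', ''e'', ''c'', ''f'', ''o1'', ''o2'', ''o3'', ''S'', ''key'', ''k''}"
  let ?rest2 = "Assign ''ma'' (V ''S'' [-] Num 1) (V ''w'') ;; Assign ''ex'' (V ''S'' [-] Num 1) (V ''e'')"
  let ?rest1 = "normalise ;; ?rest2"
  let ?if = "If (V ''a'' [\<le>] V ''th'') (put ''w'' (V ''w'' [+] V ''c'')) new_block"
  have rest: "wp F X ?rest1 s3 ((10 + h * 50) + 20) Q"
    if s3: "frame ?A s s3" "acc_rep s3 a2 w2 th2 e1" "s3 ''S'' 0 = of_nat (Suc S1)"
      "a2 = a1 + c1" "w2 = (if new then c1 else w1 + c1)" "th2 = (if new then \<lfloor>(1 + \<epsilon>) * of_int (a1 + c1)\<rfloor> else th1)"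
      "bumped a0 w0 th0 e0 a1 w1 th1 e1" "e1 \<le> max e0 f0" "c0 * 2 ^ f0 \<le> c1 * 2 ^ e1"
      "c1 * 2 ^ e1 \<le> c0 * 2 ^ f0 + (2 ^ e1 - 1)" "1 \<le> c1" "c1 \<le> Cm" "0 < e1 \<longrightarrow> R \<le> a1 + c1"
      "new \<longleftrightarrow> \<not> a1 + c1 \<le> th1" "new \<longrightarrow> S1 = S0" "\<not> new \<longrightarrow> S0 = Suc S1"
      "new \<longrightarrow> (\<forall>k<K. s3 ''key'' (int (S0 * K + k)) = s ''ky'' (int (i0 * K + k)))"
      "\<forall>j<int (S0 * K). s3 ''key'' j = s ''key'' j"
    for s3 a1 a2 w1 w2 th1 th2 e1 c1 new S1
  proof -
    have bit_bound: "0 \<le> a1" "a1 \<le> a0" "0 \<le> w1" "w1 \<le> a1" "0 \<le> th1" "th1 \<le> th0" using s3(7) by (auto simp: bumped_def)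
    have a2: "a2 \<le> 2 * Cm" "1 \<le> a2" using bit_bound s3(4,11,12) b by linarith+
    have w2: "0 \<le> w2" "w2 \<le> a2" using bit_bound s3(4,5,11) by auto
    have th2: "0 \<le> th2 \<and> th2 \<le> 4 * Cm"
    proof (cases new)
      case True
      have "0 \<le> \<lfloor>(1 + \<epsilon>) * of_int a2\<rfloor>" "\<lfloor>(1 + \<epsilon>) * of_int a2\<rfloor> \<le> 2 * a2"
        using floor_one_plus[of \<epsilon> a2] b a2 by auto
      thus ?thesis using True s3(4,6) a2 by auto
    qed (use s3(6) bit_bound b in auto)
    have "Suc S1 \<le> S0 + 1" using s3(15,16) by (cases new) simp_all
    hence S1: "Suc S1 < X" using X(2) by simp
    show ?thesis
    proof (rule wp_seq, rule wp_normalise[OF _ _ _ _ s3(2)])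
      show "s3 ''R'' 0 = of_int R" using s3(1) s by (auto simp: frame_def)
      show "a2 \<le> 2 ^ h" using a2 b by linarith
      show "0 < e1 \<Longrightarrow> R \<le> a2" using s3 by simp
    next
      fix s4 a w th e
      assume s4: "frame {''a'', ''w'', ''th'', ''e''} s3 s4" "acc_rep s4 a w th e" "bumped a2 w2 th2 e1 a w th e"
        "a < 2 * R" "0 < e \<longrightarrow> R \<le> a" "e \<le> e1 + h"
      have S4: "s4 ''S'' 0 = of_nat (Suc S1)" using s3(3) s4(1) by (auto simp: frame_def)
      have r: "s4 ''w'' 0 = of_int w" "s4 ''e'' 0 = of_nat e" using s4(2) by (auto simp: acc_rep_def)
      have bnd: "0 \<le> w" "w \<le> a" "a \<le> a2" "th \<le> th2" using s4(3) by (auto simp: bumped_def)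
      let ?s5 = "s4(''ma'' := (s4 ''ma'')(int S1 := of_int w))"
      let ?s6 = "?s5(''ex'' := (?s5 ''ex'')(int S1 := of_nat e))"
      have fin: "Q ?s6"
      proof (rule Q)
        show "frame {''a'', ''w'', ''th'', ''e'', ''c'', ''f'', ''o1'', ''o2'', ''o3'', ''S'', ''key'', ''k'', ''ma'', ''ex''} s ?s6"
          using s3(1) s4(1) by (auto simp: frame_def)
        show "acc_rep ?s6 a w th e" using s4(2) by (auto simp: acc_rep_def)
        show "absorbed \<epsilon> R a0 w0 th0 e0 c0 f0 new a w th e"
          unfolding absorbed_def using s3(4-14) s4(3-5) by blast
        show "th \<le> 4 * Cm" using bnd th2 by linarith
        show "new \<longrightarrow> S1 = S0" "\<not> new \<longrightarrow> S0 = Suc S1" by fact+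
        show "?s6 ''S'' 0 = of_nat (Suc S1)" using S4 by simp
        have "s4 ''ma'' = s ''ma''" "s4 ''ex'' = s ''ex''" "s4 ''key'' = s3 ''key''"
          using s3(1) s4(1) by (auto simp: frame_def)
        thus "?s6 ''ma'' = (s ''ma'')(int S1 := of_int w)" "?s6 ''ex'' = (s ''ex'')(int S1 := of_nat e)"
          "new \<longrightarrow> (\<forall>k<K. ?s6 ''key'' (int (S0 * K + k)) = s ''ky'' (int (i0 * K + k)))"
          "\<forall>j<int (S0 * K). ?s6 ''key'' j = s ''key'' j"
          using s3(17,18) by auto
      qed
      have "wp F X ?rest2 s4 ((ops (V ''S'' [-] Num 1) + ops (V ''w'') + 1) + (ops (V ''S'' [-] Num 1) + ops (V ''e'') + 1)) Q"
      proof (rule wp_seq, rule wp_asg[where z = "int S1" and v = "of_int w"], goal_cases)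
        case 8 show ?case using bnd a2 X by (intro si) auto
      next
        case 9 show ?case
        proof (rule wp_asg[where z = "int S1" and v = "of_nat e"], goal_cases)
          case 8
          show ?case using s4(6) s3(8) b X by (intro sn) auto
        next
          case 9 show ?case by (rule fin)
        qed (use S4 r sm in simp_all)
      qed (use S4 r sm in simp_all)
      thus "wp F X ?rest2 s4 20 Q" by (rule wp_time) simp
    qed (use X a2 w2 th2 b s3 in auto)
  qed
  show ?thesis unfolding absorb_def
  proof (rule wp_time, rule wp_seq, rule wp_align[where Cm = Cm and E = E, OF _ _ _ _ _ s(5)])
    fix s1 a1 w1 th1 e1 c1
    assume s1: "frame {''a'', ''w'', ''th'', ''e'', ''c'', ''f''} s s1" "acc_rep s1 a1 w1 th1 e1" "s1 ''c'' 0 = of_int c1"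
      "bumped a0 w0 th0 e0 a1 w1 th1 e1" "e1 \<le> max e0 f0" "c0 * 2 ^ f0 \<le> c1 * 2 ^ e1"
      "c1 * 2 ^ e1 \<le> c0 * 2 ^ f0 + (2 ^ e1 - 1)" "1 \<le> c1" "c1 \<le> Cm" "0 < e1 \<longrightarrow> R \<le> a1 + c1"
    have bit_bound: "0 \<le> a1" "a1 \<le> a0" "0 \<le> w1" "w1 \<le> a1" "0 \<le> th1" "th1 \<le> th0" using s1(4) by (auto simp: bumped_def)
    have r: "s1 ''a'' 0 = of_int a1" "s1 ''w'' 0 = of_int w1" "s1 ''th'' 0 = of_int th1" "s1 ''e'' 0 = of_nat e1"
      using s1(2) by (auto simp: acc_rep_def)
    have fr: "s1 ''S'' 0 = of_nat S0" "s1 ''K'' 0 = of_nat K" "s1 ''i'' 0 = of_nat i0" "s1 ''ep'' 0 = \<epsilon>"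
       "s1 ''zero'' = (\<lambda>_. 0)" "s1 ''ky'' = s ''ky''" "s1 ''key'' = s ''key''"
      using s1(1) s by (auto simp: frame_def)
    let ?s2 = "upd s1 ''a'' (of_int (a1 + c1))"
    have fr2: "?s2 ''S'' 0 = of_nat S0" "?s2 ''K'' 0 = of_nat K" "?s2 ''i'' 0 = of_nat i0" "?s2 ''ep'' 0 = \<epsilon>"
      "?s2 ''a'' 0 = of_int (a1 + c1)" "?s2 ''c'' 0 = of_int c1" "?s2 ''e'' 0 = of_nat e1" "?s2 ''zero'' = (\<lambda>_. 0)"
      "?s2 ''w'' 0 = of_int w1" "?s2 ''th'' 0 = of_int th1"
      using fr r s1(3) by auto
    show "wp F X (put ''a'' (V ''a'' [+] V ''c'') ;; ?if ;; ?rest1) s1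
      ((ops (V ''a'' [+] V ''c'') + 2) + ((ops (V ''a'' [\<le>] V ''th'') + 1 + ((ops (V ''w'' [+] V ''c'') + 2) + (60 + K * 40))) + ((10 + h * 50) + 20))) Q"
    proof (rule wp_seq, rule wp_putv[where v = "of_int (a1 + c1)"], goal_cases)
      case 6 show ?case
      proof (rule wp_seq, rule wp_if, goal_cases)
        case 4
        hence le: "a1 + c1 \<le> th1" using fr2 by (auto split: if_splits simp flip: of_int_add)
        \<comment> \<open>Without an open block the threshold would be 0, whereas the new total is
          positive.\<close>
        obtain S1 where S1: "S0 = Suc S1" using le bit_bound b(16) s1(8) by (cases S0) auto
        show ?case
        proof (rule wp_putv[where v = "of_int (w1 + c1)"], goal_cases)
          case 6 show ?case
            by (rule rest[where new = False and ?S1.0 = S1 and ?a1.0 = a1 and ?c1.0 = c1 and ?w1.0 = w1 and ?th1.0 = th1 and ?e1.0 = e1, OF _ _ _ refl refl refl s1(4-10)])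
              (use s1(1) fr fr2 le S1 in \<open>auto simp: frame_def acc_rep_def\<close>)
        next
          case 5 show ?case using bit_bound s1(8,9) b X by (intro si) auto
        qed (use fr2 sm in simp_all)
      next
        case 5
        hence le: "\<not> a1 + c1 \<le> th1" using fr2 by (auto split: if_splits simp flip: of_int_add)
        show ?case
        proof (rule wp_new_block[where Cm = Cm, OF _ _ _ _ _ _ fr2(1-8)])
          fix s' assume s': "frame {''w'', ''th'', ''o1'', ''o2'', ''o3'', ''S'', ''key'', ''k''} ?s2 s'"
             "acc_rep s' (a1 + c1) c1 \<lfloor>(1 + \<epsilon>) * of_int (a1 + c1)\<rfloor> e1" "s' ''S'' 0 = of_nat (Suc S0)"
             "\<And>k. k < K \<Longrightarrow> s' ''key'' (int (S0 * K + k)) = ?s2 ''ky'' (int (i0 * K + k))"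
             "\<And>j. j < int (S0 * K) \<Longrightarrow> s' ''key'' j = ?s2 ''key'' j"
          show "wp F X ?rest1 s' ((10 + h * 50) + 20) Q"
          proof (rule rest[where new = True and ?s3.0 = s' and ?S1.0 = S0 and ?a1.0 = a1 and ?c1.0 = c1 and ?w1.0 = w1 and ?th1.0 = th1 and ?e1.0 = e1, OF _ _ s'(3) refl refl refl s1(4-10)])
            show "frame ?A s s'" using s1(1) s'(1) by (auto simp: frame_def)
            show "acc_rep s' (a1 + c1) (if True then c1 else w1 + c1) (if True then \<lfloor>(1 + \<epsilon>) * rat_of_int (a1 + c1)\<rfloor> else th1) e1"
              using s'(2) by simp
          qed (use s'(4,5) fr le in auto)
        next
          show "\<And>k. k < K \<Longrightarrow> small X (?s2 ''ky'' (int (i0 * K + k)))" using ky fr by simp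
        qed (use X b bit_bound s1(8,9) in auto)
      qed (use sm in simp_all)
    next
      case 5 show ?case using bit_bound s1(8,9) b X by (intro si) auto
    qed (use r s1(3) sm in simp_all)
  qed (use X s b in auto)
qed

section \<open>Error analysis of a stage\<close>

text \<open>
  \<open>T\<close> is the exact total weight of the \<open>p\<close> elements processed so far, \<open>T1\<close> its value after the
  first element of the current block, and \<open>Lo\<close> the rounded weight of the closed blocks. Every element contributes an error
  of at most one unit in the last place. The last conjunct makes the number \<open>S\<close> of blocks logarithmic.
\<close>

definition acc_inv :: "rat \<Rightarrow> int \<Rightarrow> nat \<Rightarrow> nat \<Rightarrow> int \<Rightarrow> int \<Rightarrow> int \<Rightarrow> int \<Rightarrow> int \<Rightarrow> int \<Rightarrow> nat \<Rightarrow> bool" where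
  "acc_inv \<epsilon> R p S T T1 Lo a w th e \<longleftrightarrow>
     T \<le> a * 2 ^ e \<and> a * 2 ^ e \<le> T + (int p + 1) * (2 ^ e - 1) \<and>
     T \<le> Lo + w * 2 ^ e \<and> Lo + w * 2 ^ e \<le> T + (int p + 1) * (2 ^ e - 1) \<and>
     (0 < e \<longrightarrow> R \<le> a) \<and> 0 \<le> w \<and> w \<le> a \<and> 0 \<le> th \<and> a < 2 * R \<and>
     (S = 0 \<longrightarrow> T = 0 \<and> Lo = 0 \<and> w = 0 \<and> th = 0) \<and>
     (0 < S \<longrightarrow> 1 \<le> w \<and> 0 < T1 \<and> T1 \<le> T \<and>
        real_of_int T \<le> (1 + of_rat \<epsilon>) * (1 + of_rat \<epsilon> / 4) * real_of_int T1 \<and>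
        real_of_int (th * 2 ^ e) \<le> (1 + of_rat \<epsilon>) * (1 + of_rat \<epsilon> / 4) * real_of_int T1 \<and>
        (1 + of_rat \<epsilon>) ^ (S - 1) \<le> 2 * real_of_int T) \<and>
     (1 + of_rat \<epsilon>) ^ S \<le> real_of_int ((th + 1) * 2 ^ e)"

text \<open>Coarsening the unit from \<open>P\<close> to \<open>P'\<close> adds an error of
  \<open>P' - P\<close>, and each of the \<open>q\<close> copies of \<open>P - 1\<close> grows by
  exactly this amount.\<close>

lemma err_step:
  fixes E :: int
  assumes "E \<le> q * (P - 1)" "P \<le> P'" "1 \<le> q"
  shows "E + (P' - P) \<le> q * (P' - 1)"
proof -
  have "1 * (P' - P) \<le> q * (P' - P)" using assms by (intro mult_right_mono) auto
  thus ?thesis using assms by (simp add: algebra_simps)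
qed

text \<open>Either the unit is 1 and there is no error, or the mantissa is at least
  \<open>R\<close>, and \<open>q\<close> units are at most the fraction
  \<open>q / R <= \<epsilon> / 8\<close> of the total. The comparison with the exact total uses
  \<open>(1 + \<epsilon> / 4) * (1 - \<epsilon> / 8) >= 1\<close>.\<close>

lemma rel_err:
  fixes A T err R :: int and \<epsilon> :: real
  assumes e: "0 < \<epsilon>" "\<epsilon> \<le> 1" and A: "A \<le> T + err" "A = a * P" "err \<le> q * (P - 1)" "1 \<le> P" "0 \<le> q" "q \<le> int N + 1"
    and R: "P = 1 \<or> R \<le> a" "1 \<le> R" "8 * (real N + 1) \<le> \<epsilon> * real_of_int R" "0 \<le> A"
  shows "8 * real_of_int err \<le> \<epsilon> * real_of_int A" "real_of_int A \<le> (1 + \<epsilon> / 4) * real_of_int T"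
proof -
  have "err * R \<le> (int N + 1) * A"
  proof (cases "P = 1")
    case True
    hence "err \<le> 0" using A by simp
    hence "err * R \<le> 0" using R by (simp add: mult_nonpos_nonneg)
    also have "0 \<le> (int N + 1) * A" using R by simp
    finally show ?thesis .
  next
    case False
    hence "R \<le> a" using R by simp
    have "err * R \<le> (q * (P - 1)) * R" using A R by (intro mult_right_mono) auto
    also have "\<dots> \<le> (q * P) * R" using A R by (intro mult_right_mono mult_left_mono) auto
    also have "\<dots> \<le> (q * P) * a" using A R \<open>R \<le> a\<close> by (intro mult_left_mono) auto
    also have "\<dots> = q * A" using A by simp
    also have "\<dots> \<le> (int N + 1) * A" using A R by (intro mult_right_mono) auto
    finally show ?thesis .
  qed
  hence "real_of_int (err * R) \<le> real_of_int ((int N + 1) * A)" by (subst of_int_le_iff)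
  hence 1: "real_of_int err * real_of_int R \<le> (real N + 1) * real_of_int A" by simp
  have "8 * real_of_int err * real_of_int R \<le> (8 * (real N + 1)) * real_of_int A" using mult_left_mono[OF 1, of 8] by (simp add: algebra_simps)
  also have "\<dots> \<le> (\<epsilon> * real_of_int R) * real_of_int A" using R by (intro mult_right_mono) auto
  finally have "(8 * real_of_int err) * real_of_int R \<le> (\<epsilon> * real_of_int A) * real_of_int R" by (simp add: mult_ac)
  thus *: "8 * real_of_int err \<le> \<epsilon> * real_of_int A" using R by (simp add: mult_le_cancel_right)
  have "real_of_int A \<le> real_of_int (T + err)" using A(1) by (subst of_int_le_iff)
  hence "real_of_int A \<le> real_of_int T + real_of_int err" by simp
  hence "real_of_int A * (1 - \<epsilon> / 8) \<le> real_of_int T" using * by (simp add: algebra_simps)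
  hence 2: "(1 + \<epsilon> / 4) * (real_of_int A * (1 - \<epsilon> / 8)) \<le> (1 + \<epsilon> / 4) * real_of_int T"
    using e by (intro mult_left_mono) auto
  have "\<epsilon> * \<epsilon> \<le> \<epsilon> * 1" using e by (intro mult_left_mono) auto
  hence "1 \<le> (1 + \<epsilon> / 4) * (1 - \<epsilon> / 8)" using e(1) by (simp add: algebra_simps)
  hence "real_of_int A * 1 \<le> real_of_int A * ((1 + \<epsilon> / 4) * (1 - \<epsilon> / 8))"
    using R by (intro mult_left_mono) auto
  thus "real_of_int A \<le> (1 + \<epsilon> / 4) * real_of_int T" using 2 by (simp add: mult_ac)
qed

text \<open>The units \<open>P\<close>, \<open>P1\<close> and \<open>P'\<close> belong to the states
  before the step, after aligning and after normalising. An element is merged only if the total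
  stays below the threshold, which is at most \<open>1 + \<epsilon>\<close> times a rounded total,
  hence the factor \<open>(1 + \<epsilon>) * (1 + \<epsilon> / 4)\<close>. Opening a block means
  that the total has passed the old threshold, and the new threshold is larger by
  \<open>1 + \<epsilon>\<close>; this makes the powers of \<open>1 + \<epsilon>\<close> grow with
  the number of blocks.\<close>

lemma acc_inv_step:
  assumes acc_inv: "acc_inv \<epsilon> R p S T T1 Lo a w th e" and ab: "absorbed \<epsilon> R a w th e c f new a' w' th' e'"
    and e01: "0 < \<epsilon>" "\<epsilon> \<le> 1" and c: "1 \<le> c" and N: "p + 1 \<le> N"
    and R: "1 \<le> R" "8 * (real N + 1) \<le> real_of_rat \<epsilon> * real_of_int R"
  shows "acc_inv \<epsilon> R (Suc p) (if new then Suc S else S) (T + c * 2 ^ f) (if new then T + c * 2 ^ f else T1)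
     (if new then Lo + w * 2 ^ e else Lo) a' w' th' e'" (is ?th1)
    and "\<not> new \<Longrightarrow> 0 < S"
proof -
  obtain a1 w1 th1 e1 c1 where b1: "bumped a w th e a1 w1 th1 e1"
    and c1: "c * 2 ^ f \<le> c1 * 2 ^ e1" "c1 * 2 ^ e1 \<le> c * 2 ^ f + (2 ^ e1 - 1)" "1 \<le> c1"
    and R1: "0 < e1 \<longrightarrow> R \<le> a1 + c1" and new: "new \<longleftrightarrow> \<not> a1 + c1 \<le> th1"
    and b2: "bumped (a1 + c1) (if new then c1 else w1 + c1) (if new then \<lfloor>(1 + \<epsilon>) * of_int (a1 + c1)\<rfloor> else th1) e1 a' w' th' e'"
    and R2: "0 < e' \<longrightarrow> R \<le> a'" "a' < 2 * R"
    using ab unfolding absorbed_def by blast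
  define P P1 P' where "P = (2::int) ^ e" and "P1 = (2::int) ^ e1" and "P' = (2::int) ^ e'"
  define \<omega> where "\<omega> = c * 2 ^ f"
  define er where "er = real_of_rat \<epsilon>"
  have er: "0 < er" "er \<le> 1" using e01 by (auto simp: er_def)
  have \<omega>: "1 \<le> \<omega>" unfolding \<omega>_def using mult_mono[of 1 c 1 "2 ^ f"] c by simp
  have F: "T \<le> a * P" "a * P \<le> T + (int p + 1) * (P - 1)" "T \<le> Lo + w * P" "Lo + w * P \<le> T + (int p + 1) * (P - 1)"
    "0 \<le> w" "w \<le> a" "0 \<le> th"
    "S = 0 \<longrightarrow> T = 0 \<and> Lo = 0 \<and> w = 0 \<and> th = 0"
    "0 < S \<longrightarrow> 1 \<le> w \<and> 0 < T1 \<and> T1 \<le> T \<and> real_of_int T \<le> (1 + er) * (1 + er / 4) * real_of_int T1 \<and>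
        real_of_int (th * P) \<le> (1 + er) * (1 + er / 4) * real_of_int T1 \<and> (1 + er) ^ (S - 1) \<le> 2 * real_of_int T"
    "(1 + er) ^ S \<le> real_of_int ((th + 1) * P)"
    using acc_inv unfolding acc_inv_def P_def er_def by blast+
  have B1: "e \<le> e1" "a * P \<le> a1 * P1" "a1 * P1 \<le> a * P + (P1 - P)" "w * P \<le> w1 * P1" "w1 * P1 \<le> w * P + (P1 - P)"
    "th1 * P1 \<le> th * P" "(th + 1) * P \<le> (th1 + 1) * P1" "0 \<le> a1" "0 \<le> w1" "w1 \<le> a1" "0 \<le> th1" "th1 \<le> th"
    using b1 unfolding bumped_def P_def P1_def by blast+
  have PP: "1 \<le> P" "P \<le> P1" "1 \<le> P1" unfolding P_def P1_def using B1(1) by (auto intro: power_increasing)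
  define a2 w2 th2 where "a2 = a1 + c1" and "w2 = (if new then c1 else w1 + c1)"
    and "th2 = (if new then \<lfloor>(1 + \<epsilon>) * of_int (a1 + c1)\<rfloor> else th1)"
  have B2: "e1 \<le> e'" "a2 * P1 \<le> a' * P'" "a' * P' \<le> a2 * P1 + (P' - P1)" "w2 * P1 \<le> w' * P'" "w' * P' \<le> w2 * P1 + (P' - P1)"
    "th' * P' \<le> th2 * P1" "(th2 + 1) * P1 \<le> (th' + 1) * P'" "0 \<le> a'" "0 \<le> w'" "w' \<le> a'" "0 \<le> th'" "1 \<le> w2 \<longrightarrow> 1 \<le> w'"
    using b2 unfolding bumped_def P'_def P1_def a2_def w2_def th2_def by blast+
  have PP': "P1 \<le> P'" unfolding P'_def P1_def using B2(1) by (auto intro: power_increasing)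
  have C1: "\<omega> \<le> c1 * P1" "c1 * P1 \<le> \<omega> + (P1 - 1)" using c1 unfolding \<omega>_def P1_def by blast+
  define T' where "T' = T + \<omega>"
  have a2P: "a2 * P1 = a1 * P1 + c1 * P1" by (simp add: a2_def distrib_right)
  have q2: "(int p + 2) * (P1 - 1) = (int p + 1) * (P1 - 1) + (P1 - 1)" by (simp add: algebra_simps)
  have A2: "T' \<le> a2 * P1" "a2 * P1 \<le> T' + (int p + 2) * (P1 - 1)"
  proof -
    show "T' \<le> a2 * P1" unfolding T'_def a2P using F(1) B1(2) C1 by linarith
    have "a * P - T + (P1 - P) \<le> (int p + 1) * (P1 - 1)" using F(2) PP by (intro err_step) auto
    thus "a2 * P1 \<le> T' + (int p + 2) * (P1 - 1)" unfolding T'_def a2P q2 using B1(3) C1 by linarith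
  qed
  have A3: "T' \<le> a' * P'" "a' * P' \<le> T' + (int p + 2) * (P' - 1)"
  proof -
    show "T' \<le> a' * P'" using A2 B2 by linarith
    have "a2 * P1 - T' + (P' - P1) \<le> (int p + 2) * (P' - 1)" using A2 PP' by (intro err_step) auto
    thus "a' * P' \<le> T' + (int p + 2) * (P' - 1)" using B2(3) by linarith
  qed
  define Lo' where "Lo' = (if new then Lo + w * P else Lo)"
  have L2: "T' \<le> Lo' + w2 * P1" "Lo' + w2 * P1 \<le> T' + (int p + 2) * (P1 - 1)"
  proof -
    have w2P: "w2 * P1 = (if new then 0 else w1 * P1) + c1 * P1" by (simp add: w2_def distrib_right)
    show "T' \<le> Lo' + w2 * P1" unfolding T'_def Lo'_def w2P using F(3) B1(4) C1 by (cases new) auto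
    have *: "Lo + w * P - T + (P1 - P) \<le> (int p + 1) * (P1 - 1)" using F(4) PP by (intro err_step) auto
    thus "Lo' + w2 * P1 \<le> T' + (int p + 2) * (P1 - 1)"
      unfolding T'_def Lo'_def w2P q2 using B1(5) C1 PP by (cases new) auto
  qed
  have L3: "T' \<le> Lo' + w' * P'" "Lo' + w' * P' \<le> T' + (int p + 2) * (P' - 1)"
  proof -
    show "T' \<le> Lo' + w' * P'" using L2 B2 by linarith
    have "Lo' + w2 * P1 - T' + (P' - P1) \<le> (int p + 2) * (P' - 1)" using L2 PP' by (intro err_step) auto
    thus "Lo' + w' * P' \<le> T' + (int p + 2) * (P' - 1)" using B2(5) by linarith
  qed
  have T0: "0 \<le> T" using F(8,9) by (cases "S = 0") auto
  have T'0: "0 < T'" using T0 \<omega> by (simp add: T'_def)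
  have rel: "real_of_int (a2 * P1) \<le> (1 + er / 4) * real_of_int T'"
  proof (rule rel_err(2)[OF er _ refl, where err = "(int p + 2) * (P1 - 1)" and q = "int p + 2" and N = N and R = R])
    show "P1 = 1 \<or> R \<le> a2" using R1 by (cases "e1 = 0") (auto simp: P1_def a2_def)
    show "0 \<le> a2 * P1" using A2 T'0 by linarith
  qed (use A2 PP N R in \<open>auto simp: er_def\<close>)
  have Sp: "0 < S" if "\<not> new"
  proof (rule ccontr)
    assume "\<not> 0 < S"
    hence "th = 0" using F(8) by simp
    hence "th1 \<le> 0" using B1 by simp
    thus False using that new B1(8) c1(3) by simp
  qed
  thus "\<not> new \<Longrightarrow> 0 < S" .
  \<comment> \<open>For integers, exceeding \<open>th1\<close> means reaching
    \<open>th1 + 1\<close>, and it is \<open>th + 1\<close> whose lower bound survives rounding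
    down.\<close>
  have thp: "(th + 1) * P \<le> a2 * P1" if new
  proof -
    have "th1 + 1 \<le> a2" using that new by (simp add: a2_def)
    hence "(th1 + 1) * P1 \<le> a2 * P1" using PP by (intro mult_right_mono) auto
    thus ?thesis using B1(7) by linarith
  qed
  have fl: "real_of_int (th2 * P1) \<le> (1 + er) * real_of_int (a2 * P1)" "(1 + er) * real_of_int (a2 * P1) \<le> real_of_int ((th2 + 1) * P1)" if new
  proof -
    have t2: "th2 = \<lfloor>(1 + \<epsilon>) * of_int a2\<rfloor>" using that by (simp add: th2_def a2_def)
    have "real_of_rat (of_int th2) \<le> real_of_rat ((1 + \<epsilon>) * of_int a2)" unfolding t2 of_rat_less_eq by (rule of_int_floor_le)
    hence 1: "real_of_int th2 \<le> (1 + er) * real_of_int a2" by (simp add: of_rat_mult of_rat_add er_def)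
    have "real_of_rat ((1 + \<epsilon>) * of_int a2) \<le> real_of_rat (of_int th2 + 1)" unfolding t2 of_rat_less_eq by linarith
    hence 2: "(1 + er) * real_of_int a2 \<le> real_of_int th2 + 1" by (simp add: of_rat_mult of_rat_add er_def)
    have P0: "0 \<le> real_of_int P1" using PP by simp
    show "real_of_int (th2 * P1) \<le> (1 + er) * real_of_int (a2 * P1)"
      using mult_right_mono[OF 1 P0] by (simp add: mult_ac)
    show "(1 + er) * real_of_int (a2 * P1) \<le> real_of_int ((th2 + 1) * P1)"
      using mult_right_mono[OF 2 P0] by (simp add: mult_ac)
  qed
  define S' where "S' = (if new then Suc S else S)"
  define T1' where "T1' = (if new then T' else T1)"
  let ?\<kappa> = "(1 + er) * (1 + er / 4)"
  have k1: "1 \<le> ?\<kappa>" using er by (simp add: algebra_simps)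
  have last: "1 \<le> w' \<and> 0 < T1' \<and> T1' \<le> T' \<and> real_of_int T' \<le> ?\<kappa> * real_of_int T1' \<and>
        real_of_int (th' * P') \<le> ?\<kappa> * real_of_int T1' \<and> (1 + er) ^ (S' - 1) \<le> 2 * real_of_int T' \<and>
        (1 + er) ^ S' \<le> real_of_int ((th' + 1) * P')"
  proof (cases new)
    case True
    have w': "1 \<le> w'" using B2(12) c1 True by (simp add: w2_def)
    have i: "1 * real_of_int T' \<le> ?\<kappa> * real_of_int T'" using k1 T'0 by (intro mult_right_mono) auto
    have "real_of_int (th' * P') \<le> real_of_int (th2 * P1)" using B2(6) by (subst of_int_le_iff)
    also have "\<dots> \<le> (1 + er) * real_of_int (a2 * P1)" by (rule fl(1)[OF True])
    also have "\<dots> \<le> (1 + er) * ((1 + er / 4) * real_of_int T')" using er by (intro mult_left_mono rel) auto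
    finally have ii: "real_of_int (th' * P') \<le> ?\<kappa> * real_of_int T'" by (simp add: mult_ac)
    have "real_of_int ((th + 1) * P) \<le> real_of_int (a2 * P1)" using thp[OF True] by (subst of_int_le_iff)
    hence iii: "(1 + er) ^ S \<le> real_of_int (a2 * P1)" using F(10) by linarith
    have "(1 + er / 4) * real_of_int T' \<le> 2 * real_of_int T'" using er T'0 by (intro mult_right_mono) auto
    hence iv: "(1 + er) ^ S \<le> 2 * real_of_int T'" using iii rel by linarith
    have "(1 + er) ^ Suc S \<le> (1 + er) * real_of_int (a2 * P1)" using iii er by simp
    also have "\<dots> \<le> real_of_int ((th2 + 1) * P1)" by (rule fl(2)[OF True])
    also have "\<dots> \<le> real_of_int ((th' + 1) * P')" using B2(7) by (subst of_int_le_iff)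
    finally have "(1 + er) ^ Suc S \<le> real_of_int ((th' + 1) * P')" .
    thus ?thesis using w' i ii iv T'0 True by (simp add: S'_def T1'_def)
  next
    case False
    note S = Sp[OF False]
    have th2: "th2 = th1" "a2 \<le> th1" using False new by (auto simp: th2_def a2_def)
    have w': "1 \<le> w'" using B2(12) c1 B1(9) False by (simp add: w2_def)
    have "a2 * P1 \<le> th1 * P1" using th2 PP by (intro mult_right_mono) auto
    hence "T' \<le> th * P" "th' * P' \<le> th * P" using A2(1) B1(6) B2(6)[unfolded th2(1)] by linarith+
    hence "real_of_int T' \<le> real_of_int (th * P)" "real_of_int (th' * P') \<le> real_of_int (th * P)"
      by (simp_all only: of_int_le_iff)
    moreover have "real_of_int (th * P) \<le> ?\<kappa> * real_of_int T1" using F(9) S by blast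
    moreover have "real_of_int ((th + 1) * P) \<le> real_of_int ((th' + 1) * P')"
      using B1(7) B2(7)[unfolded th2(1)] by (subst of_int_le_iff) linarith
    moreover have "T \<le> T'" using \<omega> by (simp add: T'_def)
    hence "real_of_int T \<le> real_of_int T'" by (subst of_int_le_iff)
    ultimately show ?thesis using F(9,10) S w' False \<open>T \<le> T'\<close> by (simp add: S'_def T1'_def)
  qed
  have "acc_inv \<epsilon> R (Suc p) S' T' T1' Lo' a' w' th' e'"
    unfolding acc_inv_def er_def[symmetric] P'_def[symmetric]
    using A3 L3 R2 B2 last Sp by (auto simp: S'_def algebra_simps)
  thus ?th1 unfolding S'_def T1'_def Lo'_def T'_def \<omega>_def P_def .
qed

section \<open>Lists of budgets and their cumulative weights\<close>

definition list_weight :: "nat \<Rightarrow> (nat \<Rightarrow> int) \<Rightarrow> (nat \<Rightarrow> int) \<Rightarrow> (nat \<Rightarrow> nat) \<Rightarrow> int \<Rightarrow> int" where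
  "list_weight S kv mw me v = (\<Sum>r | r < S \<and> kv r \<le> v. mw r * 2 ^ me r)"

definition exact_weight :: "nat set \<Rightarrow> (nat \<Rightarrow> int) \<Rightarrow> (nat \<Rightarrow> int) \<Rightarrow> int \<Rightarrow> int" where
  "exact_weight P \<kappa> \<omega> v = (\<Sum>i | i \<in> P \<and> \<kappa> i \<le> v. \<omega> i)"

text \<open>\<open>kv r\<close> is the key of the element that opened block \<open>r\<close>, the
  smallest key of the block. Filing the whole block under it can only count weight too early, whence
  the lower bound. At this key the exact weight is already at least \<open>T1\<close>, which the
  finished block exceeds by a bounded factor only, whence the upper bound.\<close>

definition list_inv :: "rat \<Rightarrow> int \<Rightarrow> (nat \<Rightarrow> int) \<Rightarrow> (nat \<Rightarrow> int) \<Rightarrow> nat set \<Rightarrow> nat \<Rightarrow> (nat \<Rightarrow> int) \<Rightarrow> (nat \<Rightarrow> int) \<Rightarrow> (nat \<Rightarrow> nat) \<Rightarrow> int \<Rightarrow> int \<Rightarrow> int \<Rightarrow> int \<Rightarrow> nat \<Rightarrow> bool" where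
  "list_inv \<epsilon> R \<kappa> \<omega> P S kv mw me T1 a w th e \<longleftrightarrow> finite P \<and>
     acc_inv \<epsilon> R (card P) S (sum \<omega> P) T1 (\<Sum>r<S - 1. mw r * 2 ^ me r) a w th e \<and>
     (0 < S \<longrightarrow> mw (S - 1) = w \<and> me (S - 1) = e \<and> T1 \<le> exact_weight P \<kappa> \<omega> (kv (S - 1))) \<and>
     (\<forall>r<S. kv r \<le> kv (S - 1) \<and> kv r \<in> \<kappa> ` P) \<and>
     (\<forall>v. exact_weight P \<kappa> \<omega> v \<le> list_weight S kv mw me v \<and>
        real_of_int (list_weight S kv mw me v) \<le> (1 + of_rat \<epsilon>)\<^sup>2 * real_of_int (exact_weight P \<kappa> \<omega> v))"

lemma list_inv_init: "1 \<le> R \<Longrightarrow> list_inv \<epsilon> R \<kappa> \<omega> {} 0 kv mw me 0 0 0 0 0"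
  unfolding list_inv_def acc_inv_def exact_weight_def list_weight_def by simp

text \<open>One factor \<open>1 + \<epsilon>\<close> is the permitted growth of a block. The
  roundings of the threshold and of the weights contribute \<open>1 + \<epsilon> / 4\<close> each,
  and the square of this is at most \<open>1 + \<epsilon>\<close>.\<close>

lemma acc_inv_list_bound:
  assumes acc_inv: "acc_inv \<epsilon> R p S T T1 Lo a w th e" and S: "0 < S"
    and e01: "0 < \<epsilon>" "\<epsilon> \<le> 1" and N: "p \<le> N" and R: "1 \<le> R" "8 * (real N + 1) \<le> real_of_rat \<epsilon> * real_of_int R"
  shows "real_of_int (Lo + w * 2 ^ e) \<le> (1 + of_rat \<epsilon>)\<^sup>2 * real_of_int T1"
    and "real_of_int (a * 2 ^ e) \<le> (1 + of_rat \<epsilon> / 4) * real_of_int T"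
proof -
  define er where "er = real_of_rat \<epsilon>"
  have er: "0 < er" "er \<le> 1" using e01 by (auto simp: er_def)
  have F: "T \<le> a * 2 ^ e" "a * 2 ^ e \<le> T + (int p + 1) * (2 ^ e - 1)" "Lo + w * 2 ^ e \<le> T + (int p + 1) * (2 ^ e - 1)"
    "0 < e \<longrightarrow> R \<le> a" "0 < T1" "T1 \<le> T" "real_of_int T \<le> (1 + er) * (1 + er / 4) * real_of_int T1"
    using acc_inv S unfolding acc_inv_def er_def by blast+
  have P: "2 ^ e = (1::int) \<or> R \<le> a" using F(4) by (cases "e = 0") auto
  have A0: "0 \<le> a * 2 ^ e" using F by linarith
  have q: "int p + 1 \<le> int N + 1" "0 \<le> int p + 1" using N by auto
  have R': "8 * (real N + 1) \<le> er * real_of_int R" using R by (simp add: er_def)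
  note r = rel_err[OF er F(2) refl order.refl _ q(2,1) P R(1) R' A0]
  have r1: "8 * real_of_int ((int p + 1) * (2 ^ e - 1)) \<le> er * real_of_int (a * 2 ^ e)" using r(1) by simp
  have r2: "real_of_int (a * 2 ^ e) \<le> (1 + er / 4) * real_of_int T" using r(2) by simp
  thus "real_of_int (a * 2 ^ e) \<le> (1 + of_rat \<epsilon> / 4) * real_of_int T" by (simp add: er_def)
  have T0: "0 < real_of_int T" using F by simp
  have "er * real_of_int (a * 2 ^ e) \<le> er * ((1 + er / 4) * real_of_int T)" using r2 er by (intro mult_left_mono) auto
  also have "\<dots> \<le> er * (2 * real_of_int T)" using er T0 by (intro mult_left_mono mult_right_mono) auto
  finally have 3: "8 * real_of_int ((int p + 1) * (2 ^ e - 1)) \<le> er * (2 * real_of_int T)" using r1 by linarith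
  have "real_of_int (Lo + w * 2 ^ e) \<le> real_of_int (T + (int p + 1) * (2 ^ e - 1))" using F(3) by (subst of_int_le_iff)
  hence "real_of_int (Lo + w * 2 ^ e) \<le> real_of_int T + real_of_int ((int p + 1) * (2 ^ e - 1))" by (simp only: of_int_add)
  hence "real_of_int (Lo + w * 2 ^ e) \<le> (1 + er / 4) * real_of_int T" using 3 by (simp add: algebra_simps)
  also have "\<dots> \<le> (1 + er / 4) * ((1 + er) * (1 + er / 4) * real_of_int T1)" using er F by (intro mult_left_mono) auto
  also have "\<dots> = (1 + er) * (1 + er / 4)\<^sup>2 * real_of_int T1" by (simp add: power2_eq_square mult_ac)
  also have "\<dots> \<le> (1 + er) * (1 + er) * real_of_int T1"
  proof -
    have "er * er \<le> er" using er by (simp add: mult_left_le)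
    moreover have "(1 + er / 4)\<^sup>2 = 1 + er / 2 + er * er / 16" by (simp add: power2_eq_square field_simps)
    ultimately have "(1 + er / 4)\<^sup>2 \<le> 1 + er" using er by linarith
    thus ?thesis using er F by (intro mult_right_mono mult_left_mono) auto
  qed
  finally show "real_of_int (Lo + w * 2 ^ e) \<le> (1 + of_rat \<epsilon>)\<^sup>2 * real_of_int T1"
    by (simp add: er_def power2_eq_square)
qed

text \<open>Only budgets from the key of the last block on see a change. For them the list counts
  every row, so the bounds on the totals apply. For smaller budgets neither the new element nor the
  last row is counted.\<close>

lemma list_inv_step:
  assumes list_inv: "list_inv \<epsilon> R \<kappa> \<omega> P S kv mw me T1 a w th e" and ab: "absorbed \<epsilon> R a w th e c f new a' w' th' e'"
    and e01: "0 < \<epsilon>" "\<epsilon> \<le> 1" and c: "1 \<le> c" and N: "card P + 1 \<le> N"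
    and R: "1 \<le> R" "8 * (real N + 1) \<le> real_of_rat \<epsilon> * real_of_int R"
    and i: "i \<notin> P" "\<And>p. p \<in> P \<Longrightarrow> \<kappa> p \<le> \<kappa> i" "\<omega> i = c * 2 ^ f" and \<omega>: "\<And>p. 0 \<le> \<omega> p"
    and S1: "new \<Longrightarrow> S1 = S" "\<not> new \<Longrightarrow> S = Suc S1"
  shows "list_inv \<epsilon> R \<kappa> \<omega> (insert i P) (Suc S1) (if new then kv(S := \<kappa> i) else kv) (mw(S1 := w')) (me(S1 := e'))
    (if new then sum \<omega> (insert i P) else T1) a' w' th' e'"
proof -
  define P' kv' mw' me' T1' where "P' = insert i P" and "kv' = (if new then kv(S := \<kappa> i) else kv)"
    and "mw' = mw(S1 := w')" and "me' = me(S1 := e')" and "T1' = (if new then sum \<omega> (insert i P) else T1)"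
  have F: "finite P" "acc_inv \<epsilon> R (card P) S (sum \<omega> P) T1 (\<Sum>r<S - 1. mw r * 2 ^ me r) a w th e"
    "0 < S \<longrightarrow> mw (S - 1) = w \<and> me (S - 1) = e \<and> T1 \<le> exact_weight P \<kappa> \<omega> (kv (S - 1))"
    "\<forall>r<S. kv r \<le> kv (S - 1) \<and> kv r \<in> \<kappa> ` P"
    "\<forall>v. exact_weight P \<kappa> \<omega> v \<le> list_weight S kv mw me v \<and> real_of_int (list_weight S kv mw me v) \<le> (1 + of_rat \<epsilon>)\<^sup>2 * real_of_int (exact_weight P \<kappa> \<omega> v)"
    using list_inv unfolding list_inv_def by blast+
  have finP': "finite P'" using F by (simp add: P'_def)
  have cP: "card P' = Suc (card P)" "sum \<omega> P' = sum \<omega> P + c * 2 ^ f" using F(1) i by (auto simp: P'_def)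
  have Sp: "0 < S" if "\<not> new" using S1(2)[OF that] by simp
  have SS: "Suc S1 = (if new then Suc S else S)" using S1 by auto
  have Lo: "(\<Sum>r<S1. mw' r * 2 ^ me' r) = (if new then (\<Sum>r<S - 1. mw r * 2 ^ me r) + w * 2 ^ e else (\<Sum>r<S - 1. mw r * 2 ^ me r))"
  proof (cases new)
    case True
    have "(\<Sum>r<S1. mw' r * 2 ^ me' r) = (\<Sum>r<S. mw r * 2 ^ me r)" using S1(1)[OF True] by (simp add: mw'_def me'_def)
    also have "\<dots> = (\<Sum>r<S - 1. mw r * 2 ^ me r) + w * 2 ^ e"
    proof (cases S)
      case 0
      hence "w = 0" using F(2) by (simp add: acc_inv_def)
      thus ?thesis using 0 by simp
    next
      case (Suc n)
      thus ?thesis using F(3) by simp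
    qed
    finally show ?thesis using True by simp
  next
    case False
    thus ?thesis using S1(2)[OF False] by (simp add: mw'_def me'_def)
  qed
  have FI': "acc_inv \<epsilon> R (card P') (Suc S1) (sum \<omega> P') T1' (\<Sum>r<S1. mw' r * 2 ^ me' r) a' w' th' e'"
    using acc_inv_step(1)[OF F(2) ab e01 c N R] unfolding Lo cP SS T1'_def P'_def[symmetric] by simp
  have kvlast: "kv' S1 = (if new then \<kappa> i else kv (S - 1))" using S1 by (auto simp: kv'_def)
  have kvi: "kv r \<le> \<kappa> i" if "r < S" for r using F(4) i(2) that by auto
  have Tins: "exact_weight P' \<kappa> \<omega> v = exact_weight P \<kappa> \<omega> v" if "v < \<kappa> i" for v
  proof -
    have "{j. j \<in> P' \<and> \<kappa> j \<le> v} = {j. j \<in> P \<and> \<kappa> j \<le> v}" using that by (auto simp: P'_def)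
    thus ?thesis by (simp add: exact_weight_def)
  qed
  have Tmono: "exact_weight P' \<kappa> \<omega> u \<le> exact_weight P' \<kappa> \<omega> v" if "u \<le> v" for u v
    unfolding exact_weight_def using that finP' \<omega> by (intro sum_mono2) auto
  have Tle: "exact_weight P' \<kappa> \<omega> v \<le> sum \<omega> P'" for v unfolding exact_weight_def using finP' \<omega> by (intro sum_mono2) auto
  have T1': "T1' \<le> exact_weight P' \<kappa> \<omega> (kv' S1)"
  proof (cases new)
    case True
    have "{j. j \<in> P' \<and> \<kappa> j \<le> \<kappa> i} = P'" using i(2) by (auto simp: P'_def)
    thus ?thesis using True kvlast by (simp add: T1'_def exact_weight_def P'_def[symmetric])
  next
    case False
    have "exact_weight P \<kappa> \<omega> (kv (S - 1)) \<le> exact_weight P' \<kappa> \<omega> (kv (S - 1))"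
      unfolding exact_weight_def P'_def using F(1) \<omega> by (intro sum_mono2) auto
    thus ?thesis using False F(3) Sp kvlast by (auto simp: T1'_def)
  qed
  have sorted: "\<forall>r<Suc S1. kv' r \<le> kv' S1 \<and> kv' r \<in> \<kappa> ` P'"
  proof (cases new)
    case True
    thus ?thesis using kvi F(4) S1(1)[OF True] by (auto simp: kv'_def P'_def less_Suc_eq)
  next
    case False
    thus ?thesis using F(4) S1(2)[OF False] by (auto simp: kv'_def P'_def)
  qed
  have pt: "exact_weight P' \<kappa> \<omega> v \<le> list_weight (Suc S1) kv' mw' me' v \<and>
        real_of_int (list_weight (Suc S1) kv' mw' me' v) \<le> (1 + of_rat \<epsilon>)\<^sup>2 * real_of_int (exact_weight P' \<kappa> \<omega> v)" for v
  proof (cases "kv' S1 \<le> v")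
    case True
    hence "{r. r < Suc S1 \<and> kv' r \<le> v} = {..<Suc S1}" using sorted by force
    hence list_weight: "list_weight (Suc S1) kv' mw' me' v = (\<Sum>r<S1. mw' r * 2 ^ me' r) + w' * 2 ^ e'"
      by (simp add: list_weight_def mw'_def me'_def)
    have 1: "sum \<omega> P' \<le> list_weight (Suc S1) kv' mw' me' v" unfolding list_weight using FI' unfolding acc_inv_def by blast
    have "card P' \<le> N" using N cP by simp
    hence "real_of_int (list_weight (Suc S1) kv' mw' me' v) \<le> (1 + of_rat \<epsilon>)\<^sup>2 * real_of_int T1'"
      unfolding list_weight by (intro acc_inv_list_bound(1)[OF FI' _ e01 _ R]) auto
    also have "\<dots> \<le> (1 + of_rat \<epsilon>)\<^sup>2 * real_of_int (exact_weight P' \<kappa> \<omega> v)"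
      using T1' Tmono[OF True] by (intro mult_left_mono) auto
    finally show ?thesis using 1 Tle[of v] by auto
  next
    case False
    have vi: "v < \<kappa> i"
    proof (cases new)
      case nn: False
      have "kv (S - 1) \<le> \<kappa> i" using kvi Sp[OF nn] by simp
      thus ?thesis using False kvlast nn by auto
    qed (use False kvlast in auto)
    have "{r. r < Suc S1 \<and> kv' r \<le> v} = {r. r < S \<and> kv r \<le> v}"
      using False S1 kvlast by (cases new) (auto simp: kv'_def less_Suc_eq)
    moreover have "S1 \<notin> {r. r < Suc S1 \<and> kv' r \<le> v}" using False by simp
    ultimately have "list_weight (Suc S1) kv' mw' me' v = list_weight S kv mw me v"
      unfolding list_weight_def by (intro sum.cong) (auto simp: mw'_def me'_def)
    thus ?thesis using F(5) Tins[OF vi] by simp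
  qed
  have "list_inv \<epsilon> R \<kappa> \<omega> P' (Suc S1) kv' mw' me' T1' a' w' th' e'"
    unfolding list_inv_def using finP' FI' T1' sorted pt by (simp add: mw'_def me'_def)
  thus ?thesis unfolding P'_def kv'_def mw'_def me'_def T1'_def .
qed

section \<open>Stages of the dynamic program\<close>

text \<open>The root contains the index of the winning element, so its leaf is known without a
  search. Clearing this leaf and replaying the path above it brings the next candidate to the
  root.\<close>

definition pop_body :: prog where
  "pop_body = (put ''i'' (Cell ''tr'' (Num 1)) ;;
     Assign ''tr'' (V ''N'' [+] V ''i'' [-] Num 1) (Num 0) ;;
     put ''v'' (Floor ((V ''N'' [+] V ''i'' [-] Num 1) [/] Num 2)) ;;
     repair ;;
     put ''c'' (Cell ''ma2'' (V ''i'')) ;;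
     put ''f'' (Cell ''ex2'' (V ''i'')) ;;
     absorb)"

definition pop_init :: prog where
  "pop_init = (put ''S'' (Num 0) ;; put ''a'' (Num 0) ;; put ''e'' (Num 0) ;; put ''w'' (Num 0) ;; put ''th'' (Num 0) ;;
     put ''R'' (Floor (Num 8 [*] (V ''N'' [+] Num 1) [/] V ''ep'') [+] Num 1))"

definition pop_loop :: prog where
  "pop_loop = (pop_init ;; While (Num 1 [\<le>] Cell ''tr'' (Num 1)) pop_body)"

definition pop_vars :: "string set" where
  "pop_vars = {''i'', ''tr'', ''v'', ''x'', ''y'', ''d'', ''k'', ''le'', ''c'', ''f'', ''a'', ''w'', ''th'', ''e'',
     ''o1'', ''o2'', ''o3'', ''S'', ''key'', ''ma'', ''ex'', ''R''}"

text \<open>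
  Element \<open>i\<close> has the leaf \<open>N + i - 1\<close>. Element 0, whose key is the budget plus one, marks absent
  elements: it loses against every element in the tree.
\<close>

definition tree :: "nat \<Rightarrow> (nat \<Rightarrow> int) \<Rightarrow> nat set \<Rightarrow> (nat \<Rightarrow> nat) \<Rightarrow> bool" where
  "tree N \<kappa> A \<tau> \<longleftrightarrow> (\<forall>v. \<tau> v \<le> N) \<and> (\<forall>x. 1 \<le> x \<longrightarrow> x < N \<longrightarrow> winner_ok \<kappa> \<tau> x) \<and>
     (\<forall>i<N. \<tau> (N + i) = (if Suc i \<in> A then Suc i else 0)) \<and> \<tau> 0 = 0 \<and> (\<forall>x\<ge>2 * N. \<tau> x = 0)"

text \<open>Since the sentinel loses every match against a candidate, it reaches the root only when
  no candidate is left. The root thus serves as the test for emptiness.\<close>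

lemma tree_root:
  assumes t: "tree N \<kappa> A \<tau>" and A: "A \<subseteq> {1..N}" and lt: "\<And>i. i \<in> A \<Longrightarrow> \<kappa> i < \<kappa> 0"
  shows "\<tau> 1 = 0 \<longleftrightarrow> A = {}" "\<tau> 1 \<noteq> 0 \<Longrightarrow> \<tau> 1 \<in> A" "\<And>q. q \<in> A \<Longrightarrow> \<kappa> (\<tau> 1) \<le> \<kappa> q"
proof -
  have ok: "\<forall>x. 1 \<le> x \<longrightarrow> x < N \<longrightarrow> winner_ok \<kappa> \<tau> x" using t by (simp add: tree_def)
  have leaf: "\<tau> 1 = 0 \<or> \<tau> 1 \<in> A"
  proof (cases "N = 0")
    case True
    thus ?thesis using t by (simp add: tree_def)
  next
    case False
    then obtain i where "i < N" "\<tau> 1 = \<tau> (N + i)" using tournament_leaf[OF ok, of 1] by auto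
    thus ?thesis using t by (auto simp: tree_def)
  qed
  show min: "\<kappa> (\<tau> 1) \<le> \<kappa> q" if "q \<in> A" for q
  proof -
    have q: "1 \<le> q" "q \<le> N" using A that by auto
    have lf: "\<And>i. i < N \<Longrightarrow> \<tau> (N + i) = (if Suc i \<in> A then Suc i else 0)" using t by (simp add: tree_def)
    have "\<tau> (N + (q - 1)) = q" using lf[of "q - 1"] q that by simp
    moreover have "\<kappa> (\<tau> 1) \<le> \<kappa> (\<tau> (N + (q - 1)))" using q by (intro tournament_min[OF ok]) auto
    ultimately show ?thesis by simp
  qed
  show "\<tau> 1 \<noteq> 0 \<Longrightarrow> \<tau> 1 \<in> A" by (rule disjE[OF leaf]) auto
  have "A = {}" if "\<tau> 1 = 0" using min lt that by fastforce
  moreover have "0 \<notin> A" using A by auto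
  ultimately show "\<tau> 1 = 0 \<longleftrightarrow> A = {}" using leaf by auto
qed

lemma tree_empty:
  assumes t: "tree N \<kappa> {} \<tau>"
  shows "\<tau> v = 0"
proof (cases "1 \<le> v \<and> v < 2 * N")
  case True
  then obtain i where "i < N" "\<tau> v = \<tau> (N + i)" using tournament_leaf[of N \<kappa> \<tau> v] t by (auto simp: tree_def)
  thus ?thesis using t by (auto simp: tree_def)
next
  case False
  thus ?thesis using t by (cases "v = 0") (auto simp: tree_def)
qed

text \<open>\<open>b = 0\<close> is a deletion and \<open>b = Suc i\<close> an insertion.
  Overwriting a leaf affects at most the matches on the path above it, which is the situation that
  \<open>repair\<close> expects. Once they have been replayed, the tree stands for
  \<open>A'\<close>.\<close>

lemma tree_change:
  assumes t: "tree N \<kappa> A \<tau>" and i: "i < N" and b: "b = 0 \<and> A' = A - {Suc i} \<or> b = Suc i \<and> A' = insert (Suc i) A"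
  defines "\<tau>1 \<equiv> \<tau>(N + i := b)"
  shows "\<And>v. \<tau>1 v \<le> N" "(N + i) div 2 < N"
    "\<forall>x. 1 \<le> x \<longrightarrow> x < N \<longrightarrow> winner_ok \<kappa> \<tau>1 x \<or> (\<exists>k. x = (N + i) div 2 div 2 ^ k)"
    "(\<forall>v. \<tau>' v \<le> N) \<Longrightarrow> (\<forall>x. x = 0 \<or> N \<le> x \<longrightarrow> \<tau>' x = \<tau>1 x) \<Longrightarrow> (\<forall>x. 1 \<le> x \<longrightarrow> x < N \<longrightarrow> winner_ok \<kappa> \<tau>' x) \<Longrightarrow>
       tree N \<kappa> A' \<tau>'"
proof -
  show "\<And>v. \<tau>1 v \<le> N" using t i b by (auto simp: tree_def \<tau>1_def)
  show "(N + i) div 2 < N" using i by auto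
  show "\<forall>x. 1 \<le> x \<longrightarrow> x < N \<longrightarrow> winner_ok \<kappa> \<tau>1 x \<or> (\<exists>k. x = (N + i) div 2 div 2 ^ k)"
  proof (intro allI impI)
    fix x assume x: "1 \<le> x" "x < N"
    show "winner_ok \<kappa> \<tau>1 x \<or> (\<exists>k. x = (N + i) div 2 div 2 ^ k)"
    proof (cases "x = (N + i) div 2")
      case True
      thus ?thesis by (intro disjI2 exI[of _ 0]) simp
    next
      case False
      hence "2 * x \<noteq> N + i" "2 * x + 1 \<noteq> N + i" "x \<noteq> N + i" using x by auto
      thus ?thesis using t x by (auto simp: tree_def winner_ok_def \<tau>1_def)
    qed
  qed
  assume a: "\<forall>v. \<tau>' v \<le> N" "\<forall>x. x = 0 \<or> N \<le> x \<longrightarrow> \<tau>' x = \<tau>1 x" "\<forall>x. 1 \<le> x \<longrightarrow> x < N \<longrightarrow> winner_ok \<kappa> \<tau>' x"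
  show "tree N \<kappa> A' \<tau>'"
    unfolding tree_def
  proof (intro conjI allI impI)
    fix l assume "l < N"
    thus "\<tau>' (N + l) = (if Suc l \<in> A' then Suc l else 0)"
      using a(2) t b by (auto simp: \<tau>1_def tree_def)
  next
    show "\<tau>' 0 = 0" using a(2) t i by (auto simp: \<tau>1_def tree_def)
  next
    fix x assume "2 * N \<le> x"
    thus "\<tau>' x = 0" using a(2) t i by (auto simp: \<tau>1_def tree_def)
  qed (use a in auto)
qed

definition list_rep :: "state \<Rightarrow> nat \<Rightarrow> nat \<Rightarrow> (nat \<Rightarrow> nat \<Rightarrow> int) \<Rightarrow> (nat \<Rightarrow> int) \<Rightarrow> (nat \<Rightarrow> nat) \<Rightarrow> bool" where
  "list_rep s K S dk mw me \<longleftrightarrow> s ''S'' 0 = of_nat S \<and>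
     (\<forall>r<S. s ''ma'' (int r) = of_int (mw r) \<and> s ''ex'' (int r) = of_nat (me r) \<and>
        (\<forall>k<K. s ''key'' (int (r * K + k)) = of_int (dk r k)))"

text \<open>In the row-major layout all entries of row \<open>r\<close> precede the start of row
  \<open>S\<close>, so appending a row leaves the earlier ones intact.\<close>

lemma idx_less: "r < S \<Longrightarrow> k < K \<Longrightarrow> r * K + k < S * (K::nat)"
proof -
  assume "r < S" "k < K"
  hence "r * K + k < r * K + K" by simp
  also have "\<dots> = Suc r * K" by simp
  also have "\<dots> \<le> S * K" using \<open>r < S\<close> by (intro mult_right_mono) auto
  finally show ?thesis .
qed

text \<open>Each of at most \<open>N\<close> elements costs one unit in the last place for its own
  rounding, and one further unit pays for all coarsenings of the accumulator. A mantissa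
  \<open>8 / \<epsilon>\<close> times as large turns \<open>N + 1\<close> units into a relative
  error of \<open>\<epsilon> / 8\<close>.\<close>

definition precision :: "rat \<Rightarrow> nat \<Rightarrow> int" where
  "precision \<epsilon> N = \<lfloor>8 * (of_nat N + 1) / \<epsilon>\<rfloor> + 1"

lemma wp_pop_loop:
  fixes \<epsilon> :: rat
  assumes X: "8 \<le> X" "Sm + 1 < X" "Sm * K + K < X" "N * K < X" "K < X" "4 * Cm + 2 \<le> int X" "E + h + 1 \<le> X"
      "4 * D + 4 \<le> int X" "2 * N + 1 < X"
    and s: "s ''K'' 0 = of_nat K" "s ''N'' 0 = of_nat N" "s ''ep'' 0 = \<epsilon>" "s ''B'' 0 = of_int B" "s ''zero'' = (\<lambda>_. 0)"
    and b: "0 < \<epsilon>" "\<epsilon> \<le> 1" "2 * precision \<epsilon> N \<le> Cm" "2 * Cm \<le> 2 ^ h" "2 \<le> B" "0 \<le> D" "N \<le> 2 ^ ht"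
    and key: "key_rep s K D N d" and \<kappa>: "\<kappa> = (\<lambda>i. horner B K (d i))"
    and I: "I = {i \<in> {1..N}. \<kappa> i < \<kappa> 0}"
    and tr: "nat_rep (s ''tr'') \<tau>0" "tree N \<kappa> I \<tau>0"
    and cf: "\<And>i. 1 \<le> i \<Longrightarrow> i \<le> N \<Longrightarrow> s ''ma2'' (int i) = of_int (c i) \<and> s ''ex2'' (int i) = of_nat (f i) \<and>
        1 \<le> c i \<and> c i \<le> Cm \<and> f i \<le> E"
    and \<omega>: "\<omega> = (\<lambda>i. if i \<in> I then c i * 2 ^ f i else 0)"
    and E: "2 * sum \<omega> I \<le> 2 ^ E"
    and Sm: "\<And>S. (1 + of_rat \<epsilon>) ^ (S - 1) \<le> 2 * real_of_int (sum \<omega> I) \<Longrightarrow> S \<le> Sm"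
    and Q: "\<And>s' S dk mw me T1 a w th e. frame pop_vars s s' \<Longrightarrow> list_rep s' K S dk mw me \<Longrightarrow>
       list_inv \<epsilon> (precision \<epsilon> N) \<kappa> \<omega> I S (\<lambda>r. horner B K (dk r)) mw me T1 a w th e \<Longrightarrow>
       (\<forall>r<S. dk r \<in> d ` I \<and> 1 \<le> mw r \<and> mw r \<le> 2 * precision \<epsilon> N \<and> me r \<le> E) \<Longrightarrow> S \<le> Sm \<Longrightarrow>
       nat_rep (s' ''tr'') (\<lambda>_. 0) \<Longrightarrow> s' ''a'' 0 = of_int a \<Longrightarrow> s' ''e'' 0 = of_nat e \<Longrightarrow> Q s'"
  shows "wp F X pop_loop s (100 + N * (300 + (ht + 1) * (100 + K * 60) + E * 100 + h * 50 + K * 40)) Q"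
proof -
  define R where "R = precision \<epsilon> N"
  have sm: "small X 0" "small X 1" "small X 2" "small X 8" "1 \<le> X" using X by (auto simp: small_0 small_1 small_numeral)
  have sn: "small X (of_nat v)" if "v \<le> X" for v using that sm by (intro small_of_nat) auto
  have si: "small X (of_int v)" if "\<bar>v\<bar> \<le> int X" for v using that sm by (intro small_of_int) auto
  have finI: "finite I" unfolding I by simp
  have Isub: "I \<subseteq> {1..N}" unfolding I by auto
  have R: "1 \<le> R" "8 * (real N + 1) \<le> real_of_rat \<epsilon> * real_of_int R"
  proof -
    have "0 \<le> 8 * (of_nat N + 1) / \<epsilon>" using b by (intro divide_nonneg_nonneg) auto
    hence "0 \<le> \<lfloor>8 * (of_nat N + 1) / \<epsilon>\<rfloor>" by simp
    thus "1 \<le> R" unfolding R_def precision_def by linarith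
    have "8 * (of_nat N + 1) / \<epsilon> \<le> of_int R" unfolding R_def precision_def by linarith
    hence "8 * (of_nat N + 1) \<le> \<epsilon> * of_int R" using b by (simp add: field_simps)
    hence "real_of_rat (8 * (of_nat N + 1)) \<le> real_of_rat (\<epsilon> * of_int R)" by (subst of_rat_less_eq)
    thus "8 * (real N + 1) \<le> real_of_rat \<epsilon> * real_of_int R"
      by (simp add: of_rat_mult of_rat_add)
  qed
  have \<omega>0: "0 \<le> \<omega> i" for i
  proof (cases "i \<in> I")
    case True
    hence "1 \<le> c i" using cf[of i] Isub by auto
    thus ?thesis by (simp add: \<omega>)
  qed (simp add: \<omega>)
  \<comment> \<open>\<open>P\<close> is the set of the elements extracted so far, and the number of
    the remaining ones is the fuel.\<close>
  define J where "J = (\<lambda>k s'. \<exists>P S dk mw me T1 a w th e \<tau>. frame pop_vars s s' \<and> P \<subseteq> I \<and> card (I - P) = k \<and>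
     s' ''R'' 0 = of_int R \<and> nat_rep (s' ''tr'') \<tau> \<and> tree N \<kappa> (I - P) \<tau> \<and> (\<forall>p\<in>P. \<forall>q\<in>I - P. \<kappa> p \<le> \<kappa> q) \<and>
     list_inv \<epsilon> R \<kappa> \<omega> P S (\<lambda>r. horner B K (dk r)) mw me T1 a w th e \<and> acc_rep s' a w th e \<and> th \<le> 4 * Cm \<and>
     list_rep s' K S dk mw me \<and> (\<forall>r<S. dk r \<in> d ` I \<and> 1 \<le> mw r \<and> mw r \<le> 2 * R \<and> me r \<le> E))"
  \<comment> \<open>The bounds on the current exponent and on the number of blocks follow from the
    invariant: \<open>2 ^ e\<close> is at most the rounded total if \<open>e > 0\<close>, and the
    blocks are limited by the growth condition in \<open>acc_inv\<close>.\<close>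
  have bounds: "e \<le> E \<and> S \<le> Sm \<and> card P \<le> N" if "list_inv \<epsilon> R \<kappa> \<omega> P S kv mw me T1 a w th e" "P \<subseteq> I" for P S kv mw me T1 a w th e
  proof -
    have cP: "card P \<le> card I" using that(2) finI by (intro card_mono)
    have "card I \<le> card {1..N}" using Isub by (intro card_mono) auto
    hence cN: "card P \<le> N" using cP by simp
    have T: "sum \<omega> P \<le> sum \<omega> I" using that(2) finI \<omega>0 by (intro sum_mono2) auto
    have acc_inv: "acc_inv \<epsilon> R (card P) S (sum \<omega> P) T1 (\<Sum>r<S - 1. mw r * 2 ^ me r) a w th e" using that(1) unfolding list_inv_def by blast
    have T0: "0 \<le> sum \<omega> P" using \<omega>0 by (intro sum_nonneg)
    show ?thesis
    proof (cases "S = 0")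
      case True
      hence 0: "sum \<omega> P = 0" "th = 0" using acc_inv by (auto simp: acc_inv_def)
      \<comment> \<open>If the exact total is 0, the mantissa consists of rounding errors and is
        below \<open>card P + 1\<close>, whereas a positive exponent would require at least
        \<open>R >= N + 1\<close>.\<close>
      have "e = 0"
      proof (rule ccontr)
        assume e: "e \<noteq> 0"
        hence Ra: "R \<le> a" using acc_inv by (simp add: acc_inv_def)
        have "a * 2 ^ e \<le> (int (card P) + 1) * (2 ^ e - 1)" using acc_inv 0 by (simp add: acc_inv_def)
        also have "\<dots> < (int (card P) + 1) * 2 ^ e" by (intro mult_strict_left_mono) auto
        finally have "a < int (card P) + 1" by simp
        moreover have "int N + 1 \<le> R"
        proof -
          have "real_of_rat \<epsilon> * real_of_int R \<le> 1 * real_of_int R" using b R by (intro mult_right_mono) auto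
          from order_trans[OF R(2) this] have "real N + 1 \<le> real_of_int R" by simp
          thus ?thesis by linarith
        qed
        ultimately show False using Ra cN by linarith
      qed
      thus ?thesis using True cN by simp
    next
      case False
      have A: "real_of_int (a * 2 ^ e) \<le> (1 + of_rat \<epsilon> / 4) * real_of_int (sum \<omega> P)"
        using acc_inv_list_bound(2)[OF acc_inv _ b(1,2) cN R] False by simp
      also have "\<dots> \<le> 2 * real_of_int (sum \<omega> P)"
      proof (rule mult_right_mono)
        have "real_of_rat \<epsilon> \<le> 1" using b(2) by simp
        thus "1 + real_of_rat \<epsilon> / 4 \<le> 2" by linarith
        show "0 \<le> real_of_int (sum \<omega> P)" using T0 by (simp only: of_int_0_le_iff)
      qed
      finally have "real_of_int (a * 2 ^ e) \<le> real_of_int (2 * sum \<omega> P)" by simp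
      hence A: "a * 2 ^ e \<le> 2 * sum \<omega> P" by (subst (asm) of_int_le_iff)
      have "e \<le> E"
      proof (cases "e = 0")
        case nz: False
        hence "1 \<le> a" using acc_inv R by (simp add: acc_inv_def)
        hence "1 * 2 ^ e \<le> a * 2 ^ e" by (intro mult_right_mono) auto
        hence "(2::int) ^ e \<le> 2 ^ E" using A T E by linarith
        thus ?thesis by simp
      qed simp
      moreover have "S \<le> Sm"
      proof (rule Sm)
        have "(1 + of_rat \<epsilon>) ^ (S - 1) \<le> 2 * real_of_int (sum \<omega> P)" using acc_inv False by (simp add: acc_inv_def)
        also have "\<dots> \<le> 2 * real_of_int (sum \<omega> I)"
          using T by (intro mult_left_mono) (simp_all only: of_int_le_iff zero_le_numeral)
        finally show "(1 + of_rat \<epsilon>) ^ (S - 1) \<le> 2 * real_of_int (sum \<omega> I)" .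
      qed
      ultimately show ?thesis using cN by simp
    qed
  qed
  have body: "wp F X pop_body s1 (280 + (ht + 1) * (100 + K * 60) + E * 100 + h * 50 + K * 40) (J k)"
    if JS: "J (Suc k) s1" for k s1
  proof -
    obtain P S dk mw me T1 a w th e \<tau> where J: "frame pop_vars s s1" "P \<subseteq> I" "card (I - P) = Suc k"
       "s1 ''R'' 0 = of_int R" "nat_rep (s1 ''tr'') \<tau>" "tree N \<kappa> (I - P) \<tau>" "\<forall>p\<in>P. \<forall>q\<in>I - P. \<kappa> p \<le> \<kappa> q"
       "list_inv \<epsilon> R \<kappa> \<omega> P S (\<lambda>r. horner B K (dk r)) mw me T1 a w th e" "acc_rep s1 a w th e" "th \<le> 4 * Cm"
       "list_rep s1 K S dk mw me" "\<forall>r<S. dk r \<in> d ` I \<and> 1 \<le> mw r \<and> mw r \<le> 2 * R \<and> me r \<le> E"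
      using JS unfolding J_def by blast
    note bd = bounds[OF J(8,2)]
    have lt: "\<And>q. q \<in> I - P \<Longrightarrow> \<kappa> q < \<kappa> 0" by (auto simp: I)
    note root = tree_root[OF J(6) _ lt]
    have IP: "I - P \<subseteq> {1..N}" using Isub by auto
    have ne: "I - P \<noteq> {}" using J(3) by (metis card.empty nat.distinct(1))
    define i where "i = \<tau> 1"
    have i: "i \<in> I - P" "\<And>q. q \<in> I - P \<Longrightarrow> \<kappa> i \<le> \<kappa> q" using root[OF IP] ne by (auto simp: i_def)
    have iN: "1 \<le> i" "i \<le> N" "i \<in> I" "i \<notin> P" using i IP by auto
    define l where "l = N + (i - 1)"
    have l: "of_nat l = (of_nat N + of_nat i - 1 :: rat)" using iN by (simp add: l_def of_nat_diff)
    note ch = tree_change[OF J(6), of "i - 1" 0 "I - P - {i}"]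
    have i1: "i - 1 < N" "(0::nat) = 0 \<and> I - P - {i} = I - P - {Suc (i - 1)} \<or> (0::nat) = Suc (i - 1) \<and> I - P - {i} = insert (Suc (i - 1)) (I - P)"
      using iN by auto
    have fr: "s1 ''K'' 0 = of_nat K" "s1 ''N'' 0 = of_nat N" "s1 ''ep'' 0 = \<epsilon>" "s1 ''B'' 0 = of_int B"
      "s1 ''zero'' = (\<lambda>_. 0)" "s1 ''ky'' = s ''ky''" "s1 ''ma2'' = s ''ma2''" "s1 ''ex2'' = s ''ex2''"
      using J(1) s by (simp_all add: frame_def pop_vars_def)
    have tr1: "s1 ''tr'' 1 = of_nat i" using J(5) nat_rep_def[of "s1 ''tr''" \<tau>] i_def by (metis of_nat_1)
    let ?A = "I - P - {i}"
    let ?s2 = "upd s1 ''i'' (of_nat i)"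
    let ?s3 = "?s2(''tr'' := (?s2 ''tr'')(int l := 0))"
    let ?s4 = "upd ?s3 ''v'' (of_nat (l div 2))"
    let ?r5 = "put ''c'' (Cell ''ma2'' (V ''i'')) ;; put ''f'' (Cell ''ex2'' (V ''i'')) ;; absorb"
    let ?ta = "150 + E * 100 + h * 50 + K * 40"
    let ?t5 = "(ops (Cell ''ma2'' (V ''i'')) + 2) + ((ops (Cell ''ex2'' (V ''i'')) + 2) + ?ta)"
    have r5: "wp F X ?r5 s5 ?t5 (J k)"
      if s5: "frame {''v'', ''x'', ''y'', ''d'', ''k'', ''le'', ''tr''} ?s4 s5" "nat_rep (s5 ''tr'') \<tau>'" "tree N \<kappa> ?A \<tau>'" for s5 \<tau>'
    proof -
      have f5: "s5 ''K'' 0 = of_nat K" "s5 ''i'' 0 = of_nat i" "s5 ''ep'' 0 = \<epsilon>"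
        "s5 ''zero'' = (\<lambda>_. 0)" "s5 ''ky'' = s ''ky''" "s5 ''ma2'' = s ''ma2''" "s5 ''ex2'' = s ''ex2''"
        "s5 ''R'' 0 = of_int R" "s5 ''ma'' = s1 ''ma''" "s5 ''ex'' = s1 ''ex''" "s5 ''key'' = s1 ''key''" "s5 ''S'' 0 = of_nat S"
        using s5(1) fr J(4,11) by (simp_all add: frame_def list_rep_def)
      have fr5: "acc_rep s5 a w th e" using s5(1) J(9) by (simp add: frame_def acc_rep_def)
      have c: "s ''ma2'' (int i) = of_int (c i)" "s ''ex2'' (int i) = of_nat (f i)" "1 \<le> c i" "c i \<le> Cm" "f i \<le> E"
        using cf[OF iN(1,2)] by auto
      let ?s6 = "upd s5 ''c'' (of_int (c i))"
      let ?s7 = "upd ?s6 ''f'' (of_nat (f i))"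
      have acc_inv: "acc_inv \<epsilon> R (card P) S (sum \<omega> P) T1 (\<Sum>r<S - 1. mw r * 2 ^ me r) a w th e"
        using J(8) unfolding list_inv_def by blast
      have ab: "wp F X absorb ?s7 ?ta (J k)"
      proof (rule wp_absorb[where ?S0.0 = S and ?i0.0 = i and \<epsilon> = \<epsilon> and ?a0.0 = a and ?w0.0 = w and ?th0.0 = th and ?e0.0 = e
            and R = R and ?c0.0 = "c i" and ?f0.0 = "f i" and Cm = Cm and E = E and h = h and K = K])
        show "S + 1 < X" using bd X by simp
        have "S * K + K \<le> Sm * K + K" using bd by simp
        thus "S * K + K < X" using X(3) by (rule le_less_trans)
        have "i * K \<le> N * K" using iN by simp
        thus "i * K < X" using X(4) by (rule le_less_trans)
        show "small X (?s7 ''ky'' (int (i * K + k')))" if "k' < K" for k'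
        proof -
          have "?s7 ''ky'' (int (i * K + k')) = of_int (d i k')" "\<bar>d i k'\<bar> \<le> D"
            using key iN that f5 by (simp_all add: key_rep_def)
          thus ?thesis using X(8) b(6) by (simp only:) (rule si, linarith)
        qed
        show "acc_rep ?s7 a w th e" using fr5 by (simp add: acc_rep_def)
        show "S = 0 \<Longrightarrow> th = 0" using acc_inv by (simp add: acc_inv_def)
        show "0 \<le> w" "w \<le> a" "0 \<le> th" "a < 2 * R" "0 < e \<Longrightarrow> R \<le> a" using acc_inv by (simp_all add: acc_inv_def)
        show "2 * R \<le> Cm" using b by (simp add: R_def)
        show "e \<le> E" using bd by simp
      next
        fix s' new a' w' th' e' S1
        assume a1: "frame {''a'', ''w'', ''th'', ''e'', ''c'', ''f'', ''o1'', ''o2'', ''o3'', ''S'', ''key'', ''k'', ''ma'', ''ex''} ?s7 s'"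
          and a2: "acc_rep s' a' w' th' e'" and a3: "absorbed \<epsilon> R a w th e (c i) (f i) new a' w' th' e'" and a4: "th' \<le> 4 * Cm"
          and a5: "new \<longrightarrow> S1 = S" "\<not> new \<longrightarrow> S = Suc S1" and a6: "s' ''S'' 0 = of_nat (Suc S1)"
          and a7: "s' ''ma'' = (?s7 ''ma'')(int S1 := of_int w')" "s' ''ex'' = (?s7 ''ex'')(int S1 := of_nat e')"
          and a8: "new \<longrightarrow> (\<forall>k<K. s' ''key'' (int (S * K + k)) = ?s7 ''ky'' (int (i * K + k)))"
            "\<forall>j<int (S * K). s' ''key'' j = ?s7 ''key'' j"
        define dk' where "dk' = (if new then dk(S := d i) else dk)"
        let ?mw = "mw(S1 := w')" and ?me = "me(S1 := e')"
        let ?T1 = "if new then sum \<omega> (insert i P) else T1"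
        have kv: "(\<lambda>r. horner B K (dk' r)) = (if new then (\<lambda>r. horner B K (dk r))(S := \<kappa> i) else (\<lambda>r. horner B K (dk r)))"
          by (auto simp: dk'_def \<kappa>)
        have cI: "card P + 1 \<le> N"
        proof -
          have "card (insert i P) \<le> card {1..N}" using J(2) Isub iN by (intro card_mono) auto
          thus ?thesis using iN finite_subset[OF J(2) finI] by simp
        qed
        have PI': "list_inv \<epsilon> R \<kappa> \<omega> (insert i P) (Suc S1) (\<lambda>r. horner B K (dk' r)) ?mw ?me ?T1 a' w' th' e'"
          unfolding kv
        proof (rule list_inv_step[OF J(8) a3 b(1,2) c(3) cI R])
          show "\<And>p. p \<in> P \<Longrightarrow> \<kappa> p \<le> \<kappa> i" using J(7) i(1) by blast
          show "\<omega> i = c i * 2 ^ f i" using iN by (simp add: \<omega>)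
        qed (use iN \<omega>0 a5 in auto)
        have sub: "insert i P \<subseteq> I" using J(2) iN by simp
        note bd' = bounds[OF PI' sub]
        have FI': "1 \<le> w'" "w' \<le> a'" "a' < 2 * R" using PI' unfolding list_inv_def acc_inv_def by auto
        have eqA: "I - insert i P = ?A" by auto
        show "J k s'"
          unfolding J_def
        proof (intro exI conjI)
          show "frame pop_vars s s'"
            using J(1) s5(1) a1 by (auto simp: frame_def pop_vars_def)
          show "insert i P \<subseteq> I" by (rule sub)
          show "card (I - insert i P) = k" unfolding eqA using J(3) i(1) finI by simp
          show "s' ''R'' 0 = of_int R" using a1 f5 by (simp add: frame_def)
          have "s' ''tr'' = s5 ''tr''" using a1 by (simp add: frame_def)
          thus "nat_rep (s' ''tr'') \<tau>'" using s5(2) by simp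
          show "tree N \<kappa> (I - insert i P) \<tau>'" unfolding eqA by (rule s5(3))
          show "\<forall>p\<in>insert i P. \<forall>q\<in>I - insert i P. \<kappa> p \<le> \<kappa> q" using J(7) i(2) by auto
          show "list_inv \<epsilon> R \<kappa> \<omega> (insert i P) (Suc S1) (\<lambda>r. horner B K (dk' r)) ?mw ?me ?T1 a' w' th' e'" by (rule PI')
          show "acc_rep s' a' w' th' e'" by (rule a2)
          show "th' \<le> 4 * Cm" by (rule a4)
          show "list_rep s' K (Suc S1) dk' ?mw ?me"
            unfolding list_rep_def
          proof (intro conjI allI impI)
            show "s' ''S'' 0 = of_nat (Suc S1)" by (rule a6)
            fix r assume r: "r < Suc S1"
            have rS: "r < S \<or> new \<and> r = S" using r a5 by (cases new) auto
            have SS: "S1 = S \<or> S = Suc S1" using a5 by blast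
            have rr: "r = S1 \<or> r < S" using r SS by auto
            show "s' ''ma'' (int r) = of_int (?mw r)" "s' ''ex'' (int r) = of_nat (?me r)"
              using a7 f5 J(11) rr by (auto simp: list_rep_def)
            fix k' assume k': "k' < K"
            show "s' ''key'' (int (r * K + k')) = of_int (dk' r k')"
            proof (cases "r < S")
              case True
              hence "int (r * K + k') < int (S * K)" using idx_less[OF True k'] by (simp only: of_nat_less_iff)
              hence "s' ''key'' (int (r * K + k')) = s1 ''key'' (int (r * K + k'))" using a8(2) f5 by simp
              thus ?thesis using J(11) True k' by (simp add: list_rep_def dk'_def)
            next
              case False
              hence "new" "r = S" using rS by auto
              thus ?thesis using a8(1) k' f5 key iN by (simp add: dk'_def key_rep_def)
            qed
          qed
          show "\<forall>r<Suc S1. dk' r \<in> d ` I \<and> 1 \<le> ?mw r \<and> ?mw r \<le> 2 * R \<and> ?me r \<le> E"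
          proof (intro allI impI)
            fix r assume r: "r < Suc S1"
            have rS: "r < S \<or> new \<and> r = S" using r a5 by (cases new) auto
            have SS: "S1 = S \<or> S = Suc S1" using a5 by blast
            have rr: "r = S1 \<or> r < S" using r SS by auto
            have "dk' r \<in> d ` I" using rS J(12) iN by (auto simp: dk'_def)
            moreover have "1 \<le> ?mw r \<and> ?mw r \<le> 2 * R \<and> ?me r \<le> E" using rr J(12) FI' bd' by auto
            ultimately show "dk' r \<in> d ` I \<and> 1 \<le> ?mw r \<and> ?mw r \<le> 2 * R \<and> ?me r \<le> E" by blast
          qed
        qed
      qed (use X b c f5 R J(10) in auto)
      show ?thesis
      proof (rule wp_seq, rule wp_putv[where v = "of_int (c i)"], goal_cases)
        case 6
        show ?case
        proof (rule wp_seq, rule wp_putv[where v = "of_nat (f i)"], goal_cases)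
          case 6 show ?case by (rule ab)
        next
          case 5 show ?case using c X by (intro sn) auto
        qed (use f5 c sm in simp_all)
      next
        case 5 show ?case using c X by (intro si) auto
      qed (use f5 c sm in simp_all)
    qed
    have l2: "l div 2 < N" "l div 2 < 2 ^ ht" using ch(2)[OF i1] b(7) by (auto simp: l_def)
    let ?e1 = "Cell ''tr'' (Num 1)" and ?e2 = "V ''N'' [+] V ''i'' [-] Num 1"
    have "wp F X pop_body s1 ((ops ?e1 + 2) + ((ops ?e2 + ops (Num 0) + 1) + ((ops (Floor (?e2 [/] Num 2)) + 2) +
       ((ht + 1) * (100 + K * 60) + ?t5)))) (J k)"
      unfolding pop_body_def
    proof (rule wp_seq, rule wp_putv[where v = "of_nat i"], goal_cases)
      case 6
      show ?case
      proof (rule wp_seq, rule wp_asg[where z = "int l" and v = 0], goal_cases)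
        case 9
        show ?case
        proof (rule wp_seq, rule wp_putv[where v = "of_nat (l div 2)"], goal_cases)
          case 6
          show ?case
          proof (rule wp_seq, rule wp_repair[where K = K and D = D and I = N and N = N and B = B and ?v0.0 = "l div 2" and d = d
                and \<kappa> = \<kappa> and ?\<tau>0.0 = "\<tau>(l := 0)" and h = ht])
            show "nat_rep (?s4 ''tr'') (\<tau>(l := 0))" using nat_rep_upd[OF J(5), of l 0] by simp
            show "\<And>v. (\<tau>(l := 0)) v \<le> N" using ch(1)[OF i1] by (simp add: l_def)
            show "l div 2 < 2 ^ ht" "l div 2 < N" by fact+
            show "\<forall>x. 1 \<le> x \<longrightarrow> x < N \<longrightarrow> winner_ok \<kappa> (\<tau>(l := 0)) x \<or> (\<exists>k. x = l div 2 div 2 ^ k)"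
              using ch(3)[OF i1] by (simp add: l_def)
            show "key_rep ?s4 K D N d" using key fr by (simp add: key_rep_def)
          next
            fix s5 \<tau>'
            assume s5: "frame {''v'', ''x'', ''y'', ''d'', ''k'', ''le'', ''tr''} ?s4 s5" "nat_rep (s5 ''tr'') \<tau>'"
              "\<forall>v. \<tau>' v \<le> N" "\<forall>x. x = 0 \<or> N \<le> x \<longrightarrow> \<tau>' x = (\<tau>(l := 0)) x" "\<forall>x. 1 \<le> x \<longrightarrow> x < N \<longrightarrow> winner_ok \<kappa> \<tau>' x"
            have "tree N \<kappa> ?A \<tau>'" using ch(4)[OF i1 s5(3) _ s5(5)] s5(4) by (simp add: l_def)
            thus "wp F X ?r5 s5 ?t5 (J k)" using s5 by (intro r5)
          qed (use X b fr \<kappa> in auto)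
        next
          case 5 show ?case using l2 X by (intro sn) auto
        next
          case 1
          have "\<lfloor>of_nat l / 2 :: rat\<rfloor> = int (l div 2)" using floor_divide_of_nat_eq[of l 2, where 'a = rat] by simp
          thus ?case using fr l by simp
        qed (use sm in simp_all)
      qed (use fr l sm in simp_all)
    next
      case 5 show ?case using iN X by (intro sn) auto
    qed (use tr1 sm in simp_all)
    thus ?thesis by (rule wp_time) simp
  qed
  let ?re = "Floor (Num 8 [*] (V ''N'' [+] Num 1) [/] V ''ep'') [+] Num 1"
  have RX: "small X (of_int R)" using b(3) R(1) X by (intro si) (auto simp: R_def)
  have whl: "wp F X (While (Num 1 [\<le>] Cell ''tr'' (Num 1)) pop_body) s0 (10 + N * (290 + (ht + 1) * (100 + K * 60) + E * 100 + h * 50 + K * 40)) Q"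
    if s0: "frame {''S'', ''a'', ''e'', ''w'', ''th'', ''R''} s s0" "acc_rep s0 0 0 0 0" "s0 ''S'' 0 = 0" "s0 ''R'' 0 = of_int R" for s0
  proof -
    have "wp F X (While (Num 1 [\<le>] Cell ''tr'' (Num 1)) pop_body) s0
       ((card I + 1) * (ops (Num 1 [\<le>] Cell ''tr'' (Num 1)) + 1) + card I * (280 + (ht + 1) * (100 + K * 60) + E * 100 + h * 50 + K * 40)) Q"
    proof (rule wp_while[where I = J])
      show "J (card I) s0"
        unfolding J_def
      proof (intro exI conjI)
        show "frame pop_vars s s0" using s0(1) by (rule frame_mono) (simp add: pop_vars_def)
        show "{} \<subseteq> I" by simp
        show "nat_rep (s0 ''tr'') \<tau>0" using s0(1) tr by (simp add: frame_def)
        show "list_inv \<epsilon> R \<kappa> \<omega> {} 0 (\<lambda>r. horner B K (d 0)) (\<lambda>_. 0) (\<lambda>_. 0) 0 0 0 0 0" using R(1) by (rule list_inv_init)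
        show "list_rep s0 K 0 (\<lambda>_. d 0) (\<lambda>_. 0) (\<lambda>_. 0)" using s0 by (simp add: list_rep_def)
        show "0 \<le> 4 * Cm" using b(3) R(1) by (simp add: R_def)
      qed (use s0 tr in auto)
    next
      fix k s1 assume "J (Suc k) s1" "val F s1 (Num 1 [\<le>] Cell ''tr'' (Num 1)) \<noteq> 0"
      thus "wp F X pop_body s1 (280 + (ht + 1) * (100 + K * 60) + E * 100 + h * 50 + K * 40) (J k)" by (intro body)
    next
      fix s1 assume "J 0 s1"
      then obtain P \<tau> where J: "card (I - P) = 0" "nat_rep (s1 ''tr'') \<tau>" "tree N \<kappa> (I - P) \<tau>" unfolding J_def by blast
      have "I - P = {}" using J(1) finI by (metis card_0_eq finite_Diff)
      with J(3) have "tree N \<kappa> {} \<tau>" by (simp only:)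
      hence "\<tau> 1 = 0" by (rule tree_empty)
      hence "s1 ''tr'' 1 = 0" using J(2) nat_rep_def[of "s1 ''tr''" \<tau>] by (metis of_nat_0 of_nat_1)
      thus "val F s1 (Num 1 [\<le>] Cell ''tr'' (Num 1)) = 0" by simp
    next
      fix k s1 assume "J k s1" and z: "val F s1 (Num 1 [\<le>] Cell ''tr'' (Num 1)) = 0"
      then obtain P S dk mw me T1 a w th e \<tau> where J: "frame pop_vars s s1" "P \<subseteq> I"
         "s1 ''R'' 0 = of_int R" "nat_rep (s1 ''tr'') \<tau>" "tree N \<kappa> (I - P) \<tau>"
         "list_inv \<epsilon> R \<kappa> \<omega> P S (\<lambda>r. horner B K (dk r)) mw me T1 a w th e" "acc_rep s1 a w th e"
         "list_rep s1 K S dk mw me" "\<forall>r<S. dk r \<in> d ` I \<and> 1 \<le> mw r \<and> mw r \<le> 2 * R \<and> me r \<le> E"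
        unfolding J_def by blast
      have "s1 ''tr'' 1 = of_nat (\<tau> 1)" using J(4) nat_rep_def[of "s1 ''tr''" \<tau>] by (metis of_nat_1)
      hence t1: "\<tau> 1 = 0" using z by (cases "\<tau> 1") (auto split: if_splits)
      have sub: "I - P \<subseteq> {1..N}" using Isub by auto
      have lt: "\<And>q. q \<in> I - P \<Longrightarrow> \<kappa> q < \<kappa> 0" by (simp add: I)
      have "I - P = {}" by (rule tree_root(1)[OF J(5) sub lt, THEN iffD1]) (use t1 in simp_all)
      hence list_inv: "P = I" using J(2) by blast
      \<comment> \<open>A tree without candidates is 0 at every node. The next stage therefore finds
        an empty tree whatever its number of leaves is.\<close>
      have tz: "\<tau> v = 0" for v using tree_empty[of N \<kappa> \<tau>] J(5) list_inv by simp
      hence "nat_rep (s1 ''tr'') (\<lambda>_. 0)" using J(4) by (simp add: nat_rep_def)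
      moreover have "S \<le> Sm" using bounds[OF J(6,2)] by simp
      ultimately show "Q s1" using J list_inv
        by (intro Q[of s1 S dk mw me T1 a w th e]) (simp_all only: R_def[symmetric] acc_rep_def simp_thms)
    qed (use sm in auto)
    moreover have "card I \<le> N" using card_mono[of "{1..N}" I] Isub by simp
    hence "(card I + 1) * (ops (Num 1 [\<le>] Cell ''tr'' (Num 1)) + 1) + card I * (280 + (ht + 1) * (100 + K * 60) + E * 100 + h * 50 + K * 40)
       \<le> (N + 1) * 5 + N * (280 + (ht + 1) * (100 + K * 60) + E * 100 + h * 50 + K * 40)"
      by (intro add_mono mult_mono) auto
    hence "(card I + 1) * (ops (Num 1 [\<le>] Cell ''tr'' (Num 1)) + 1) + card I * (280 + (ht + 1) * (100 + K * 60) + E * 100 + h * 50 + K * 40)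
       \<le> 10 + N * (290 + (ht + 1) * (100 + K * 60) + E * 100 + h * 50 + K * 40)"
      by (simp add: algebra_simps)
    ultimately show ?thesis by (rule wp_time)
  qed
  have "wp F X pop_loop s (((ops (Num 0) + 2) + ((ops (Num 0) + 2) + ((ops (Num 0) + 2) + ((ops (Num 0) + 2) + ((ops (Num 0) + 2) +
     (ops ?re + 2)))))) + (10 + N * (290 + (ht + 1) * (100 + K * 60) + E * 100 + h * 50 + K * 40))) Q"
    unfolding pop_loop_def pop_init_def
    apply (rule wp_seq)
    apply (rule wp_seq, rule wp_putv[where v = 0], (use sm in simp_all)[5])
    apply (rule wp_seq, rule wp_putv[where v = 0], (use sm in simp_all)[5])
    apply (rule wp_seq, rule wp_putv[where v = 0], (use sm in simp_all)[5])
    apply (rule wp_seq, rule wp_putv[where v = 0], (use sm in simp_all)[5])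
    apply (rule wp_seq, rule wp_putv[where v = 0], (use sm in simp_all)[5])
    apply (rule wp_putv[where v = "of_int R"], (use s sm RX in \<open>simp_all add: R_def precision_def\<close>)[5])
    apply (rule whl)
       apply (auto simp: frame_def acc_rep_def)
    done
  thus ?thesis by (rule wp_time) (simp add: algebra_simps)
qed

section \<open>Generating the candidates of a stage\<close>

text \<open>Candidate \<open>t = r * M + m\<close> extends block \<open>r\<close> by grid point
  \<open>m\<close> of coordinate \<open>j\<close>. Element indices are shifted by one because 0 is
  the sentinel, and the rows of \<open>D\<close> because row 0 holds the budget. The number
  \<open>mu\<close> of integers represented by the grid point multiplies the mantissa and leaves the
  exponent unchanged.\<close>

definition gen_elem :: prog where
  "gen_elem = (put ''i'' (V ''t'' [+] Num 1) ;;
     put ''r'' (Floor (V ''t'' [/] V ''M'')) ;;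
     put ''m'' (V ''t'' [-] V ''r'' [*] V ''M'') ;;
     put ''o1'' (V ''i'' [*] V ''K'') ;;
     put ''o2'' (V ''r'' [*] V ''K'') ;;
     put ''o3'' ((Num 1 [+] V ''j'' [*] V ''M'' [+] V ''m'') [*] V ''K'') ;;
     add_vec ''ky'' ''o1'' ''key'' ''o2'' ''D'' ''o3'' ;;
     Assign ''ma2'' (V ''i'') (Cell ''ma'' (V ''r'') [*] Cell ''mu'' (V ''m'')) ;;
     Assign ''ex2'' (V ''i'') (Cell ''ex'' (V ''r'')))"

text \<open>A candidate whose key is at least that of the sentinel exceeds the budget and never
  enters the tree. Hence no list contains a key beyond the budget.\<close>

definition gen_insert :: prog where
  "gen_insert = (put ''x'' (Num 0) ;; put ''y'' (V ''i'') ;; compare_keys ;;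
     If (V ''le'') Skip
       (Assign ''tr'' (V ''N'' [+] V ''t'') (V ''i'') ;;
        put ''v'' (Floor ((V ''N'' [+] V ''t'') [/] Num 2)) ;;
        repair))"

definition stage :: prog where
  "stage = (put ''N'' (V ''S'' [*] V ''M'') ;; loop ''t'' (V ''N'') (gen_elem ;; gen_insert) ;; pop_loop)"

lemma wp_gen_elem:
  assumes X: "8 \<le> X" "K < X" "(N + 1) * K < X" "(J + 1) * M + 1 < X" "((J + 1) * M + 1) * K < X" "N + 1 < X" "4 * D + 4 \<le> int X" "Cm \<le> int X" "E \<le> X"
    and s: "s ''K'' 0 = of_nat K" "s ''M'' 0 = of_nat M" "s ''j'' 0 = of_nat j" "s ''t'' 0 = of_nat t"
    and b: "t < N" "N = S * M" "r = t div M" "m = t mod M" "j \<le> J"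
    and ls: "list_rep s K S dk mw me"
    and dg: "\<And>k. k < K \<Longrightarrow> s ''D'' (int ((1 + j * M + m) * K + k)) = of_int (\<phi> k)"
    and mu: "s ''mu'' (int m) = of_int \<mu>"
    and bd: "\<And>k. k < K \<Longrightarrow> \<bar>dk r k + \<phi> k\<bar> \<le> D" "1 \<le> mw r * \<mu>" "mw r * \<mu> \<le> Cm" "me r \<le> E"
    and Q: "\<And>s'. frame {''i'', ''r'', ''m'', ''o1'', ''o2'', ''o3'', ''ky'', ''k'', ''ma2'', ''ex2''} s s' \<Longrightarrow>
       s' ''i'' 0 = of_nat (Suc t) \<Longrightarrow>
       (\<And>k. k < K \<Longrightarrow> s' ''ky'' (int (Suc t * K + k)) = of_int (dk r k + \<phi> k)) \<Longrightarrow>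
       (\<And>i. i < int (Suc t * K) \<Longrightarrow> s' ''ky'' i = s ''ky'' i) \<Longrightarrow>
       s' ''ma2'' = (s ''ma2'')(int (Suc t) := of_int (mw r * \<mu>)) \<Longrightarrow>
       s' ''ex2'' = (s ''ex2'')(int (Suc t) := of_nat (me r)) \<Longrightarrow> Q s'"
  shows "wp F X gen_elem s (90 + K * 40) Q"
proof -
  have sm: "small X 0" "small X 1" "small X 2" "1 \<le> X" using X by (auto simp: small_0 small_1 small_numeral)
  have sn: "small X (of_nat v)" if "v \<le> X" for v using that sm by (intro small_of_nat) auto
  have si: "small X (of_int v)" if "\<bar>v\<bar> \<le> int X" for v using that sm by (intro small_of_int) auto
  have M: "0 < M" using b by (cases M) auto
  have r: "r < S" "r * M \<le> t" "m < M" "r \<le> t" using b M by (auto simp: less_mult_imp_div_less)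
  have rr: "\<lfloor>of_nat t / of_nat M :: rat\<rfloor> = int r" unfolding b(3) by (simp add: floor_divide_of_nat_eq)
  have "of_nat t = (of_nat (r * M + m) :: rat)" unfolding b(3,4) by simp
  hence mm: "of_nat t - of_nat r * of_nat M = (of_nat m :: rat)" by simp
  define q where "q = (1 + j * M + m) * K"
  have jM: "1 + j * M + m \<le> (J + 1) * M + 1"
  proof -
    have "j * M + m \<le> J * M + M" by (rule add_mono) (use b(5) r in simp_all)
    thus ?thesis by simp
  qed
  have qX: "q < X" "1 + j * M + m < X"
  proof -
    have "q \<le> ((J + 1) * M + 1) * K" unfolding q_def using jM by (intro mult_right_mono) auto
    thus "q < X" using X(5) by (rule le_less_trans)
    show "1 + j * M + m < X" using jM X(4) by (rule le_less_trans)
  qed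
  have tX: "Suc t * K < X" "r * K < X"
  proof -
    have "Suc t \<le> N + 1" "r \<le> N + 1" using b(1) r(4) by simp_all
    hence "Suc t * K \<le> (N + 1) * K" "r * K \<le> (N + 1) * K" by (simp_all only: mult_le_mono1)
    thus "Suc t * K < X" "r * K < X" using le_less_trans X(3) by blast+
  qed
  have qq: "(1 + of_nat j * of_nat M + of_nat m) * of_nat K = (of_nat q :: rat)" by (simp add: q_def algebra_simps)
  have lr: "s ''ma'' (int r) = of_int (mw r)" "s ''ex'' (int r) = of_nat (me r)"
     "\<And>k. k < K \<Longrightarrow> s ''key'' (int (r * K + k)) = of_int (dk r k)"
    using ls r by (auto simp: list_rep_def)
  let ?s1 = "upd s ''i'' (of_nat (Suc t))"
  let ?s2 = "upd ?s1 ''r'' (of_nat r)"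
  let ?s3 = "upd ?s2 ''m'' (of_nat m)"
  let ?s4 = "upd ?s3 ''o1'' (of_nat (Suc t * K))"
  let ?s5 = "upd ?s4 ''o2'' (of_nat (r * K))"
  let ?s6 = "upd ?s5 ''o3'' (of_nat q)"
  let ?m1 = "Cell ''ma'' (V ''r'') [*] Cell ''mu'' (V ''m'')" and ?m2 = "Cell ''ex'' (V ''r'')"
  have last: "wp F X (Assign ''ma2'' (V ''i'') ?m1 ;; Assign ''ex2'' (V ''i'') ?m2) s'
     ((ops (V ''i'') + ops ?m1 + 1) + (ops (V ''i'') + ops ?m2 + 1)) Q"
    if s': "frame {''ky'', ''k''} ?s6 s'"
      "\<And>k. k < K \<Longrightarrow> s' ''ky'' (int (Suc t * K + k)) = ?s6 ''key'' (int (r * K + k)) + ?s6 ''D'' (int (q + k))"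
      "\<And>i. i < int (Suc t * K) \<or> int (Suc t * K + K) \<le> i \<Longrightarrow> s' ''ky'' i = ?s6 ''ky'' i" for s'
  proof -
    have f: "s' ''i'' 0 = of_nat (Suc t)" "s' ''r'' 0 = of_nat r" "s' ''m'' 0 = of_nat m"
      "s' ''ma'' = s ''ma''" "s' ''mu'' = s ''mu''" "s' ''ex'' = s ''ex''" "s' ''ma2'' = s ''ma2''" "s' ''ex2'' = s ''ex2''"
      using s'(1) by (simp_all add: frame_def)
    let ?t1 = "s'(''ma2'' := (s' ''ma2'')(int (Suc t) := of_int (mw r * \<mu>)))"
    let ?t2 = "?t1(''ex2'' := (?t1 ''ex2'')(int (Suc t) := of_nat (me r)))"
    have Q2: "Q ?t2"
    proof (rule Q)
      show "frame {''i'', ''r'', ''m'', ''o1'', ''o2'', ''o3'', ''ky'', ''k'', ''ma2'', ''ex2''} s ?t2"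
        using s'(1) by (auto simp: frame_def)
      show "?t2 ''i'' 0 = of_nat (Suc t)" using f by simp
      show "?t2 ''ky'' (int (Suc t * K + k)) = of_int (dk r k + \<phi> k)" if "k < K" for k
        using s'(2)[OF that] lr(3)[OF that] dg[OF that] by (simp add: q_def)
      show "?t2 ''ky'' i = s ''ky'' i" if "i < int (Suc t * K)" for i
        using s'(3)[of i] that by simp
    qed (use f in simp_all)
    show ?thesis
    proof (rule wp_seq, rule wp_asg[where z = "int (Suc t)" and v = "of_int (mw r * \<mu>)"], goal_cases)
      case 8 show ?case using bd X by (intro si) auto
    next
      case 9 show ?case
      proof (rule wp_asg[where z = "int (Suc t)" and v = "of_nat (me r)"], goal_cases)
        case 8 show ?case using bd X by (intro sn) auto
      next
        case 9 show ?case by (rule Q2)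
      qed (use f lr sm in simp_all)
    qed (use f lr mu sm in simp_all)
  qed
  have av: "wp F X (add_vec ''ky'' ''o1'' ''key'' ''o2'' ''D'' ''o3'') ?s6 (12 + K * 40)
     (\<lambda>s'. wp F X (Assign ''ma2'' (V ''i'') ?m1 ;; Assign ''ex2'' (V ''i'') ?m2) s'
       ((ops (V ''i'') + ops ?m1 + 1) + (ops (V ''i'') + ops ?m2 + 1)) Q)"
  proof (rule wp_add_vec[where K = K and ?p1.0 = "Suc t * K" and ?p2.0 = "r * K" and ?p3.0 = q])
    show "small X (?s6 ''key'' (int (r * K + k)) + ?s6 ''D'' (int (q + k)))" if "k < K" for k
    proof -
      have "?s6 ''key'' (int (r * K + k)) + ?s6 ''D'' (int (q + k)) = of_int (dk r k + \<phi> k)"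
        using lr(3)[OF that] dg[OF that] by (simp add: q_def)
      moreover have "\<bar>dk r k + \<phi> k\<bar> \<le> int X" using bd(1)[OF that] X(7) by linarith
      ultimately show ?thesis by (simp only: si)
    qed
  qed (use X s last in simp_all)
  have c: "small X (1 + of_nat t)" "small X (of_nat r)" "small X (of_nat m)" "small X ((1 + of_nat t) * of_nat K)"
    "small X (of_nat r * of_nat K)" "small X (of_nat q)"
    using sn[of "Suc t"] sn[of r] sn[of m] sn[of "Suc t * K"] sn[of "r * K"] sn[of q] X b(1) r tX qX jM
    by (simp_all add: algebra_simps)
  have "wp F X gen_elem s ((ops (V ''t'' [+] Num 1) + 2) + ((ops (Floor (V ''t'' [/] V ''M'')) + 2) +
     ((ops (V ''t'' [-] V ''r'' [*] V ''M'') + 2) + ((ops (V ''i'' [*] V ''K'') + 2) + ((ops (V ''r'' [*] V ''K'') + 2) +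
     ((ops ((Num 1 [+] V ''j'' [*] V ''M'' [+] V ''m'') [*] V ''K'') + 2) + ((12 + K * 40) +
     ((ops (V ''i'') + ops ?m1 + 1) + (ops (V ''i'') + ops ?m2 + 1))))))))) Q"
    unfolding gen_elem_def
    apply (rule wp_seq, rule wp_putv[where v = "of_nat (Suc t)"], (use s sm c in simp_all)[5])
    apply (rule wp_seq, rule wp_putv[where v = "of_nat r"], (use s sm c rr in simp_all)[5])
    apply (rule wp_seq, rule wp_putv[where v = "of_nat m"], (use s sm c mm in simp_all)[5])
    apply (rule wp_seq, rule wp_putv[where v = "of_nat (Suc t * K)"], (use s sm c in \<open>simp_all add: algebra_simps\<close>)[5])
    apply (rule wp_seq, rule wp_putv[where v = "of_nat (r * K)"], (use s sm c in simp_all)[5])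
    apply (rule wp_seq, rule wp_putv[where v = "of_nat q"], (use s sm c qq in simp_all)[5])
    apply (rule wp_seq, rule av)
    done
  thus ?thesis by (rule wp_time) simp
qed

lemma tree_mem:
  assumes t: "tree N \<kappa> A \<tau>"
  shows "\<tau> v = 0 \<or> \<tau> v \<in> A"
proof (cases "1 \<le> v \<and> v < 2 * N")
  case True
  then obtain i where "i < N" "\<tau> v = \<tau> (N + i)" using tournament_leaf[of N \<kappa> \<tau> v] t by (auto simp: tree_def)
  thus ?thesis using t by (auto simp: tree_def)
next
  case False
  thus ?thesis using t by (cases "v = 0") (auto simp: tree_def)
qed

lemma wp_gen_insert:
  assumes X: "8 \<le> X" "K < X" "4 * D + 4 \<le> int X" "2 * N + 1 < X"
    and s: "s ''K'' 0 = of_nat K" "s ''N'' 0 = of_nat N" "s ''B'' 0 = of_int B" "s ''t'' 0 = of_nat t" "s ''i'' 0 = of_nat (Suc t)"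
    and b: "t < N" "2 \<le> B" "0 \<le> D" "N \<le> 2 ^ ht"
    and key: "key_rep s K D (Suc t) d" and \<kappa>: "\<kappa> = (\<lambda>i. horner B K (d i))"
    and tr: "nat_rep (s ''tr'') \<tau>" "tree N \<kappa> {i \<in> {1..t}. \<kappa> i < \<kappa> 0} \<tau>"
    and Q: "\<And>s' \<tau>'. frame {''x'', ''y'', ''d'', ''k'', ''le'', ''tr'', ''v''} s s' \<Longrightarrow> nat_rep (s' ''tr'') \<tau>' \<Longrightarrow>
       tree N \<kappa> {i \<in> {1..Suc t}. \<kappa> i < \<kappa> 0} \<tau>' \<Longrightarrow> Q s'"
  shows "wp F X gen_insert s (100 + K * 60 + (ht + 1) * (100 + K * 60)) Q"
proof -
  have sm: "small X 0" "small X 1" "small X 2" "1 \<le> X" using X by (auto simp: small_0 small_1 small_numeral)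
  have sn: "small X (of_nat v)" if "v \<le> X" for v using that sm by (intro small_of_nat) auto
  let ?A = "{i \<in> {1..t}. \<kappa> i < \<kappa> 0}" and ?A' = "{i \<in> {1..Suc t}. \<kappa> i < \<kappa> 0}"
  let ?s1 = "upd s ''x'' 0"
  let ?s2 = "upd ?s1 ''y'' (of_nat (Suc t))"
  let ?e2 = "V ''N'' [+] V ''t''"
  let ?tf = "(ht + 1) * (100 + K * 60)"
  let ?ins = "Assign ''tr'' ?e2 (V ''i'') ;; put ''v'' (Floor (?e2 [/] Num 2)) ;; repair"
  let ?ti = "(ops ?e2 + ops (V ''i'') + 1) + ((ops (Floor (?e2 [/] Num 2)) + 2) + ?tf)"
  have \<tau>t: "\<tau> v \<le> Suc t" for v using tree_mem[OF tr(2), of v] by auto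
  have ins: "wp F X ?ins s3 ?ti Q"
    if s3: "frame {''d'', ''k'', ''le''} ?s2 s3" and lt: "\<kappa> (Suc t) < \<kappa> 0" for s3
  proof -
    have f: "s3 ''K'' 0 = of_nat K" "s3 ''N'' 0 = of_nat N" "s3 ''B'' 0 = of_int B" "s3 ''t'' 0 = of_nat t" "s3 ''i'' 0 = of_nat (Suc t)"
      "s3 ''tr'' = s ''tr''" "s3 ''ky'' = s ''ky''"
      using s3 s by (simp_all add: frame_def)
    have "?A' = insert (Suc t) ?A" using lt by (auto simp: le_Suc_eq)
    hence ch0: "Suc t = 0 \<and> ?A' = ?A - {Suc t} \<or> Suc t = Suc t \<and> ?A' = insert (Suc t) ?A" by simp
    note ch = tree_change[OF tr(2) b(1) ch0]
    define l where "l = N + t"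
    let ?s4 = "s3(''tr'' := (s3 ''tr'')(int l := of_nat (Suc t)))"
    let ?s5 = "upd ?s4 ''v'' (of_nat (l div 2))"
    have l2: "l div 2 < N" using ch(2) by (simp add: l_def)
    have fl: "\<lfloor>(of_nat N + of_nat t) / 2 :: rat\<rfloor> = int (l div 2)"
      using floor_divide_of_nat_eq[of l 2, where 'a = rat] by (simp add: l_def)
    have fx: "wp F X repair ?s5 ?tf Q"
    proof (rule wp_repair[where K = K and D = D and I = "Suc t" and N = N and B = B and ?v0.0 = "l div 2" and d = d
                and \<kappa> = \<kappa> and ?\<tau>0.0 = "\<tau>(l := Suc t)" and h = ht])
      show "nat_rep (?s5 ''tr'') (\<tau>(l := Suc t))" using nat_rep_upd[OF tr(1), of l "Suc t"] f by simp
      show "\<And>v. (\<tau>(l := Suc t)) v \<le> Suc t" using \<tau>t by simp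
      show "l div 2 < N" by fact
      show "l div 2 < 2 ^ ht" using l2 b(4) by linarith
      show "\<forall>x. 1 \<le> x \<longrightarrow> x < N \<longrightarrow> winner_ok \<kappa> (\<tau>(l := Suc t)) x \<or> (\<exists>k. x = l div 2 div 2 ^ k)"
        using ch(3) by (simp add: l_def)
      show "key_rep ?s5 K D (Suc t) d" using key f by (simp add: key_rep_def)
    next
      fix s6 \<tau>'
      assume s6: "frame {''v'', ''x'', ''y'', ''d'', ''k'', ''le'', ''tr''} ?s5 s6" "nat_rep (s6 ''tr'') \<tau>'"
        "\<forall>v. \<tau>' v \<le> Suc t" "\<forall>x. x = 0 \<or> N \<le> x \<longrightarrow> \<tau>' x = (\<tau>(l := Suc t)) x" "\<forall>x. 1 \<le> x \<longrightarrow> x < N \<longrightarrow> winner_ok \<kappa> \<tau>' x"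
      have le: "\<forall>v. \<tau>' v \<le> N" using s6(3) b(1) by (meson Suc_leI le_trans)
      have "tree N \<kappa> ?A' \<tau>'" using ch(4)[OF le _ s6(5)] s6(4) by (simp add: l_def)
      moreover have "frame {''x'', ''y'', ''d'', ''k'', ''le'', ''tr'', ''v''} s s6"
        using s6(1) s3 by (auto simp: frame_def)
      ultimately show "Q s6" using s6(2) by (intro Q[of s6 \<tau>'])
    qed (use X b f \<kappa> in auto)
    show ?thesis
    proof (rule wp_seq, rule wp_asg[where z = "int l" and v = "of_nat (Suc t)"], goal_cases)
      case 8 show ?case using b(1) X by (intro sn) auto
    next
      case 9 show ?case
      proof (rule wp_seq, rule wp_putv[where v = "of_nat (l div 2)"], goal_cases)
        case 5 show ?case using l2 X by (intro sn) auto
      next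
        case 6 show ?case by (rule fx)
      qed (use f sm fl in simp_all)
    qed (use f sm in \<open>simp_all add: l_def\<close>)
  qed
  have cm: "wp F X (compare_keys ;; If (V ''le'') Skip ?ins) ?s2 ((30 + K * 60) + (ops (V ''le'') + 1 + (1 + ?ti))) Q"
  proof (rule wp_seq, rule wp_compare_keys[OF X(2,3) b(3), where x = 0 and y = "Suc t" and dx = "d 0" and dy = "d (Suc t)"])
    fix s3 assume s3: "frame {''d'', ''k'', ''le''} ?s2 s3" "s3 ''le'' 0 = (if horner B K (d 0) \<le> horner B K (d (Suc t)) then 1 else 0)"
    show "wp F X (If (V ''le'') Skip ?ins) s3 (ops (V ''le'') + 1 + (1 + ?ti)) Q"
    proof (rule wp_if)
      assume "val F s3 (V ''le'') \<noteq> 0"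
      hence "\<not> \<kappa> (Suc t) < \<kappa> 0" using s3(2) by (auto simp: \<kappa> split: if_splits)
      hence A: "?A' = ?A" by (auto simp: le_Suc_eq)
      have "Q s3"
      proof (rule Q)
        show "frame {''x'', ''y'', ''d'', ''k'', ''le'', ''tr'', ''v''} s s3" using s3(1) by (auto simp: frame_def)
        show "nat_rep (s3 ''tr'') \<tau>" using s3(1) tr by (simp add: frame_def)
        show "tree N \<kappa> ?A' \<tau>" unfolding A by (rule tr(2))
      qed
      thus "wp F X Skip s3 1 Q" by (rule wp_skip)
    next
      assume "val F s3 (V ''le'') = 0"
      hence "\<kappa> (Suc t) < \<kappa> 0" using s3(2) by (auto simp: \<kappa> split: if_splits)
      thus "wp F X ?ins s3 ?ti Q" using s3(1) by (intro ins)
    qed (use sm in simp_all)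
  next
    show "\<And>k. k < K \<Longrightarrow> ?s2 ''ky'' (int (0 * K + k)) = of_int (d 0 k)"
      "\<And>k. k < K \<Longrightarrow> \<bar>d 0 k\<bar> \<le> D" "\<And>k. k < K \<Longrightarrow> \<bar>d (Suc t) k\<bar> \<le> D"
      "\<And>k. k < K \<Longrightarrow> ?s2 ''ky'' (int (Suc t * K + k)) = of_int (d (Suc t) k)"
      using key unfolding key_rep_def by fastforce+
  qed (use s b in simp_all)
  have "wp F X gen_insert s ((ops (Num 0) + 2) + ((ops (V ''i'') + 2) + ((30 + K * 60) + (ops (V ''le'') + 1 + (1 + ?ti))))) Q"
    unfolding gen_insert_def
    apply (rule wp_seq, rule wp_putv[where v = 0], (use s sm in simp_all)[5])
    apply (rule wp_seq, rule wp_putv[where v = "of_nat (Suc t)"], (use s sm sn[of "Suc t"] b(1) X in simp_all)[5])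
    apply (rule cm)
    done
  thus ?thesis by (rule wp_time) simp
qed

definition stage_vars :: "string set" where
  "stage_vars = pop_vars \<union> {''N'', ''t'', ''r'', ''m'', ''ky'', ''ma2'', ''ex2''}"

lemma key_rep_mono: "key_rep s K D I d \<Longrightarrow> I' \<le> I \<Longrightarrow> key_rep s K D I' d"
  unfolding key_rep_def by auto

text \<open>The array of the tree is 0 everywhere before and after, so stages with different numbers
  of leaves, and hence different addresses, can follow each other without clearing. The key of the
  sentinel in row 0 survives because the keys of candidates are written from row 1 on.\<close>

lemma wp_stage:
  fixes \<epsilon> :: rat
  assumes X: "8 \<le> X" "Sm + 1 < X" "Sm * K + K < X" "(N + 1) * K < X" "K < X" "4 * Cm + 2 \<le> int X" "E + h + 1 \<le> X"
      "4 * D + 4 \<le> int X" "2 * N + 1 < X" "(j0 + 1) * M + 1 < X" "((j0 + 1) * M + 1) * K < X"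
    and s: "s ''K'' 0 = of_nat K" "s ''M'' 0 = of_nat M" "s ''j'' 0 = of_nat j" "s ''ep'' 0 = \<epsilon>" "s ''B'' 0 = of_int B" "s ''zero'' = (\<lambda>_. 0)"
    and b: "0 < \<epsilon>" "\<epsilon> \<le> 1" "2 * precision \<epsilon> N \<le> Cm" "2 * Cm \<le> 2 ^ h" "2 \<le> B" "0 \<le> D" "N \<le> 2 ^ ht" "N = S * M" "j \<le> j0"
    and ls: "list_rep s K S dk mw me" and tr: "nat_rep (s ''tr'') (\<lambda>_. 0)"
    and dg: "\<And>m k. m < M \<Longrightarrow> k < K \<Longrightarrow> s ''D'' (int ((1 + j * M + m) * K + k)) = of_int (\<phi> m k)"
    and mu: "\<And>m. m < M \<Longrightarrow> s ''mu'' (int m) = of_int (\<mu> m)"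
    and key0: "key_rep s K D 0 d"
    and d: "\<And>t. t < N \<Longrightarrow> d (Suc t) = (\<lambda>k. dk (t div M) k + \<phi> (t mod M) k)"
    and dD: "\<And>t k. t < N \<Longrightarrow> k < K \<Longrightarrow> \<bar>d (Suc t) k\<bar> \<le> D"
    and c: "\<And>t. t < N \<Longrightarrow> c (Suc t) = mw (t div M) * \<mu> (t mod M)" "\<And>t. t < N \<Longrightarrow> f (Suc t) = me (t div M)"
      "\<And>t. t < N \<Longrightarrow> 1 \<le> c (Suc t) \<and> c (Suc t) \<le> Cm \<and> f (Suc t) \<le> E"
    and \<kappa>: "\<kappa> = (\<lambda>i. horner B K (d i))"
    and I: "I = {i \<in> {1..N}. \<kappa> i < \<kappa> 0}"
    and \<omega>: "\<omega> = (\<lambda>i. if i \<in> I then c i * 2 ^ f i else 0)"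
    and E: "2 * sum \<omega> I \<le> 2 ^ E"
    and Sm: "\<And>S. (1 + of_rat \<epsilon>) ^ (S - 1) \<le> 2 * real_of_int (sum \<omega> I) \<Longrightarrow> S \<le> Sm"
    and Q: "\<And>s' S dk mw me T1 a w th e. frame stage_vars s s' \<Longrightarrow> list_rep s' K S dk mw me \<Longrightarrow>
       list_inv \<epsilon> (precision \<epsilon> N) \<kappa> \<omega> I S (\<lambda>r. horner B K (dk r)) mw me T1 a w th e \<Longrightarrow>
       (\<forall>r<S. dk r \<in> d ` I \<and> 1 \<le> mw r \<and> mw r \<le> 2 * precision \<epsilon> N \<and> me r \<le> E) \<Longrightarrow> S \<le> Sm \<Longrightarrow>
       nat_rep (s' ''tr'') (\<lambda>_. 0) \<Longrightarrow> key_rep s' K D 0 d \<Longrightarrow> s' ''a'' 0 = of_int a \<Longrightarrow> s' ''e'' 0 = of_nat e \<Longrightarrow> Q s'"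
  shows "wp F X stage s (150 + N * (600 + (2 * ht + 2) * (100 + K * 60) + E * 100 + h * 50 + K * 200)) Q"
proof -
  have sm: "small X 0" "small X 1" "small X 2" "1 \<le> X" using X by (auto simp: small_0 small_1 small_numeral)
  have sn: "small X (of_nat v)" if "v \<le> X" for v using that sm by (intro small_of_nat) auto
  let ?gv = "{''i'', ''r'', ''m'', ''o1'', ''o2'', ''o3'', ''ky'', ''k'', ''ma2'', ''ex2'', ''x'', ''y'', ''d'', ''le'', ''tr'', ''v'', ''N'', ''t''}"
  define J where "J = (\<lambda>t s'. frame ?gv s s' \<and> s' ''N'' 0 = of_nat N \<and> key_rep s' K D t d \<and>
     (\<forall>i<t. s' ''ma2'' (int (Suc i)) = of_int (c (Suc i)) \<and> s' ''ex2'' (int (Suc i)) = of_nat (f (Suc i))) \<and>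
     (\<exists>\<tau>. nat_rep (s' ''tr'') \<tau> \<and> tree N \<kappa> {i \<in> {1..t}. \<kappa> i < \<kappa> 0} \<tau>))"
  let ?tg = "(90 + K * 40) + (100 + K * 60 + (ht + 1) * (100 + K * 60))"
  let ?tp = "100 + N * (300 + (ht + 1) * (100 + K * 60) + E * 100 + h * 50 + K * 40)"
  let ?s1 = "upd s ''N'' (of_nat N)"
  have CmX: "Cm \<le> int X" using X(6) b(3,4) by (cases "0 \<le> Cm") auto
  have body: "wp F X (gen_elem ;; gen_insert) s1 ?tg (\<lambda>s'. s' ''t'' 0 = of_nat t \<and> J (Suc t) (upd s' ''t'' (of_nat (Suc t))))"
    if t: "t < N" and Jt: "J t s1" and st: "s1 ''t'' 0 = of_nat t" for t s1
  proof -
    obtain \<tau> where J: "frame ?gv s s1" "s1 ''N'' 0 = of_nat N" "key_rep s1 K D t d"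
      "\<forall>i<t. s1 ''ma2'' (int (Suc i)) = of_int (c (Suc i)) \<and> s1 ''ex2'' (int (Suc i)) = of_nat (f (Suc i))"
      "nat_rep (s1 ''tr'') \<tau>" "tree N \<kappa> {i \<in> {1..t}. \<kappa> i < \<kappa> 0} \<tau>"
      using Jt unfolding J_def by blast
    have fr: "s1 ''K'' 0 = of_nat K" "s1 ''M'' 0 = of_nat M" "s1 ''j'' 0 = of_nat j" "s1 ''B'' 0 = of_int B"
      "s1 ''D'' = s ''D''" "s1 ''mu'' = s ''mu''"
      using J(1) s by (simp_all add: frame_def)
    have ls1: "list_rep s1 K S dk mw me" using ls J(1) by (simp add: list_rep_def frame_def)
    have M: "0 < M" using t b(8) by (cases M) auto
    hence mM: "t mod M < M" by simp
    show ?thesis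
    proof (rule wp_seq, rule wp_gen_elem[where K = K and N = N and J = j0 and M = M and D = D and Cm = Cm and E = E and j = j
          and t = t and S = S and r = "t div M" and m = "t mod M" and dk = dk and mw = mw and me = me and \<phi> = "\<phi> (t mod M)" and \<mu> = "\<mu> (t mod M)"])
      show "\<And>k. k < K \<Longrightarrow> s1 ''D'' (int ((1 + j * M + t mod M) * K + k)) = of_int (\<phi> (t mod M) k)"
        using dg[OF mM] fr by simp
      show "s1 ''mu'' (int (t mod M)) = of_int (\<mu> (t mod M))" using mu[OF mM] fr by simp
      show "\<And>k. k < K \<Longrightarrow> \<bar>dk (t div M) k + \<phi> (t mod M) k\<bar> \<le> D" using dD[OF t] d[OF t] by simp
      show "1 \<le> mw (t div M) * \<mu> (t mod M)" "mw (t div M) * \<mu> (t mod M) \<le> Cm" "me (t div M) \<le> E" using c[OF t] by simp_all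
    next
      fix s2 assume s2: "frame {''i'', ''r'', ''m'', ''o1'', ''o2'', ''o3'', ''ky'', ''k'', ''ma2'', ''ex2''} s1 s2"
         "s2 ''i'' 0 = of_nat (Suc t)"
         "\<And>k. k < K \<Longrightarrow> s2 ''ky'' (int (Suc t * K + k)) = of_int (dk (t div M) k + \<phi> (t mod M) k)"
         "\<And>i. i < int (Suc t * K) \<Longrightarrow> s2 ''ky'' i = s1 ''ky'' i"
         "s2 ''ma2'' = (s1 ''ma2'')(int (Suc t) := of_int (mw (t div M) * \<mu> (t mod M)))"
         "s2 ''ex2'' = (s1 ''ex2'')(int (Suc t) := of_nat (me (t div M)))"
      have fr2: "s2 ''K'' 0 = of_nat K" "s2 ''N'' 0 = of_nat N" "s2 ''B'' 0 = of_int B" "s2 ''t'' 0 = of_nat t" "s2 ''tr'' = s1 ''tr''"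
        using s2(1) fr J(2) st by (simp_all add: frame_def)
      have key2: "key_rep s2 K D (Suc t) d"
        unfolding key_rep_def
      proof (intro allI impI)
        fix i k assume i: "i \<le> Suc t" and k: "k < K"
        show "s2 ''ky'' (int (i * K + k)) = of_int (d i k) \<and> \<bar>d i k\<bar> \<le> D"
        proof (cases "i = Suc t")
          case True
          thus ?thesis using s2(3)[OF k] d[OF t] dD[OF t k] by simp
        next
          case False
          hence "i < Suc t" using i by simp
          hence "int (i * K + k) < int (Suc t * K)" using idx_less[OF _ k] by (simp only: of_nat_less_iff)
          hence "s2 ''ky'' (int (i * K + k)) = s1 ''ky'' (int (i * K + k))" by (rule s2(4))
          thus ?thesis using J(3) \<open>i < Suc t\<close> k by (simp add: key_rep_def)
        qed
      qed
      show "wp F X gen_insert s2 (100 + K * 60 + (ht + 1) * (100 + K * 60)) (\<lambda>s'. s' ''t'' 0 = of_nat t \<and> J (Suc t) (upd s' ''t'' (of_nat (Suc t))))"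
      proof (rule wp_gen_insert[OF X(1) X(5) X(8) X(9) fr2(1,2,3,4) s2(2) t b(5,6,7) key2 \<kappa> _ J(6)])
        show "nat_rep (s2 ''tr'') \<tau>" using J(5) fr2 by simp
        fix s3 \<tau>' assume s3: "frame {''x'', ''y'', ''d'', ''k'', ''le'', ''tr'', ''v''} s2 s3" "nat_rep (s3 ''tr'') \<tau>'"
          "tree N \<kappa> {i \<in> {1..Suc t}. \<kappa> i < \<kappa> 0} \<tau>'"
        have f3: "s3 ''ky'' = s2 ''ky''" "s3 ''ma2'' = s2 ''ma2''" "s3 ''ex2'' = s2 ''ex2''" "s3 ''t'' 0 = of_nat t" "s3 ''N'' 0 = of_nat N"
          using s3(1) fr2 by (simp_all add: frame_def)
        let ?s4 = "upd s3 ''t'' (of_nat (Suc t))"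
        have "J (Suc t) ?s4"
          unfolding J_def
        proof (intro conjI exI)
          show "frame ?gv s ?s4" using J(1) s2(1) s3(1) by (auto simp: frame_def)
          show "key_rep ?s4 K D (Suc t) d" using key2 f3 by (simp add: key_rep_def)
          show "\<forall>i<Suc t. ?s4 ''ma2'' (int (Suc i)) = of_int (c (Suc i)) \<and> ?s4 ''ex2'' (int (Suc i)) = of_nat (f (Suc i))"
            using J(4) f3 s2(5,6) c(1,2)[OF t] by (auto simp: less_Suc_eq)
          show "nat_rep (?s4 ''tr'') \<tau>'" using s3(2) by simp
        qed (use f3 s3 in auto)
        thus "s3 ''t'' 0 = of_nat t \<and> J (Suc t) ?s4" using f3 by simp
      qed
    qed (use X CmX fr st t b ls1 in auto)
  qed
  have lp: "wp F X (loop ''t'' (V ''N'') (gen_elem ;; gen_insert)) ?s1 (10 + ops (V ''N'') + N * (?tg + ops (V ''N'') + 15)) (\<lambda>s'. wp F X pop_loop s' ?tp Q)"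
  proof (rule wp_loop[where J = J])
    show "J 0 (upd ?s1 ''t'' 0)"
      unfolding J_def
    proof (intro conjI exI)
      show "key_rep (upd ?s1 ''t'' 0) K D 0 d" using key0 by (simp add: key_rep_def)
      show "nat_rep (upd ?s1 ''t'' 0 ''tr'') (\<lambda>_. 0)" using tr by simp
      \<comment> \<open>With all entries 0, every match is a tie of the sentinel with
        itself.\<close>
      show "tree N \<kappa> {i \<in> {1..0}. \<kappa> i < \<kappa> 0} (\<lambda>_. 0)" by (simp add: tree_def winner_ok_def)
    qed (auto simp: frame_def)
  next
    fix t s1 assume "J t s1" thus "val F s1 (V ''N'') = of_nat N" by (simp add: J_def)
  next
    fix s1 assume Jt: "J N s1"
    then obtain \<tau> where J: "frame ?gv s s1" "s1 ''N'' 0 = of_nat N" "key_rep s1 K D N d"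
      "\<forall>i<N. s1 ''ma2'' (int (Suc i)) = of_int (c (Suc i)) \<and> s1 ''ex2'' (int (Suc i)) = of_nat (f (Suc i))"
      "nat_rep (s1 ''tr'') \<tau>" "tree N \<kappa> {i \<in> {1..N}. \<kappa> i < \<kappa> 0} \<tau>"
      unfolding J_def by blast
    have fr: "s1 ''K'' 0 = of_nat K" "s1 ''ep'' 0 = \<epsilon>" "s1 ''B'' 0 = of_int B" "s1 ''zero'' = (\<lambda>_. 0)"
      using J(1) s by (simp_all add: frame_def)
    have NK: "N * K < X" using X(4) by (simp add: algebra_simps)
    show "wp F X pop_loop s1 ?tp Q"
    proof (rule wp_pop_loop[OF X(1,2,3) NK X(5,6,7,8,9) fr(1) J(2) fr(2,3,4) b(1,2) _ b(4,5,6,7) J(3) \<kappa> I J(5) _ _ \<omega> E Sm])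
      show "2 * precision \<epsilon> N \<le> Cm" by (rule b(3))
      show "tree N \<kappa> I \<tau>" using J(6) I by simp
      show "s1 ''ma2'' (int i) = of_int (c i) \<and> s1 ''ex2'' (int i) = of_nat (f i) \<and> 1 \<le> c i \<and> c i \<le> Cm \<and> f i \<le> E"
        if i: "1 \<le> i" "i \<le> N" for i
      proof -
        obtain i' where "i = Suc i'" using i by (cases i) auto
        thus ?thesis using J(4) c(3)[of i'] i by auto
      qed
    next
      fix s' S' dk' mw' me' T1 a w th e
      assume p: "frame pop_vars s1 s'" "list_rep s' K S' dk' mw' me'"
        "list_inv \<epsilon> (precision \<epsilon> N) \<kappa> \<omega> I S' (\<lambda>r. horner B K (dk' r)) mw' me' T1 a w th e"
        "\<forall>r<S'. dk' r \<in> d ` I \<and> 1 \<le> mw' r \<and> mw' r \<le> 2 * precision \<epsilon> N \<and> me' r \<le> E" "S' \<le> Sm"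
        "nat_rep (s' ''tr'') (\<lambda>_. 0)" "s' ''a'' 0 = of_int a" "s' ''e'' 0 = of_nat e"
      show "Q s'"
      proof (rule Q[OF _ p(2) p(3) p(4) p(5,6) _ p(7,8)])
        show "frame stage_vars s s'" using J(1) p(1) by (auto simp: frame_def stage_vars_def pop_vars_def)
        have "s' ''ky'' = s1 ''ky''" using p(1) by (simp add: frame_def pop_vars_def)
        thus "key_rep s' K D 0 d" using key_rep_mono[OF J(3), of 0] by (simp add: key_rep_def)
      qed
    qed
  qed (use X sm body in auto)
  have "wp F X stage s ((ops (V ''S'' [*] V ''M'') + 2) + ((10 + ops (V ''N'') + N * (?tg + ops (V ''N'') + 15)) + ?tp)) Q"
    unfolding stage_def
  proof (rule wp_seq, rule wp_putv[where v = "of_nat N"], goal_cases)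
    case 5 show ?case using X(9) by (intro sn) simp
  next
    case 6 show ?case by (rule wp_seq, rule lp)
  qed (use s ls sm in \<open>simp_all add: list_rep_def b(8)\<close>)
  thus ?thesis by (rule wp_time) (simp add: algebra_simps)
qed

section \<open>Weighted counts and the recursion of the dynamic program\<close>

text \<open>Unfolded, this sums the products of the weights \<open>\<mu> (x i)\<close> over all
  vectors \<open>x\<close> of length \<open>j\<close> with entries below \<open>M\<close> whose
  values \<open>\<Phi> i (x i)\<close> add up to at most \<open>v\<close>. An arbitrary ordered
  group is allowed because real values, rational values and scaled integers have to be
  related.\<close>

fun weighted_count :: "nat \<Rightarrow> (nat \<Rightarrow> int) \<Rightarrow> (nat \<Rightarrow> nat \<Rightarrow> 'a::linordered_ab_group_add) \<Rightarrow> nat \<Rightarrow> 'a \<Rightarrow> int" where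
  "weighted_count M \<mu> \<Phi> 0 v = (if 0 \<le> v then 1 else 0)"
| "weighted_count M \<mu> \<Phi> (Suc j) v = (\<Sum>m<M. \<mu> m * weighted_count M \<mu> \<Phi> j (v - \<Phi> j m))"

lemma weighted_count_bounds:
  assumes "\<And>m. m < M \<Longrightarrow> 0 \<le> \<mu> m"
  shows "0 \<le> weighted_count M \<mu> \<Phi> j v" "weighted_count M \<mu> \<Phi> j v \<le> (\<Sum>m<M. \<mu> m) ^ j"
proof -
  show nn: "0 \<le> weighted_count M \<mu> \<Phi> j v" for j v
    using assms by (induction j arbitrary: v) (auto intro!: sum_nonneg)
  show "weighted_count M \<mu> \<Phi> j v \<le> (\<Sum>m<M. \<mu> m) ^ j"
  proof (induction j arbitrary: v)
    case (Suc j)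
    have "weighted_count M \<mu> \<Phi> (Suc j) v \<le> (\<Sum>m<M. \<mu> m * (\<Sum>m<M. \<mu> m) ^ j)"
      unfolding weighted_count.simps using assms Suc by (intro sum_mono mult_left_mono) auto
    thus ?case by (simp add: sum_distrib_right)
  qed simp
qed

lemma sum_lessThan_add:
  fixes g :: "nat \<Rightarrow> 'a::comm_monoid_add"
  shows "(\<Sum>t<a + b. g t) = (\<Sum>t<a. g t) + (\<Sum>t<b. g (a + t))"
  by (induction b) (auto simp: add.assoc)

lemma sum_div_mod:
  fixes g :: "nat \<Rightarrow> nat \<Rightarrow> 'a::comm_monoid_add"
  shows "(\<Sum>t<S * M. g (t div M) (t mod M)) = (\<Sum>r<S. \<Sum>m<M. g r m)"
proof (induction S)
  case (Suc S)
  have "(\<Sum>m<M. g ((S * M + m) div M) ((S * M + m) mod M)) = (\<Sum>m<M. g S m)"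
    by (intro sum.cong) auto
  thus ?case using Suc sum_lessThan_add[of "\<lambda>t. g (t div M) (t mod M)" "S * M" M] by (simp add: add.commute[of M])
qed simp

text \<open>One stage is one step of the recursion of \<open>weighted_count\<close>, with the
  cumulative weights of the previous list in place of the counts. Dropping candidates beyond the
  budget is invisible for \<open>v < \<kappa>0\<close>.\<close>

lemma exact_weight_product:
  assumes N: "N = S * M" and \<kappa>: "\<And>t. t < N \<Longrightarrow> \<kappa> (Suc t) = kv (t div M) + \<Phi> (t mod M)"
    and I: "I = {i \<in> {1..N}. \<kappa> i < \<kappa>0}"
    and \<omega>: "\<And>t. t < N \<Longrightarrow> Suc t \<in> I \<Longrightarrow> \<omega> (Suc t) = (mw (t div M) * \<mu> (t mod M)) * 2 ^ me (t div M)"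
    and v: "v < \<kappa>0"
  shows "exact_weight I \<kappa> \<omega> v = (\<Sum>m<M. \<mu> m * list_weight S kv mw me (v - \<Phi> m))"
proof -
  have S: "{i. i \<in> I \<and> \<kappa> i \<le> v} = Suc ` {t. t < N \<and> \<kappa> (Suc t) \<le> v}"
  proof (intro equalityI subsetI)
    fix i assume i: "i \<in> {i. i \<in> I \<and> \<kappa> i \<le> v}"
    then obtain t where "i = Suc t" by (cases i) (auto simp: I)
    thus "i \<in> Suc ` {t. t < N \<and> \<kappa> (Suc t) \<le> v}" using i by (auto simp: I)
  qed (use v in \<open>auto simp: I\<close>)
  have "exact_weight I \<kappa> \<omega> v = (\<Sum>t | t < N \<and> \<kappa> (Suc t) \<le> v. \<omega> (Suc t))"
    unfolding exact_weight_def S by (simp add: sum.reindex)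
  also have "\<dots> = (\<Sum>t | t < N \<and> \<kappa> (Suc t) \<le> v. (mw (t div M) * \<mu> (t mod M)) * 2 ^ me (t div M))"
    using v by (intro sum.cong \<omega>) (auto simp: I)
  also have "\<dots> = (\<Sum>t<N. if \<kappa> (Suc t) \<le> v then (mw (t div M) * \<mu> (t mod M)) * 2 ^ me (t div M) else 0)"
    by (intro sum.mono_neutral_cong_left) auto
  also have "\<dots> = (\<Sum>t<N. if kv (t div M) + \<Phi> (t mod M) \<le> v then (mw (t div M) * \<mu> (t mod M)) * 2 ^ me (t div M) else 0)"
    by (intro sum.cong) (auto simp: \<kappa>)
  also have "\<dots> = (\<Sum>r<S. \<Sum>m<M. if kv r + \<Phi> m \<le> v then (mw r * \<mu> m) * 2 ^ me r else 0)"
    unfolding N by (rule sum_div_mod)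
  also have "\<dots> = (\<Sum>m<M. \<Sum>r<S. if kv r + \<Phi> m \<le> v then (mw r * \<mu> m) * 2 ^ me r else 0)"
    by (rule sum.swap)
  also have "\<dots> = (\<Sum>m<M. \<mu> m * list_weight S kv mw me (v - \<Phi> m))"
  proof (intro sum.cong refl)
    fix m
    have "\<mu> m * list_weight S kv mw me (v - \<Phi> m) = \<mu> m * (\<Sum>r<S. if kv r \<le> v - \<Phi> m then mw r * 2 ^ me r else 0)"
      unfolding list_weight_def by (intro arg_cong[where f = "\<lambda>x. \<mu> m * x"] sum.mono_neutral_cong_left) auto
    also have "\<dots> = (\<Sum>r<S. if kv r + \<Phi> m \<le> v then (mw r * \<mu> m) * 2 ^ me r else 0)"
      unfolding sum_distrib_left by (intro sum.cong) (auto simp: le_diff_eq mult_ac)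
    finally show "(\<Sum>r<S. if kv r + \<Phi> m \<le> v then (mw r * \<mu> m) * 2 ^ me r else 0) = \<mu> m * list_weight S kv mw me (v - \<Phi> m)" by simp
  qed
  finally show ?thesis .
qed

text \<open>The answer is read off from the running total of the last stage rather than from its
  list. In contrast to the bound for lists, this one also covers a stage without any
  candidate.\<close>

lemma acc_inv_total:
  assumes acc_inv: "acc_inv \<epsilon> R p S T T1 Lo a w th e"
    and e01: "0 < \<epsilon>" "\<epsilon> \<le> 1" and N: "p \<le> N" and R: "1 \<le> R" "8 * (real N + 1) \<le> real_of_rat \<epsilon> * real_of_int R"
  shows "T \<le> a * 2 ^ e" "real_of_int (a * 2 ^ e) \<le> (1 + of_rat \<epsilon> / 4) * real_of_int T"
proof -
  have F: "T \<le> a * 2 ^ e" "a * 2 ^ e \<le> T + (int p + 1) * (2 ^ e - 1)" "0 < e \<longrightarrow> R \<le> a" "0 \<le> a"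
    using acc_inv unfolding acc_inv_def by auto
  show "T \<le> a * 2 ^ e" by (rule F)
  have P: "2 ^ e = (1::int) \<or> R \<le> a" using F(3) by (cases "e = 0") auto
  have A0: "0 \<le> a * 2 ^ e" using F(4) by simp
  have q: "int p + 1 \<le> int N + 1" "0 \<le> int p + 1" using N by auto
  have er: "0 < real_of_rat \<epsilon>" "real_of_rat \<epsilon> \<le> 1" using e01 by auto
  show "real_of_int (a * 2 ^ e) \<le> (1 + of_rat \<epsilon> / 4) * real_of_int T"
    using rel_err(2)[OF er F(2) refl order.refl _ q(2,1) P R A0] by simp
qed

lemma precision_bounds:
  assumes "0 < \<epsilon>"
  shows "1 \<le> precision \<epsilon> N" "8 * (real N + 1) \<le> real_of_rat \<epsilon> * real_of_int (precision \<epsilon> N)" "N \<le> N' \<Longrightarrow> precision \<epsilon> N \<le> precision \<epsilon> N'"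
proof -
  have "0 \<le> 8 * (of_nat N + 1) / \<epsilon>" using assms by (intro divide_nonneg_nonneg) auto
  hence "0 \<le> \<lfloor>8 * (of_nat N + 1) / \<epsilon>\<rfloor>" by simp
  thus "1 \<le> precision \<epsilon> N" unfolding precision_def by linarith
  have "8 * (of_nat N + 1) / \<epsilon> \<le> of_int (precision \<epsilon> N)" unfolding precision_def by linarith
  hence "8 * (of_nat N + 1) \<le> \<epsilon> * of_int (precision \<epsilon> N)" using assms by (simp add: field_simps)
  hence "real_of_rat (8 * (of_nat N + 1)) \<le> real_of_rat (\<epsilon> * of_int (precision \<epsilon> N))" by (subst of_rat_less_eq)
  thus "8 * (real N + 1) \<le> real_of_rat \<epsilon> * real_of_int (precision \<epsilon> N)" by (simp add: of_rat_mult of_rat_add)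
  show "N \<le> N' \<Longrightarrow> precision \<epsilon> N \<le> precision \<epsilon> N'"
    unfolding precision_def using assms by (auto intro!: floor_mono divide_right_mono)
qed

text \<open>The initial list consists of the empty partial solution: one block with key 0, mantissa
  1 and exponent 0. Only the two entries 1 differ from the initial memory.\<close>

definition stages :: prog where
  "stages = (put ''S'' (Num 1) ;; Assign ''ma'' (Num 0) (Num 1) ;; loop ''j'' (V ''n'') stage)"

lemma horner_zero: "horner B k (\<lambda>_. 0) = 0"
  by (induction k) auto

text \<open>Every stage multiplies the error by \<open>(1 + er)^2\<close>. The invariant only speaks
  about budgets \<open>v <= bt\<close>; as the values are nonnegative, the recursion stays in this
  range. The premise that the accumulated error is at most 2 turns \<open>u ^ n\<close> into a bound
  for the approximate weights, and thereby for exponents and lists.\<close>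

lemma wp_stages:
  fixes \<epsilon> :: rat
  defines "er \<equiv> real_of_rat \<epsilon>"
  assumes X: "8 \<le> X" "Sm + 1 < X" "Sm * K + K < X" "(Sm * M + 1) * K < X" "K < X" "4 * Cm + 2 \<le> int X" "E + h + 1 \<le> X"
      "4 * D + 4 \<le> int X" "2 * (Sm * M) + 1 < X" "(n + 1) * M + 1 < X" "((n + 1) * M + 1) * K < X" "n < X"
    and s: "s ''K'' 0 = of_nat K" "s ''M'' 0 = of_nat M" "s ''n'' 0 = of_nat n" "s ''ep'' 0 = \<epsilon>" "s ''B'' 0 = of_int B"
      "s ''zero'' = (\<lambda>_. 0)" "s ''ex'' = (\<lambda>_. 0)" "s ''key'' = (\<lambda>_. 0)" "s ''tr'' = (\<lambda>_. 0)"
    and b: "0 < \<epsilon>" "\<epsilon> \<le> 1" "Cm = 2 * precision \<epsilon> (Sm * M) * int u" "2 * Cm \<le> 2 ^ h" "2 \<le> B" "Sm * M \<le> 2 ^ ht" "1 \<le> n" "1 \<le> u"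
      "D = int (n + 1) * Dg" "1 \<le> Dg"
    and dg: "\<And>j m k. j < n \<Longrightarrow> m < M \<Longrightarrow> k < K \<Longrightarrow> s ''D'' (int ((1 + j * M + m) * K + k)) = of_int (\<phi> j m k) \<and> \<bar>\<phi> j m k\<bar> \<le> Dg"
    and \<Phi>: "\<Phi> = (\<lambda>j m. horner B K (\<phi> j m))" "\<And>j m. j < n \<Longrightarrow> m < M \<Longrightarrow> 0 \<le> \<Phi> j m"
    and mu: "\<And>m. m < M \<Longrightarrow> s ''mu'' (int m) = of_int (\<mu> m) \<and> 1 \<le> \<mu> m" "(\<Sum>m<M. \<mu> m) = int u"
    and key0: "key_rep s K D 0 (\<lambda>_. d0)" and bt: "bt = horner B K d0 - 1"
    and er2: "(1 + er) ^ (2 * n) \<le> 2"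
    and E: "4 * int u ^ n \<le> 2 ^ E"
    and Sm: "\<And>S. (1 + er) ^ (S - 1) \<le> 4 * real u ^ n \<Longrightarrow> S \<le> Sm"
    and Q: "\<And>s' a e. s' ''a'' 0 = of_int a \<Longrightarrow> s' ''e'' 0 = of_nat e \<Longrightarrow> weighted_count M \<mu> \<Phi> n bt \<le> a * 2 ^ e \<Longrightarrow>
       real_of_int (a * 2 ^ e) \<le> (1 + er) ^ (2 * n) * real_of_int (weighted_count M \<mu> \<Phi> n bt) \<Longrightarrow> Q s'"
  shows "wp F X stages s (20 + n * (200 + (Sm * M) * (600 + (2 * ht + 2) * (100 + K * 60) + E * 100 + h * 50 + K * 200))) Q"
proof -
  have sm: "small X 0" "small X 1" "small X 2" "1 \<le> X" using X by (auto simp: small_0 small_1 small_numeral)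
  have er: "0 < er" "er \<le> 1" using b by (auto simp: er_def)
  have mu1: "1 \<le> \<mu> m" "\<mu> m \<le> int u" if "m < M" for m
  proof -
    show "1 \<le> \<mu> m" using mu(1)[OF that] by blast
    have "\<mu> m \<le> (\<Sum>m<M. \<mu> m)" using that mu(1) by (intro member_le_sum) force+
    thus "\<mu> m \<le> int u" using mu(2) by simp
  qed
  let ?Nm = "Sm * M" and ?W = "weighted_count M \<mu> \<Phi>"
  define Tst where "Tst = 150 + ?Nm * (600 + (2 * ht + 2) * (100 + K * 60) + E * 100 + h * 50 + K * 200)"
  define J where "J = (\<lambda>j s'. frame (insert ''j'' stage_vars) s s' \<and> nat_rep (s' ''tr'') (\<lambda>_. 0) \<and> key_rep s' K D 0 (\<lambda>_. d0) \<and>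
     (\<exists>S dk mw me. list_rep s' K S dk mw me \<and> S \<le> Sm \<and>
       (\<forall>r<S. 1 \<le> mw r \<and> mw r \<le> 2 * precision \<epsilon> ?Nm \<and> me r \<le> E \<and> (\<forall>k<K. \<bar>dk r k\<bar> \<le> int j * Dg)) \<and>
       (\<forall>v\<le>bt. ?W j v \<le> list_weight S (\<lambda>r. horner B K (dk r)) mw me v \<and>
          real_of_int (list_weight S (\<lambda>r. horner B K (dk r)) mw me v) \<le> (1 + er) ^ (2 * j) * real_of_int (?W j v))) \<and>
     (0 < j \<longrightarrow> (\<exists>a e. s' ''a'' 0 = of_int a \<and> s' ''e'' 0 = of_nat e \<and> ?W j bt \<le> a * 2 ^ e \<and>
        real_of_int (a * 2 ^ e) \<le> (1 + er) ^ (2 * j) * real_of_int (?W j bt))))"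
  have W0: "0 \<le> ?W j v" for j v using mu1 by (intro weighted_count_bounds) force
  have Wu: "?W j v \<le> int u ^ j" for j v using weighted_count_bounds(2)[of M \<mu> \<Phi> j v] mu mu1 by force
  have Rm: "1 \<le> precision \<epsilon> ?Nm" by (rule precision_bounds(1)[OF b(1)])
  have body: "wp F X stage s1 Tst (\<lambda>s'. s' ''j'' 0 = of_nat j \<and> J (Suc j) (upd s' ''j'' (of_nat (Suc j))))"
    if j: "j < n" and Jj: "J j s1" and sj: "s1 ''j'' 0 = of_nat j" for j s1
  proof -
    obtain S dk mw me where J: "frame (insert ''j'' stage_vars) s s1" "nat_rep (s1 ''tr'') (\<lambda>_. 0)" "key_rep s1 K D 0 (\<lambda>_. d0)"
       "list_rep s1 K S dk mw me" "S \<le> Sm"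
       "\<forall>r<S. 1 \<le> mw r \<and> mw r \<le> 2 * precision \<epsilon> ?Nm \<and> me r \<le> E \<and> (\<forall>k<K. \<bar>dk r k\<bar> \<le> int j * Dg)"
       "\<forall>v\<le>bt. ?W j v \<le> list_weight S (\<lambda>r. horner B K (dk r)) mw me v \<and>
          real_of_int (list_weight S (\<lambda>r. horner B K (dk r)) mw me v) \<le> (1 + er) ^ (2 * j) * real_of_int (?W j v)"
      using Jj unfolding J_def by blast
    define N where "N = S * M"
    have N: "N \<le> ?Nm" using J(5) by (simp add: N_def)
    define d where "d = (\<lambda>i. if i = 0 then d0 else (\<lambda>k. dk ((i - 1) div M) k + \<phi> j ((i - 1) mod M) k))"
    define c where "c = (\<lambda>i. mw ((i - 1) div M) * \<mu> ((i - 1) mod M))"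
    define f where "f = (\<lambda>i. me ((i - 1) div M))"
    define \<kappa> where "\<kappa> = (\<lambda>i. horner B K (d i))"
    define I where "I = {i \<in> {1..N}. \<kappa> i < \<kappa> 0}"
    define \<omega> where "\<omega> = (\<lambda>i. if i \<in> I then c i * 2 ^ f i else 0)"
    \<comment> \<open>The sentinel lies one above the scaled budget, so
      \<open>\<kappa> i < \<kappa> 0\<close> means \<open>\<kappa> i <= bt\<close>.\<close>
    have \<kappa>0: "\<kappa> 0 = bt + 1" by (simp add: \<kappa>_def d_def bt)
    have Isub: "I \<subseteq> {1..N}" by (auto simp: I_def)
    have fr: "s1 ''K'' 0 = of_nat K" "s1 ''M'' 0 = of_nat M" "s1 ''ep'' 0 = \<epsilon>" "s1 ''B'' 0 = of_int B"
      "s1 ''zero'' = (\<lambda>_. 0)" "s1 ''D'' = s ''D''" "s1 ''mu'' = s ''mu''"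
      using J(1) s by (simp_all add: frame_def stage_vars_def pop_vars_def)
    have rm: "t div M < S" "t mod M < M" if "t < N" for t
    proof -
      have "0 < M" using that by (cases M) (auto simp: N_def)
      thus "t mod M < M" by simp
      show "t div M < S" using that by (simp add: N_def less_mult_imp_div_less)
    qed
    have dD: "\<bar>d (Suc t) k\<bar> \<le> int (Suc j) * Dg" if "t < N" "k < K" for t k
    proof -
      have "\<bar>dk (t div M) k\<bar> \<le> int j * Dg" using J(6) rm[OF that(1)] that(2) by blast
      moreover have "\<bar>\<phi> j (t mod M) k\<bar> \<le> Dg" using dg[OF j rm(2)[OF that(1)] that(2)] by blast
      ultimately show ?thesis by (simp add: d_def algebra_simps)
    qed
    have jD: "int (Suc j) * Dg \<le> D" unfolding b(9) using j b(10) by (intro mult_right_mono) auto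
    have prod: "exact_weight I \<kappa> \<omega> v = (\<Sum>m<M. \<mu> m * list_weight S (\<lambda>r. horner B K (dk r)) mw me (v - \<Phi> j m))" if "v \<le> bt" for v
    proof (rule exact_weight_product[OF N_def _ I_def])
      show "\<And>t. t < N \<Longrightarrow> \<kappa> (Suc t) = horner B K (dk (t div M)) + \<Phi> j (t mod M)"
        by (simp add: \<kappa>_def d_def \<Phi>(1) horner_add)
      show "\<And>t. t < N \<Longrightarrow> Suc t \<in> I \<Longrightarrow> \<omega> (Suc t) = mw (t div M) * \<mu> (t mod M) * 2 ^ me (t div M)"
        by (simp add: \<omega>_def c_def f_def)
      show "v < \<kappa> 0" using that \<kappa>0 by simp
    qed
    have TW: "?W (Suc j) v \<le> exact_weight I \<kappa> \<omega> v" "real_of_int (exact_weight I \<kappa> \<omega> v) \<le> (1 + er) ^ (2 * j) * real_of_int (?W (Suc j) v)" if v: "v \<le> bt" for v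
    proof -
      have v': "v - \<Phi> j m \<le> bt" if "m < M" for m using \<Phi>(2)[OF j that] v by simp
      show "?W (Suc j) v \<le> exact_weight I \<kappa> \<omega> v" unfolding prod[OF v] weighted_count.simps
        using J(7) v' mu1 by (intro sum_mono mult_left_mono) force+
      have "real_of_int (exact_weight I \<kappa> \<omega> v) = (\<Sum>m<M. real_of_int (\<mu> m) * real_of_int (list_weight S (\<lambda>r. horner B K (dk r)) mw me (v - \<Phi> j m)))"
        unfolding prod[OF v] by simp
      also have "\<dots> \<le> (\<Sum>m<M. real_of_int (\<mu> m) * ((1 + er) ^ (2 * j) * real_of_int (?W j (v - \<Phi> j m))))"
      proof (intro sum_mono mult_left_mono)
        fix m assume "m \<in> {..<M}"
        hence m: "m < M" by simp
        show "real_of_int (list_weight S (\<lambda>r. horner B K (dk r)) mw me (v - \<Phi> j m)) \<le> (1 + er) ^ (2 * j) * real_of_int (?W j (v - \<Phi> j m))"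
          using J(7) v'[OF m] by blast
        show "0 \<le> real_of_int (\<mu> m)" using mu1(1)[OF m] by simp
      qed
      also have "\<dots> = (1 + er) ^ (2 * j) * real_of_int (?W (Suc j) v)"
        by (simp add: sum_distrib_left mult_ac)
      finally show "real_of_int (exact_weight I \<kappa> \<omega> v) \<le> (1 + er) ^ (2 * j) * real_of_int (?W (Suc j) v)" .
    qed
    have sumI: "sum \<omega> I = exact_weight I \<kappa> \<omega> bt"
    proof -
      have "{i. i \<in> I \<and> \<kappa> i \<le> bt} = I" using \<kappa>0 by (auto simp: I_def)
      thus ?thesis by (simp add: exact_weight_def)
    qed
    have tot: "real_of_int (sum \<omega> I) \<le> 2 * real u ^ n"
    proof -
      have "real_of_int (sum \<omega> I) \<le> (1 + er) ^ (2 * j) * real_of_int (?W (Suc j) bt)" unfolding sumI by (rule TW(2)) simp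
      also have "\<dots> \<le> 2 * real u ^ n"
      proof (rule mult_mono)
        have "(1 + er) ^ (2 * j) \<le> (1 + er) ^ (2 * n)" using er j by (intro power_increasing) auto
        thus "(1 + er) ^ (2 * j) \<le> 2" using er2 by linarith
        have "real_of_int (?W (Suc j) bt) \<le> real_of_int (int u ^ Suc j)" using Wu[of "Suc j" bt] by (subst of_int_le_iff)
        also have "\<dots> = real u ^ Suc j" by simp
        also have "\<dots> \<le> real u ^ n" using j b(8) by (intro power_increasing) auto
        finally show "real_of_int (?W (Suc j) bt) \<le> real u ^ n" .
        show "0 \<le> real_of_int (?W (Suc j) bt)" using W0[of "Suc j" bt] by (simp only: of_int_0_le_iff)
      qed simp
      finally show ?thesis .
    qed
    have "wp F X stage s1 (150 + N * (600 + (2 * ht + 2) * (100 + K * 60) + E * 100 + h * 50 + K * 200))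
       (\<lambda>s'. s' ''j'' 0 = of_nat j \<and> J (Suc j) (upd s' ''j'' (of_nat (Suc j))))"
    proof (rule wp_stage[where N = N and Cm = Cm and D = D and ?j0.0 = n and j = j and dk = dk and mw = mw and me = me and \<phi> = "\<phi> j" and \<mu> = \<mu>
          and d = d and c = c and f = f and \<kappa> = \<kappa> and \<omega> = \<omega> and E = E and I = I and h = h and ht = ht and K = K and M = M and S = S and B = B and Sm = Sm])
      have "(N + 1) * K \<le> (?Nm + 1) * K" using N by (intro mult_right_mono) auto
      thus "(N + 1) * K < X" using X(4) by (rule le_less_trans)
      show "2 * N + 1 < X" using N X(9) by linarith
      show "N \<le> 2 ^ ht" using N b(6) by linarith
      have uR: "2 * precision \<epsilon> ?Nm * 1 \<le> 2 * precision \<epsilon> ?Nm * int u" using Rm b(8) by (intro mult_left_mono) auto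
      thus "2 * precision \<epsilon> N \<le> Cm" unfolding b(3) using precision_bounds(3)[OF b(1) N] by linarith
      show "0 \<le> D" unfolding b(9) using b(10) by simp
      show "key_rep s1 K D 0 d" using J(3) by (simp add: key_rep_def d_def)
      show "\<And>t. t < N \<Longrightarrow> d (Suc t) = (\<lambda>k. dk (t div M) k + \<phi> j (t mod M) k)" by (simp add: d_def)
      show "\<And>t k. t < N \<Longrightarrow> k < K \<Longrightarrow> \<bar>d (Suc t) k\<bar> \<le> D" by (rule order_trans[OF dD jD])
      show "1 \<le> c (Suc t) \<and> c (Suc t) \<le> Cm \<and> f (Suc t) \<le> E" if t: "t < N" for t
      proof -
        have w: "1 \<le> mw (t div M)" "mw (t div M) \<le> 2 * precision \<epsilon> ?Nm" "me (t div M) \<le> E" using J(6) rm[OF t] by blast+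
        have m: "1 \<le> \<mu> (t mod M)" "\<mu> (t mod M) \<le> int u" using mu1 rm[OF t] by blast+
        have "1 * 1 \<le> mw (t div M) * \<mu> (t mod M)" using w m by (intro mult_mono) auto
        \<comment> \<open>This is the reason for the factor \<open>u\<close> in \<open>Cm\<close>: a
          grid point may represent up to \<open>u\<close> integers.\<close>
        moreover have "mw (t div M) * \<mu> (t mod M) \<le> (2 * precision \<epsilon> ?Nm) * int u" using w m by (intro mult_mono) auto
        ultimately show ?thesis using w by (simp add: c_def f_def b(3))
      qed
      have "real_of_int (2 * sum \<omega> I) \<le> 4 * real u ^ n" using tot by simp
      also have "4 * real u ^ n = real_of_int (4 * int u ^ n)" by simp
      finally have "2 * sum \<omega> I \<le> 4 * int u ^ n" by (simp only: of_int_le_iff)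
      thus "2 * sum \<omega> I \<le> 2 ^ E" using E by linarith
      show "S' \<le> Sm" if "(1 + real_of_rat \<epsilon>) ^ (S' - 1) \<le> 2 * real_of_int (sum \<omega> I)" for S'
        using that tot by (intro Sm) (simp add: er_def)
      show "\<And>m k. m < M \<Longrightarrow> k < K \<Longrightarrow> s1 ''D'' (int ((1 + j * M + m) * K + k)) = of_int (\<phi> j m k)"
        using dg[OF j] fr by simp
      show "\<And>m. m < M \<Longrightarrow> s1 ''mu'' (int m) = of_int (\<mu> m)" using mu fr by simp
    next
      fix s2 S' dk' mw' me' T1 a w th e
      assume p: "frame stage_vars s1 s2" "list_rep s2 K S' dk' mw' me'"
        "list_inv \<epsilon> (precision \<epsilon> N) \<kappa> \<omega> I S' (\<lambda>r. horner B K (dk' r)) mw' me' T1 a w th e"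
        "\<forall>r<S'. dk' r \<in> d ` I \<and> 1 \<le> mw' r \<and> mw' r \<le> 2 * precision \<epsilon> N \<and> me' r \<le> E" "S' \<le> Sm"
        "nat_rep (s2 ''tr'') (\<lambda>_. 0)" "key_rep s2 K D 0 d" "s2 ''a'' 0 = of_int a" "s2 ''e'' 0 = of_nat e"
      let ?s3 = "upd s2 ''j'' (of_nat (Suc j))"
      have cI: "card I \<le> N" using card_mono[OF _ Isub] by simp
      have acc_inv: "acc_inv \<epsilon> (precision \<epsilon> N) (card I) S' (sum \<omega> I) T1 (\<Sum>r<S' - 1. mw' r * 2 ^ me' r) a w th e"
        using p(3) unfolding list_inv_def by blast
      note A = acc_inv_total[OF acc_inv b(1,2) cI precision_bounds(1,2)[OF b(1)]]
      have pw: "(1 + er) ^ (2 * Suc j) = (1 + er)\<^sup>2 * (1 + er) ^ (2 * j)" by (simp add: power2_eq_square)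
      have j2: "s2 ''j'' 0 = of_nat j" using p(1) sj by (simp add: frame_def stage_vars_def pop_vars_def)
      have "J (Suc j) ?s3"
        unfolding J_def
      proof (intro conjI impI exI)
        show "frame (insert ''j'' stage_vars) s ?s3" using J(1) p(1) by (auto simp: frame_def)
        show "nat_rep (?s3 ''tr'') (\<lambda>_. 0)" using p(6) by simp
        show "key_rep ?s3 K D 0 (\<lambda>_. d0)" using p(7) by (simp add: key_rep_def d_def)
        show "list_rep ?s3 K S' dk' mw' me'" using p(2) by (simp add: list_rep_def)
        show "S' \<le> Sm" by (rule p(5))
        show "\<forall>r<S'. 1 \<le> mw' r \<and> mw' r \<le> 2 * precision \<epsilon> ?Nm \<and> me' r \<le> E \<and> (\<forall>k<K. \<bar>dk' r k\<bar> \<le> int (Suc j) * Dg)"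
        proof (intro allI impI)
          fix r assume r: "r < S'"
          have q: "dk' r \<in> d ` I" "1 \<le> mw' r" "mw' r \<le> 2 * precision \<epsilon> N" "me' r \<le> E" using p(4) r by blast+
          obtain i where i: "i \<in> I" "dk' r = d i" using q(1) by blast
          obtain t where t: "i = Suc t" "t < N" using i(1) Isub by (cases i) auto
          show "1 \<le> mw' r \<and> mw' r \<le> 2 * precision \<epsilon> ?Nm \<and> me' r \<le> E \<and> (\<forall>k<K. \<bar>dk' r k\<bar> \<le> int (Suc j) * Dg)"
            using q precision_bounds(3)[OF b(1) N] dD[OF t(2)] i(2) t(1) by auto
        qed
        show "\<forall>v\<le>bt. ?W (Suc j) v \<le> list_weight S' (\<lambda>r. horner B K (dk' r)) mw' me' v \<and>
          real_of_int (list_weight S' (\<lambda>r. horner B K (dk' r)) mw' me' v) \<le> (1 + er) ^ (2 * Suc j) * real_of_int (?W (Suc j) v)"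
        proof (intro allI impI)
          fix v assume v: "v \<le> bt"
          have pt: "exact_weight I \<kappa> \<omega> v \<le> list_weight S' (\<lambda>r. horner B K (dk' r)) mw' me' v"
            "real_of_int (list_weight S' (\<lambda>r. horner B K (dk' r)) mw' me' v) \<le> (1 + er)\<^sup>2 * real_of_int (exact_weight I \<kappa> \<omega> v)"
            using p(3) unfolding list_inv_def er_def by blast+
          have "(1 + er)\<^sup>2 * real_of_int (exact_weight I \<kappa> \<omega> v) \<le> (1 + er)\<^sup>2 * ((1 + er) ^ (2 * j) * real_of_int (?W (Suc j) v))"
            by (intro mult_left_mono TW(2)[OF v]) simp
          hence "real_of_int (list_weight S' (\<lambda>r. horner B K (dk' r)) mw' me' v) \<le> (1 + er) ^ (2 * Suc j) * real_of_int (?W (Suc j) v)"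
            unfolding pw using pt(2) by (simp only: mult.assoc)
          thus "?W (Suc j) v \<le> list_weight S' (\<lambda>r. horner B K (dk' r)) mw' me' v \<and>
            real_of_int (list_weight S' (\<lambda>r. horner B K (dk' r)) mw' me' v) \<le> (1 + er) ^ (2 * Suc j) * real_of_int (?W (Suc j) v)"
            using TW(1)[OF v] pt(1) by linarith
        qed
        show "?s3 ''a'' 0 = of_int a" "?s3 ''e'' 0 = of_nat e" using p(8,9) by simp_all
        show "?W (Suc j) bt \<le> a * 2 ^ e" using A(1) TW(1)[of bt] unfolding sumI by simp
        have "real_of_int (a * 2 ^ e) \<le> (1 + er / 4) * real_of_int (sum \<omega> I)" using A(2) by (simp add: er_def)
        also have "\<dots> \<le> (1 + er)\<^sup>2 * ((1 + er) ^ (2 * j) * real_of_int (?W (Suc j) bt))"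
        proof (rule mult_mono)
          have "1 + er / 4 \<le> (1 + er) ^ 1" using er by simp
          also have "\<dots> \<le> (1 + er)\<^sup>2" using er by (intro power_increasing) auto
          finally show "1 + er / 4 \<le> (1 + er)\<^sup>2" .
          show "real_of_int (sum \<omega> I) \<le> (1 + er) ^ (2 * j) * real_of_int (?W (Suc j) bt)" unfolding sumI by (rule TW(2)) simp
          have "0 \<le> sum \<omega> I" unfolding sumI using TW(1)[of bt] W0[of "Suc j" bt] by linarith
          thus "0 \<le> real_of_int (sum \<omega> I)" by (simp only: of_int_0_le_iff)
        qed simp
        finally show "real_of_int (a * 2 ^ e) \<le> (1 + er) ^ (2 * Suc j) * real_of_int (?W (Suc j) bt)"
          unfolding pw by (simp only: mult.assoc)
      qed
      thus "s2 ''j'' 0 = of_nat j \<and> J (Suc j) ?s3" using j2 by simp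
    qed (use X b J fr sj j in \<open>auto simp: \<kappa>_def I_def \<omega>_def N_def c_def f_def\<close>)
    thus ?thesis
      by (rule wp_time) (use N in \<open>auto simp: Tst_def intro!: mult_right_mono\<close>)
  qed
  have "1 \<le> real u ^ n" using b(8) by (intro one_le_power) simp
  hence Sm1: "1 \<le> Sm" using Sm[of 1] by simp
  have lp: "wp F X (loop ''j'' (V ''n'') stage) s1 (10 + ops (V ''n'') + n * (Tst + ops (V ''n'') + 15)) Q"
    if s1: "s1 = (upd s ''S'' 1)(''ma'' := (s ''ma'')(0 := 1))" for s1
  proof (rule wp_loop[where J = J])
    show "J 0 (upd s1 ''j'' 0)"
      unfolding J_def
    proof (intro conjI exI)
      show "frame (insert ''j'' stage_vars) s (upd s1 ''j'' 0)" unfolding s1 by (auto simp: frame_def stage_vars_def pop_vars_def)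
      show "nat_rep (upd s1 ''j'' 0 ''tr'') (\<lambda>_. 0)" using s by (simp add: s1 nat_rep_def)
      show "key_rep (upd s1 ''j'' 0) K D 0 (\<lambda>_. d0)" using key0 by (simp add: s1 key_rep_def)
      show "list_rep (upd s1 ''j'' 0) K 1 (\<lambda>_ _. 0) (\<lambda>_. 1) (\<lambda>_. 0)" using s by (simp add: s1 list_rep_def)
      show "1 \<le> Sm" by fact
      show "\<forall>r<1. 1 \<le> (1::int) \<and> 1 \<le> 2 * precision \<epsilon> ?Nm \<and> 0 \<le> E \<and> (\<forall>k<K. \<bar>0\<bar> \<le> int 0 * Dg)" using Rm by simp
      have "{r. r < 1 \<and> horner B K (\<lambda>_. 0) \<le> v} = (if 0 \<le> v then {0::nat} else {})" for v by (auto simp: horner_zero)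
      thus "\<forall>v\<le>bt. ?W 0 v \<le> list_weight 1 (\<lambda>r. horner B K (\<lambda>_. 0)) (\<lambda>_. 1) (\<lambda>_. 0) v \<and>
         real_of_int (list_weight 1 (\<lambda>r. horner B K (\<lambda>_. 0)) (\<lambda>_. 1) (\<lambda>_. 0) v) \<le> (1 + er) ^ (2 * 0) * real_of_int (?W 0 v)"
        by (simp add: list_weight_def)
    qed simp
  next
    fix j s2 assume "J j s2"
    thus "val F s2 (V ''n'') = of_nat n" using s by (simp add: J_def frame_def stage_vars_def pop_vars_def)
  next
    fix s2 assume "J n s2"
    then obtain a e where "s2 ''a'' 0 = of_int a" "s2 ''e'' 0 = of_nat e" "?W n bt \<le> a * 2 ^ e"
        "real_of_int (a * 2 ^ e) \<le> (1 + er) ^ (2 * n) * real_of_int (?W n bt)"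
      unfolding J_def using b(7) by auto
    thus "Q s2" by (intro Q[of s2 a e])
  qed (use X sm body in auto)
  have "wp F X stages s ((ops (Num 1) + 2) + ((ops (Num 0) + ops (Num 1) + 1) + (10 + ops (V ''n'') + n * (Tst + ops (V ''n'') + 15)))) Q"
    unfolding stages_def
    apply (rule wp_seq, rule wp_putv[where v = 1], (use sm in simp_all)[5])
    apply (rule wp_seq, rule wp_asg[where z = 0 and v = 1], (use sm in simp_all)[8])
    apply (rule lp)
    apply simp
    done
  thus ?thesis by (rule wp_time) (simp add: Tst_def algebra_simps)
qed

section \<open>Denominators and digits of the input\<close>

definition den :: "rat \<Rightarrow> int" where "den r = snd (quotient_of r)"

lemma den_pos: "0 < den r"
  unfolding den_def by (cases "quotient_of r") (auto dest: quotient_of_denom_pos)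

lemma small_quotient:
  assumes "small Y r"
  obtains p where "r = of_int p / of_int (den r)" "coprime p (den r)" "\<bar>p\<bar> \<le> int Y" "den r \<le> int Y"
proof -
  obtain p q where pq: "r = of_int p / of_int q" "\<bar>p\<bar> \<le> int Y" "0 < q" "q \<le> int Y" using assms by (rule smallE)
  obtain p' q' where q: "quotient_of r = (p', q')" by (metis surj_pair)
  have "den r = q'" using q by (simp add: den_def)
  moreover note quotient_of_bound[OF pq(1,3) q] quotient_of_div[OF q] quotient_of_coprime[OF q]
  ultimately show thesis using pq by (intro that[of p']) auto
qed

lemma frac_of_int_div:
  fixes a c :: int
  assumes "0 < c"
  shows "of_int a / of_int c - of_int \<lfloor>of_int a / of_int c :: rat\<rfloor> = (of_int (a mod c) / of_int c :: rat)"
proof -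
  have "a = c * (a div c) + a mod c" by simp
  hence "of_int a = (of_int c * of_int (a div c) + of_int (a mod c) :: rat)" by (metis of_int_add of_int_mult)
  thus ?thesis unfolding floor_divide_of_int_eq using assms by (simp add: field_simps)
qed

text \<open>
  The values of \<open>x\<close> are the quotients of consecutive remainders of the Euclidean algorithm, hence their
  product is the denominator of the initial value.
\<close>

definition euclid :: prog where
  "euclid = While (V ''x'' [-] Floor (V ''x''))
     (put ''x'' (Num 1 [/] (V ''x'' [-] Floor (V ''x''))) ;; put ''q'' (V ''q'' [*] V ''x''))"

text \<open>The instructions give no direct access to a denominator, but fractional part and
  reciprocal together simulate a division with remainder, leading from \<open>a / c\<close> to
  \<open>c / (a mod c)\<close>. Since \<open>q\<close> is kept equal to \<open>den r / c\<close>,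
  multiplying it by the new \<open>x\<close> replaces \<open>c\<close> by \<open>a mod c\<close>.
  The loop ends at an integer, and then coprimality forces \<open>c = 1\<close>.\<close>

lemma wp_euclid:
  assumes X: "8 \<le> X" "Y \<le> X" and Y: "small Y r" "int Y * int Y \<le> 2 ^ hy"
    and s: "s ''x'' 0 = r" "s ''q'' 0 = 1"
    and Q: "\<And>s'. frame {''x'', ''q''} s s' \<Longrightarrow> s' ''q'' 0 = of_int (den r) \<Longrightarrow> Q s'"
  shows "wp F X euclid s (10 + (hy + 1) * 30) Q"
proof -
  have sm: "small X 0" "small X 1" "small X 2" "1 \<le> X" using X by (auto simp: small_0 small_1 small_numeral)
  obtain p where p: "r = of_int p / of_int (den r)" "coprime p (den r)" "\<bar>p\<bar> \<le> int Y" "den r \<le> int Y"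
    using Y(1) by (rule small_quotient)
  define q0 where "q0 = den r"
  have q0: "0 < q0" "q0 \<le> int Y" using p den_pos by (auto simp: q0_def)
  define P where "P = (\<lambda>s' a c. frame {''x'', ''q''} s s' \<and> coprime a c \<and> 0 < c \<and> c \<le> int Y \<and>
     s' ''x'' 0 = of_int a / of_int c \<and> s' ''q'' 0 = of_int q0 / of_int c)"
  \<comment> \<open>The product \<open>c * a\<close> of consecutive remainders is at least halved in
    every round. The disjunct with full fuel stands for the first round, where the numerator may be
    negative or smaller than the denominator.\<close>
  define J where "J = (\<lambda>k s'. \<exists>a c. P s' a c \<and> (k = Suc hy \<or> c < a \<and> c * a < 2 ^ k))"
  note fr = frac_of_int_div
  have "wp F X euclid s ((Suc hy + 1) * (ops (V ''x'' [-] Floor (V ''x'')) + 1) + Suc hy * 20) Q"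
    unfolding euclid_def
  proof (rule wp_while[where I = J])
    show "J (Suc hy) s" unfolding J_def P_def using p q0 s frame_refl by (intro exI[of _ p] exI[of _ q0]) (auto simp: q0_def)
  next
    fix k s1 assume J: "J (Suc k) s1" and nz: "val F s1 (V ''x'' [-] Floor (V ''x'')) \<noteq> 0"
    obtain a c where P: "P s1 a c" and k: "Suc k = Suc hy \<or> c < a \<and> c * a < 2 ^ Suc k" using J unfolding J_def by blast
    have P': "frame {''x'', ''q''} s s1" "coprime a c" "0 < c" "c \<le> int Y" "s1 ''x'' 0 = of_int a / of_int c" "s1 ''q'' 0 = of_int q0 / of_int c"
      using P unfolding P_def by blast+
    define c' where "c' = a mod c"
    have v: "s1 ''x'' 0 - of_int \<lfloor>s1 ''x'' 0\<rfloor> = of_int c' / of_int c" unfolding P'(5) c'_def by (rule fr[OF P'(3)])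
    have c': "0 < c'" "c' < c"
    proof -
      have "c' \<noteq> 0" using nz v by auto
      moreover have "0 \<le> c'" "c' < c" using P'(3) by (auto simp: c'_def)
      ultimately show "0 < c'" "c' < c" by auto
    qed
    have k': "c' < c \<and> c' * c < 2 ^ k"
      using k
    proof
      assume "Suc k = Suc hy"
      have "c' * c < c * c" using c' P' by (intro mult_strict_right_mono) auto
      also have "c * c \<le> int Y * int Y" using c' P' by (intro mult_mono) auto
      finally have "c' * c < int Y * int Y" .
      thus ?thesis using Y(2) \<open>Suc k = Suc hy\<close> c' by simp
    next
      assume ca: "c < a \<and> c * a < 2 ^ Suc k"
      have "a = c * (a div c) + c'" by (simp add: c'_def)
      moreover have "1 \<le> a div c" using ca P'(3) by (simp add: pos_imp_zdiv_pos_iff int_one_le_iff_zero_less)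
      hence "c * 1 \<le> c * (a div c)" using P'(3) by (intro mult_left_mono) auto
      ultimately have "2 * c' \<le> a" using c' by linarith
      hence "c * (2 * c') \<le> c * a" using P'(3) by (intro mult_left_mono) auto
      hence "2 * (c' * c) < 2 * 2 ^ k" using ca by (simp add: mult_ac)
      thus ?thesis using c' by simp
    qed
    let ?x = "of_int c / of_int c' :: rat" and ?q = "of_int q0 / of_int c' :: rat"
    let ?s2 = "upd (upd s1 ''x'' ?x) ''q'' ?q"
    have "P ?s2 c c'"
      unfolding P_def
    proof (intro conjI)
      show "frame {''x'', ''q''} s ?s2" using P'(1) by (auto simp: frame_def)
      show "coprime c c'" using P'(2) gcd_red_int[of a c] by (simp add: c'_def coprime_iff_gcd_eq_1)
    qed (use c' P' in auto)
    hence Js: "J k ?s2" using k' unfolding J_def by blast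
    have smx: "small X ?x" "small X ?q" using c' P' q0 X by (auto intro!: smallI)
    show "wp F X (put ''x'' (Num 1 [/] (V ''x'' [-] Floor (V ''x''))) ;; put ''q'' (V ''q'' [*] V ''x'')) s1 20 (J k)"
    proof (rule wp_time)
      show "wp F X (put ''x'' (Num 1 [/] (V ''x'' [-] Floor (V ''x''))) ;; put ''q'' (V ''q'' [*] V ''x'')) s1
         ((ops (Num 1 [/] (V ''x'' [-] Floor (V ''x''))) + 2) + (ops (V ''q'' [*] V ''x'') + 2)) (J k)"
        apply (rule wp_seq, rule wp_putv[where v = ?x], (use v smx sm in simp_all)[5])
        apply (rule wp_putv[where v = ?q], (use P' c' smx sm in simp_all)[5])
        apply (rule Js)
        done
    qed simp
  next
    fix s1 assume "J 0 s1"
    then obtain a c where P: "P s1 a c" "c < a \<and> c * a < 1" unfolding J_def by auto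
    hence "0 < c * a" by (auto simp: P_def)
    hence False using P by linarith
    thus "val F s1 (V ''x'' [-] Floor (V ''x'')) = 0" ..
  next
    fix k s1 assume "J k s1" and z: "val F s1 (V ''x'' [-] Floor (V ''x'')) = 0"
    then obtain a c where P: "P s1 a c" unfolding J_def by blast
    have P': "frame {''x'', ''q''} s s1" "coprime a c" "0 < c" "s1 ''x'' 0 = of_int a / of_int c" "s1 ''q'' 0 = of_int q0 / of_int c"
      using P unfolding P_def by blast+
    have "of_int (a mod c) / of_int c = (0::rat)" using z fr[OF P'(3), of a] P'(4) by simp
    hence "a mod c = 0" using P'(3) by simp
    hence "c dvd a" by auto
    hence "is_unit c" using P'(2) by (meson coprime_common_divisor dvd_refl)
    hence "c = 1" using P'(3) by simp
    thus "Q s1" using P' by (intro Q) (auto simp: q0_def)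
  qed (use sm in auto)
  thus ?thesis by (rule wp_time) simp
qed

section \<open>Digits of a rational number by long division\<close>

fun digit_rest :: "int \<Rightarrow> rat \<Rightarrow> nat \<Rightarrow> rat" where
  "digit_rest B r 0 = r"
| "digit_rest B r (Suc k) = (digit_rest B r k - of_int \<lfloor>digit_rest B r k\<rfloor>) * of_int B"

definition digit :: "int \<Rightarrow> rat \<Rightarrow> nat \<Rightarrow> int" where "digit B r k = \<lfloor>digit_rest B r k\<rfloor>"

lemma horner_digit: "r * of_int (B ^ k) = of_int (horner B (Suc k) (digit B r)) + (digit_rest B r k - of_int (digit B r k))"
proof (induction k)
  case (Suc k)
  have "r * of_int (B ^ Suc k) = (r * of_int (B ^ k)) * of_int B" by simp
  also have "\<dots> = of_int (B * horner B (Suc k) (digit B r)) + digit_rest B r (Suc k)"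
    unfolding Suc by (simp add: digit_def algebra_simps)
  finally show ?case by simp
qed (simp add: digit_def)

text \<open>What remains after \<open>k + 1\<close> digits is a fractional part, hence in the
  interval from 0 to 1 without 1, so the digits taken so far spell out the floor.\<close>

lemma horner_digit_floor: "horner B (Suc k) (digit B r) = \<lfloor>r * of_int (B ^ k)\<rfloor>"
proof (rule floor_unique[symmetric])
  have "of_int (digit B r k) \<le> digit_rest B r k" "digit_rest B r k < of_int (digit B r k) + 1" unfolding digit_def by linarith+
  thus "of_int (horner B (Suc k) (digit B r)) \<le> r * of_int (B ^ k)"
    "r * of_int (B ^ k) < of_int (horner B (Suc k) (digit B r)) + 1"
    unfolding horner_digit by linarith+
qed

text \<open>All remainders can be written with the denominator of \<open>r\<close>, their numerators
  being residues times \<open>B\<close> after the first step, so long division creates no longer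
  fractions. The leading digit is the floor of \<open>r\<close> and may be negative or exceed the
  base; only the later digits lie between 0 and \<open>B - 1\<close>.\<close>

lemma digit_rest_small:
  assumes "small Y r" "0 \<le> B" "1 \<le> B"
  shows "small (Y * nat B) (digit_rest B r k)" and "0 < k \<Longrightarrow> 0 \<le> digit B r k \<and> digit B r k < B" and "\<bar>digit B r 0\<bar> \<le> int Y"
proof -
  obtain p q where pq: "r = of_int p / of_int q" "\<bar>p\<bar> \<le> int Y" "0 < q" "q \<le> int Y" using assms(1) by (rule smallE)
  have "\<exists>a. digit_rest B r k = of_int a / of_int q \<and> \<bar>a\<bar> \<le> int Y * B"
  proof (induction k)
    case 0
    have "int Y * 1 \<le> int Y * B" using assms by (intro mult_left_mono) auto
    hence "\<bar>p\<bar> \<le> int Y * B" using pq(2) by linarith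
    thus ?case using pq(1) by auto
  next
    case (Suc k)
    then obtain a where a: "digit_rest B r k = of_int a / of_int q" by blast
    have "digit_rest B r (Suc k) = of_int ((a mod q) * B) / of_int q"
      unfolding digit_rest.simps a frac_of_int_div[OF pq(3)] by simp
    moreover have "0 \<le> (a mod q) * B" "(a mod q) * B \<le> int Y * B"
    proof -
      have "0 \<le> a mod q" "a mod q \<le> int Y" using pq pos_mod_bound[OF pq(3), of a] by (simp, linarith)
      thus "0 \<le> (a mod q) * B" "(a mod q) * B \<le> int Y * B" using assms by (simp_all add: mult_right_mono)
    qed
    ultimately show ?case by (intro exI[of _ "(a mod q) * B"]) auto
  qed
  then obtain a where a: "digit_rest B r k = of_int a / of_int q" "\<bar>a\<bar> \<le> int Y * B" by blast
  have "int Y * 1 \<le> int Y * B" using assms by (intro mult_left_mono) auto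
  hence "q \<le> int Y * B" using pq(4) by linarith
  thus "small (Y * nat B) (digit_rest B r k)" unfolding a(1) using pq(3) a(2) assms by (intro smallI) auto
  show "0 \<le> digit B r k \<and> digit B r k < B" if "0 < k"
  proof -
    obtain l where l: "k = Suc l" using \<open>0 < k\<close> by (cases k) auto
    let ?f = "digit_rest B r l - of_int \<lfloor>digit_rest B r l\<rfloor>"
    have f: "0 \<le> ?f" "?f < 1" by linarith+
    have "?f * of_int B < 1 * of_int B" using f assms by (intro mult_strict_right_mono) auto
    thus ?thesis using f assms by (simp add: l digit_def floor_less_iff)
  qed
  have "small Y (of_int \<lfloor>r\<rfloor>)" using assms(1) by (rule small_floor)
  then obtain p' where p': "of_int \<lfloor>r\<rfloor> = (of_int p' / of_int (den (of_int \<lfloor>r\<rfloor>)) :: rat)" "\<bar>p'\<bar> \<le> int Y"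
    by (rule small_quotient)
  thus "\<bar>digit B r 0\<bar> \<le> int Y" by (simp add: digit_def den_def)
qed

definition digits :: prog where
  "digits = (put ''x'' (Cell ''val'' (V ''t'')) ;; put ''o1'' (V ''t'' [*] V ''K'') ;;
     loop ''k'' (V ''K'') (Assign ''D'' (V ''o1'' [+] V ''k'') (Floor (V ''x'')) ;;
        put ''x'' ((V ''x'' [-] Floor (V ''x'')) [*] V ''B'')))"

lemma wp_digits:
  assumes X: "8 \<le> X" "Y * nat B \<le> X" "K < X" "t * K < X" and Y: "small Y r" "1 \<le> B"
    and s: "s ''val'' (int t) = r" "s ''K'' 0 = of_nat K" "s ''t'' 0 = of_nat t" "s ''B'' 0 = of_int B"
    and Q: "\<And>s'. frame {''x'', ''o1'', ''k'', ''D''} s s' \<Longrightarrow>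
       (\<And>k. k < K \<Longrightarrow> s' ''D'' (int (t * K + k)) = of_int (digit B r k)) \<Longrightarrow>
       (\<And>i. i < int (t * K) \<Longrightarrow> s' ''D'' i = s ''D'' i) \<Longrightarrow> Q s'"
  shows "wp F X digits s (40 + K * 50) Q"
proof -
  have sm: "small X 0" "small X 1" "small X 2" "1 \<le> X" using X by (auto simp: small_0 small_1 small_numeral)
  have sn: "small X (of_nat v)" if "v \<le> X" for v using that sm by (intro small_of_nat) auto
  have sx: "small X (digit_rest B r k)" for k
  proof -
    have "0 \<le> B" using Y(2) by simp
    from digit_rest_small(1)[OF Y(1) this Y(2)] X(2) show ?thesis by (rule small_mono)
  qed
  have fl: "\<lfloor>of_nat t * of_nat K + of_nat k :: rat\<rfloor> = int (t * K + k)" for k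
    using floor_of_nat[of "t * K + k", where 'a = rat] by simp
  define J where "J = (\<lambda>k s'. frame {''x'', ''o1'', ''k'', ''D''} s s' \<and> s' ''o1'' 0 = of_nat (t * K) \<and> s' ''x'' 0 = digit_rest B r k \<and>
      (\<forall>i<k. s' ''D'' (int (t * K + i)) = of_int (digit B r i)) \<and> (\<forall>i<int (t * K). s' ''D'' i = s ''D'' i))"
  let ?b = "Assign ''D'' (V ''o1'' [+] V ''k'') (Floor (V ''x'')) ;; put ''x'' ((V ''x'' [-] Floor (V ''x'')) [*] V ''B'')"
  let ?s1 = "upd s ''x'' r"
  let ?s2 = "upd ?s1 ''o1'' (of_nat (t * K))"
  have lp: "wp F X (loop ''k'' (V ''K'') ?b) ?s2 (10 + ops (V ''K'') + K * (25 + ops (V ''K'') + 15)) Q"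
  proof (rule wp_loop[where J = J])
    show "J 0 (upd ?s2 ''k'' 0)" by (auto simp: J_def frame_def)
  next
    fix k s' assume "J k s'" thus "val F s' (V ''K'') = of_nat K" using s by (simp add: J_def frame_def)
  next
    fix k s' assume k: "k < K" and J: "J k s'" and sk: "s' ''k'' 0 = of_nat k"
    have f: "s' ''o1'' 0 = of_nat (t * K)" "s' ''x'' 0 = digit_rest B r k" "s' ''B'' 0 = of_int B" using J s by (auto simp: J_def frame_def)
    let ?s3 = "s'(''D'' := (s' ''D'')(int (t * K + k) := of_int (digit B r k)))"
    let ?s4 = "upd ?s3 ''x'' (digit_rest B r (Suc k))"
    have Js: "J (Suc k) (upd ?s4 ''k'' (of_nat (Suc k)))"
      unfolding J_def
    proof (intro conjI)
      show "frame {''x'', ''o1'', ''k'', ''D''} s (upd ?s4 ''k'' (of_nat (Suc k)))" using J by (auto simp: J_def frame_def)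
      show "\<forall>i<Suc k. (upd ?s4 ''k'' (of_nat (Suc k))) ''D'' (int (t * K + i)) = of_int (digit B r i)"
        using J by (auto simp: J_def less_Suc_eq)
      show "\<forall>i<int (t * K). (upd ?s4 ''k'' (of_nat (Suc k))) ''D'' i = s ''D'' i" using J by (auto simp: J_def)
    qed (use f in auto)
    have "small X (of_int (digit B r k))" unfolding digit_def using sx by (rule small_floor)
    hence "wp F X ?b s' ((ops (V ''o1'' [+] V ''k'') + ops (Floor (V ''x'')) + 1) + (ops ((V ''x'' [-] Floor (V ''x'')) [*] V ''B'') + 2))
      (\<lambda>s'. s' ''k'' 0 = of_nat k \<and> J (Suc k) (upd s' ''k'' (of_nat (Suc k))))"
      apply (intro wp_seq)
      apply (rule wp_asg[where z = "int (t * K + k)" and v = "of_int (digit B r k)"], (use f sk sm in \<open>simp_all add: digit_def\<close>)[8])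
      apply (rule wp_putv[where v = "digit_rest B r (Suc k)"], (use f sx[of "Suc k"] sm in simp_all)[5])
      using Js sk apply simp
      done
    thus "wp F X ?b s' 25 (\<lambda>s'. s' ''k'' 0 = of_nat k \<and> J (Suc k) (upd s' ''k'' (of_nat (Suc k))))"
      by (rule wp_time) simp
  next
    fix s' assume "J K s'" thus "Q s'" by (intro Q) (simp_all only: J_def)
  qed (use X sm in auto)
  have "wp F X digits s ((ops (Cell ''val'' (V ''t'')) + 2) + ((ops (V ''t'' [*] V ''K'') + 2) + (10 + ops (V ''K'') + K * (25 + ops (V ''K'') + 15)))) Q"
    unfolding digits_def
    apply (rule wp_seq, rule wp_putv[where v = r], (use s sm sx[of 0] in simp_all)[5])
    apply (rule wp_seq, rule wp_putv[where v = "of_nat (t * K)"], (use s sm sn[of "t * K"] X in simp_all)[5])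
    apply (rule lp)
    done
  thus ?thesis by (rule wp_time) simp
qed

text \<open>The query is the outermost operation and its answer is assumed to be small, so that no
  property of the oracle enters the rules for expressions.\<close>

lemma wp_query:
  assumes "1 \<le> X" "consts_small X i" "expr_size i \<le> 60" "consts_small X e1" "expr_size e1 \<le> 60" "consts_small X e2" "expr_size e2 \<le> 60"
    "val F s i = of_int z" "val F s (Query e1 e2) = v" "small X v" "Q (s(a := (s a)(z := v)))"
  shows "wp F X (Assign a i (Query e1 e2)) s (ops i + ops (Query e1 e2) + 1) Q"
  unfolding wp_def
proof
  assume g: "small_state X s"
  have "enc_len v \<le> bit_bound X" using assms(1,10) by (intro enc_le_bit_bound[of X 1]) (auto intro: small_mono)
  hence b: "max (bits F s i) (bits F s (Query e1 e2)) \<le> bit_bound X"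
    using bits_le[OF g assms(1)] assms(2-9) by simp
  have "small_state X (s(a := (s a)(z := v)))" using g assms(10) by (rule small_state_upd)
  thus "\<exists>t m s'. exec F (Assign a i (Query e1 e2)) s t m s' \<and> t \<le> ops i + ops (Query e1 e2) + 1 \<and> m \<le> bit_bound X \<and> small_state X s' \<and> Q s'"
    using exec.Assign[of F a i "Query e1 e2" s] b assms(8,9,11)
    by (intro exI[of _ "ops i + ops (Query e1 e2) + 1"] exI[of _ "max (bits F s i) (bits F s (Query e1 e2))"]
        exI[of _ "s(a := (s a)(z := v))"]) simp
qed

text \<open>A copied value is small because it is already in memory, so its size is not asked for.
  This is used for the final mantissa and exponent.\<close>

lemma wp_copy:
  assumes "1 \<le> X" "Q (upd s a (s c 0))"
  shows "wp F X (put a (V c)) s 4 Q"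
  unfolding wp_def
proof
  assume g: "small_state X s"
  hence "small X (s c 0)" by (simp add: small_state_def)
  hence "wp F X (put a (V c)) s (ops (V c) + 2) Q"
    using assms by (intro wp_putv[where v = "s c 0"]) (auto simp: small_0)
  hence "wp F X (put a (V c)) s 4 Q" by (rule wp_time) simp
  thus "\<exists>t m s'. exec F (put a (V c)) s t m s' \<and> t \<le> 4 \<and> m \<le> bit_bound X \<and> small_state X s' \<and> Q s'"
    using g unfolding wp_def by blast
qed

section \<open>The geometric grid\<close>

fun grid :: "rat \<Rightarrow> nat \<Rightarrow> nat \<Rightarrow> nat" where
  "grid \<epsilon> u 0 = 0"
| "grid \<epsilon> u (Suc m) = min u (nat \<lfloor>(1 + \<epsilon>) * (of_nat (grid \<epsilon> u m) + 1)\<rfloor>)"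

text \<open>Because of the \<open>+ 1\<close>, the floor advances by at least 1 however small
  \<open>\<epsilon>\<close> is. Moreover \<open>grid + 1\<close> grows by the factor
  \<open>1 + \<epsilon>\<close> in every step that stays below \<open>u\<close>, which makes the
  number of grid points logarithmic.\<close>

lemma grid_step:
  assumes "0 \<le> \<epsilon>"
  shows "grid \<epsilon> u m < u \<Longrightarrow> grid \<epsilon> u m < grid \<epsilon> u (Suc m)"
    and "grid \<epsilon> u m \<le> u"
    and "of_nat (grid \<epsilon> u (Suc m)) \<le> (1 + \<epsilon>) * (of_nat (grid \<epsilon> u m) + 1)"
    and "grid \<epsilon> u m < u \<Longrightarrow> (1 + \<epsilon>) ^ m \<le> of_nat (grid \<epsilon> u m) + 1"
proof -
  let ?f = "\<lambda>m. (1 + \<epsilon>) * (of_nat (grid \<epsilon> u m) + 1)"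
  have ge: "of_nat (grid \<epsilon> u m) + 1 \<le> ?f m" for m
    using mult_right_mono[of 1 "1 + \<epsilon>" "of_nat (grid \<epsilon> u m) + 1"] assms by simp
  have f0: "0 \<le> ?f m" for m using assms by simp
  have fl: "grid \<epsilon> u m + 1 \<le> nat \<lfloor>?f m\<rfloor>" for m
  proof -
    have "\<lfloor>of_nat (grid \<epsilon> u m) + 1 :: rat\<rfloor> \<le> \<lfloor>?f m\<rfloor>" using ge by (rule floor_mono)
    hence "int (grid \<epsilon> u m) + 1 \<le> \<lfloor>?f m\<rfloor>" by simp
    thus ?thesis by linarith
  qed
  show "grid \<epsilon> u m < u \<Longrightarrow> grid \<epsilon> u m < grid \<epsilon> u (Suc m)" using fl[of m] by simp
  show "grid \<epsilon> u m \<le> u" by (cases m) auto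
  have "of_nat (nat \<lfloor>?f m\<rfloor>) \<le> ?f m" using f0[of m] by simp
  moreover have "of_nat (grid \<epsilon> u (Suc m)) \<le> (of_nat (nat \<lfloor>?f m\<rfloor>) :: rat)" by (subst of_nat_le_iff) simp
  ultimately show "of_nat (grid \<epsilon> u (Suc m)) \<le> ?f m" by linarith
  show "grid \<epsilon> u m < u \<Longrightarrow> (1 + \<epsilon>) ^ m \<le> of_nat (grid \<epsilon> u m) + 1"
  proof (induction m)
    case (Suc m)
    have lt: "nat \<lfloor>?f m\<rfloor> < u" "grid \<epsilon> u (Suc m) = nat \<lfloor>?f m\<rfloor>" using Suc.prems by auto
    hence "grid \<epsilon> u m < u" using fl[of m] by simp
    hence "(1 + \<epsilon>) * (1 + \<epsilon>) ^ m \<le> ?f m" using Suc.IH assms by (intro mult_left_mono) auto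
    moreover have "?f m \<le> of_nat (nat \<lfloor>?f m\<rfloor>) + 1" using f0[of m] by linarith
    ultimately show ?case using lt(2) by simp
  qed simp
qed

declare grid.simps(2) [simp del]

text \<open>A grid point stands for the integers from itself up to the next grid point exclusively,
  \<open>mu\<close> many. Cutting off at \<open>u\<close> makes these cells a partition of the
  integers below \<open>u\<close>.\<close>

definition grid_loop :: prog where
  "grid_loop = While (V ''g'' [+] Num 1 [\<le>] V ''u'')
     (Assign ''G'' (V ''M'') (V ''g'') ;;
      put ''h'' (Floor ((Num 1 [+] V ''ep'') [*] (V ''g'' [+] Num 1))) ;;
      If (V ''u'' [\<le>] V ''h'') (put ''h'' (V ''u'')) Skip ;;
      Assign ''mu'' (V ''M'') (V ''h'' [-] V ''g'') ;;
      put ''g'' (V ''h'') ;;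
      put ''M'' (V ''M'' [+] Num 1))"

lemma wp_grid_loop:
  assumes X: "8 \<le> X" "2 * (u + 1) \<le> X" "Mm < X"
    and s: "s ''u'' 0 = of_nat u" "s ''ep'' 0 = \<epsilon>" "s ''g'' 0 = 0" "s ''M'' 0 = 0"
    and e: "0 < \<epsilon>" "\<epsilon> \<le> 1" and Mm: "\<And>m. (1 + \<epsilon>) ^ m \<le> of_nat u \<Longrightarrow> m < Mm" and u: "1 \<le> u"
    and Q: "\<And>s' M. frame {''g'', ''M'', ''G'', ''h'', ''mu''} s s' \<Longrightarrow> s' ''M'' 0 = of_nat M \<Longrightarrow> M \<le> Mm \<Longrightarrow> 1 \<le> M \<Longrightarrow>
      (\<And>m. m < M \<Longrightarrow> s' ''G'' (int m) = of_nat (grid \<epsilon> u m) \<and> grid \<epsilon> u m < u \<and>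
         s' ''mu'' (int m) = of_int (int (grid \<epsilon> u (Suc m)) - int (grid \<epsilon> u m))) \<Longrightarrow> grid \<epsilon> u M = u \<Longrightarrow> Q s'"
  shows "wp F X grid_loop s (10 + Mm * 60) Q"
proof -
  have sm: "small X 0" "small X 1" "small X 2" "1 \<le> X" using X by (auto simp: small_0 small_1 small_numeral)
  have sn: "small X (of_nat v)" if "v \<le> X" for v using that sm by (intro small_of_nat) auto
  let ?g = "grid \<epsilon> u"
  have e0: "0 \<le> \<epsilon>" using e by simp
  define P where "P = (\<lambda>s' M. frame {''g'', ''M'', ''G'', ''h'', ''mu''} s s' \<and> s' ''M'' 0 = of_nat M \<and> s' ''g'' 0 = of_nat (?g M) \<and>
      (\<forall>m<M. s' ''G'' (int m) = of_nat (?g m) \<and> ?g m < u \<and> s' ''mu'' (int m) = of_int (int (?g (Suc m)) - int (?g m))))"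
  define J where "J = (\<lambda>k s'. \<exists>M. P s' M \<and> M + k = Mm)"
  \<comment> \<open>Below \<open>u\<close> the power \<open>(1 + \<epsilon>) ^ M\<close> is still at
    most \<open>u\<close>, so the fuel \<open>Mm\<close> cannot have run out.\<close>
  have lt: "M < Mm" if "?g M < u" for M
  proof (rule Mm)
    have "(1 + \<epsilon>) ^ M \<le> of_nat (?g M + 1)" using grid_step(4)[OF e0 that] by simp
    also have "\<dots> \<le> of_nat u" using that by (subst of_nat_le_iff) simp
    finally show "(1 + \<epsilon>) ^ M \<le> of_nat u" .
  qed
  have cond: "val F s1 (V ''g'' [+] Num 1 [\<le>] V ''u'') \<noteq> 0 \<longleftrightarrow> ?g M < u" if "P s1 M" for s1 M
  proof -
    have "s1 ''g'' 0 = of_nat (?g M)" "s1 ''u'' 0 = of_nat u" using that s by (auto simp: P_def frame_def)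
    hence "val F s1 (V ''g'' [+] Num 1 [\<le>] V ''u'') \<noteq> 0 \<longleftrightarrow> of_nat (?g M + 1) \<le> (of_nat u :: rat)" by simp
    also have "\<dots> \<longleftrightarrow> ?g M < u" by (subst of_nat_le_iff) auto
    finally show ?thesis .
  qed
  show ?thesis unfolding grid_loop_def
  proof (rule wp_time, rule wp_while[where I = J and k = Mm])
    show "J Mm s" unfolding J_def P_def using s frame_refl by (intro exI[of _ 0]) auto
  next
    fix k s1 assume J: "J (Suc k) s1" and nz: "val F s1 (V ''g'' [+] Num 1 [\<le>] V ''u'') \<noteq> 0"
    obtain M where P: "P s1 M" and k: "M + Suc k = Mm" using J unfolding J_def by blast
    have gu: "?g M < u" using cond[OF P] nz by simp
    have p: "frame {''g'', ''M'', ''G'', ''h'', ''mu''} s s1" "s1 ''M'' 0 = of_nat M" "s1 ''g'' 0 = of_nat (?g M)"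
      "s1 ''u'' 0 = of_nat u" "s1 ''ep'' 0 = \<epsilon>"
      using P s by (auto simp: P_def frame_def)
    let ?f = "(1 + \<epsilon>) * (of_nat (?g M) + 1)"
    define h1 where "h1 = nat \<lfloor>?f\<rfloor>"
    have f0: "0 \<le> ?f" using e0 by simp
    have h1: "of_int \<lfloor>?f\<rfloor> = (of_nat h1 :: rat)" using f0 by (simp add: h1_def)
    have "?f \<le> 2 * of_nat (u + 1)" using e gu by (intro mult_mono) auto
    hence "of_nat h1 \<le> (of_nat (2 * (u + 1)) :: rat)" using h1 by linarith
    hence h1X: "h1 \<le> X" using X(2) by (simp only: of_nat_le_iff)
    have gS: "?g (Suc M) = min u h1" by (simp add: h1_def grid.simps)
    have ggS: "?g M < ?g (Suc M)" by (rule grid_step(1)[OF e0 gu])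
    have gSu: "?g (Suc M) \<le> u" by (rule grid_step(2)[OF e0])
    let ?s2 = "s1(''G'' := (s1 ''G'')(int M := of_nat (?g M)))"
    let ?s3 = "upd ?s2 ''h'' (of_nat h1)"
    let ?r6 = "put ''M'' (V ''M'' [+] Num 1)"
    let ?r5 = "put ''g'' (V ''h'') ;; ?r6"
    let ?r4 = "Assign ''mu'' (V ''M'') (V ''h'' [-] V ''g'') ;; ?r5"
    have r4: "wp F X ?r4 s4 ((ops (V ''M'') + ops (V ''h'' [-] V ''g'') + 1) + ((ops (V ''h'') + 2) + (ops (V ''M'' [+] Num 1) + 2))) (J k)"
      if s4: "frame {''h''} ?s2 s4" "s4 ''h'' 0 = of_nat (?g (Suc M))" for s4
    proof -
      have f: "s4 ''M'' 0 = of_nat M" "s4 ''g'' 0 = of_nat (?g M)" "s4 ''mu'' = s1 ''mu''" "s4 ''G'' = (s1 ''G'')(int M := of_nat (?g M))"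
        using s4 p by (auto simp: frame_def)
      let ?d = "of_int (int (?g (Suc M)) - int (?g M)) :: rat"
      let ?s5 = "s4(''mu'' := (s4 ''mu'')(int M := ?d))"
      let ?s6 = "upd ?s5 ''g'' (of_nat (?g (Suc M)))"
      let ?s7 = "upd ?s6 ''M'' (of_nat (Suc M))"
      have P7: "P ?s7 (Suc M)" unfolding P_def
      proof (intro conjI)
        show "frame {''g'', ''M'', ''G'', ''h'', ''mu''} s ?s7" using p(1) s4(1) by (auto simp: frame_def)
        show "\<forall>m<Suc M. ?s7 ''G'' (int m) = of_nat (?g m) \<and> ?g m < u \<and> ?s7 ''mu'' (int m) = of_int (int (?g (Suc m)) - int (?g m))"
        proof (intro allI impI)
          fix m assume "m < Suc M"
          hence "m = M \<or> m < M" by auto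
          thus "?s7 ''G'' (int m) = of_nat (?g m) \<and> ?g m < u \<and> ?s7 ''mu'' (int m) = of_int (int (?g (Suc m)) - int (?g m))"
            using P f gu unfolding P_def by (auto simp del: grid.simps)
        qed
      qed (simp_all del: grid.simps)
      have J7: "J k ?s7" unfolding J_def using P7 k by (intro exI[of _ "Suc M"]) auto
      have "small X ?d" using X(2) ggS gSu by (intro small_of_int) auto
      note sd = this sn[of "?g (Suc M)"] sn[of "Suc M"]
      have uX: "u \<le> X" using X(2) by simp
      have MX: "Suc M \<le> X" using k X(3) by simp
      note sd' = sd(1) sd(2)[OF le_trans[OF gSu uX]] sd(3)[OF MX]
      show ?thesis
        apply (rule wp_seq, rule wp_asg[where z = "int M" and v = ?d], (use f s4 sm sd' in \<open>simp_all del: grid.simps\<close>)[8])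
        apply (rule wp_seq, rule wp_putv[where v = "of_nat (?g (Suc M))"], (use f s4 sm sd' in \<open>simp_all del: grid.simps\<close>)[5])
        apply (rule wp_putv[where v = "of_nat (Suc M)"], (use f s4 sm sd' in \<open>simp_all del: grid.simps\<close>)[5])
        apply (rule J7)
        done
    qed
    let ?t4 = "((ops (V ''M'') + ops (V ''h'' [-] V ''g'') + 1) + ((ops (V ''h'') + 2) + (ops (V ''M'' [+] Num 1) + 2)))"
    have iff: "wp F X (If (V ''u'' [\<le>] V ''h'') (put ''h'' (V ''u'')) Skip ;; ?r4) ?s3 ((ops (V ''u'' [\<le>] V ''h'') + 1 + ((ops (V ''u'') + 2) + 1)) + ?t4) (J k)"
    proof (rule wp_seq, rule wp_if, goal_cases)
      case 4
      hence "(of_nat u :: rat) \<le> of_nat h1" using p by (auto split: if_splits)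
      hence le: "u \<le> h1" by (simp only: of_nat_le_iff)
      show ?case
        apply (rule wp_putv[where v = "of_nat u"], (use p sm sn[of u] X in simp_all)[5])
        apply (rule r4)
         apply (simp add: frame_def)
        using le gS apply (simp del: grid.simps)
        done
    next
      case 5
      hence "\<not> (of_nat u :: rat) \<le> of_nat h1" using p by (auto split: if_splits)
      hence le: "h1 < u" by (simp only: of_nat_le_iff not_le)
      show ?case by (rule wp_skip, rule r4) (use le gS in \<open>simp_all add: frame_def del: grid.simps\<close>)
    qed (use sm in simp_all)
    have "wp F X (Assign ''G'' (V ''M'') (V ''g'') ;;
      put ''h'' (Floor ((Num 1 [+] V ''ep'') [*] (V ''g'' [+] Num 1))) ;;
      If (V ''u'' [\<le>] V ''h'') (put ''h'' (V ''u'')) Skip ;; ?r4) s1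
      ((ops (V ''M'') + ops (V ''g'') + 1) + ((ops (Floor ((Num 1 [+] V ''ep'') [*] (V ''g'' [+] Num 1))) + 2) +
      ((ops (V ''u'' [\<le>] V ''h'') + 1 + ((ops (V ''u'') + 2) + 1)) + ?t4))) (J k)"
      apply (rule wp_seq, rule wp_asg[where z = "int M" and v = "of_nat (?g M)"], (use p sm sn[of "?g M"] gu X in \<open>simp_all del: grid.simps\<close>)[8])
      apply (rule wp_seq, rule wp_putv[where v = "of_nat h1"], (use p sm sn[OF h1X] h1 in \<open>simp_all del: grid.simps\<close>)[5])
      apply (rule iff)
      done
    thus "wp F X (Assign ''G'' (V ''M'') (V ''g'') ;;
      put ''h'' (Floor ((Num 1 [+] V ''ep'') [*] (V ''g'' [+] Num 1))) ;;
      If (V ''u'' [\<le>] V ''h'') (put ''h'' (V ''u'')) Skip ;; ?r4) s1 50 (J k)"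
      by (rule wp_time) simp
  next
    fix s1 assume "J 0 s1"
    then obtain M where P: "P s1 M" "M = Mm" unfolding J_def by auto
    show "val F s1 (V ''g'' [+] Num 1 [\<le>] V ''u'') = 0" using cond[OF P(1)] lt[of M] P(2) by blast
  next
    fix k s1 assume "J k s1" and z: "val F s1 (V ''g'' [+] Num 1 [\<le>] V ''u'') = 0"
    then obtain M where P: "P s1 M" "M + k = Mm" unfolding J_def by blast
    have "\<not> ?g M < u" using cond[OF P(1)] z by simp
    hence gM: "?g M = u" using grid_step(2)[OF e0, of u M] by simp
    hence "1 \<le> M" using u by (cases M) auto
    thus "Q s1" using P gM by (intro Q[of s1 M]) (auto simp: P_def simp del: grid.simps)
  qed (use sm in auto)
qed

text \<open>The budget is placed in front of the function values, so that the denominators of all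
  numbers are treated by one loop and their digits by another.\<close>

definition val_loop :: prog where
  "val_loop = (Assign ''val'' (Num 0) (V ''b'') ;;
     loop ''t'' (V ''n'' [*] V ''M'')
       (put ''j'' (Floor (V ''t'' [/] V ''M'')) ;; put ''m'' (V ''t'' [-] V ''j'' [*] V ''M'') ;;
        Assign ''val'' (V ''t'' [+] Num 1) (Query (V ''j'' [+] Num 1) (Cell ''G'' (V ''m'')))))"

lemma wp_val_loop:
  assumes X: "8 \<le> X" "n * M + 1 < X"
    and s: "s ''n'' 0 = of_nat n" "s ''M'' 0 = of_nat M" "s ''b'' 0 = b"
    and b: "small X b"
    and G: "\<And>m. m < M \<Longrightarrow> s ''G'' (int m) = of_nat (g m)"
    and Fv: "\<And>j m. j < n \<Longrightarrow> m < M \<Longrightarrow> F (int (Suc j)) (of_nat (g m)) = Fv j m \<and> small X (Fv j m)"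
    and Q: "\<And>s'. frame {''val'', ''t'', ''j'', ''m''} s s' \<Longrightarrow> s' ''val'' 0 = b \<Longrightarrow>
       (\<And>t. t < n * M \<Longrightarrow> s' ''val'' (int (Suc t)) = Fv (t div M) (t mod M)) \<Longrightarrow> Q s'"
  shows "wp F X val_loop s (30 + n * M * 60) Q"
proof -
  have sm: "small X 0" "small X 1" "small X 2" "1 \<le> X" using X by (auto simp: small_0 small_1 small_numeral)
  have sn: "small X (of_nat v)" if "v \<le> X" for v using that sm by (intro small_of_nat) auto
  let ?A = "{''val'', ''t'', ''j'', ''m''}"
  let ?q = "Query (V ''j'' [+] Num 1) (Cell ''G'' (V ''m''))"
  let ?b = "put ''j'' (Floor (V ''t'' [/] V ''M'')) ;; put ''m'' (V ''t'' [-] V ''j'' [*] V ''M'') ;; Assign ''val'' (V ''t'' [+] Num 1) ?q"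
  define J where "J = (\<lambda>t s'. frame ?A s s' \<and> s' ''val'' 0 = b \<and> (\<forall>i<t. s' ''val'' (int (Suc i)) = Fv (i div M) (i mod M)))"
  let ?s1 = "s(''val'' := (s ''val'')(0 := b))"
  have lp: "wp F X (loop ''t'' (V ''n'' [*] V ''M'') ?b) ?s1 (10 + ops (V ''n'' [*] V ''M'') + n * M * (35 + ops (V ''n'' [*] V ''M'') + 15)) Q"
  proof (rule wp_loop[where J = J])
    show "J 0 (upd ?s1 ''t'' 0)" by (auto simp: J_def frame_def)
  next
    fix k s' assume "J k s'" thus "val F s' (V ''n'' [*] V ''M'') = of_nat (n * M)" using s by (simp add: J_def frame_def)
  next
    fix t s' assume t: "t < n * M" and J: "J t s'" and st: "s' ''t'' 0 = of_nat t"
    have f: "s' ''M'' 0 = of_nat M" "s' ''G'' = s ''G''" using J s by (auto simp: J_def frame_def)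
    define j m where "j = t div M" and "m = t mod M"
    have M0: "0 < M" using t by (cases M) auto
    have jm: "j < n" "m < M" using t M0 by (auto simp: j_def m_def less_mult_imp_div_less)
    have fj: "\<lfloor>of_nat t / of_nat M :: rat\<rfloor> = int j" unfolding j_def by (simp add: floor_divide_of_nat_eq)
    have "of_nat t = (of_nat (j * M + m) :: rat)" unfolding j_def m_def by simp
    hence mm: "of_nat t - of_nat j * of_nat M = (of_nat m :: rat)" by simp
    have jt: "j \<le> t" "m \<le> t" by (auto simp: j_def m_def)
    have fl: "\<lfloor>of_nat j + 1 :: rat\<rfloor> = int (Suc j)" using floor_of_nat[of "Suc j", where 'a = rat] by (simp add: add.commute)
    have Fj: "F (int (Suc j)) (of_nat (g m)) = Fv j m" "small X (Fv j m)" using Fv[OF jm] by auto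
    let ?s2 = "upd s' ''j'' (of_nat j)"
    let ?s3 = "upd ?s2 ''m'' (of_nat m)"
    let ?s4 = "?s3(''val'' := (?s3 ''val'')(int (Suc t) := Fv j m))"
    have vq: "val F ?s3 ?q = Fv j m"
      using f G[OF jm(2)] Fj(1) by (simp add: fl del: of_nat_Suc)
    have sj: "small X (of_nat j)" "small X (of_nat m)" using jt t X by (auto intro!: sn)
    have Js: "J (Suc t) (upd ?s4 ''t'' (of_nat (Suc t)))"
      using J by (auto simp: J_def frame_def less_Suc_eq j_def m_def)
    have "wp F X ?b s' ((ops (Floor (V ''t'' [/] V ''M'')) + 2) + ((ops (V ''t'' [-] V ''j'' [*] V ''M'') + 2) + (ops (V ''t'' [+] Num 1) + ops ?q + 1)))
       (\<lambda>s'. s' ''t'' 0 = of_nat t \<and> J (Suc t) (upd s' ''t'' (of_nat (Suc t))))"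
      apply (rule wp_seq, rule wp_putv[where v = "of_nat j"], (use f st sm sj fj in simp_all)[5])
      apply (rule wp_seq, rule wp_putv[where v = "of_nat m"], (use f st sm sj mm in simp_all)[5])
      apply (rule wp_query[where z = "int (Suc t)" and v = "Fv j m"])
      using sm apply simp using sm apply simp apply simp using sm apply simp apply simp using sm apply simp apply simp
      using st apply simp
      apply (rule vq)
      apply (rule Fj(2))
      using Js st apply simp
      done
    thus "wp F X ?b s' 35 (\<lambda>s'. s' ''t'' 0 = of_nat t \<and> J (Suc t) (upd s' ''t'' (of_nat (Suc t))))"
      by (rule wp_time) simp
  next
    fix s' assume "J (n * M) s'" thus "Q s'" by (intro Q) (simp_all only: J_def)
  qed (use X sm in auto)
  have "wp F X val_loop s ((ops (Num 0) + ops (V ''b'') + 1) + (10 + ops (V ''n'' [*] V ''M'') + n * M * (35 + ops (V ''n'' [*] V ''M'') + 15))) Q"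
    unfolding val_loop_def
    apply (rule wp_seq, rule wp_asg[where z = 0 and v = b], (use s b sm in simp_all)[8])
    apply (rule lp)
    done
  thus ?thesis by (rule wp_time) simp
qed

text \<open>
  The sum of the denominators bounds each of them, and unlike their product it is short.
\<close>

definition den_loop :: prog where
  "den_loop = (put ''Q'' (Num 0) ;;
     loop ''t'' (V ''n'' [*] V ''M'' [+] Num 1)
       (put ''x'' (Cell ''val'' (V ''t'')) ;; put ''q'' (Num 1) ;; euclid ;; put ''Q'' (V ''Q'' [+] V ''q'')) ;;
     put ''B'' (V ''Q'' [*] (V ''n'' [+] Num 1)))"

lemma wp_den_loop:
  assumes X: "8 \<le> X" "n * M + 2 < X" "Y \<le> X" "(n * M + 1) * Y * (n + 1) \<le> X" and Y: "int Y * int Y \<le> 2 ^ hy" "1 \<le> Y"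
    and s: "s ''n'' 0 = of_nat n" "s ''M'' 0 = of_nat M"
    and v: "\<And>t. t < n * M + 1 \<Longrightarrow> s ''val'' (int t) = vv t \<and> small Y (vv t)"
    and Q: "\<And>s' B. frame {''Q'', ''t'', ''x'', ''q'', ''B''} s s' \<Longrightarrow>
       s' ''B'' 0 = of_int ((\<Sum>t<n * M + 1. den (vv t)) * (int n + 1)) \<Longrightarrow> Q s'"
  shows "wp F X den_loop s (40 + (n * M + 1) * (80 + (hy + 1) * 30)) Q"
proof -
  have sm: "small X 0" "small X 1" "small X 2" "1 \<le> X" using X by (auto simp: small_0 small_1 small_numeral)
  have si: "small X (of_int v)" if "\<bar>v\<bar> \<le> int X" for v using that sm by (intro small_of_int) auto
  let ?A = "{''Q'', ''t'', ''x'', ''q''}" and ?N = "n * M + 1" and ?e = "V ''n'' [*] V ''M'' [+] Num 1"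
  have dY: "den (vv t) \<le> int Y" if "t < ?N" for t
  proof -
    have "small Y (vv t)" using v[OF that] by blast
    thus ?thesis by (rule small_quotient)
  qed
  define q where "q = (\<lambda>t. \<Sum>i<t. den (vv i))"
  have q0: "0 \<le> q t" for t unfolding q_def using den_pos by (intro sum_nonneg) (simp add: less_imp_le)
  have qY: "q t \<le> int (?N * Y)" if "t \<le> ?N" for t
  proof -
    have "q t \<le> (\<Sum>i<t. int Y)" unfolding q_def using that dY by (intro sum_mono) auto
    also have "\<dots> = int (t * Y)" by simp
    also have "\<dots> \<le> int (?N * Y)" using that by (intro zle_int[THEN iffD2] mult_le_mono1)
    finally show ?thesis .
  qed
  have YX: "?N * Y \<le> X"
  proof -
    have "?N * Y * 1 \<le> ?N * Y * (n + 1)" by (intro mult_le_mono2) simp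
    thus ?thesis using X(4) by linarith
  qed
  define J where "J = (\<lambda>t s'. frame ?A s s' \<and> s' ''Q'' 0 = of_int (q t))"
  let ?b = "put ''x'' (Cell ''val'' (V ''t'')) ;; put ''q'' (Num 1) ;; euclid ;; put ''Q'' (V ''Q'' [+] V ''q'')"
  let ?l = "put ''B'' (V ''Q'' [*] (V ''n'' [+] Num 1))"
  let ?s1 = "upd s ''Q'' 0"
  have lp: "wp F X (loop ''t'' ?e ?b) ?s1 (10 + ops ?e + ?N * ((30 + (10 + (hy + 1) * 30)) + ops ?e + 15)) (\<lambda>s'. wp F X ?l s' (ops (V ''Q'' [*] (V ''n'' [+] Num 1)) + 2) Q)"
  proof (rule wp_loop[where J = J])
    show "J 0 (upd ?s1 ''t'' 0)" by (auto simp: J_def frame_def q_def)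
  next
    fix k s' assume "J k s'" thus "val F s' ?e = of_nat ?N" using s by (simp add: J_def frame_def)
  next
    fix t s' assume t: "t < ?N" and J: "J t s'" and st: "s' ''t'' 0 = of_nat t"
    have f: "s' ''val'' (int t) = vv t" "small Y (vv t)" "s' ''Q'' 0 = of_int (q t)" using J v[OF t] by (auto simp: J_def frame_def)
    have fX: "small X (vv t)" using f(2) X(3) by (rule small_mono)
    let ?s2 = "upd s' ''x'' (vv t)"
    let ?s3 = "upd ?s2 ''q'' 1"
    have eu: "wp F X (euclid ;; put ''Q'' (V ''Q'' [+] V ''q'')) ?s3 ((10 + (hy + 1) * 30) + (ops (V ''Q'' [+] V ''q'') + 2))
       (\<lambda>s'. s' ''t'' 0 = of_nat t \<and> J (Suc t) (upd s' ''t'' (of_nat (Suc t))))"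
    proof (rule wp_seq, rule wp_euclid[OF X(1,3) f(2) Y(1)])
      fix s4 assume s4: "frame {''x'', ''q''} ?s3 s4" "s4 ''q'' 0 = of_int (den (vv t))"
      have f4: "s4 ''Q'' 0 = of_int (q t)" "s4 ''t'' 0 = of_nat t" using s4(1) f st by (auto simp: frame_def)
      have qS: "of_int (q t) + of_int (den (vv t)) = (of_int (q (Suc t)) :: rat)" by (simp add: q_def)
      have "\<bar>q (Suc t)\<bar> \<le> int X" using q0[of "Suc t"] qY[of "Suc t"] t YX by linarith
      hence sq: "small X (of_int (q (Suc t)))" by (rule si)
      have "J (Suc t) (upd (upd s4 ''Q'' (of_int (q (Suc t)))) ''t'' (of_nat (Suc t)))"
        using J s4(1) by (auto simp: J_def frame_def)
      thus "wp F X (put ''Q'' (V ''Q'' [+] V ''q'')) s4 (ops (V ''Q'' [+] V ''q'') + 2)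
          (\<lambda>s'. s' ''t'' 0 = of_nat t \<and> J (Suc t) (upd s' ''t'' (of_nat (Suc t))))"
        using f4 s4(2) qS sq sm by (intro wp_putv[where v = "of_int (q (Suc t))"]) auto
    qed auto
    have "wp F X ?b s' ((ops (Cell ''val'' (V ''t'')) + 2) + ((ops (Num 1) + 2) + ((10 + (hy + 1) * 30) + (ops (V ''Q'' [+] V ''q'') + 2))))
       (\<lambda>s'. s' ''t'' 0 = of_nat t \<and> J (Suc t) (upd s' ''t'' (of_nat (Suc t))))"
      apply (rule wp_seq, rule wp_putv[where v = "vv t"], (use f st sm fX in simp_all)[5])
      apply (rule wp_seq, rule wp_putv[where v = 1], (use sm in simp_all)[5])
      apply (rule eu)
      done
    thus "wp F X ?b s' (30 + (10 + (hy + 1) * 30)) (\<lambda>s'. s' ''t'' 0 = of_nat t \<and> J (Suc t) (upd s' ''t'' (of_nat (Suc t))))"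
      by (rule wp_time) simp
  next
    fix s' assume J: "J ?N s'"
    have f: "s' ''Q'' 0 = of_int (q ?N)" "s' ''n'' 0 = of_nat n" using J s by (auto simp: J_def frame_def)
    have "q ?N * (int n + 1) \<le> int (?N * Y) * (int n + 1)" using qY[of ?N] by (intro mult_right_mono) auto
    also have "\<dots> = int (?N * Y * (n + 1))" by (simp only: of_nat_mult of_nat_add of_nat_1)
    also have "\<dots> \<le> int X" using X(4) by (simp only: zle_int)
    finally have "\<bar>q ?N * (int n + 1)\<bar> \<le> int X" using q0[of ?N] by simp
    hence sb: "small X (of_int (q ?N * (int n + 1)))" by (rule si)
    have "Q (upd s' ''B'' (of_int (q ?N * (int n + 1))))"
      by (rule Q) (use J in \<open>auto simp: J_def frame_def q_def\<close>)
    thus "wp F X ?l s' (ops (V ''Q'' [*] (V ''n'' [+] Num 1)) + 2) Q"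
      using f sb sm by (intro wp_putv[where v = "of_int (q ?N * (int n + 1))"]) auto
  qed (use X sm in auto)
  have "wp F X den_loop s ((ops (Num 0) + 2) + ((10 + ops ?e + ?N * ((30 + (10 + (hy + 1) * 30)) + ops ?e + 15)) + (ops (V ''Q'' [*] (V ''n'' [+] Num 1)) + 2))) Q"
    unfolding den_loop_def
    apply (rule wp_seq, rule wp_putv[where v = 0], (use sm in simp_all)[5])
    apply (rule wp_seq, rule lp)
    done
  thus ?thesis by (rule wp_time) (simp add: algebra_simps)
qed

definition digit_loop :: prog where
  "digit_loop = loop ''t'' (V ''n'' [*] V ''M'' [+] Num 1) digits"

lemma wp_digit_loop:
  assumes X: "8 \<le> X" "n * M + 2 < X" "Y * nat B \<le> X" "K < X" "(n * M + 1) * K < X" and B: "1 \<le> B"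
    and s: "s ''n'' 0 = of_nat n" "s ''M'' 0 = of_nat M" "s ''K'' 0 = of_nat K" "s ''B'' 0 = of_int B"
    and v: "\<And>t. t < n * M + 1 \<Longrightarrow> s ''val'' (int t) = vv t \<and> small Y (vv t)"
    and Q: "\<And>s'. frame {''t'', ''x'', ''o1'', ''k'', ''D''} s s' \<Longrightarrow>
       (\<And>t k. t < n * M + 1 \<Longrightarrow> k < K \<Longrightarrow> s' ''D'' (int (t * K + k)) = of_int (digit B (vv t) k)) \<Longrightarrow> Q s'"
  shows "wp F X digit_loop s (20 + (n * M + 1) * (70 + K * 50)) Q"
proof -
  have sm: "small X 0" "small X 1" "small X 2" "1 \<le> X" using X by (auto simp: small_0 small_1 small_numeral)
  let ?A = "{''t'', ''x'', ''o1'', ''k'', ''D''}" and ?N = "n * M + 1" and ?e = "V ''n'' [*] V ''M'' [+] Num 1"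
  define J where "J = (\<lambda>t s'. frame ?A s s' \<and> (\<forall>i<t. \<forall>k<K. s' ''D'' (int (i * K + k)) = of_int (digit B (vv i) k)))"
  have "wp F X (loop ''t'' ?e digits) s (10 + ops ?e + ?N * ((40 + K * 50) + ops ?e + 15)) Q"
  proof (rule wp_loop[where J = J])
    show "J 0 (upd s ''t'' 0)" by (auto simp: J_def frame_def)
  next
    fix k s' assume "J k s'" thus "val F s' ?e = of_nat ?N" using s by (simp add: J_def frame_def)
  next
    fix t s' assume t: "t < ?N" and J: "J t s'" and st: "s' ''t'' 0 = of_nat t"
    have f: "s' ''val'' (int t) = vv t" "small Y (vv t)" "s' ''K'' 0 = of_nat K" "s' ''B'' 0 = of_int B"
      using J v[OF t] s by (auto simp: J_def frame_def)
    have "t * K \<le> ?N * K" using t by (intro mult_le_mono1) simp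
    hence tK: "t * K < X" using X(5) by (rule le_less_trans)
    show "wp F X digits s' (40 + K * 50) (\<lambda>s'. s' ''t'' 0 = of_nat t \<and> J (Suc t) (upd s' ''t'' (of_nat (Suc t))))"
    proof (rule wp_digits[OF X(1,3,4) tK f(2) B f(1,3) st f(4)])
      fix s4 assume s4: "frame {''x'', ''o1'', ''k'', ''D''} s' s4" "\<And>k. k < K \<Longrightarrow> s4 ''D'' (int (t * K + k)) = of_int (digit B (vv t) k)"
        "\<And>i. i < int (t * K) \<Longrightarrow> s4 ''D'' i = s' ''D'' i"
      let ?s5 = "upd s4 ''t'' (of_nat (Suc t))"
      have "J (Suc t) ?s5"
        unfolding J_def
      proof (intro conjI allI impI)
        show "frame ?A s ?s5" using J s4(1) by (auto simp: J_def frame_def)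
        fix i k assume i: "i < Suc t" and k: "k < K"
        show "?s5 ''D'' (int (i * K + k)) = of_int (digit B (vv i) k)"
        proof (cases "i = t")
          case True
          thus ?thesis using s4(2)[OF k] by simp
        next
          case False
          hence it: "i < t" using i by simp
          have "int (i * K + k) < int (t * K)" using idx_less[OF it k] by (simp only: of_nat_less_iff)
          thus ?thesis using s4(3)[of "int (i * K + k)"] J it k by (simp add: J_def)
        qed
      qed
      moreover have "s4 ''t'' 0 = of_nat t" using s4(1) st by (simp add: frame_def)
      ultimately show "s4 ''t'' 0 = of_nat t \<and> J (Suc t) ?s5" by simp
    qed
  next
    fix s' assume "J ?N s'" thus "Q s'" by (intro Q) (simp_all only: J_def)
  qed (use X sm in auto)
  thus ?thesis unfolding digit_loop_def by (rule wp_time) (simp add: algebra_simps)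
qed

section \<open>Thinning and scaling\<close>

text \<open>A weighted count depends only on which vectors meet the budget, so it can be transferred
  between groups: between real and rational values, and between rational values and scaled
  integers.\<close>

lemma weighted_count_cong:
  fixes \<Phi> :: "nat \<Rightarrow> nat \<Rightarrow> 'a::linordered_ab_group_add" and \<Phi>' :: "nat \<Rightarrow> nat \<Rightarrow> 'b::linordered_ab_group_add"
  assumes "\<And>x. (\<And>j. j < n \<Longrightarrow> x j < M) \<Longrightarrow> (\<Sum>j<n. \<Phi> j (x j)) \<le> v \<longleftrightarrow> (\<Sum>j<n. \<Phi>' j (x j)) \<le> v'"
  shows "weighted_count M \<mu> \<Phi> n v = weighted_count M \<mu> \<Phi>' n v'"
  using assms
proof (induction n arbitrary: v v')
  case 0
  from 0[of "\<lambda>_. 0"] show ?case by simp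
next
  case (Suc n)
  have "weighted_count M \<mu> \<Phi> n (v - \<Phi> n m) = weighted_count M \<mu> \<Phi>' n (v' - \<Phi>' n m)" if m: "m < M" for m
  proof (rule Suc.IH)
    fix x :: "nat \<Rightarrow> nat" assume x: "\<And>j. j < n \<Longrightarrow> x j < M"
    have "(\<Sum>j<Suc n. \<Phi> j ((x(n := m)) j)) \<le> v \<longleftrightarrow> (\<Sum>j<Suc n. \<Phi>' j ((x(n := m)) j)) \<le> v'"
      using x m by (intro Suc.prems) auto
    moreover have "(\<Sum>j<n. \<Phi> j ((x(n := m)) j)) = (\<Sum>j<n. \<Phi> j (x j))" "(\<Sum>j<n. \<Phi>' j ((x(n := m)) j)) = (\<Sum>j<n. \<Phi>' j (x j))"
      by (intro sum.cong; simp)+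
    ultimately show "(\<Sum>j<n. \<Phi> j (x j)) \<le> v - \<Phi> n m \<longleftrightarrow> (\<Sum>j<n. \<Phi>' j (x j)) \<le> v' - \<Phi>' n m"
      by (simp add: le_diff_eq)
  qed
  thus ?case by simp
qed

lemma weighted_count_mono:
  assumes "\<And>m. m < M \<Longrightarrow> 0 \<le> \<mu> m" "v \<le> v'"
  shows "weighted_count M \<mu> \<Phi> n v \<le> weighted_count M \<mu> \<Phi> n v'"
  using assms(2)
proof (induction n arbitrary: v v')
  case (Suc n)
  thus ?case using assms(1) by (auto intro!: sum_mono mult_left_mono Suc.IH diff_right_mono)
qed auto

text \<open>The last coordinate is split off, and the others are counted with the budget reduced by
  its value. Resetting the split coordinate to \<open>undefined\<close> keeps the functions
  extensional, which makes the splitting a bijection.\<close>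

lemma card_box_weighted_count:
  fixes f :: "nat \<Rightarrow> real \<Rightarrow> real"
  shows "int (card {x \<in> {1..n} \<rightarrow>\<^sub>E {0..<u}. (\<Sum>j=1..n. f j (real (x j))) \<le> v}) =
    weighted_count u (\<lambda>_. 1) (\<lambda>j k. f (Suc j) (real k)) n v"
proof (induction n arbitrary: v)
  case 0
  show ?case by (cases "0 \<le> v") auto
next
  case (Suc n)
  define A where "A = (\<lambda>n v. {x \<in> {1..n} \<rightarrow>\<^sub>E {0..<u}. (\<Sum>j=1..n. f j (real (x j))) \<le> v})"
  have fin: "finite (A n v)" for n v unfolding A_def by (rule finite_subset[of _ "{1..n} \<rightarrow>\<^sub>E {0..<u}"]) (auto intro: finite_PiE)
  have "bij_betw (\<lambda>(k, x). x(Suc n := k)) (SIGMA k:{..<u}. A n (v - f (Suc n) (real k))) (A (Suc n) v)"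
  proof (rule bij_betw_byWitness[where f' = "\<lambda>x. (x (Suc n), x(Suc n := undefined))"])
    show "\<forall>p\<in>SIGMA k:{..<u}. A n (v - f (Suc n) (real k)). (\<lambda>x. (x (Suc n), x(Suc n := undefined))) ((\<lambda>(k, x). x(Suc n := k)) p) = p"
      by (auto simp: A_def PiE_def extensional_def fun_eq_iff)
    show "\<forall>x\<in>A (Suc n) v. (\<lambda>(k, x). x(Suc n := k)) (x (Suc n), x(Suc n := undefined)) = x" by auto
    show "(\<lambda>(k, x). x(Suc n := k)) ` (SIGMA k:{..<u}. A n (v - f (Suc n) (real k))) \<subseteq> A (Suc n) v"
    proof
      fix y assume "y \<in> (\<lambda>(k, x). x(Suc n := k)) ` (SIGMA k:{..<u}. A n (v - f (Suc n) (real k)))"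
      then obtain k x where y: "y = x(Suc n := k)" "k < u" "x \<in> A n (v - f (Suc n) (real k))" by auto
      have "(\<Sum>j=1..n. f j (real (y j))) = (\<Sum>j=1..n. f j (real (x j)))" by (intro sum.cong) (auto simp: y(1))
      thus "y \<in> A (Suc n) v" using y by (auto simp: A_def PiE_def Pi_def extensional_def le_Suc_eq)
    qed
    show "(\<lambda>x. (x (Suc n), x(Suc n := undefined))) ` A (Suc n) v \<subseteq> (SIGMA k:{..<u}. A n (v - f (Suc n) (real k)))"
    proof
      fix p assume "p \<in> (\<lambda>x. (x (Suc n), x(Suc n := undefined))) ` A (Suc n) v"
      then obtain x where p: "p = (x (Suc n), x(Suc n := undefined))" "x \<in> A (Suc n) v" by auto
      have "(\<Sum>j=1..n. f j (real ((x(Suc n := undefined)) j))) = (\<Sum>j=1..n. f j (real (x j)))" by (intro sum.cong) auto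
      thus "p \<in> (SIGMA k:{..<u}. A n (v - f (Suc n) (real k)))"
        using p by (auto simp: A_def PiE_def Pi_def extensional_def)
    qed
  qed
  hence "card (A (Suc n) v) = card (SIGMA k:{..<u}. A n (v - f (Suc n) (real k)))" by (simp add: bij_betw_same_card)
  also have "\<dots> = (\<Sum>k<u. card (A n (v - f (Suc n) (real k))))" using fin by (intro card_SigmaI) auto
  finally have "int (card (A (Suc n) v)) = (\<Sum>k<u. int (card (A n (v - f (Suc n) (real k)))))" by simp
  thus ?case using Suc by (simp add: A_def)
qed

text \<open>On a cell, an antitone function is at most its value at the left end.\<close>

lemma grid_sum_lower:
  fixes h :: "nat \<Rightarrow> real"
  assumes "\<And>a b. a \<le> b \<Longrightarrow> h b \<le> h a" and "\<And>m. m < M \<Longrightarrow> g m \<le> g (Suc m)" and "g 0 = 0"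
  shows "(\<Sum>k<g M. h k) \<le> (\<Sum>m<M. (real (g (Suc m)) - real (g m)) * h (g m))"
  using assms(2)
proof (induction M)
  case (Suc M)
  obtain c where c: "g (Suc M) = g M + c" using Suc.prems[of M] by (auto simp: le_iff_add)
  have "(\<Sum>t<c. h (g M + t)) \<le> (\<Sum>t<c. h (g M))" using assms(1) by (intro sum_mono) auto
  hence "(\<Sum>k<g (Suc M). h k) \<le> (\<Sum>k<g M. h k) + real c * h (g M)" unfolding c by (simp add: sum_lessThan_add)
  thus ?case using Suc c by simp
qed (use assms in simp)

lemma grid_sum_upper:
  fixes h :: "nat \<Rightarrow> real"
  assumes h: "\<And>a b. a \<le> b \<Longrightarrow> h b \<le> h a" and g: "\<And>m. m \<le> M \<Longrightarrow> g m < g (Suc m)" "g 0 = 0"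
    and e: "\<And>m. m \<le> M \<Longrightarrow> real (g (Suc m)) \<le> (1 + \<epsilon>) * (real (g m) + 1)" "0 \<le> \<epsilon>"
  shows "(\<Sum>m<Suc M. (real (g (Suc m)) - real (g m)) * h (g m)) + ((1 + \<epsilon>) * (real (g M) + 1) - real (g (Suc M))) * h (g M)
     \<le> (1 + \<epsilon>) * (\<Sum>k<Suc (g M). h k)"
  using g(1) e(1)
proof (induction M)
  case 0
  show ?case using g(2) by (simp add: algebra_simps)
next
  case (Suc M)
  obtain c where c: "g (Suc M) = g M + c" using Suc.prems(1)[of M] le_iff_add[of "g M" "g (Suc M)"] by auto
  let ?A = "\<Sum>m<Suc M. (real (g (Suc m)) - real (g m)) * h (g m)"
  let ?h = "h (g (Suc M))"
  let ?s = "(1 + \<epsilon>) * (real (g M) + 1) - real (g (Suc M))"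
  have IH: "?A + ?s * h (g M) \<le> (1 + \<epsilon>) * (\<Sum>k<Suc (g M). h k)" using Suc by simp
  have "?s * ?h \<le> ?s * h (g M)" using Suc.prems(2)[of M] h[of "g M" "g (Suc M)"] c by (intro mult_left_mono) auto
  moreover have "(\<Sum>t<c. ?h) \<le> (\<Sum>t<c. h (Suc (g M) + t))" using h c by (intro sum_mono) auto
  hence "(\<Sum>k<Suc (g M). h k) + (\<Sum>t<c. ?h) \<le> (\<Sum>k<Suc (g M) + c. h k)"
    unfolding sum_lessThan_add[of h "Suc (g M)"] by (rule add_left_mono)
  hence "(\<Sum>k<Suc (g M). h k) + real c * ?h \<le> (\<Sum>k<Suc (g M) + c. h k)" by simp
  hence "(1 + \<epsilon>) * ((\<Sum>k<Suc (g M). h k) + real c * ?h) \<le> (1 + \<epsilon>) * (\<Sum>k<Suc (g (Suc M)). h k)"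
    using e(2) c by (intro mult_left_mono) auto
  ultimately have "?A + ?s * ?h + (1 + \<epsilon>) * (real c * ?h) \<le> (1 + \<epsilon>) * (\<Sum>k<Suc (g (Suc M)). h k)"
    using IH by (simp add: distrib_left)
  moreover have "?s * ?h + (1 + \<epsilon>) * (real c * ?h) = ((1 + \<epsilon>) * (real (g (Suc M)) + 1) - real (g (Suc M))) * ?h"
    by (simp add: c algebra_simps)
  ultimately show ?case by (simp add: algebra_simps)
qed

text \<open>One coordinate is thinned at a time. \<open>h k\<close> is the exact number of
  completions if the last coordinate has the value \<open>k\<close>; it is antitone because the
  function is monotone and counts are monotone in the budget. The last grid point before
  \<open>u\<close> lies below \<open>u\<close>, so the sum up to it is part of the sum over all
  integers below \<open>u\<close>.\<close>

lemma grid_count: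
  fixes f :: "nat \<Rightarrow> real \<Rightarrow> real"
  assumes f: "\<And>j. j < n \<Longrightarrow> mono (f (Suc j))" and g: "\<And>m. m < M \<Longrightarrow> g m < g (Suc m)" "g 0 = 0" "g M = u" "1 \<le> M"
    and e: "\<And>m. m < M \<Longrightarrow> real (g (Suc m)) \<le> (1 + \<epsilon>) * (real (g m) + 1)" "0 \<le> \<epsilon>"
  defines "Z \<equiv> weighted_count u (\<lambda>_. 1) (\<lambda>j k. f (Suc j) (real k))"
    and "W \<equiv> weighted_count M (\<lambda>m. int (g (Suc m)) - int (g m)) (\<lambda>j m. f (Suc j) (real (g m)))"
  shows "real_of_int (Z n v) \<le> real_of_int (W n v) \<and> real_of_int (W n v) \<le> (1 + \<epsilon>) ^ n * real_of_int (Z n v)"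
  using f
proof (induction n arbitrary: v)
  case 0
  show ?case by (simp add: Z_def W_def)
next
  case (Suc n)
  define h where "h = (\<lambda>k. real_of_int (Z n (v - f (Suc n) (real k))))"
  have h: "h b \<le> h a" if "a \<le> b" for a b
  proof -
    have "f (Suc n) (real a) \<le> f (Suc n) (real b)" using that Suc.prems[of n] by (auto simp: mono_def)
    hence "Z n (v - f (Suc n) (real b)) \<le> Z n (v - f (Suc n) (real a))" unfolding Z_def by (intro weighted_count_mono) auto
    thus ?thesis by (simp add: h_def)
  qed
  have h0: "0 \<le> h k" for k unfolding h_def Z_def by (simp only: of_int_0_le_iff) (rule weighted_count_bounds, simp)
  have ZS: "real_of_int (Z (Suc n) v) = (\<Sum>k<g M. h k)" unfolding Z_def h_def g(3) by simp
  have WS: "real_of_int (W (Suc n) v) = (\<Sum>m<M. (real (g (Suc m)) - real (g m)) * real_of_int (W n (v - f (Suc n) (real (g m)))))"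
    unfolding W_def by simp
  have IH: "h (g m) \<le> real_of_int (W n (v - f (Suc n) (real (g m))))"
    "real_of_int (W n (v - f (Suc n) (real (g m)))) \<le> (1 + \<epsilon>) ^ n * h (g m)" for m
    using Suc.IH[of "v - f (Suc n) (real (g m))"] Suc.prems unfolding h_def by auto
  have pos: "0 \<le> real (g (Suc m)) - real (g m)" if "m < M" for m using g(1)[OF that] by simp
  have "(\<Sum>k<g M. h k) \<le> (\<Sum>m<M. (real (g (Suc m)) - real (g m)) * h (g m))"
    using h g by (intro grid_sum_lower) (auto simp: less_imp_le)
  also have "\<dots> \<le> real_of_int (W (Suc n) v)" unfolding WS using pos IH by (intro sum_mono mult_left_mono) auto
  finally have 1: "real_of_int (Z (Suc n) v) \<le> real_of_int (W (Suc n) v)" unfolding ZS .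
  obtain M' where M': "M = Suc M'" using g(4) by (cases M) auto
  have "(\<Sum>m<Suc M'. (real (g (Suc m)) - real (g m)) * h (g m)) + ((1 + \<epsilon>) * (real (g M') + 1) - real (g (Suc M'))) * h (g M')
     \<le> (1 + \<epsilon>) * (\<Sum>k<Suc (g M'). h k)"
    using h g e M' by (intro grid_sum_upper) auto
  moreover have "0 \<le> ((1 + \<epsilon>) * (real (g M') + 1) - real (g (Suc M'))) * h (g M')"
    using e(1)[of M'] M' h0 by (intro mult_nonneg_nonneg) auto
  moreover have "(\<Sum>k<Suc (g M'). h k) \<le> (\<Sum>k<g M. h k)"
    using g(1)[of M'] M' h0 by (intro sum_mono2) auto
  hence "(1 + \<epsilon>) * (\<Sum>k<Suc (g M'). h k) \<le> (1 + \<epsilon>) * (\<Sum>k<g M. h k)" using e(2) by (intro mult_left_mono) auto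
  ultimately have up: "(\<Sum>m<M. (real (g (Suc m)) - real (g m)) * h (g m)) \<le> (1 + \<epsilon>) * (\<Sum>k<g M. h k)"
    unfolding M' by linarith
  have "real_of_int (W (Suc n) v) \<le> (\<Sum>m<M. (real (g (Suc m)) - real (g m)) * ((1 + \<epsilon>) ^ n * h (g m)))"
    unfolding WS using pos IH by (intro sum_mono mult_left_mono) auto
  also have "\<dots> = (1 + \<epsilon>) ^ n * (\<Sum>m<M. (real (g (Suc m)) - real (g m)) * h (g m))" by (simp add: sum_distrib_left mult_ac)
  also have "\<dots> \<le> (1 + \<epsilon>) ^ n * ((1 + \<epsilon>) * (\<Sum>k<g M. h k))" using e(2) by (intro mult_left_mono up) auto
  finally have "real_of_int (W (Suc n) v) \<le> (1 + \<epsilon>) ^ Suc n * real_of_int (Z (Suc n) v)" unfolding ZS by (simp add: mult_ac)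
  thus ?case using 1 by blast
qed

lemma den_Ints: "r * of_int (den r) \<in> \<int>"
proof -
  obtain p q where q: "quotient_of r = (p, q)" by (metis surj_pair)
  have "r = of_int p / of_int q" "0 < q" using q by (rule quotient_of_div, rule quotient_of_denom_pos)
  hence "r * of_int q = of_int p" by simp
  moreover have "den r = q" by (simp add: den_def q)
  ultimately show ?thesis by simp
qed

text \<open>A sum that exceeds the budget does so by a positive multiple of \<open>1 / D\<close>,
  where the product \<open>D\<close> of the denominators is at most \<open>q ^ (n + 1)\<close>.
  Scaled by \<open>P\<close>, the excess is at least \<open>n + 1\<close>, more than
  \<open>n\<close> floors can lose. Taking \<open>(n + 1) ^ (n + 1)\<close> instead of
  \<open>n + 1\<close> makes \<open>P\<close> a power of \<open>q * (n + 1)\<close>, as digits in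
  this base require.\<close>

lemma floor_sum_le_iff:
  fixes r :: "nat \<Rightarrow> rat" and b :: rat and q :: int
  assumes d: "\<And>j. j < n \<Longrightarrow> den (r j) \<le> q" "den b \<le> q"
  defines "P \<equiv> (q * (int n + 1)) ^ (n + 1)"
  shows "(\<Sum>j<n. \<lfloor>r j * of_int P\<rfloor>) \<le> \<lfloor>b * of_int P\<rfloor> \<longleftrightarrow> (\<Sum>j<n. r j) \<le> b"
proof
  have q0: "0 < q" using den_pos[of b] d(2) by linarith
  hence P0: "0 < P" by (simp add: P_def)
  assume "(\<Sum>j<n. r j) \<le> b"
  hence "(\<Sum>j<n. r j) * of_int P \<le> b * of_int P" using P0 by (intro mult_right_mono) auto
  moreover have "of_int (\<Sum>j<n. \<lfloor>r j * of_int P\<rfloor>) \<le> (\<Sum>j<n. r j) * of_int P"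
    unfolding sum_distrib_right of_int_sum by (intro sum_mono) auto
  ultimately have "of_int (\<Sum>j<n. \<lfloor>r j * of_int P\<rfloor>) \<le> b * of_int P" by linarith
  thus "(\<Sum>j<n. \<lfloor>r j * of_int P\<rfloor>) \<le> \<lfloor>b * of_int P\<rfloor>" by (simp only: le_floor_iff)
next
  have q0: "0 < q" using den_pos[of b] d(2) by linarith
  hence P0: "0 < P" by (simp add: P_def)
  assume le: "(\<Sum>j<n. \<lfloor>r j * of_int P\<rfloor>) \<le> \<lfloor>b * of_int P\<rfloor>"
  show "(\<Sum>j<n. r j) \<le> b"
  proof (rule ccontr)
    assume "\<not> (\<Sum>j<n. r j) \<le> b"
    define s where "s = (\<Sum>j<n. r j) - b"
    have s: "0 < s" using \<open>\<not> _\<close> by (simp add: s_def)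
    define D where "D = den b * (\<Prod>j<n. den (r j))"
    have D: "0 < D" "D \<le> q ^ (n + 1)"
    proof -
      show "0 < D" unfolding D_def using den_pos by (simp add: prod_pos)
      have "(\<Prod>j<n. den (r j)) \<le> (\<Prod>j<n. q)" using d(1) den_pos by (intro prod_mono) (auto simp: less_imp_le)
      hence "D \<le> q * (\<Prod>j<n. q)" unfolding D_def using d(2) q0 den_pos
        by (intro mult_mono) (auto intro!: prod_nonneg simp: less_imp_le)
      thus "D \<le> q ^ (n + 1)" by simp
    qed
    have "r j * of_int D \<in> \<int>" if "j < n" for j
    proof -
      have "(\<Prod>j<n. den (r j)) = den (r j) * (\<Prod>i\<in>{..<n} - {j}. den (r i))" using that by (simp add: prod.remove)
      hence "r j * of_int D = (r j * of_int (den (r j))) * of_int (den b * (\<Prod>i\<in>{..<n} - {j}. den (r i)))"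
        by (simp add: D_def mult_ac)
      thus ?thesis using den_Ints by (metis Ints_mult Ints_of_int)
    qed
    moreover have "b * of_int D \<in> \<int>"
    proof -
      have "b * of_int D = (b * of_int (den b)) * of_int (\<Prod>j<n. den (r j))" by (simp add: D_def mult_ac)
      thus ?thesis using den_Ints by (metis Ints_mult Ints_of_int)
    qed
    ultimately have "s * of_int D \<in> \<int>"
      unfolding s_def left_diff_distrib sum_distrib_right by (intro Ints_diff Ints_sum) auto
    then obtain k where k: "s * of_int D = of_int k" by (elim Ints_cases)
    have "0 < s * of_int D" using s D by simp
    hence "1 \<le> k" unfolding k by simp
    hence "1 \<le> s * of_int D" unfolding k by simp
    also have "s * of_int D \<le> s * of_int (q ^ (n + 1))" using s D by (intro mult_left_mono) (simp_all only: of_int_le_iff less_imp_le)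
    finally have s1: "1 \<le> s * of_int (q ^ (n + 1))" .
    have PP: "P = q ^ (n + 1) * (int n + 1) ^ (n + 1)" by (simp add: P_def power_mult_distrib)
    have "(int n + 1) ^ 1 \<le> (int n + 1) ^ (n + 1)" by (intro power_increasing) auto
    hence "(of_int (int n + 1) :: rat) \<le> of_int ((int n + 1) ^ (n + 1))" by (simp only: of_int_le_iff power_one_right)
    also have "\<dots> \<le> (s * of_int (q ^ (n + 1))) * of_int ((int n + 1) ^ (n + 1))"
      using mult_right_mono[OF s1, of "of_int ((int n + 1) ^ (n + 1))"] by simp
    also have "\<dots> = s * of_int P" unfolding PP by simp
    finally have sP: "of_nat n + 1 \<le> s * of_int P" by simp
    have "(\<Sum>j<n. r j * of_int P - 1) \<le> (\<Sum>j<n. of_int \<lfloor>r j * of_int P\<rfloor>)" by (intro sum_mono) linarith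
    hence "(\<Sum>j<n. r j) * of_int P - of_nat n \<le> of_int (\<Sum>j<n. \<lfloor>r j * of_int P\<rfloor>)"
      by (simp add: sum_subtractf sum_distrib_right)
    also have "\<dots> \<le> of_int \<lfloor>b * of_int P\<rfloor>" using le by (simp only: of_int_le_iff)
    also have "\<dots> \<le> b * of_int P" by simp
    finally have "s * of_int P \<le> of_nat n" unfolding s_def by (simp add: left_diff_distrib)
    thus False using sP by linarith
  qed
qed

text \<open>The power is at most \<open>exp (d / 2)\<close>, and \<open>exp y <= 1 + y + y^2\<close>
  with \<open>y = d / 2\<close> stays below \<open>1 + d\<close> because \<open>y^2 <= y\<close>.
  This is where the constant 6 of the grid parameter pays off.\<close>

lemma power_one_plus_le:
  fixes d :: real
  assumes "0 < d" "d \<le> 1" "1 \<le> n"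
  shows "(1 + d / (6 * real n)) ^ (3 * n) \<le> 1 + d"
proof -
  have "(1 + d / (6 * real n)) ^ (3 * n) \<le> exp (d / (6 * real n)) ^ (3 * n)"
    using assms by (intro power_mono exp_ge_add_one_self) auto
  also have "\<dots> = exp (real (3 * n) * (d / (6 * real n)))" by (simp only: exp_of_nat_mult)
  also have "real (3 * n) * (d / (6 * real n)) = d / 2" using assms by simp
  also have "exp (d / 2) \<le> 1 + d / 2 + (d / 2)\<^sup>2" using assms by (intro exp_bound) auto
  also have "\<dots> \<le> 1 + d"
  proof -
    have "(d / 2)\<^sup>2 \<le> d / 2 * 1" unfolding power2_eq_square using assms by (intro mult_left_mono) auto
    thus ?thesis by simp
  qed
  finally show ?thesis .
qed

section \<open>The complete program\<close>

text \<open>With \<open>K = n + 2\<close> digits, a number \<open>r\<close> is represented by the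
  floor of \<open>r * B ^ (n + 1)\<close>. The key of the sentinel is a copy of the digits of the
  budget with 1 added to the last one. This digit may become equal to the base, which the
  representation by arbitrary integers permits.\<close>

definition main_prog :: prog where
  "main_prog = (If (V ''delta'' [\<le>] Num 1) (put ''ep'' (V ''delta'' [/] (Num 6 [*] V ''n''))) (put ''ep'' (Num 1 [/] (Num 6 [*] V ''n''))) ;;
     put ''K'' (V ''n'' [+] Num 2) ;;
     grid_loop ;; val_loop ;; den_loop ;; digit_loop ;;
     put ''o1'' (Num 0) ;; add_vec ''ky'' ''o1'' ''D'' ''o1'' ''zero'' ''o1'' ;;
     Assign ''ky'' (V ''K'' [-] Num 1) (Cell ''ky'' (V ''K'' [-] Num 1) [+] Num 1) ;;
     stages ;;
     put ''mantissa'' (V ''a'') ;; put ''exponent'' (V ''e''))"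

text \<open>
  \<open>Mm\<close> and \<open>Sm\<close> bound the numbers of grid points and of blocks, \<open>hy\<close> the length of the Euclidean
  algorithm, \<open>ht\<close> the height of the tree, and \<open>E\<close> and \<open>h\<close> the exponents and the lengths of the mantissas.
\<close>

definition time_main :: "nat \<Rightarrow> nat \<Rightarrow> nat \<Rightarrow> nat \<Rightarrow> nat \<Rightarrow> nat \<Rightarrow> nat \<Rightarrow> nat" where
  "time_main n Mm Sm hy ht h E = 400 + Mm * 60 + n * Mm * 60 + (n * Mm + 1) * (200 + (hy + 1) * 30 + (n + 2) * 50) + (n + 2) * 40 +
     n * (200 + (Sm * Mm) * (600 + (2 * ht + 2) * (100 + (n + 2) * 60) + E * 100 + h * 50 + (n + 2) * 200))"

lemma wp_main:
  fixes \<delta> b \<epsilon> :: rat and rv :: "nat \<Rightarrow> nat \<Rightarrow> rat" and n K :: nat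
  defines "\<epsilon> \<equiv> min 1 \<delta> / (6 * of_nat n)"
  defines "K \<equiv> n + 2"
  assumes X: "8 \<le> X" "2 * (u + 1) \<le> X" "Mm < X" "n * Mm + 2 < X" "Y \<le> X" "(n * Mm + 1) * Y * (n + 1) \<le> Bm" "Y * Bm \<le> X" "Bm \<le> X"
      "K < X" "(n * Mm + 1) * K < X" "Sm + 1 < X" "Sm * K + K < X" "(Sm * Mm + 1) * K < X"
      "8 * precision \<epsilon> (Sm * Mm) * int u + 2 \<le> int X" "E + h + 1 \<le> X" "4 * (int (n + 1) * int (Y + Bm)) + 4 \<le> int X" "2 * (Sm * Mm) + 1 < X"
      "(n + 1) * Mm + 1 < X" "((n + 1) * Mm + 1) * K < X" "small X \<epsilon>"
    and n: "1 \<le> n" and u: "1 \<le> u" and \<delta>: "0 < \<delta>"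
    and Y: "int Y * int Y \<le> 2 ^ hy" "1 \<le> Y" "small Y b"
    and rv: "\<And>j k. j < n \<Longrightarrow> k < u \<Longrightarrow> F (int (Suc j)) (of_nat k) = rv j k \<and> small Y (rv j k) \<and> 0 \<le> rv j k"
    and Mm: "\<And>m. (1 + \<epsilon>) ^ m \<le> of_nat u \<Longrightarrow> m < Mm"
    and h: "4 * precision \<epsilon> (Sm * Mm) * int u \<le> 2 ^ h" and ht: "Sm * Mm \<le> 2 ^ ht" and E: "4 * int u ^ n \<le> 2 ^ E"
    and Sm: "\<And>S. (1 + real_of_rat \<epsilon>) ^ (S - 1) \<le> 4 * real u ^ n \<Longrightarrow> S \<le> Sm"
    and er2: "(1 + real_of_rat \<epsilon>) ^ (2 * n) \<le> 2"
    and Q: "\<And>s' a e M. s' ''mantissa'' 0 = of_int a \<Longrightarrow> s' ''exponent'' 0 = of_nat e \<Longrightarrow> 1 \<le> M \<Longrightarrow> grid \<epsilon> u M = u \<Longrightarrow>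
       (\<forall>m<M. grid \<epsilon> u m < u) \<Longrightarrow>
       weighted_count M (\<lambda>m. int (grid \<epsilon> u (Suc m)) - int (grid \<epsilon> u m)) (\<lambda>j m. rv j (grid \<epsilon> u m)) n b \<le> a * 2 ^ e \<Longrightarrow>
       real_of_int (a * 2 ^ e) \<le> (1 + real_of_rat \<epsilon>) ^ (2 * n) *
         real_of_int (weighted_count M (\<lambda>m. int (grid \<epsilon> u (Suc m)) - int (grid \<epsilon> u m)) (\<lambda>j m. rv j (grid \<epsilon> u m)) n b) \<Longrightarrow> Q s'"
  shows "wp F X main_prog (initial_state n u b \<delta>) (time_main n Mm Sm hy ht h E) Q"
proof -
  have sm: "small X 0" "small X 1" "small X 2" "small X 6" "1 \<le> X" using X(1) by (auto simp: small_0 small_1 small_numeral)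
  have sn: "small X (of_nat v)" if "v \<le> X" for v using that sm by (intro small_of_nat) auto
  have si: "small X (of_int v)" if "\<bar>v\<bar> \<le> int X" for v using that sm by (intro small_of_int) auto
  have e01: "0 < \<epsilon>" "\<epsilon> \<le> 1"
  proof -
    show "0 < \<epsilon>" unfolding \<epsilon>_def using \<delta> n by (intro divide_pos_pos) auto
    have "min 1 \<delta> \<le> 6 * of_nat n" using n by (simp add: min_le_iff_disj)
    thus "\<epsilon> \<le> 1" unfolding \<epsilon>_def using n by (simp add: divide_le_eq)
  qed
  let ?g = "grid \<epsilon> u"
  let ?fin = "put ''mantissa'' (V ''a'') ;; put ''exponent'' (V ''e'')"
  let ?r8 = "stages ;; ?fin"
  let ?r7 = "Assign ''ky'' (V ''K'' [-] Num 1) (Cell ''ky'' (V ''K'' [-] Num 1) [+] Num 1) ;; ?r8"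
  let ?r6 = "put ''o1'' (Num 0) ;; add_vec ''ky'' ''o1'' ''D'' ''o1'' ''zero'' ''o1'' ;; ?r7"
  let ?r3 = "val_loop ;; den_loop ;; digit_loop ;; ?r6"
  let ?ts = "\<lambda>M. 20 + n * (200 + (Sm * M) * (600 + (2 * ht + 2) * (100 + K * 60) + E * 100 + h * 50 + K * 200))"
  let ?t8 = "\<lambda>M. ?ts M + (4 + 4)"
  let ?t6 = "\<lambda>M. 3 + ((12 + K * 40) + (12 + ?t8 M))"
  let ?t3 = "\<lambda>M. (30 + n * M * 60) + ((40 + (n * M + 1) * (80 + (hy + 1) * 30)) + ((20 + (n * M + 1) * (70 + K * 50)) + ?t6 M))"
  let ?s0 = "initial_state n u b \<delta>"
  let ?s2 = "upd (upd ?s0 ''ep'' \<epsilon>) ''K'' (of_nat K)"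
  have i0: "?s0 ''n'' 0 = of_nat n" "?s0 ''u'' 0 = of_nat u" "?s0 ''b'' 0 = b" "?s0 ''delta'' 0 = \<delta>"
    "?s0 ''g'' 0 = 0" "?s0 ''M'' 0 = 0" "?s0 ''zero'' = (\<lambda>_. 0)" "?s0 ''ex'' = (\<lambda>_. 0)" "?s0 ''key'' = (\<lambda>_. 0)" "?s0 ''tr'' = (\<lambda>_. 0)"
    by (simp_all add: initial_state_def)
  have rest: "wp F X ?r3 s3 (?t3 M) Q"
    if s3: "frame {''g'', ''M'', ''G'', ''h'', ''mu''} ?s2 s3" and M: "s3 ''M'' 0 = of_nat M" "M \<le> Mm" "1 \<le> M"
      and G: "\<And>m. m < M \<Longrightarrow> s3 ''G'' (int m) = of_nat (?g m) \<and> ?g m < u \<and>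
         s3 ''mu'' (int m) = of_int (int (?g (Suc m)) - int (?g m))" and gM: "?g M = u" for s3 M
  proof -
    have f3: "s3 ''n'' 0 = of_nat n" "s3 ''b'' 0 = b" "s3 ''K'' 0 = of_nat K" "s3 ''ep'' 0 = \<epsilon>" "s3 ''zero'' = (\<lambda>_. 0)" "s3 ''ex'' = (\<lambda>_. 0)"
      "s3 ''key'' = (\<lambda>_. 0)" "s3 ''tr'' = (\<lambda>_. 0)"
      using s3 i0 by (simp_all add: frame_def)
    have nM: "n * M \<le> n * Mm" using M by simp
    have sX: "small X v" if "small Y v" for v using that X(5) by (rule small_mono)
    \<comment> \<open>The intended contents of \<open>val\<close>: the budget, followed by the
      values at the grid points, coordinate by coordinate.\<close>
    define vv where "vv = (\<lambda>t. if t = 0 then b else rv ((t - 1) div M) (?g ((t - 1) mod M)))"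
    have jm: "t div M < n" "t mod M < M" if "t < n * M" for t using that M by (simp_all add: less_mult_imp_div_less)
    have vs: "small Y (vv t)" if "t < n * M + 1" for t
    proof (cases t)
      case (Suc i)
      hence i: "i < n * M" using that by simp
      thus ?thesis using rv[OF jm(1)[OF i], of "?g (i mod M)"] G[OF jm(2)[OF i]] Suc by (simp add: vv_def)
    qed (use Y in \<open>simp add: vv_def\<close>)
    define q where "q = (\<Sum>t<n * M + 1. den (vv t))"
    define B where "B = q * (int n + 1)"
    have dq: "den (vv t) \<le> q" if "t < n * M + 1" for t
      unfolding q_def using that den_pos by (intro member_le_sum) (auto simp: less_imp_le)
    have q1: "1 \<le> q" using dq[of 0] den_pos[of "vv 0"] by simp
    have B2: "2 \<le> B"
    proof -
      have "1 * 2 \<le> q * (int n + 1)" using q1 n by (intro mult_mono) auto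
      thus ?thesis by (simp add: B_def)
    qed
    have BBm: "B \<le> int Bm"
    proof -
      have "q \<le> (\<Sum>t<n * M + 1. int Y)"
      proof (unfold q_def, rule sum_mono)
        fix t assume "t \<in> {..<n * M + 1}"
        hence "small Y (vv t)" using vs by simp
        thus "den (vv t) \<le> int Y" by (rule small_quotient)
      qed
      also have "\<dots> = int ((n * M + 1) * Y)" by (simp only: sum_constant card_lessThan of_nat_mult)
      also have "\<dots> \<le> int ((n * Mm + 1) * Y)" using nM by (intro zle_int[THEN iffD2] mult_le_mono1) simp
      finally have "B \<le> int ((n * Mm + 1) * Y) * (int n + 1)" unfolding B_def by (intro mult_right_mono) auto
      also have "\<dots> = int ((n * Mm + 1) * Y * (n + 1))" by (simp only: of_nat_mult of_nat_add of_nat_1)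
      also have "\<dots> \<le> int Bm" using X(6) by (simp only: zle_int)
      finally show ?thesis .
    qed
    have YB: "Y * nat B \<le> X"
    proof -
      have "nat B \<le> Bm" using BBm by simp
      hence "Y * nat B \<le> Y * Bm" by (rule mult_le_mono2)
      thus ?thesis using X(7) by (rule le_trans)
    qed
    define \<phi> where "\<phi> = (\<lambda>j m. digit B (rv j (?g m)))"
    define \<Phi> where "\<Phi> = (\<lambda>j m. horner B K (\<phi> j m))"
    define \<mu> where "\<mu> = (\<lambda>m. int (?g (Suc m)) - int (?g m))"
    define d0 where "d0 = (digit B b)(n + 1 := digit B b (n + 1) + 1)"
    define bt where "bt = horner B K (digit B b)"
    \<comment> \<open>\<open>Y\<close> bounds the leading digit, and \<open>Bm\<close> bounds the
      base and thus the other digits.\<close>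
    define Dg where "Dg = int (Y + Bm)"
    have digb: "\<bar>digit B r k\<bar> \<le> Dg - 1" if "small Y r" for r k
    proof (cases "k = 0")
      case True
      thus ?thesis using digit_rest_small(3)[of Y r B] that B2 BBm by (simp add: Dg_def)
    next
      case False
      thus ?thesis using digit_rest_small(2)[of Y r B k] that B2 BBm by (simp add: Dg_def)
    qed
    have Kn: "K = Suc (n + 1)" by (simp add: K_def)
    have PB: "B ^ (n + 1) = (q * (int n + 1)) ^ (n + 1)" by (simp add: B_def)
    have kf: "horner B K (digit B r) = \<lfloor>r * of_int ((q * (int n + 1)) ^ (n + 1))\<rfloor>" for r
      unfolding Kn horner_digit_floor PB ..
    \<comment> \<open>Here the exactness of the scaled comparison enters: the integer keys meet the
      scaled budget precisely when the rational values meet \<open>b\<close>.\<close>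
    have WW: "weighted_count M \<mu> \<Phi> n bt = weighted_count M \<mu> (\<lambda>j m. rv j (?g m)) n b"
    proof (rule weighted_count_cong)
      fix x :: "nat \<Rightarrow> nat" assume x: "\<And>j. j < n \<Longrightarrow> x j < M"
      show "(\<Sum>j<n. \<Phi> j (x j)) \<le> bt \<longleftrightarrow> (\<Sum>j<n. rv j (?g (x j))) \<le> b"
        unfolding \<Phi>_def \<phi>_def bt_def kf
      proof (rule floor_sum_le_iff)
        show "den b \<le> q" using dq[of 0] by (simp add: vv_def)
        fix j assume j: "j < n"
        have "j * M + x j < n * M" by (rule idx_less[OF j x[OF j]])
        moreover have "vv (Suc (j * M + x j)) = rv j (?g (x j))" using x[OF j] by (simp add: vv_def)
        ultimately show "den (rv j (?g (x j))) \<le> q" using dq[of "Suc (j * M + x j)"] by simp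
      qed
    qed
    have bt: "bt = horner B K d0 - 1"
    proof -
      have "horner B (n + 1) d0 = horner B (n + 1) (digit B b)" by (rule horner_cong) (simp add: d0_def)
      moreover have "horner B K d = B * horner B (n + 1) d + d (n + 1)" for d by (simp only: Kn horner.simps)
    moreover have "d0 (n + 1) = digit B b (n + 1) + 1" by (simp add: d0_def)
    ultimately show ?thesis unfolding bt_def by (simp del: horner.simps)
    qed
    have g1: "?g m < ?g (Suc m)" if "m < M" for m using grid_step(1)[of \<epsilon> u m] e01 G[OF that] by simp
    have musum: "(\<Sum>m<M. \<mu> m) = int u"
      unfolding \<mu>_def using sum_lessThan_telescope[of "\<lambda>m. int (?g m)" M] gM by simp
    have smk: "Sm * M \<le> Sm * Mm" using M by simp
    have Rle: "precision \<epsilon> (Sm * M) \<le> precision \<epsilon> (Sm * Mm)" by (rule precision_bounds(3)[OF e01(1) smk])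
    hence Ru: "precision \<epsilon> (Sm * M) * int u \<le> precision \<epsilon> (Sm * Mm) * int u" by (intro mult_right_mono) auto
    have st: "wp F X ?r8 s7 (?t8 M) Q"
      if s7: "s7 ''K'' 0 = of_nat K" "s7 ''M'' 0 = of_nat M" "s7 ''n'' 0 = of_nat n" "s7 ''ep'' 0 = \<epsilon>" "s7 ''B'' 0 = of_int B"
        "s7 ''zero'' = (\<lambda>_. 0)" "s7 ''ex'' = (\<lambda>_. 0)" "s7 ''key'' = (\<lambda>_. 0)" "s7 ''tr'' = (\<lambda>_. 0)"
        and D7: "\<And>t k. t < n * M + 1 \<Longrightarrow> k < K \<Longrightarrow> s7 ''D'' (int (t * K + k)) = of_int (digit B (vv t) k)"
        and mu7: "s7 ''mu'' = s3 ''mu''" and ky7: "\<And>k. k < K \<Longrightarrow> s7 ''ky'' (int k) = of_int (d0 k)" for s7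
    proof (rule wp_seq, rule wp_stages[where Sm = Sm and K = K and M = M and Cm = "2 * precision \<epsilon> (Sm * M) * int u" and E = E and h = h
          and D = "int (n + 1) * Dg" and Dg = Dg and n = n and u = u and \<epsilon> = \<epsilon> and B = B and ht = ht and \<phi> = \<phi> and \<Phi> = \<Phi> and \<mu> = \<mu> and ?d0.0 = d0 and bt = bt])
      show "n < X" using X(9) by (simp add: K_def)
      have "(Sm * M + 1) * K \<le> (Sm * Mm + 1) * K" using smk by (intro mult_le_mono1) simp
      thus "(Sm * M + 1) * K < X" using X(13) by (rule le_less_trans)
      show "4 * (2 * precision \<epsilon> (Sm * M) * int u) + 2 \<le> int X" using X(14) Ru by linarith
      show "4 * (int (n + 1) * Dg) + 4 \<le> int X" using X(16) by (simp only: Dg_def)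
      show "2 * (Sm * M) + 1 < X" using X(17) smk by linarith
      have nM1: "(n + 1) * M + 1 \<le> (n + 1) * Mm + 1" by (intro add_right_mono mult_le_mono2 M(2))
      thus "(n + 1) * M + 1 < X" using X(18) by (rule le_less_trans)
      have "((n + 1) * M + 1) * K \<le> ((n + 1) * Mm + 1) * K" using nM1 by (rule mult_le_mono1)
      thus "((n + 1) * M + 1) * K < X" using X(19) by (rule le_less_trans)
      show "2 * (2 * precision \<epsilon> (Sm * M) * int u) \<le> 2 ^ h" using h Ru by linarith
      show "Sm * M \<le> 2 ^ ht" using ht smk by linarith
      show "1 \<le> Dg" using Y(2) by (simp add: Dg_def)
      show "\<Phi> = (\<lambda>j m. horner B K (\<phi> j m))" by (rule \<Phi>_def)
      show "0 \<le> \<Phi> j m" if "j < n" "m < M" for j m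
      proof -
        have "0 \<le> rv j (?g m)" using rv[OF that(1), of "?g m"] G[OF that(2)] by blast
        moreover have "0 \<le> (of_int ((q * (int n + 1)) ^ (n + 1)) :: rat)" using q1 by simp
        ultimately show ?thesis unfolding \<Phi>_def \<phi>_def kf by (simp only: zero_le_floor mult_nonneg_nonneg)
      qed
      show "s7 ''D'' (int ((1 + j * M + m) * K + k)) = of_int (\<phi> j m k) \<and> \<bar>\<phi> j m k\<bar> \<le> Dg" if "j < n" "m < M" "k < K" for j m k
      proof -
        have lt: "j * M + m < n * M" by (rule idx_less[OF that(1,2)])
        have "vv (1 + j * M + m) = rv j (?g m)" using that(2) by (simp add: vv_def)
        moreover have "small Y (rv j (?g m))" using rv[OF that(1), of "?g m"] G[OF that(2)] by blast
        ultimately show ?thesis using D7[of "1 + j * M + m" k] lt that(3) digb[of "rv j (?g m)" k] by (simp add: \<phi>_def)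
      qed
      show "s7 ''mu'' (int m) = of_int (\<mu> m) \<and> 1 \<le> \<mu> m" if "m < M" for m
        using G[OF that] g1[OF that] mu7 by (simp add: \<mu>_def)
      show "key_rep s7 K (int (n + 1) * Dg) 0 (\<lambda>_. d0)"
        unfolding key_rep_def
      proof (intro allI impI conjI)
        fix i k :: nat assume "i \<le> 0" "k < K"
        thus "s7 ''ky'' (int (i * K + k)) = of_int (d0 k)" using ky7 by simp
        have "\<bar>d0 k\<bar> \<le> Dg" using digb[OF Y(3), of k] digb[OF Y(3), of "n + 1"] by (auto simp: d0_def)
        also have "Dg \<le> int (n + 1) * Dg" using mult_right_mono[of 1 "int (n + 1)" Dg] by (simp add: Dg_def)
        finally show "\<bar>d0 k\<bar> \<le> int (n + 1) * Dg" .
      qed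
      show "\<And>S. (1 + real_of_rat \<epsilon>) ^ (S - 1) \<le> 4 * real u ^ n \<Longrightarrow> S \<le> Sm" by (rule Sm)
      fix s8 :: state and a :: int and e :: nat assume s8: "s8 ''a'' 0 = of_int a" "s8 ''e'' 0 = of_nat e" "weighted_count M \<mu> \<Phi> n bt \<le> a * 2 ^ e"
         "real_of_int (a * 2 ^ e) \<le> (1 + real_of_rat \<epsilon>) ^ (2 * n) * real_of_int (weighted_count M \<mu> \<Phi> n bt)"
      have Q9: "Q (upd (upd s8 ''mantissa'' (s8 ''a'' 0)) ''exponent'' (s8 ''e'' 0))"
        by (rule Q[of _ a e M]) (use s8(1,2) s8(3,4)[unfolded WW, unfolded \<mu>_def] M gM G in simp_all)
      show "wp F X ?fin s8 (4 + 4) Q"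
        by (rule wp_seq, rule wp_copy[OF sm(5)], rule wp_copy[OF sm(5)]) (use Q9 in simp)
    qed (use X M s7 e01 n u bt E er2 musum B2 in \<open>simp_all\<close>)
    show ?thesis
    proof (rule wp_seq, rule wp_val_loop[where n = n and M = M and b = b and g = ?g and Fv = "\<lambda>j m. rv j (?g m)"])
      show "F (int (Suc j)) (of_nat (?g m)) = rv j (?g m) \<and> small X (rv j (?g m))" if "j < n" "m < M" for j m
        using rv[OF that(1), of "?g m"] G[OF that(2)] sX by blast
      show "n * M + 1 < X" using X(4) nM by linarith
    next
      fix s4 assume s4: "frame {''val'', ''t'', ''j'', ''m''} s3 s4" "s4 ''val'' 0 = b"
        "\<And>t. t < n * M \<Longrightarrow> s4 ''val'' (int (Suc t)) = rv (t div M) (?g (t mod M))"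
      have v4: "s4 ''val'' (int t) = vv t \<and> small Y (vv t)" if "t < n * M + 1" for t
      proof
        show "s4 ''val'' (int t) = vv t" using s4(2) s4(3)[of "t - 1"] that by (cases t) (simp_all add: vv_def)
      qed (rule vs[OF that])
      have f4: "s4 ''n'' 0 = of_nat n" "s4 ''M'' 0 = of_nat M" using s4(1) f3 M by (simp_all add: frame_def)
      have nMm: "(n * M + 1) * Y * (n + 1) \<le> X"
      proof -
        have "(n * M + 1) * Y * (n + 1) \<le> (n * Mm + 1) * Y * (n + 1)" using nM by (intro mult_le_mono1) simp
        thus ?thesis using X(6,8) by linarith
      qed
      show "wp F X (den_loop ;; digit_loop ;; ?r6) s4 ((40 + (n * M + 1) * (80 + (hy + 1) * 30)) + ((20 + (n * M + 1) * (70 + K * 50)) + ?t6 M)) Q"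
      proof (rule wp_seq, rule wp_den_loop[OF X(1) _ X(5) nMm Y(1,2) f4 v4])
        show "n * M + 2 < X" using X(4) nM by linarith
        fix s5 assume s5: "frame {''Q'', ''t'', ''x'', ''q'', ''B''} s4 s5" "s5 ''B'' 0 = of_int ((\<Sum>t<n * M + 1. den (vv t)) * (int n + 1))"
        have f5: "s5 ''n'' 0 = of_nat n" "s5 ''M'' 0 = of_nat M" "s5 ''K'' 0 = of_nat K" "s5 ''val'' = s4 ''val''"
          using s4(1) s5(1) f3 M by (simp_all add: frame_def)
        have B5: "s5 ''B'' 0 = of_int B" using s5(2) by (simp add: B_def q_def)
        have v5: "s5 ''val'' (int t) = vv t \<and> small Y (vv t)" if "t < n * M + 1" for t using v4[OF that] f5 by simp
        have nK: "(n * M + 1) * K < X"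
        proof -
          have "(n * M + 1) * K \<le> (n * Mm + 1) * K" using nM by (intro mult_le_mono1) simp
          thus ?thesis using X(10) by (rule le_less_trans)
        qed
        show "wp F X (digit_loop ;; ?r6) s5 ((20 + (n * M + 1) * (70 + K * 50)) + ?t6 M) Q"
        proof (rule wp_seq, rule wp_digit_loop[OF X(1) _ YB X(9) nK _ f5(1,2,3) B5 v5])
          show "n * M + 2 < X" using X(4) nM by linarith
          show "1 \<le> B" using B2 by simp
          fix s6 assume s6: "frame {''t'', ''x'', ''o1'', ''k'', ''D''} s5 s6"
            "\<And>t k. t < n * M + 1 \<Longrightarrow> k < K \<Longrightarrow> s6 ''D'' (int (t * K + k)) = of_int (digit B (vv t) k)"
          have e6: "frame {''val'', ''t'', ''j'', ''m'', ''Q'', ''x'', ''q'', ''B'', ''o1'', ''k'', ''D''} s3 s6"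
            using s4(1) s5(1) s6(1) by (auto simp: frame_def)
          have B6: "s6 ''B'' 0 = of_int B" using s6(1) B5 by (simp add: frame_def)
          let ?sa = "upd s6 ''o1'' 0"
          have K6: "?sa ''K'' 0 = of_nat K" "?sa ''zero'' = (\<lambda>_. 0)" using e6 f3 by (simp_all add: frame_def)
          have Db: "?sa ''D'' (int (0 + k)) = of_int (digit B b k)" if "k < K" for k
            using s6(2)[of 0 k] that by (simp add: vv_def)
          have dbX: "\<bar>digit B b k\<bar> + 1 \<le> int X" for k
          proof -
            have "Dg \<le> int (n + 1) * Dg" using mult_right_mono[of 1 "int (n + 1)" Dg] by (simp add: Dg_def)
            moreover have "4 * (int (n + 1) * Dg) + 4 \<le> int X" using X(16) by (simp only: Dg_def)
            moreover have "0 \<le> Dg" by (simp add: Dg_def)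
            ultimately show ?thesis using digb[OF Y(3), of k] by linarith
          qed
          have av: "wp F X (add_vec ''ky'' ''o1'' ''D'' ''o1'' ''zero'' ''o1'' ;; ?r7) ?sa ((12 + K * 40) + (12 + ?t8 M)) Q"
          proof (rule wp_seq, rule wp_add_vec[where K = K and ?p1.0 = 0 and ?p2.0 = 0 and ?p3.0 = 0])
            show "small X (?sa ''D'' (int (0 + k)) + ?sa ''zero'' (int (0 + k)))" if "k < K" for k
              unfolding Db[OF that] K6 using dbX[of k] by (simp add: si)
          next
            fix s7 assume s7: "frame {''ky'', ''k''} ?sa s7"
              "\<And>k. k < K \<Longrightarrow> s7 ''ky'' (int (0 + k)) = ?sa ''D'' (int (0 + k)) + ?sa ''zero'' (int (0 + k))"
            let ?s8 = "s7(''ky'' := (s7 ''ky'')(int (n + 1) := of_int (digit B b (n + 1) + 1)))"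
            have k7: "s7 ''ky'' (int k) = of_int (digit B b k)" if "k < K" for k
              using s7(2)[OF that] Db[OF that] K6 by simp
            have K7: "s7 ''K'' 0 = of_nat n + 2" using s7(1) K6 by (simp add: frame_def K_def)
            have r8: "wp F X ?r8 ?s8 (?t8 M) Q"
            proof (rule st)
              show "?s8 ''K'' 0 = of_nat K" "?s8 ''M'' 0 = of_nat M" "?s8 ''n'' 0 = of_nat n" "?s8 ''ep'' 0 = \<epsilon>" "?s8 ''B'' 0 = of_int B"
                "?s8 ''zero'' = (\<lambda>_. 0)" "?s8 ''ex'' = (\<lambda>_. 0)" "?s8 ''key'' = (\<lambda>_. 0)" "?s8 ''tr'' = (\<lambda>_. 0)" "?s8 ''mu'' = s3 ''mu''"
                using s7(1) e6 f3 M B6 by (simp_all add: frame_def)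
              show "?s8 ''D'' (int (t * K + k)) = of_int (digit B (vv t) k)" if "t < n * M + 1" "k < K" for t k
                using s6(2)[OF that] s7(1) by (simp add: frame_def)
              show "?s8 ''ky'' (int k) = of_int (d0 k)" if "k < K" for k
                using k7[OF that] by (simp add: d0_def)
            qed
            have "small X (of_int (digit B b (n + 1) + 1))" using dbX[of "n + 1"] by (intro si) linarith
            hence "wp F X ?r7 s7 ((ops (V ''K'' [-] Num 1) + ops (Cell ''ky'' (V ''K'' [-] Num 1) [+] Num 1) + 1) + ?t8 M) Q"
              apply (intro wp_seq)
              apply (rule wp_asg[where z = "int (n + 1)" and v = "of_int (digit B b (n + 1) + 1)"])
              using K7 k7[of "n + 1"] sm r8 floor_of_nat[of "n + 1", where 'a = rat] apply (simp_all add: K_def add.commute)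
              done
            thus "wp F X ?r7 s7 (12 + ?t8 M) Q" by (rule wp_time) simp
          qed (use X K6 in simp_all)
          have "wp F X ?r6 s6 ((ops (Num 0) + 2) + ((12 + K * 40) + (12 + ?t8 M))) Q"
            by (rule wp_seq, rule wp_putv[where v = 0]) (use sm av in simp_all)
          thus "wp F X ?r6 s6 (?t6 M) Q" by (rule wp_time) simp
        qed
      qed
    qed (use X nM f3 M G Y sX in auto)
  qed
  have t3: "?t3 M \<le> ?t3 Mm" if "M \<le> Mm" for M
    using that by (intro add_mono mult_mono) auto
  have gl: "wp F X (grid_loop ;; ?r3) ?s2 ((10 + Mm * 60) + ?t3 Mm) Q"
  proof (rule wp_seq, rule wp_grid_loop[OF X(1,2,3) _ _ _ _ e01 Mm u])
    fix s3 M assume a: "frame {''g'', ''M'', ''G'', ''h'', ''mu''} ?s2 s3" "s3 ''M'' 0 = of_nat M" "M \<le> Mm" "1 \<le> M"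
      "\<And>m. m < M \<Longrightarrow> s3 ''G'' (int m) = of_nat (?g m) \<and> ?g m < u \<and> s3 ''mu'' (int m) = of_int (int (?g (Suc m)) - int (?g m))" "?g M = u"
    show "wp F X ?r3 s3 (?t3 Mm) Q" by (rule wp_time[OF rest[OF a] t3[OF a(3)]])
  qed (use i0 in simp_all)
  let ?c = "V ''delta'' [\<le>] Num 1"
  let ?e1 = "V ''delta'' [/] (Num 6 [*] V ''n'')" and ?e2 = "Num 1 [/] (Num 6 [*] V ''n'')"
  have Kp: "wp F X (put ''K'' (V ''n'' [+] Num 2) ;; grid_loop ;; ?r3) (upd ?s0 ''ep'' \<epsilon>) ((ops (V ''n'' [+] Num 2) + 2) + ((10 + Mm * 60) + ?t3 Mm)) Q"
  proof (rule wp_seq, rule wp_putv[where v = "of_nat K"], goal_cases)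
    case 5 show ?case using X(9) by (intro sn) simp
  next
    case 6 show ?case by (rule gl)
  qed (use i0 sm in \<open>simp_all add: K_def\<close>)
  have "wp F X main_prog ?s0 ((ops ?c + 1 + ((ops ?e1 + 2) + (ops ?e2 + 2))) + ((ops (V ''n'' [+] Num 2) + 2) + ((10 + Mm * 60) + ?t3 Mm))) Q"
    unfolding main_prog_def
  proof (rule wp_seq, rule wp_if, goal_cases)
    case 4
    hence "min 1 \<delta> = \<delta>" using i0 by (auto split: if_splits)
    hence "\<epsilon> = \<delta> / (6 * of_nat n)" by (simp add: \<epsilon>_def)
    thus ?case using i0 sm X(20) Kp by (intro wp_putv[where v = \<epsilon>]) simp_all
  next
    case 5
    hence "min 1 \<delta> = 1" using i0 by (auto split: if_splits)
    hence "\<epsilon> = 1 / (6 * of_nat n)" by (simp add: \<epsilon>_def)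
    thus ?case using i0 sm X(20) Kp by (intro wp_putv[where v = \<epsilon>]) simp_all
  qed (use sm in simp_all)
  thus ?thesis by (rule wp_time) (simp add: time_main_def K_def algebra_simps)
qed

section \<open>Estimates of sizes and of the running time\<close>

definition poly_bounded :: "nat \<Rightarrow> nat \<Rightarrow> nat \<Rightarrow> nat \<Rightarrow> bool" where
  "poly_bounded z c i a \<longleftrightarrow> a \<le> c * z ^ i"

lemma poly_bounded_mult: "poly_bounded z c i a \<Longrightarrow> poly_bounded z e j b \<Longrightarrow> poly_bounded z (c * e) (i + j) (a * b)"
  unfolding poly_bounded_def using mult_le_mono[of a "c * z ^ i" b "e * z ^ j"] by (simp add: power_add mult_ac)

lemma poly_bounded_up: "poly_bounded z c i a \<Longrightarrow> 1 \<le> z \<Longrightarrow> i \<le> j \<Longrightarrow> c \<le> e \<Longrightarrow> poly_bounded z e j a"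
  unfolding poly_bounded_def using mult_le_mono[of c e "z ^ i" "z ^ j"] power_increasing[of i j z] by simp

lemma poly_bounded_add: "poly_bounded z c i a \<Longrightarrow> poly_bounded z e j b \<Longrightarrow> 1 \<le> z \<Longrightarrow> i \<le> k \<Longrightarrow> j \<le> k \<Longrightarrow> poly_bounded z (c + e) k (a + b)"
  using poly_bounded_up[of z c i a k c] poly_bounded_up[of z e j b k e] unfolding poly_bounded_def by (simp add: distrib_right)

lemma poly_bounded_const: "1 \<le> z \<Longrightarrow> poly_bounded z c 0 c" unfolding poly_bounded_def by simp

text \<open>\<open>z\<close> stands for \<open>n\<close> times the bound \<open>Y\<close> on the
  parts of the values. Every quantity is estimated by a monomial in \<open>z\<close> with explicit
  coefficient and degree. The degree 6 is due to \<open>Y * Bm\<close>, to the mantissas in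
  \<open>8 * R * u\<close> and to the sums of digits, and \<open>2 ^ 20\<close> generously exceeds
  all coefficients.\<close>

lemma size_bounds:
  fixes z n u Y Mm Sm Bm R h E :: nat
  assumes z: "1 \<le> z" and n: "n \<le> z" and u: "u \<le> z" and Y: "Y \<le> z" and Mm: "Mm \<le> 7 * z ^ 2" and Sm: "Sm \<le> 13 * z ^ 2"
    and Bm: "Bm = (n * Mm + 1) * Y * (n + 1)" and R: "R \<le> 48 * (Sm * Mm + 1) * z + 1"
    and h: "h \<le> 4 * R * u" and E: "E \<le> z + 2"
  defines "X \<equiv> 2 ^ 20 * z ^ 6"
  shows "8 \<le> X" "2 * (u + 1) \<le> X" "Mm < X" "n * Mm + 2 < X" "Y \<le> X" "Y * Bm \<le> X" "Bm \<le> X"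
      "n + 2 < X" "(n * Mm + 1) * (n + 2) < X" "Sm + 1 < X" "Sm * (n + 2) + (n + 2) < X" "(Sm * Mm + 1) * (n + 2) < X"
      "8 * R * u + 2 \<le> X" "E + h + 1 \<le> X" "4 * ((n + 1) * (Y + Bm)) + 4 \<le> X" "2 * (Sm * Mm) + 1 < X"
      "(n + 1) * Mm + 1 < X" "((n + 1) * Mm + 1) * (n + 2) < X" "6 * z \<le> X"
proof -
  note One_nat_def [simp del] add_2_eq_Suc [simp del] add_2_eq_Suc' [simp del]
  note A = poly_bounded_add[OF _ _ z] and M = poly_bounded_mult and C = poly_bounded_const[OF z]
  have Xlt: "a < X" if "poly_bounded z c i a" "c < 2 ^ 20" "i \<le> 6" for a c i
  proof -
    have "a \<le> c * z ^ 6" using poly_bounded_up[OF that(1) z that(3) order_refl] by (simp add: poly_bounded_def)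
    moreover have "0 < z ^ 6" using z by simp
    ultimately show ?thesis unfolding X_def using that(2) by (meson le_less_trans mult_less_mono1)
  qed
  have b1: "poly_bounded z 1 1 n" "poly_bounded z 1 1 u" "poly_bounded z 1 1 Y" "poly_bounded z 7 2 Mm" "poly_bounded z 13 2 Sm" "poly_bounded z 1 1 z" using n u Y Mm Sm by (simp_all add: poly_bounded_def)
  have n1: "poly_bounded z 2 1 (n + 1)" using A[OF b1(1) C[of 1], of 1] by simp
  have n2: "poly_bounded z 3 1 (n + 2)" using A[OF b1(1) C[of 2], of 1] by simp
  have nM: "poly_bounded z 7 3 (n * Mm)" using M[OF b1(1,4)] by simp
  have nM1: "poly_bounded z 8 3 (n * Mm + 1)" using A[OF nM C[of 1], of 3] by simp
  have Bmp: "poly_bounded z 16 5 Bm" unfolding Bm using M[OF M[OF nM1 b1(3)] n1] by simp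
  have N: "poly_bounded z 91 4 (Sm * Mm)" using M[OF b1(5,4)] by simp
  have N1: "poly_bounded z 92 4 (Sm * Mm + 1)" using A[OF N C[of 1], of 4] by simp
  have R0: "poly_bounded z 4416 5 (48 * (Sm * Mm + 1) * z)" using M[OF M[OF C[of 48] N1] b1(6)] by simp
  have Rp: "poly_bounded z 4417 5 R" using A[OF R0 C[of 1], of 5] R by (simp add: poly_bounded_def)
  have Ru: "poly_bounded z 17668 6 (4 * R * u)" "poly_bounded z 35336 6 (8 * R * u)" using M[OF M[OF C[of 4] Rp] b1(2)] M[OF M[OF C[of 8] Rp] b1(2)] by simp_all
  have hp: "poly_bounded z 17668 6 h" using Ru(1) h unfolding poly_bounded_def by linarith
  have Ep: "poly_bounded z 3 1 E" using A[OF b1(6) C[of 2], of 1] E unfolding poly_bounded_def by simp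
  show "8 \<le> X" using Xlt[OF C[of 8]] by simp
  show "2 * (u + 1) \<le> X" using Xlt[OF M[OF C[of 2] A[OF b1(2) C[of 1], of 1]]] by simp
  show "Mm < X" using Xlt[OF b1(4)] by simp
  show "n * Mm + 2 < X" using Xlt[OF A[OF nM C[of 2], of 3]] by simp
  show "Y \<le> X" using Xlt[OF b1(3)] by simp
  show "Y * Bm \<le> X" using Xlt[OF M[OF b1(3) Bmp]] by simp
  show "Bm \<le> X" using Xlt[OF Bmp] by simp
  show "n + 2 < X" using Xlt[OF n2] by simp
  show "(n * Mm + 1) * (n + 2) < X" using Xlt[OF M[OF nM1 n2]] by simp
  show "Sm + 1 < X" using Xlt[OF A[OF b1(5) C[of 1], of 2]] by simp
  show "Sm * (n + 2) + (n + 2) < X" using Xlt[OF A[OF M[OF b1(5) n2] n2, of 3]] by simp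
  show "(Sm * Mm + 1) * (n + 2) < X" using Xlt[OF M[OF N1 n2]] by simp
  show "8 * R * u + 2 \<le> X" using Xlt[OF A[OF Ru(2) C[of 2], of 6]] by simp
  show "E + h + 1 \<le> X" using Xlt[OF A[OF A[OF Ep hp, of 6] C[of 1], of 6]] by simp
  show "4 * ((n + 1) * (Y + Bm)) + 4 \<le> X" using Xlt[OF A[OF M[OF C[of 4] M[OF n1 A[OF b1(3) Bmp, of 5]]] C[of 4], of 6]] by simp
  show "2 * (Sm * Mm) + 1 < X" using Xlt[OF A[OF M[OF C[of 2] N] C[of 1], of 4]] by simp
  have nM2: "poly_bounded z 15 3 ((n + 1) * Mm + 1)" using A[OF M[OF n1 b1(4)] C[of 1], of 3] by simp
  show "(n + 1) * Mm + 1 < X" using Xlt[OF nM2] by simp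
  show "((n + 1) * Mm + 1) * (n + 2) < X" using Xlt[OF M[OF nM2 n2]] by simp
  show "6 * z \<le> X" using Xlt[OF M[OF C[of 6] b1(6)]] by simp
qed

text \<open>\<open>g\<close>, \<open>l\<close> and \<open>D\<close> stand for \<open>lg u\<close>,
  \<open>L + log 2 n\<close> and \<open>1 / min 1 \<delta>\<close>. The tree paths, the alignment
  and the copying for one candidate take at most a constant times \<open>q = n * g * l\<close>.
  Multiplied by the \<open>n\<close> stages and by the number of candidates, this gives the leading
  term, which dominates the preprocessing.\<close>

lemma time_bound:
  fixes n Mm Sm hy ht h E :: nat and g l D :: real
  assumes n: "1 \<le> n" and g: "1 \<le> g" and l: "2 \<le> l" and D: "1 \<le> D"
    and Mm: "real Mm \<le> 7 * real n * g * D" and N: "real (Sm * Mm) \<le> 133 * real n ^ 3 * g ^ 2 * D ^ 2"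
    and hy: "real hy \<le> 8 * l * g" and ht: "real ht \<le> 9 * l" and h: "real h \<le> 15 * l" and E: "real E \<le> 6 * real n * g"
  shows "real (time_main n Mm Sm hy ht h E) \<le> 1000000 * (real n ^ 5 * g ^ 3 * l * D ^ 2)"
proof -
  define x where "x = real n"
  have x: "1 \<le> x" using n by (simp add: x_def)
  define q where "q = x * g * l"
  have xg: "1 \<le> x * g" using mult_mono[OF x g] x by simp
  have gl: "2 \<le> g * l" using mult_mono[OF g l] g by simp
  have xl: "2 \<le> x * l" using mult_mono[OF x l] x by simp
  have q2: "2 \<le> q" using mult_mono[OF xg l] xg by (simp add: q_def)
  have ql: "l \<le> q" using mult_right_mono[OF xg, of l] l by (simp add: q_def)
  have qx: "2 * x \<le> q" using mult_left_mono[OF gl, of x] x by (simp add: q_def mult_ac)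
  have qxg: "2 * (x * g) \<le> q" using mult_left_mono[OF l, of "x * g"] xg by (simp add: q_def mult_ac)
  have qgl: "g * l \<le> q" using mult_right_mono[OF x, of "g * l"] gl by (simp add: q_def mult_ac)
  have qxl: "x * l \<le> q" using mult_left_mono[OF g, of "x * l"] xl by (simp add: q_def mult_ac)
  define I where "I = 600 + (2 * real ht + 2) * (100 + (x + 2) * 60) + real E * 100 + real h * 50 + (x + 2) * 200"
  have I: "I \<le> 7000 * q"
  proof -
    have "(2 * real ht + 2) * (100 + (x + 2) * 60) \<le> (19 * l) * (280 * x)" using ht l x by (intro mult_mono) auto
    also have "\<dots> = 5320 * (x * l)" by simp
    finally have "(2 * real ht + 2) * (100 + (x + 2) * 60) \<le> 5320 * (x * l)" .
    moreover have "real E \<le> 6 * (x * g)" using E by (simp add: x_def)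
    ultimately have "(2 * real ht + 2) * (100 + (x + 2) * 60) + real E * 100 \<le> 5320 * q + 300 * q"
      using qxg qxl by argo
    moreover have "real h * 50 \<le> 750 * q" using h ql by linarith
    moreover have "600 + (x + 2) * 200 \<le> 600 * q" using qx q2 x by (simp add: distrib_right)
    moreover have "600 + a + b + c + e \<le> 7000 * q" if "a + b \<le> 5320 * q + 300 * q" "c \<le> 750 * q" "600 + e \<le> 600 * q" for a b c e
      using that q2 by linarith
    ultimately show ?thesis unfolding I_def by blast
  qed
  have I0: "0 \<le> I" unfolding I_def using x by simp
  define W where "W = x ^ 3 * g ^ 2 * D ^ 2"
  have W1: "1 \<le> W" unfolding W_def
    using mult_mono[OF mult_mono[OF one_le_power[OF x, of 3] one_le_power[OF g, of 2]] one_le_power[OF D, of 2]] x g by simp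
  have Wq: "1 * q \<le> W * q" using W1 q2 by (intro mult_right_mono) auto
  have "real (Sm * Mm) * I \<le> (133 * W) * (7000 * q)" using N I I0 by (intro mult_mono) (auto simp: W_def x_def)
  hence st: "200 + real (Sm * Mm) * I \<le> 931100 * (W * q)" using Wq q2 by linarith
  define G where "G = real n ^ 5 * g ^ 3 * l * D ^ 2"
  have GW: "x * (W * q) = G" unfolding G_def W_def q_def x_def[symmetric] by (simp add: power_numeral_reduce mult_ac)
  have stage: "x * (200 + real (Sm * Mm) * I) \<le> 931100 * G"
  proof -
    have "x * (200 + real (Sm * Mm) * I) \<le> x * (931100 * (W * q))" using x by (intro mult_left_mono st) simp
    also have "\<dots> = 931100 * (x * (W * q))" by simp
    finally show ?thesis unfolding GW .
  qed
  define U where "U = x ^ 2 * g * D"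
  have U1: "1 \<le> U" unfolding U_def using mult_mono[OF mult_mono[OF one_le_power[OF x, of 2] g] D] x g by simp
  have xM: "x * real Mm \<le> 7 * U"
    using mult_left_mono[OF Mm, of x] x by (simp add: U_def x_def power2_eq_square mult_ac)
  have Mx: "real Mm \<le> x * real Mm" using mult_right_mono[OF x, of "real Mm"] by simp
  have pr: "(x * real Mm + 1) * (200 + (real hy + 1) * 30 + (x + 2) * 50) \<le> (8 * U) * (430 * q)"
  proof (rule mult_mono)
    show "200 + (real hy + 1) * 30 + (x + 2) * 50 \<le> 430 * q" using hy q2 qgl qx by (simp add: mult_ac)
  qed (use xM U1 x in auto)
  have UqG: "U * q \<le> G"
  proof -
    have "U * q \<le> (x ^ 2 * g * D) * q * (x ^ 2 * D)"
    proof -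
      have "1 \<le> x ^ 2 * D" using mult_mono[OF one_le_power[OF x, of 2] D] x by simp
      thus ?thesis unfolding U_def[symmetric] using U1 q2 mult_left_mono[of 1 "x ^ 2 * D" "U * q"] by simp
    qed
    also have "\<dots> = x ^ 5 * g ^ 2 * l * D ^ 2" by (simp add: q_def power_numeral_reduce mult_ac)
    also have "\<dots> \<le> x ^ 5 * g ^ 3 * l * D ^ 2"
      using x g l D by (intro mult_right_mono mult_left_mono power_increasing) auto
    finally show ?thesis by (simp add: G_def x_def)
  qed
  have UU: "q \<le> U * q" "U \<le> U * q"
    using mult_right_mono[OF U1, of q] mult_left_mono[of 1 q U] q2 U1 by simp_all
  have x40: "(x + 2) * 40 \<le> 60 * q" using qx q2 by (simp add: distrib_right)
  have "real (time_main n Mm Sm hy ht h E) = 400 + real Mm * 60 + x * real Mm * 60 +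
     (x * real Mm + 1) * (200 + (real hy + 1) * 30 + (x + 2) * 50) + (x + 2) * 40 + x * (200 + real (Sm * Mm) * I)"
    unfolding time_main_def I_def x_def by (simp only: of_nat_add of_nat_mult of_nat_numeral of_nat_1)
  also have "\<dots> \<le> 400 + 60 * (7 * U) + 60 * (7 * U) + (8 * U) * (430 * q) + 60 * q + 931100 * G"
    using xM Mx pr stage x40 by (intro add_mono) simp_all
  also have "\<dots> \<le> 1000000 * G" using UU UqG q2 by linarith
  finally show ?thesis by (simp add: G_def)
qed

lemma enc_len_nat: "enc_len (of_nat k) = nat \<lceil>log 2 (real k + 1)\<rceil> + 1"
proof -
  have "quotient_of (of_int (int k)) = (int k, 1)" using quotient_of_int[of "int k"] by (simp add: Rat.of_int_def)
  hence "quotient_of (of_nat k) = (int k, 1)" by simp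
  thus ?thesis by (simp add: enc_len_def)
qed

lemma nat_ceil_log_le: "1 \<le> v \<Longrightarrow> nat \<lceil>log 2 (real v)\<rceil> \<le> v"
proof -
  assume v: "1 \<le> v"
  have "real v \<le> 2 ^ v" using of_nat_less_two_power[of v, where 'a = real] by simp
  hence "log 2 (real v) \<le> real v" using v by (simp add: log_le_iff powr_realpow)
  thus ?thesis by (simp add: ceiling_le_iff)
qed

lemma le_two_power_ceil_log: "1 \<le> v \<Longrightarrow> v \<le> 2 ^ nat \<lceil>log 2 (real v)\<rceil>"
proof -
  assume v: "1 \<le> v"
  have "real v = 2 powr (log 2 (real v))" using v by simp
  also have "\<dots> \<le> 2 powr (real (nat \<lceil>log 2 (real v)\<rceil>))" by (intro powr_mono) linarith+
  also have "\<dots> = real (2 ^ nat \<lceil>log 2 (real v)\<rceil>)" by (simp add: powr_realpow)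
  finally show ?thesis by (simp only: of_nat_le_iff)
qed

lemma nat_ceil_log_real: "1 \<le> v \<Longrightarrow> real (nat \<lceil>log 2 (real v)\<rceil>) \<le> log 2 (real v) + 1"
proof -
  assume "1 \<le> v"
  hence "0 \<le> log 2 (real v)" by simp
  thus ?thesis by linarith
qed

text \<open>In the given range \<open>1 + e\<close> is at least \<open>2 powr e\<close>: on the one
  hand \<open>ln 2 <= 5 / 6\<close>, because \<open>(7 / 6) ^ 5 >= 2\<close>; on the other hand
  \<open>ln (1 + e) >= e - e^2 >= 5 * e / 6\<close>. The numbers of grid points and of blocks are
  bounded in this way.\<close>

lemma power_le_imp_mult_le:
  fixes e y :: real
  assumes e: "0 < e" "e \<le> 1 / 6" and le: "(1 + e) ^ m \<le> y" and y: "0 < y"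
  shows "e * real m \<le> log 2 y"
proof -
  have "(7 / 6) ^ 5 \<le> exp (1 / 6 :: real) ^ 5"
    using exp_ge_add_one_self[of "1 / 6 :: real"] by (intro power_mono) auto
  also have "\<dots> = exp (5 / 6)" using exp_of_nat_mult[of 5 "1 / 6 :: real"] by simp
  finally have "(2::real) \<le> exp (5 / 6)" by (simp add: power_numeral_reduce)
  hence "ln (2::real) \<le> ln (exp (5 / 6))" by (subst ln_le_cancel_iff) auto
  hence "ln 2 \<le> (5 / 6 :: real)" by simp
  hence "e * ln 2 \<le> e * (5 / 6)" using e by (intro mult_left_mono) auto
  also have "\<dots> \<le> e - e\<^sup>2"
  proof -
    have "e * e \<le> e * (1 / 6)" using e by (intro mult_left_mono) auto
    thus ?thesis by (simp add: power2_eq_square)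
  qed
  also have "\<dots> \<le> ln (1 + e)" using e by (intro ln_one_plus_pos_lower_bound) auto
  finally have l2: "e * ln 2 \<le> ln (1 + e)" .
  have "real m * ln (1 + e) = ln ((1 + e) ^ m)" using e by (simp add: ln_realpow)
  also have "\<dots> \<le> ln y" using le e y by simp
  finally have "real m * (e * ln 2) \<le> ln y" using mult_left_mono[OF l2, of "real m"] by simp
  hence "(e * real m) * ln 2 \<le> ln y" by (simp add: mult_ac)
  thus ?thesis by (simp add: log_def le_divide_eq)
qed

section \<open>Choice of the parameters and conclusion\<close>

theorem theorem1p7:
  "\<exists>(p :: prog) (C :: real). C > 0 \<and>
     (\<forall>(n :: nat) (u :: nat) (b :: rat) (f :: nat \<Rightarrow> real \<Rightarrow> real) (\<delta> :: rat) (L :: nat).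
        n \<ge> 1 \<longrightarrow> u > 0 \<longrightarrow> \<delta> > 0 \<longrightarrow>
        (\<forall>j\<in>{1..n}. mono (f j) \<and> (\<forall>x. f j x \<ge> 0) \<and> (\<forall>x\<in>\<rat>. f j x \<in> \<rat>)) \<longrightarrow>
        input_length_le n f b u \<delta> L \<longrightarrow>
        (\<exists>t m s. exec (evaluator n f) p (initial_state n u b \<delta>) t m s \<and>
           real (card (solutions n f b u)) \<le> result s \<and>
           result s \<le> (1 + of_rat \<delta>) * real (card (solutions n f b u)) \<and>
           real t \<le> C * (real n ^ 5 * lg u ^ 3 * (real L + log 2 (real n)) / (min 1 (of_rat \<delta>))\<^sup>2) \<and>
           real m \<le> C * (real L * lg u + log 2 (real n))))"
proof (intro exI[of _ main_prog] exI[of _ "1000000::real"] conjI allI impI)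
  fix n u :: nat and b \<delta> :: rat and f :: "nat \<Rightarrow> real \<Rightarrow> real" and L :: nat
  assume n: "1 \<le> n" and u: "0 < u" and \<delta>: "0 < \<delta>"
    and f: "\<forall>j\<in>{1..n}. mono (f j) \<and> (\<forall>x. f j x \<ge> 0) \<and> (\<forall>x\<in>\<rat>. f j x \<in> \<rat>)"
    and L: "input_length_le n f b u \<delta> L"
  define hL where "hL = enc_len (of_nat u)"
  \<comment> \<open>Integers below \<open>u\<close> have encoding length at most \<open>hL\<close>,
    so \<open>2 ^ (L * hL)\<close> bounds the parts of all function values that are queried. It is
    at least \<open>2 ^ L\<close> and therefore bounds \<open>u\<close> and the parts of
    \<open>b\<close> and \<open>\<delta>\<close> too.\<close>
  define Y where "Y = (2::nat) ^ (L * hL)"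
  \<comment> \<open>The dimension is not covered by \<open>L\<close> and enters as a factor; this is
    the source of \<open>log n\<close> in the bit bound.\<close>
  define z where "z = n * Y"
  define d where "d = real_of_rat (min 1 \<delta>)"
  define \<epsilon> where "\<epsilon> = min 1 \<delta> / (6 * of_nat n)"
  define er where "er = real_of_rat \<epsilon>"
  have LI: "hL \<le> L" "enc_len b \<le> L" "enc_len \<delta> \<le> L"
    "\<And>j x. j \<in> {1..n} \<Longrightarrow> enc_len (rat_value (f j) x) \<le> L * enc_len x"
    using L unfolding input_length_le_def hL_def by blast+
  have hLr: "hL = nat \<lceil>log 2 (real u + 1)\<rceil> + 1" unfolding hL_def by (rule enc_len_nat)
  have lu: "0 \<le> log 2 (real u)" "log 2 (real u) \<le> log 2 (real u + 1)" "1 \<le> log 2 (real u + 1)"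
    using u by (simp_all add: le_log_iff)
  have hL2: "2 \<le> hL" "log 2 (real u) \<le> real hL" using lu unfolding hLr by linarith+
  have "log 2 (real u + 1) \<le> log 2 (2 * real u)" using u by (intro log_mono) auto
  also have "\<dots> = log 2 (real u) + 1" using u by (simp add: log_mult)
  finally have "real hL \<le> log 2 (real u) + 3" unfolding hLr using lu by linarith
  define g where "g = lg u"
  have g: "1 \<le> g" "log 2 (real u) \<le> g" unfolding g_def lg_def by auto
  have hLg: "real hL \<le> 4 * g" using \<open>real hL \<le> log 2 (real u) + 3\<close> g by linarith
  have L2: "2 \<le> L" using hL2 LI by simp
  have gL: "g \<le> real L" unfolding g_def lg_def using hL2 LI L2 by auto
  have ln0: "0 \<le> log 2 (real n)" using n by simp
  define l where "l = real L + log 2 (real n)"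
  have l2: "2 \<le> l" using L2 ln0 by (simp add: l_def)
  have L_le: "L \<le> L * hL" using hL2 by simp
  have YL: "2 ^ L \<le> Y" unfolding Y_def by (intro power_increasing L_le) simp
  have Y1: "1 \<le> Y" by (simp add: Y_def)
  have LY: "L \<le> Y" "hL \<le> Y" using YL LI(1) less_exp[of L] by linarith+
  have z1: "1 \<le> z" "n \<le> z" "Y \<le> z" using n Y1 by (simp_all add: z_def)
  have u2: "u \<le> 2 ^ hL"
  proof -
    have "real u = 2 powr (log 2 (real u))" using u by simp
    also have "\<dots> \<le> 2 powr (real hL)" by (intro powr_mono hL2) simp
    also have "\<dots> = real (2 ^ hL)" by (simp add: powr_realpow)
    finally show ?thesis by (simp only: of_nat_le_iff)
  qed
  have uY: "u \<le> Y"
  proof -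
    have "(2::nat) ^ hL \<le> 2 ^ L" using LI by (intro power_increasing) auto
    thus ?thesis using u2 YL by linarith
  qed
  have uz: "u \<le> z" using uY z1 by simp
  have \<delta>s: "small (2 ^ L) (min 1 \<delta>)"
  proof (cases "\<delta> \<le> 1")
    case True
    thus ?thesis using small_of_enc_len[OF LI(3)] by (simp add: min_def)
  next
    case False
    thus ?thesis using small_1[of "2 ^ L"] by (simp add: min_def)
  qed
  have d: "0 < d" "d \<le> 1" using \<delta> by (simp_all add: d_def)
  have dm: "min 1 (real_of_rat \<delta>) = d"
  proof (cases "\<delta> \<le> 1")
    case True
    hence "real_of_rat \<delta> \<le> 1" by simp
    thus ?thesis using True by (simp add: d_def min_def)
  next
    case False
    hence "\<not> real_of_rat \<delta> \<le> 1" by simp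
    thus ?thesis using False by (simp add: d_def min_def)
  qed
  define D where "D = 1 / d"
  have D1: "1 \<le> D" using d by (simp add: D_def)
  \<comment> \<open>The reciprocal of a positive fraction whose parts are at most
    \<open>2 ^ L\<close> is again at most \<open>2 ^ L\<close>, so \<open>1 / d\<close> adds at most
    \<open>L\<close> to the lengths of numbers.\<close>
  have DL: "D \<le> 2 ^ L"
  proof -
    obtain p q where pq: "min 1 \<delta> = of_int p / of_int q" "\<bar>p\<bar> \<le> int (2 ^ L)" "0 < q" "q \<le> int (2 ^ L)"
      using \<delta>s by (rule smallE)
    have "0 < min 1 \<delta>" using \<delta> by simp
    hence "0 < p" using pq(1,3) by (simp add: zero_less_divide_iff)
    have "real_of_int q \<le> 2 ^ L" using pq(4) by (metis of_int_le_iff of_int_of_nat_eq of_nat_numeral of_nat_power)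
    moreover have "d = real_of_int p / real_of_int q" unfolding d_def pq(1) by (simp add: of_rat_divide)
    hence "D = real_of_int q / real_of_int p" by (simp add: D_def)
    moreover have "real_of_int q / real_of_int p \<le> real_of_int q / 1" using \<open>0 < p\<close> pq(3) by (intro divide_left_mono) auto
    ultimately have "D \<le> real_of_int q" by simp
    thus ?thesis using \<open>real_of_int q \<le> 2 ^ L\<close> by (rule order_trans)
  qed
  have erd: "er = d / (6 * real n)" by (simp add: er_def \<epsilon>_def d_def of_rat_divide of_rat_mult)
  have er: "0 < er" "er \<le> 1 / 6"
  proof -
    show "0 < er" unfolding erd using d n by simp
    have "d / (6 * real n) \<le> 1 / (6 * 1)" using d n by (intro frac_le) auto
    thus "er \<le> 1 / 6" unfolding erd by simp
  qed
  have e0: "0 < \<epsilon>" using er by (simp add: er_def)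
  have ier: "1 / er = 6 * real n * D" unfolding erd D_def by simp
  \<comment> \<open>\<open>Mm\<close> and \<open>Sm\<close> bound logarithms to the base
    \<open>1 + er\<close> by means of \<open>power_le_imp_mult_le\<close>: of \<open>u\<close> for
    the grid and of \<open>4 * u ^ n\<close> for the blocks.\<close>
  define Mm where "Mm = nat \<lfloor>log 2 (real u) / er\<rfloor> + 1"
  define Sm where "Sm = nat \<lfloor>(2 + real n * log 2 (real u)) / er\<rfloor> + 1"
  have nlu: "0 \<le> log 2 (real u) / er" "0 \<le> (2 + real n * log 2 (real u)) / er" using lu er by auto
  have Mmr: "real Mm \<le> log 2 (real u) * (6 * real n * D) + 1"
  proof -
    have "real Mm \<le> log 2 (real u) / er + 1" unfolding Mm_def using nlu by linarith
    thus ?thesis using ier by (simp add: divide_inverse)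
  qed
  have Smr: "real Sm \<le> (2 + real n * log 2 (real u)) * (6 * real n * D) + 1"
  proof -
    have "real Sm \<le> (2 + real n * log 2 (real u)) / er + 1" unfolding Sm_def using nlu by linarith
    thus ?thesis using ier by (simp add: divide_inverse)
  qed
  have nr: "1 \<le> real n" using n by simp
  have nD: "1 \<le> real n * D" using mult_mono[OF nr D1] by simp
  have gnD: "1 \<le> real n * g * D" using mult_mono[OF mult_mono[OF nr g(1)] D1] nr g by simp
  have Mm7: "real Mm \<le> 7 * real n * g * D"
  proof -
    have "log 2 (real u) * (6 * real n * D) \<le> g * (6 * real n * D)" using g D1 by (intro mult_right_mono) auto
    thus ?thesis using Mmr gnD by (simp add: mult_ac)
  qed
  have Sm19: "real Sm \<le> 19 * (real n ^ 2 * g * D)"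
  proof -
    have "1 \<le> real n * g" using mult_mono[OF nr g(1)] by simp
    moreover have "real n * log 2 (real u) \<le> real n * g" using g by (intro mult_left_mono) auto
    ultimately have "2 + real n * log 2 (real u) \<le> 3 * (real n * g)" by linarith
    hence "(2 + real n * log 2 (real u)) * (6 * real n * D) \<le> (3 * (real n * g)) * (6 * real n * D)"
      using D1 by (intro mult_right_mono) auto
    also have "\<dots> = 18 * (real n ^ 2 * g * D)" by (simp add: power2_eq_square mult_ac)
    finally have "(2 + real n * log 2 (real u)) * (6 * real n * D) \<le> 18 * (real n ^ 2 * g * D)" .
    moreover have "1 \<le> real n ^ 2 * g * D"
      using mult_mono[OF nr gnD] by (simp add: power2_eq_square mult_ac)
    ultimately show ?thesis using Smr by linarith
  qed
  have N133: "real (Sm * Mm) \<le> 133 * real n ^ 3 * g ^ 2 * D ^ 2"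
  proof -
    have "real (Sm * Mm) \<le> (19 * (real n ^ 2 * g * D)) * (7 * real n * g * D)"
      unfolding of_nat_mult using Sm19 Mm7 g D1 by (intro mult_mono) auto
    thus ?thesis by (simp add: power_numeral_reduce mult_ac)
  qed
  have nDz: "real n * D \<le> real z"
  proof -
    have "real n * D \<le> real n * real (2 ^ L)" using DL by (intro mult_left_mono) auto
    also have "\<dots> \<le> real n * real Y" using YL by (intro mult_left_mono) (simp_all only: of_nat_le_iff of_nat_0_le_iff)
    finally show ?thesis by (simp add: z_def)
  qed
  have luz: "log 2 (real u) \<le> real Y" using hL2 LY by linarith
  have zr: "1 \<le> real z" using z1 by simp
  have Mmz: "Mm \<le> 7 * z ^ 2"
  proof -
    have "log 2 (real u) * (6 * real n * D) \<le> real z * (6 * real z)"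
      using luz nDz z1(3) lu D1 by (intro mult_mono[of _ _ "6 * real n * D"]) auto
    moreover have "1 \<le> real z ^ 2" using zr by simp
    ultimately have "real Mm \<le> real (7 * z ^ 2)" using Mmr by (simp add: power2_eq_square)
    thus ?thesis by (simp only: of_nat_le_iff)
  qed
  have Smz: "Sm \<le> 13 * z ^ 2"
  proof -
    have Y4: "2 \<le> Y"
    proof -
      have "(2::nat) ^ 1 \<le> 2 ^ L" using L2 by (intro power_increasing) auto
      thus ?thesis using YL by simp
    qed
    have "real n * log 2 (real u) \<le> real n * real Y" using luz by (intro mult_left_mono) auto
    hence "real n * log 2 (real u) \<le> real z" by (simp add: z_def)
    hence "2 + real n * log 2 (real u) \<le> 2 * real z" using Y4 z1 by linarith
    hence "(2 + real n * log 2 (real u)) * (6 * real n * D) \<le> (2 * real z) * (6 * real z)"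
      using nDz lu D1 by (intro mult_mono[of _ _ "6 * real n * D"]) auto
    also have "\<dots> = 12 * real z ^ 2" by (simp add: power2_eq_square)
    finally have "real Sm \<le> 12 * real z ^ 2 + 1" using Smr by linarith
    moreover have "1 \<le> real z ^ 2" using zr by simp
    ultimately have "real Sm \<le> real (13 * z ^ 2)" by simp
    thus ?thesis by (simp only: of_nat_le_iff)
  qed
  have SM1: "1 \<le> Sm * Mm" by (simp add: Sm_def Mm_def)
  define R where "R = nat (precision \<epsilon> (Sm * Mm))"
  have R1: "1 \<le> precision \<epsilon> (Sm * Mm)" by (rule precision_bounds(1)[OF e0])
  have Ri: "precision \<epsilon> (Sm * Mm) = int R" using R1 by (simp add: R_def)
  have Rr: "real R \<le> 8 * (real (Sm * Mm) + 1) * (6 * real n * D) + 1"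
  proof -
    have "of_int (precision \<epsilon> (Sm * Mm)) \<le> 8 * (of_nat (Sm * Mm) + 1) / \<epsilon> + 1" unfolding precision_def by linarith
    hence "real_of_rat (of_int (precision \<epsilon> (Sm * Mm))) \<le> real_of_rat (8 * (of_nat (Sm * Mm) + 1) / \<epsilon> + 1)"
      by (simp only: of_rat_less_eq)
    hence "real R \<le> 8 * (real (Sm * Mm) + 1) / er + 1"
      unfolding Ri by (simp add: of_rat_add of_rat_mult of_rat_divide er_def)
    thus ?thesis using ier by (simp add: divide_inverse)
  qed
  have Rz: "R \<le> 48 * (Sm * Mm + 1) * z + 1"
  proof -
    have "8 * (real (Sm * Mm) + 1) * (6 * real n * D) \<le> 8 * (real (Sm * Mm) + 1) * (6 * real z)"
      using nDz by (intro mult_left_mono) auto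
    also have "\<dots> = real (48 * (Sm * Mm + 1) * z)" by (simp add: algebra_simps)
    finally have "real R \<le> real (48 * (Sm * Mm + 1) * z + 1)" using Rr unfolding of_nat_add by linarith
    thus ?thesis by (simp only: of_nat_le_iff)
  qed
  define h where "h = nat \<lceil>log 2 (real (4 * R * u))\<rceil>"
  define ht where "ht = nat \<lceil>log 2 (real (Sm * Mm))\<rceil>"
  \<comment> \<open>\<open>2 ^ hL\<close> is at least \<open>u\<close>, and two more bits provide
    the factor 4 in front of \<open>u ^ n\<close>.\<close>
  define E where "E = n * hL + 2"
  define Bm where "Bm = (n * Mm + 1) * Y * (n + 1)"
  define X where "X = 2 ^ 20 * z ^ 6"
  have Ru1: "1 \<le> 4 * R * u" using R1 u by (simp add: R_def)
  have hz: "h \<le> 4 * R * u" unfolding h_def by (rule nat_ceil_log_le[OF Ru1])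
  have Ez: "E \<le> z + 2" unfolding E_def z_def using LY by simp
  note sb = size_bounds[OF z1(1,2) uz z1(3) Mmz Smz Bm_def Rz hz Ez, folded X_def]
  define rv where "rv = (\<lambda>j k. rat_value (f (Suc j)) (of_nat k))"
  have rvf: "real_of_rat (rv j k) = f (Suc j) (real k)" if "j < n" for j k
  proof -
    have "f (Suc j) (real_of_rat (of_nat k)) \<in> \<rat>" using f that by simp
    then obtain q where q: "f (Suc j) (real_of_rat (of_nat k)) = real_of_rat q" by (auto elim: Rats_cases)
    have "rv j k = q" unfolding rv_def rat_value_def q by (rule the_equality) auto
    thus ?thesis using q by simp
  qed
  let ?F = "evaluator n f"
  have rv: "?F (int (Suc j)) (of_nat k) = rv j k \<and> small Y (rv j k) \<and> 0 \<le> rv j k" if j: "j < n" and k: "k < u" for j k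
  proof (intro conjI)
    show "?F (int (Suc j)) (of_nat k) = rv j k" using j by (simp add: evaluator_def rv_def nat_add_distrib)
    have "log 2 (real k + 1) \<le> log 2 (real u + 1)" using k by (intro log_mono) auto
    hence "nat \<lceil>log 2 (real k + 1)\<rceil> \<le> nat \<lceil>log 2 (real u + 1)\<rceil>" by (intro nat_mono ceiling_mono)
    hence "enc_len (of_nat k) \<le> hL" unfolding enc_len_nat hLr by simp
    hence "L * enc_len (of_nat k) \<le> L * hL" by (rule mult_le_mono2)
    moreover have "enc_len (rv j k) \<le> L * enc_len (of_nat k)" unfolding rv_def using j by (intro LI(4)) auto
    ultimately have "enc_len (rv j k) \<le> L * hL" by linarith
    thus "small Y (rv j k)" unfolding Y_def by (rule small_of_enc_len)
    have "0 \<le> real_of_rat (rv j k)" using rvf[OF j] f j by simp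
    thus "0 \<le> rv j k" by (simp only: zero_le_of_rat_iff)
  qed
  have e_min: "\<epsilon> = min 1 \<delta> / (6 * of_nat n)" by (rule \<epsilon>_def)
  have gx: "small_state X (initial_state n u b \<delta>)"
  proof -
    have X1: "1 \<le> X" "z \<le> X" "2 ^ L \<le> X" "n \<le> X" "u \<le> X" using sb(1,5) YL z1 uY sb(19) by linarith+
    have "small X b" using small_mono[OF small_of_enc_len[OF LI(2)] X1(3)] .
    moreover have "small X \<delta>" using small_mono[OF small_of_enc_len[OF LI(3)] X1(3)] .
    ultimately show ?thesis using X1 small_of_nat[of n X] small_of_nat[of u X] small_0[of X]
      by (auto simp: small_state_def initial_state_def)
  qed
  have ex: "small X \<epsilon>"
  proof -
    have "small (6 * n) (of_nat (6 * n))" using n by (intro small_of_nat) auto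
    hence "small (6 * n) (inverse (of_nat (6 * n)))" by (rule small_inverse)
    hence "small (2 ^ L * (6 * n)) (min 1 \<delta> * inverse (of_nat (6 * n)))" by (rule small_mult[OF \<delta>s])
    moreover have "2 ^ L * (6 * n) \<le> 6 * z" using mult_le_mono2[OF YL, of "6 * n"] by (simp add: z_def mult_ac)
    hence "2 ^ L * (6 * n) \<le> X" using sb(19) by linarith
    ultimately have "small X (min 1 \<delta> * inverse (of_nat (6 * n)))" by (rule small_mono)
    moreover have "\<epsilon> = min 1 \<delta> * inverse (of_nat (6 * n))"
      unfolding \<epsilon>_def divide_inverse by (simp only: of_nat_mult of_nat_numeral)
    ultimately show ?thesis by (simp only:)
  qed
  define Z where "Z = real (card (solutions n f b u))"
  have Zc: "Z = real_of_int (weighted_count u (\<lambda>_. 1) (\<lambda>j k. f (Suc j) (real k)) n (of_rat b))"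
    unfolding Z_def solutions_def card_box_weighted_count[symmetric] by simp
  have p3: "(1 + er) ^ (3 * n) \<le> 1 + d" unfolding erd by (rule power_one_plus_le[OF d n])
  have p2: "(1 + er) ^ (2 * n) \<le> 2"
  proof -
    have "(1 + er) ^ (2 * n) \<le> (1 + er) ^ (3 * n)" using er by (intro power_increasing) auto
    thus ?thesis using p3 d by linarith
  qed
  have ur: "0 < real u" using u by simp
  have wpm: "wp ?F X main_prog (initial_state n u b \<delta>) (time_main n Mm Sm (2 * (L * hL)) ht h E)
     (\<lambda>s. Z \<le> result s \<and> result s \<le> (1 + of_rat \<delta>) * Z)"
  proof (rule wp_main[where \<delta> = \<delta> and n = n and b = b and X = X and u = u and Mm = Mm and Y = Y and Bm = Bm and Sm = Sm and rv = rv, folded e_min])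
    show "8 * precision \<epsilon> (Sm * Mm) * int u + 2 \<le> int X" unfolding Ri using zle_int[THEN iffD2, OF sb(13)] by simp
    show "4 * (int (n + 1) * int (Y + Bm)) + 4 \<le> int X" using zle_int[THEN iffD2, OF sb(15)] by (simp add: distrib_right)
    show "int Y * int Y \<le> 2 ^ (2 * (L * hL))" by (simp add: Y_def power_add mult_2)
    show "small Y b" using small_of_enc_len[OF LI(2)] YL by (rule small_mono)
    show "m < Mm" if "(1 + \<epsilon>) ^ m \<le> of_nat u" for m
    proof -
      have "real_of_rat ((1 + \<epsilon>) ^ m) \<le> real_of_rat (of_nat u)" using that by (simp only: of_rat_less_eq)
      hence "(1 + er) ^ m \<le> real u" by (simp add: of_rat_power of_rat_add er_def)
      hence "er * real m \<le> log 2 (real u)" using power_le_imp_mult_le[OF er] ur by blast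
      hence "real m \<le> log 2 (real u) / er" using er by (simp add: pos_le_divide_eq mult.commute)
      thus ?thesis unfolding Mm_def by linarith
    qed
    have "4 * R * u \<le> 2 ^ h" unfolding h_def by (rule le_two_power_ceil_log[OF Ru1])
    hence "int (4 * R * u) \<le> int (2 ^ h)" by (simp only: zle_int)
    thus "4 * precision \<epsilon> (Sm * Mm) * int u \<le> 2 ^ h" unfolding Ri by simp
    show "Sm * Mm \<le> 2 ^ ht" unfolding ht_def by (rule le_two_power_ceil_log[OF SM1])
    show "4 * int u ^ n \<le> 2 ^ E"
    proof -
      have "int u \<le> 2 ^ hL" using u2 by (metis of_nat_le_iff of_nat_numeral of_nat_power)
      hence "int u ^ n \<le> (2 ^ hL) ^ n" by (intro power_mono) auto
      thus ?thesis by (simp add: E_def power_add power_mult mult.commute[of n])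
    qed
    show "S \<le> Sm" if "(1 + real_of_rat \<epsilon>) ^ (S - 1) \<le> 4 * real u ^ n" for S
    proof -
      have "er * real (S - 1) \<le> log 2 (4 * real u ^ n)"
        using that ur by (intro power_le_imp_mult_le[OF er]) (simp_all add: er_def)
      also have "\<dots> = log 2 (2 ^ 2) + log 2 (real u ^ n)" using ur by (simp add: log_mult)
      also have "\<dots> = 2 + real n * log 2 (real u)" using ur by (simp only: log_nat_power) simp
      finally have "real (S - 1) \<le> (2 + real n * log 2 (real u)) / er" using er by (simp add: pos_le_divide_eq mult.commute)
      thus ?thesis unfolding Sm_def by linarith
    qed
    show "(1 + real_of_rat \<epsilon>) ^ (2 * n) \<le> 2" using p2 by (simp add: er_def)
  next
    fix s' :: state and a :: int and e M :: nat
    let ?W = "weighted_count M (\<lambda>m. int (grid \<epsilon> u (Suc m)) - int (grid \<epsilon> u m)) (\<lambda>j m. rv j (grid \<epsilon> u m)) n b"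
    assume s': "s' ''mantissa'' 0 = of_int a" "s' ''exponent'' 0 = of_nat e" and M: "1 \<le> M" "grid \<epsilon> u M = u" "\<forall>m<M. grid \<epsilon> u m < u"
      and lo: "?W \<le> a * 2 ^ e" and up: "real_of_int (a * 2 ^ e) \<le> (1 + real_of_rat \<epsilon>) ^ (2 * n) * real_of_int ?W"
    have res: "result s' = real_of_int (a * 2 ^ e)" unfolding result_def s' by (simp add: power_int_def)
    have WW: "?W = weighted_count M (\<lambda>m. int (grid \<epsilon> u (Suc m)) - int (grid \<epsilon> u m)) (\<lambda>j m. f (Suc j) (real (grid \<epsilon> u m))) n (real_of_rat b)"
    proof (rule weighted_count_cong)
      fix x :: "nat \<Rightarrow> nat"
      have "(\<Sum>j<n. rv j (grid \<epsilon> u (x j))) \<le> b \<longleftrightarrow> real_of_rat (\<Sum>j<n. rv j (grid \<epsilon> u (x j))) \<le> real_of_rat b"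
        by (simp only: of_rat_less_eq)
      also have "real_of_rat (\<Sum>j<n. rv j (grid \<epsilon> u (x j))) = (\<Sum>j<n. f (Suc j) (real (grid \<epsilon> u (x j))))"
        unfolding of_rat_sum by (intro sum.cong) (auto simp: rvf)
      finally show "(\<Sum>j<n. rv j (grid \<epsilon> u (x j))) \<le> b \<longleftrightarrow> (\<Sum>j<n. f (Suc j) (real (grid \<epsilon> u (x j)))) \<le> real_of_rat b" .
    qed
    have gr: "Z \<le> real_of_int ?W \<and> real_of_int ?W \<le> (1 + er) ^ n * Z"
      unfolding Zc WW
    proof (rule grid_count)
      show "\<And>j. j < n \<Longrightarrow> mono (f (Suc j))" using f by simp
      show "\<And>m. m < M \<Longrightarrow> grid \<epsilon> u m < grid \<epsilon> u (Suc m)" using grid_step(1)[of \<epsilon> u] e0 M by simp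
      show "real (grid \<epsilon> u (Suc m)) \<le> (1 + er) * (real (grid \<epsilon> u m) + 1)" for m
      proof -
        have "of_nat (grid \<epsilon> u (Suc m)) \<le> (1 + \<epsilon>) * (of_nat (grid \<epsilon> u m) + 1)" using e0 by (intro grid_step(3)) simp
        hence "real_of_rat (of_nat (grid \<epsilon> u (Suc m))) \<le> real_of_rat ((1 + \<epsilon>) * (of_nat (grid \<epsilon> u m) + 1))"
          by (simp only: of_rat_less_eq)
        thus ?thesis by (simp add: of_rat_mult of_rat_add er_def)
      qed
    qed (use M er in auto)
    have "real_of_int ?W \<le> real_of_int (a * 2 ^ e)" using lo by (simp only: of_int_le_iff)
    hence low: "Z \<le> result s'" unfolding res using gr by linarith
    have "result s' \<le> (1 + er) ^ (2 * n) * real_of_int ?W" unfolding res using up by (simp only: er_def)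
    also have "\<dots> \<le> (1 + er) ^ (2 * n) * ((1 + er) ^ n * Z)" using gr er by (intro mult_left_mono) auto
    \<comment> \<open>Two factors per coordinate come from the stages and one from the grid.\<close>
    also have "\<dots> = (1 + er) ^ (2 * n + n) * Z" by (simp only: power_add mult.assoc)
    also have "2 * n + n = 3 * n" by simp
    also have "(1 + er) ^ (3 * n) * Z \<le> (1 + d) * Z" using p3 by (intro mult_right_mono) (simp_all add: Z_def)
    also have "\<dots> \<le> (1 + of_rat \<delta>) * Z" using dm by (intro mult_right_mono) (auto simp: Z_def)
    finally show "Z \<le> result s' \<and> result s' \<le> (1 + of_rat \<delta>) * Z" using low by blast
  qed (use sb n u \<delta> Y1 ex rv in \<open>simp_all add: Bm_def\<close>)
  then obtain t m s where ex: "exec ?F main_prog (initial_state n u b \<delta>) t m s"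
    "t \<le> time_main n Mm Sm (2 * (L * hL)) ht h E" "m \<le> bit_bound X" "Z \<le> result s" "result s \<le> (1 + of_rat \<delta>) * Z"
    using gx unfolding wp_def by blast
  \<comment> \<open>The height of the tree and the length of the mantissas involve the logarithms of
    \<open>1 / d\<close> and of \<open>lg u\<close>. Both are at most \<open>L\<close>, so the
    bounds for \<open>ht\<close> and \<open>h\<close> depend on \<open>L + log n\<close>
    only.\<close>
  have logD: "log 2 D \<le> real L"
  proof -
    have "log 2 D \<le> log 2 (2 ^ L)" using DL D1 by (intro log_mono) auto
    thus ?thesis by simp
  qed
  have logg: "log 2 g \<le> real L"
  proof -
    have "g \<le> 2 ^ L" using gL of_nat_less_two_power[of L, where 'a = real] by linarith
    hence "log 2 g \<le> log 2 (2 ^ L)" using g by (intro log_mono) auto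
    thus ?thesis by simp
  qed
  have n0: "0 < real n" and g0: "0 < g" and D0: "0 < D" using n g D1 by auto
  have logN: "log 2 (133 * real n ^ 3 * g ^ 2 * D ^ 2) = log 2 133 + 3 * log 2 (real n) + 2 * log 2 g + 2 * log 2 D"
    using n0 g0 D0 by (simp add: log_mult log_nat_power)
  have lg133: "log 2 (133::real) \<le> 8" by (simp add: log_le_iff)
  have htl: "real ht \<le> 9 * l"
  proof -
    have "real ht \<le> log 2 (real (Sm * Mm)) + 1" unfolding ht_def by (rule nat_ceil_log_real[OF SM1])
    also have "log 2 (real (Sm * Mm)) \<le> log 2 (133 * real n ^ 3 * g ^ 2 * D ^ 2)"
      using N133 SM1 by (intro log_mono) auto
    finally show ?thesis unfolding logN using lg133 logg logD l2 ln0 by (simp add: l_def)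
  qed
  have hl: "real h \<le> 15 * l"
  proof -
    define V where "V = 133 * real n ^ 3 * g ^ 2 * D ^ 2"
    have V0: "0 < V" using n0 g0 D0 by (simp add: V_def)
    have V1: "1 \<le> V" using N133 SM1 unfolding V_def by linarith
    have "8 * (real (Sm * Mm) + 1) * (6 * real n * D) \<le> 8 * (2 * V) * (6 * real n * D)"
      using N133 V1 n0 D0 unfolding V_def[symmetric] by (intro mult_right_mono) auto
    also have "\<dots> = 96 * (V * (real n * D))" by simp
    finally have "real R \<le> 96 * (V * (real n * D)) + 1" using Rr by linarith
    also have "1 \<le> V * (real n * D)" using mult_mono[OF V1 nD] V1 by simp
    hence "96 * (V * (real n * D)) + 1 \<le> 97 * (V * (real n * D))" by linarith
    finally have "real R \<le> 97 * (V * (real n * D))" .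
    hence "real (4 * R * u) \<le> 4 * (97 * (V * (real n * D))) * real u"
      unfolding of_nat_mult by (intro mult_right_mono mult_mono) auto
    hence "real (4 * R * u) \<le> 388 * V * real n * D * real u" by (simp add: mult_ac)
    hence "log 2 (real (4 * R * u)) \<le> log 2 (388 * V * real n * D * real u)"
      using Ru1 by (intro log_mono) auto
    also have "\<dots> = log 2 388 + log 2 V + log 2 (real n) + log 2 D + log 2 (real u)"
      using V0 n0 D0 ur by (simp add: log_mult)
    finally have 1: "log 2 (real (4 * R * u)) \<le> log 2 388 + log 2 V + log 2 (real n) + log 2 D + log 2 (real u)" .
    have 2: "log 2 (388::real) \<le> 9" by (simp add: log_le_iff)
    have 3: "log 2 (real u) \<le> real L" using g gL by linarith
    have "real h \<le> log 2 (real (4 * R * u)) + 1" unfolding h_def by (rule nat_ceil_log_real[OF Ru1])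
    thus ?thesis using 1 2 3 lg133 logg logD l2 ln0 unfolding V_def logN by (simp add: l_def)
  qed
  have El: "real E \<le> 6 * real n * g"
  proof -
    have "real n * real hL \<le> real n * (4 * g)" using hLg by (intro mult_left_mono) auto
    moreover have "1 \<le> real n * g" using mult_mono[OF nr g(1)] by simp
    ultimately show ?thesis by (simp add: E_def)
  qed
  have hyl: "real (2 * (L * hL)) \<le> 8 * l * g"
  proof -
    have "real L * real hL \<le> l * (4 * g)" using hLg ln0 l2 by (intro mult_mono) (auto simp: l_def)
    thus ?thesis by (simp add: mult_ac)
  qed
  have "real t \<le> real (time_main n Mm Sm (2 * (L * hL)) ht h E)" using ex(2) by simp
  also have "\<dots> \<le> 1000000 * (real n ^ 5 * g ^ 3 * l * D ^ 2)"
    by (rule time_bound[OF n g(1) l2 D1 Mm7 N133 hyl htl hl El])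
  also have "real n ^ 5 * g ^ 3 * l * D ^ 2 = real n ^ 5 * lg u ^ 3 * (real L + log 2 (real n)) / (min 1 (of_rat \<delta>))\<^sup>2"
    unfolding dm by (simp add: D_def g_def l_def power_divide)
  finally have T: "real t \<le> 1000000 * (real n ^ 5 * lg u ^ 3 * (real L + log 2 (real n)) / (min 1 (of_rat \<delta>))\<^sup>2)" .
  have M: "real m \<le> 1000000 * (real L * lg u + log 2 (real n))"
  proof -
    \<comment> \<open>The bit bound is, up to constants, a fixed multiple of \<open>A\<close>, hence
      of \<open>log n + L * hL\<close>, and \<open>hL <= 4 * lg u\<close>. The additive constants
      are absorbed because \<open>L * lg u >= 2\<close>.\<close>
    define A where "A = log 2 (2 * real X)"
    have X0: "1 \<le> real X" using sb(1) by simp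
    have zr0: "0 < real z" using zr by simp
    have "A = log 2 (2 ^ 21 * real z ^ 6)" unfolding A_def X_def by simp
    also have "\<dots> = log 2 (2 ^ 21) + log 2 (real z ^ 6)" using zr0 by (subst log_mult) auto
    also have "\<dots> = 21 + 6 * log 2 (real z)" using zr0 by (subst (1 2) log_nat_power) simp_all
    also have "log 2 (real z) = log 2 (real n) + log 2 (2 ^ (L * hL))"
      unfolding z_def Y_def using n0 by (simp add: log_mult)
    also have "log 2 (2 ^ (L * hL)) = real L * real hL" by (simp only: log_nat_power) simp
    finally have A: "A = 21 + 6 * (log 2 (real n) + real L * real hL)" .
    have A0: "0 \<le> A" unfolding A_def using X0 by simp
    have "real ((2 * X) ^ 60) + 1 \<le> 2 * (2 * real X) ^ 60"
    proof -
      have "1 \<le> (2 * real X) ^ 60" using X0 by (intro one_le_power) auto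
      thus ?thesis by simp
    qed
    hence "log 2 (real ((2 * X) ^ 60) + 1) \<le> log 2 (2 * (2 * real X) ^ 60)"
      by (intro log_mono) (auto intro: add_nonneg_pos)
    also have "\<dots> = 1 + log 2 ((2 * real X) ^ 60)"
    proof -
      have "log 2 (2 * y) = 1 + log 2 y" if "0 < y" for y :: real using that by (simp add: log_mult)
      moreover have "0 < (2 * real X) ^ 60" using X0 by (intro zero_less_power) simp
      ultimately show ?thesis by blast
    qed
    also have "log 2 ((2 * real X) ^ 60) = 60 * A"
      unfolding A_def using X0 by (subst log_nat_power) simp_all
    finally have "log 2 (real ((2 * X) ^ 60) + 1) \<le> 1 + 60 * A" .
    have "real (bit_bound X) \<le> 2 * (1 + 60 * A + 1)"
    proof -
      have "real (2 * nat \<lceil>y\<rceil>) \<le> 2 * (1 + 60 * A + 1)" if "y \<le> 1 + 60 * A" for y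
      proof -
        have "real (nat \<lceil>y\<rceil>) \<le> 1 + 60 * A + 1" using that A0 by linarith
        thus ?thesis by simp
      qed
      thus ?thesis unfolding bit_bound_def using \<open>log 2 (real ((2 * X) ^ 60) + 1) \<le> 1 + 60 * A\<close> by blast
    qed
    hence "real m \<le> 2 * (1 + 60 * A + 1)" using ex(3) by linarith
    moreover have "real L * real hL \<le> real L * (4 * g)" using hLg by (intro mult_left_mono) auto
    moreover have "2 * 1 \<le> real L * g" using L2 g by (intro mult_mono) auto
    ultimately have "real m \<le> 1000000 * (real L * g) + 1000000 * log 2 (real n)" using A ln0
      by (simp add: distrib_left)
    thus ?thesis by (simp add: g_def distrib_left)
  qed
  show "\<exists>t m s. exec (evaluator n f) main_prog (initial_state n u b \<delta>) t m s \<and>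
           real (card (solutions n f b u)) \<le> result s \<and>
           result s \<le> (1 + of_rat \<delta>) * real (card (solutions n f b u)) \<and>
           real t \<le> 1000000 * (real n ^ 5 * lg u ^ 3 * (real L + log 2 (real n)) / (min 1 (of_rat \<delta>))\<^sup>2) \<and>
           real m \<le> 1000000 * (real L * lg u + log 2 (real n))"
    using ex(1,4,5) T M unfolding Z_def by blast
qed simp

end
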